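(* Consider the LPSA iterates described in the context with $\eta_n=\eta_0n^{-\alpha}$, $p_n=\min\{\gamma\eta_n^\beta,1\}$, where $\gamma>0$, $0<\alpha\le1$, $\beta\in(1/2,1)$ and $\eta_0>2\cdot\mathbb{1}_{\{\alpha=1\}}/\mu$ (and $\eta_0>0$). Assume: $\|\nabla f(x)-\nabla f(y)\|\le L\|x-y\|$ for all $x,y$; $f$ is $\mu$-strongly convex, $\mu>0$; $\|\Sigma(x)-\Sigma(y)\|\le L\|x-y\|$ for all $x,y$; and there is $q>2$ with $\sup_n\mathbb{E}\|\xi_n\|^q<\infty$. Let $\check v_n=\eta_{n-1}^{\beta-1}v_n$ with $v_n=P_Ax_n$, and let $\bar v^{(n)}=(\bar v^{(n)}_t)_{t\ge0}$ be the càdlàg interpolated processes defined in the context. Then the processes $\bar v^{(n)}$ converge weakly, as $n\to\infty$, to the stationary weak solution of the SDE $$dY_t=-\nabla f(x^\star)\,dt-Y_{t-}\,N_\gamma(dt),$$ where $N_\gamma$ is a Poisson process with intensity $\gamma$. Further, the sequence $(\check v_n)$ converges weakly to the invariant distribution of this SDE, namely the law of $-\frac{\nabla f(x^\star)}{\|\nabla f(x^\star)\|}\cdot E$, where $E$ is an exponential random variable with intensity (rate) $\gamma/\|\nabla f(x^\star)\|$, i.e. with mean $\|\nabla f(x^\star)\|/\gamma$.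
   Context: Setting (LPSA, loopless projected stochastic approximation). Let $A$ be a real matrix with $d$ rows; $P_A$ is the orthogonal projection of $\mathbb{R}^d$ onto the column space of $A$, and $P_{A^\perp}=I_d-P_A$ the orthogonal projection onto the null space of $A^\top$. Let $\mathcal D$ be a probability distribution, $f(x)=\mathbb{E}_{\zeta\sim\mathcal D}f(x,\zeta)$, with $\mathbb{E}_{\zeta\sim\mathcal D}\nabla f(x,\zeta)=\nabla f(x)$ (gradients in $x$). Let $x^\star$ be the unique minimizer of $f$ over $\{x\in\mathbb{R}^d: A^\top x=0\}$; standing assumption: $\nabla f(x^\star)\ne 0$. Starting from a deterministic point $x_1$, for $n\ge 1$ sample $\zeta_n\sim\mathcal D$ and $\omega_n\sim\mathrm{Bernoulli}(p_n)$ (all independent), set $x_{n+1/2}=x_n-\eta_n\nabla f(x_n,\zeta_n)$, and set $x_{n+1}=P_{A^\perp}x_{n+1/2}$ if $\omega_n=1$, $x_{n+1}=x_{n+1/2}$ if $\omega_n=0$. The gradient noise is $\xi_n=\nabla f(x_n)-\nabla f(x_n,\zeta_n)$, a martingale difference with respect to $\mathcal F_n=\sigma(\zeta_k,\omega_k:k<n)$, and $\mathbb{E}[\xi_n\xi_n^\top\mid\mathcal F_n]=\Sigma(x_n)$, where $\Sigma(x)$ is the covariance matrix of $\nabla f(x,\zeta)$, $\zeta\sim\mathcal D$. $\|\cdot\|$ is the Euclidean norm for vectors and the spectral norm for matrices. Interpolation. Let $\check v_{(n+1)-}=\eta_n^{\beta-1}P_Ax_{n+1/2}$ be the value before the coin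 toss (so $\check v_{n+1}=\check v_{(n+1)-}$ if $\omega_n=0$ and $\check v_{n+1}=0$ if $\omega_n=1$), put $\xi_n^{(2)}=P_A\xi_n$ and define $d_n$ by $\check v_{(n+1)-}=\check v_n-\eta_n^\beta d_n+\eta_n^\beta\xi_n^{(2)}$. For $n\ge1,t\ge0$ let $N(n,t)=\min\{m\ge n:\sum_{k=n}^m\eta_k^\beta>t\}$, $\Gamma_n=\sum_{k=1}^{n-1}\eta_k^\beta$, $\underline t_n=\Gamma_{N(n,t)}-\Gamma_n$, and $$\bar v^{(n)}_t=\check v_{N(n,t)}-(t-\underline t_n)\big(d_{N(n,t)}-\xi^{(2)}_{N(n,t)}\big).$$ Thus on each interval $[\Gamma_m-\Gamma_n,\Gamma_{m+1}-\Gamma_n)$, $m\ge n$, the process moves linearly from $\check v_m$ towards $\check v_{(m+1)-}$, and then takes the value $\check v_{m+1}$ at time $\Gamma_{m+1}-\Gamma_n$. Weak convergence of càdlàg processes is with respect to the Skorokhod topology on every finite time interval. In the SDE, the jump term means that $Y$ is reset to $0$ at each jump time of $N_\gamma$. *)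

theory Defs
  imports "HOL-Probability.Probability"
begin

section \<open>Linear algebra and regularity\<close>

definition orth_proj :: "'v::euclidean_space set \<Rightarrow> 'v \<Rightarrow> 'v" where
  "orth_proj S x = (THE p. p \<in> S \<and> (\<forall>y\<in>S. orthogonal (x - p) y))"

definition column_space :: "real^'m^'d \<Rightarrow> (real^'d) set" where
  "column_space A = span (columns A)"

definition strongly_convex_with_gradient ::
    "real \<Rightarrow> ('v::real_inner \<Rightarrow> real) \<Rightarrow> ('v \<Rightarrow> 'v) \<Rightarrow> bool" where
  "strongly_convex_with_gradient \<mu> f f' \<longleftrightarrow>
     (\<forall>x. GDERIV f x :> f' x) \<and>
     (\<forall>x y. f y \<ge> f x + f' x \<bullet> (y - x) + \<mu> / 2 * (norm (y - x))\<^sup>2)"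

definition covariance_matrix :: "'z measure \<Rightarrow> ('z \<Rightarrow> real^'d) \<Rightarrow> real^'d^'d" where
  "covariance_matrix D Z =
     (\<chi> i j. \<integral>z. (Z z $ i - (\<integral>u. Z u \<partial>D) $ i) * (Z z $ j - (\<integral>u. Z u \<partial>D) $ j) \<partial>D)"

definition spectral_norm :: "real^'n^'m \<Rightarrow> real" where
  "spectral_norm A = onorm ((*v) A)"


section \<open>The Skorokhod space of cadlag paths on a compact interval\<close>

definition cadlag_on :: "real set \<Rightarrow> (real \<Rightarrow> 'v::topological_space) \<Rightarrow> bool" where
  "cadlag_on S x \<longleftrightarrow> (\<forall>t\<in>S. (x \<longlongrightarrow> x t) (at t within (S \<inter> {t<..})) \<and>
                            (\<exists>l. (x \<longlongrightarrow> l) (at t within (S \<inter> {..<t}))))"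

definition cadlag_space :: "real \<Rightarrow> (real \<Rightarrow> 'v::topological_space) set" where
  "cadlag_space T = {x \<in> extensional {0..T}. cadlag_on {0..T} x}"

text \<open>Increasing bijections of \<open>[0,T]\<close>; continuity is automatic.\<close>

definition time_changes :: "real \<Rightarrow> (real \<Rightarrow> real) set" where
  "time_changes T = {l. strict_mono_on {0..T} l \<and> l ` {0..T} = {0..T}}"

text \<open>The J1 metric. The value \<open>0\<close> off the carrier is there only because
  \<^locale>\<open>Metric_space\<close> asks for nonnegativity and symmetry everywhere.\<close>

definition skorokhod_close ::
    "real \<Rightarrow> (real \<Rightarrow> 'v::metric_space) \<Rightarrow> (real \<Rightarrow> 'v) \<Rightarrow> real \<Rightarrow> bool" where
  "skorokhod_close T x y e \<longleftrightarrow>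
     (\<exists>l\<in>time_changes T. \<forall>t\<in>{0..T}. \<bar>l t - t\<bar> \<le> e \<and> dist (x (l t)) (y t) \<le> e)"

definition skorokhod_dist ::
    "real \<Rightarrow> (real \<Rightarrow> 'v::metric_space) \<Rightarrow> (real \<Rightarrow> 'v) \<Rightarrow> real" where
  "skorokhod_dist T x y =
     (if x \<in> cadlag_space T \<and> y \<in> cadlag_space T
      then Inf {e. 0 < e \<and> skorokhod_close T x y e} else 0)"

lemma cadlag_space_bounded:
  fixes x :: "real \<Rightarrow> 'v::metric_space"
  assumes "x \<in> cadlag_space T"
  shows "bounded (x ` {0..T})"
proof -
  have "\<exists>U. open U \<and> t \<in> U \<and> bounded (x ` (U \<inter> {0..T}))" if t: "t \<in> {0..T}" for t
  proof -
    obtain l where r: "(x \<longlongrightarrow> x t) (at t within ({0..T} \<inter> {t<..}))"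
      and l: "(x \<longlongrightarrow> l) (at t within ({0..T} \<inter> {..<t}))"
      using assms t unfolding cadlag_space_def cadlag_on_def by blast
    have "\<forall>\<^sub>F s in at t within ({0..T} \<inter> {t<..}). dist (x s) (x t) < 1"
      using r by (rule tendstoD) simp
    then obtain U where U: "open U" "t \<in> U"
      "\<forall>s\<in>U. s \<noteq> t \<longrightarrow> s \<in> {0..T} \<inter> {t<..} \<longrightarrow> dist (x s) (x t) < 1"
      unfolding eventually_at_topological by blast
    have "\<forall>\<^sub>F s in at t within ({0..T} \<inter> {..<t}). dist (x s) l < 1"
      using l by (rule tendstoD) simp
    then obtain V where V: "open V" "t \<in> V"
      "\<forall>s\<in>V. s \<noteq> t \<longrightarrow> s \<in> {0..T} \<inter> {..<t} \<longrightarrow> dist (x s) l < 1"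
      unfolding eventually_at_topological by blast
    have "x ` (U \<inter> V \<inter> {0..T}) \<subseteq> ball (x t) 1 \<union> ball l 1"
    proof
      fix z assume "z \<in> x ` (U \<inter> V \<inter> {0..T})"
      then obtain s where s: "s \<in> U" "s \<in> V" "s \<in> {0..T}" "z = x s" by auto
      consider "s = t" | "s > t" | "s < t" by linarith
      then show "z \<in> ball (x t) 1 \<union> ball l 1"
        using U(3)[rule_format, of s] V(3)[rule_format, of s] s
        by cases (auto simp: dist_commute)
    qed
    then have "bounded (x ` (U \<inter> V \<inter> {0..T}))"
      by (rule bounded_subset[rotated]) simp
    with U V show ?thesis by (intro exI[of _ "U \<inter> V"]) auto
  qed
  then obtain U where U: "\<And>t. t \<in> {0..T} \<Longrightarrow>
      open (U t) \<and> t \<in> U t \<and> bounded (x ` (U t \<inter> {0..T}))" by metis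
  obtain C where C: "C \<subseteq> {0..T}" "finite C" "{0..T} \<subseteq> (\<Union>t\<in>C. U t)"
    by (rule compactE_image[OF compact_Icc[of 0 T], of "{0..T}" U]) (use U in auto)
  have "x ` {0..T} \<subseteq> (\<Union>t\<in>C. x ` (U t \<inter> {0..T}))" using C(3) by blast
  moreover have "bounded (\<Union>t\<in>C. x ` (U t \<inter> {0..T}))"
    using C U by (intro bounded_UN) auto
  ultimately show ?thesis by (rule bounded_subset[rotated])
qed

lemma id_time_change: "(\<lambda>t. t) \<in> time_changes T"
  by (auto simp: time_changes_def strict_mono_on_def)

lemma skorokhod_close_ex:
  assumes "x \<in> cadlag_space T" "y \<in> cadlag_space T"
  shows "\<exists>e>0. skorokhod_close T x y e"
proof -
  have "bounded (x ` {0..T} \<union> y ` {0..T})"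
    using assms cadlag_space_bounded by auto
  then obtain e where e: "\<forall>u\<in>x ` {0..T} \<union> y ` {0..T}. \<forall>v\<in>x ` {0..T} \<union> y ` {0..T}. dist u v \<le> e"
    using bounded_two_points by meson
  have "skorokhod_close T x y (max e 1)"
    unfolding skorokhod_close_def using e
    by (intro bexI[OF _ id_time_change]) (auto simp: le_max_iff_disj)
  then show ?thesis by (intro exI[of _ "max e 1"]) auto
qed

lemma skorokhod_close_commute:
  assumes "skorokhod_close T x y e" shows "skorokhod_close T y x e"
proof -
  obtain l where l: "strict_mono_on {0..T} l" "l ` {0..T} = {0..T}"
    and c: "\<And>t. t \<in> {0..T} \<Longrightarrow> \<bar>l t - t\<bar> \<le> e \<and> dist (x (l t)) (y t) \<le> e"
    using assms by (auto simp: skorokhod_close_def time_changes_def)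
  have inj: "inj_on l {0..T}" using l(1) by (rule strict_mono_on_imp_inj_on)
  define k where "k = inv_into {0..T} l"
  have k: "k s \<in> {0..T}" "l (k s) = s" if "s \<in> {0..T}" for s
    using that l(2) by (auto simp: k_def inv_into_into f_inv_into_f simp del: atLeastAtMost_iff)
  have "strict_mono_on {0..T} k"
  proof (rule strict_mono_onI)
    fix r s assume rs: "r \<in> {0..T}" "s \<in> {0..T}" "r < s"
    show "k r < k s"
    proof (rule ccontr)
      assume "\<not> k r < k s"
      then have "l (k s) \<le> l (k r)"
        using k rs l(1) by (metis order.order_iff_strict not_less strict_mono_onD)
      with k rs show False by simp
    qed
  qed
  moreover have "k ` {0..T} = {0..T}"
    using inj l(2) unfolding k_def by (metis inv_into_image_cancel order_refl)
  moreover have "\<bar>k s - s\<bar> \<le> e \<and> dist (y (k s)) (x s) \<le> e" if "s \<in> {0..T}" for s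
    using c[OF k(1)[OF that]] k(2)[OF that] by (simp add: dist_commute abs_minus_commute)
  ultimately show ?thesis unfolding skorokhod_close_def time_changes_def by blast
qed

lemma skorokhod_close_trans:
  assumes "skorokhod_close T x y a" "skorokhod_close T y z b"
  shows "skorokhod_close T x z (a + b)"
proof -
  obtain l where l: "strict_mono_on {0..T} l" "l ` {0..T} = {0..T}"
    and cl: "\<And>t. t \<in> {0..T} \<Longrightarrow> \<bar>l t - t\<bar> \<le> a \<and> dist (x (l t)) (y t) \<le> a"
    using assms(1) by (auto simp: skorokhod_close_def time_changes_def)
  obtain k where k: "strict_mono_on {0..T} k" "k ` {0..T} = {0..T}"
    and ck: "\<And>t. t \<in> {0..T} \<Longrightarrow> \<bar>k t - t\<bar> \<le> b \<and> dist (y (k t)) (z t) \<le> b"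
    using assms(2) by (auto simp: skorokhod_close_def time_changes_def)
  have kT: "k t \<in> {0..T}" if "t \<in> {0..T}" for t using k(2) that by blast
  have "strict_mono_on {0..T} (\<lambda>t. l (k t))"
    using l(1) k(1) kT unfolding strict_mono_on_def by blast
  moreover have "(\<lambda>t. l (k t)) ` {0..T} = {0..T}"
    using l(2) k(2) by (metis image_image)
  moreover have "\<bar>l (k t) - t\<bar> \<le> a + b \<and> dist (x (l (k t))) (z t) \<le> a + b"
    if "t \<in> {0..T}" for t
    using cl[OF kT[OF that]] ck[OF that] dist_triangle[of "x (l (k t))" "z t" "y (k t)"]
    by linarith
  ultimately show ?thesis
    unfolding skorokhod_close_def time_changes_def
    by (intro bexI[of _ "\<lambda>t. l (k t)"] ballI CollectI conjI) simp_all
qed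

lemma skorokhod_close_all_imp_eq:
  fixes x y :: "real \<Rightarrow> 'v::metric_space"
  assumes x: "x \<in> cadlag_space T" and y: "y \<in> cadlag_space T"
    and close: "\<And>e. e > 0 \<Longrightarrow> skorokhod_close T x y e"
  shows "x = y"
proof (rule extensionalityI)
  show "x \<in> extensional {0..T}" "y \<in> extensional {0..T}"
    using x y by (auto simp: cadlag_space_def)
  fix t assume t: "t \<in> {0..T}"
  show "x t = y t"
  proof (cases "t = T")
    case True
    have lT: "l T = T" if l: "l \<in> time_changes T" for l
    proof -
      have T: "T \<in> l ` {0..T}" using l t True by (auto simp: time_changes_def)
      then obtain s where s: "s \<in> {0..T}" "l s = T" by auto
      have "l T \<in> {0..T}" using l t True by (auto simp: time_changes_def)
      have "\<not> s < T"
      proof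
        assume "s < T"
        then have "l s < l T"
          using s(1) l t True by (auto simp: time_changes_def strict_mono_on_def)
        with s \<open>l T \<in> {0..T}\<close> show False by simp
      qed
      then have "s = T" using s(1) by simp
      with s show ?thesis by simp
    qed
    have "dist (x t) (y t) \<le> e" if "e > 0" for e
      using close[OF that] t True lT by (force simp: skorokhod_close_def)
    then have "dist (x t) (y t) \<le> 0" by (rule dense_ge)
    then show ?thesis by simp
  next
    case False
    then have tT: "0 \<le> t" "t < T" using t by auto
    have near: "\<exists>d>0. \<forall>s\<in>{t..<t+d}. s \<in> {0..T} \<longrightarrow> dist (z s) (z t) < e"
      if z: "z \<in> cadlag_space T" and e: "e > 0" for z :: "real \<Rightarrow> 'v" and e
    proof -
      have "(z \<longlongrightarrow> z t) (at t within ({0..T} \<inter> {t<..}))"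
        using z t by (auto simp: cadlag_space_def cadlag_on_def)
      then have "\<forall>\<^sub>F s in at t within ({0..T} \<inter> {t<..}). dist (z s) (z t) < e"
        using e by (rule tendstoD)
      then obtain d where d: "d > 0"
        "\<forall>s\<in>{0..T} \<inter> {t<..}. s \<noteq> t \<and> dist s t < d \<longrightarrow> dist (z s) (z t) < e"
        unfolding eventually_at by blast
      have "dist (z s) (z t) < e" if s: "s \<in> {t..<t+d}" "s \<in> {0..T}" for s
        using d(2)[rule_format, of s] s e by (cases "s = t") (auto simp: dist_real_def)
      with d(1) show ?thesis by blast
    qed
    have "dist (x t) (y t) \<le> e" if "e > 0" for e
    proof -
      have e3: "e / 3 > 0" using that by simp
      obtain d1 where d1: "d1 > 0" "\<And>s. s \<in> {t..<t+d1} \<Longrightarrow> s \<in> {0..T} \<Longrightarrow> dist (x s) (x t) < e/3"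
        using near[OF x e3] by blast
      obtain d2 where d2: "d2 > 0" "\<And>s. s \<in> {t..<t+d2} \<Longrightarrow> s \<in> {0..T} \<Longrightarrow> dist (y s) (y t) < e/3"
        using near[OF y e3] by blast
      define d where "d = min (min d1 d2) (T - t)"
      have d: "d > 0" "d \<le> d1" "d \<le> d2" "d \<le> T - t" using d1 d2 tT by (auto simp: d_def)
      define s where "s = t + d / 2"
      have sT: "s \<in> {0..T}" using d tT by (auto simp: s_def field_simps)
      define \<epsilon> where "\<epsilon> = min (e/3) (d/4)"
      have eps: "\<epsilon> > 0" "\<epsilon> \<le> e/3" "\<epsilon> \<le> d/4" using d e3 by (auto simp: \<epsilon>_def)
      obtain l where l: "l \<in> time_changes T"
        "\<bar>l s - s\<bar> \<le> \<epsilon>" "dist (x (l s)) (y s) \<le> \<epsilon>"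
        using close[OF eps(1)] sT by (auto simp: skorokhod_close_def)
      have lsT: "l s \<in> {0..T}" using l(1) sT by (auto simp: time_changes_def)
      have 1: "l s \<in> {t..<t+d1}" using l(2) eps d by (auto simp: s_def)
      have 2: "s \<in> {t..<t+d2}" using d by (auto simp: s_def)
      have "dist (x t) (y t) \<le> dist (x (l s)) (x t) + dist (x (l s)) (y s) + dist (y s) (y t)"
        using dist_triangle[of "x t" "y t" "x (l s)"] dist_triangle[of "x (l s)" "y t" "y s"]
        by (simp add: dist_commute)
      also have "\<dots> \<le> e"
        using d1(2)[OF 1 lsT] d2(2)[OF 2 sT] l(3) eps by simp
      finally show ?thesis .
    qed
    then have "dist (x t) (y t) \<le> 0" by (rule dense_ge)
    then show ?thesis by simp
  qed
qed

lemma Metric_space_skorokhod: "Metric_space (cadlag_space T) (skorokhod_dist T)"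
proof
  fix x y z :: "real \<Rightarrow> 'a"
  let ?S = "\<lambda>x y. {e. 0 < e \<and> skorokhod_close T x y e}"
  have bdd: "bdd_below (?S x y)" for x y :: "real \<Rightarrow> 'a"
    by (rule bdd_belowI[of _ 0]) auto
  have ne: "?S x y \<noteq> {}" if "x \<in> cadlag_space T" "y \<in> cadlag_space T" for x y :: "real \<Rightarrow> 'a"
    using skorokhod_close_ex[OF that] by blast
  show "0 \<le> skorokhod_dist T x y"
    unfolding skorokhod_dist_def using ne[of x y] by (auto intro!: cInf_greatest)
  show "skorokhod_dist T x y = skorokhod_dist T y x"
  proof -
    have "skorokhod_close T x y e \<longleftrightarrow> skorokhod_close T y x e" for e
      using skorokhod_close_commute by blast
    then show ?thesis by (simp add: skorokhod_dist_def conj_commute)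
  qed
  have lt: "skorokhod_close T x y e"
    if "x \<in> cadlag_space T" "y \<in> cadlag_space T" "skorokhod_dist T x y < e"
    for x y :: "real \<Rightarrow> 'a" and e
  proof -
    note ne_xy = ne[OF that(1,2)]
    have "Inf (?S x y) < e" using that by (simp add: skorokhod_dist_def)
    then obtain e' where "skorokhod_close T x y e'" "e' < e"
      using cInf_less_iff[OF ne_xy bdd] by auto
    then show ?thesis unfolding skorokhod_close_def
      by (meson order.strict_implies_order order_trans)
  qed
  assume x: "x \<in> cadlag_space T" and y: "y \<in> cadlag_space T"
  show "skorokhod_dist T x y = 0 \<longleftrightarrow> x = y"
  proof
    assume "skorokhod_dist T x y = 0"
    then show "x = y" using lt[OF x y] by (intro skorokhod_close_all_imp_eq[OF x y]) auto
  next
    assume xy: "x = y"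
    have "skorokhod_close T x y e" if "e > 0" for e
      unfolding skorokhod_close_def xy using that by (intro bexI[OF _ id_time_change]) auto
    then have "?S x y = {0<..}" by auto
    then show "skorokhod_dist T x y = 0" using x y by (simp add: skorokhod_dist_def)
  qed
  assume z: "z \<in> cadlag_space T"
  show "skorokhod_dist T x z \<le> skorokhod_dist T x y + skorokhod_dist T y z"
  proof (rule field_le_epsilon)
    fix e :: real assume e: "e > 0"
    have 1: "skorokhod_close T x y (skorokhod_dist T x y + e/2)" using lt[OF x y] e by simp
    have 2: "skorokhod_close T y z (skorokhod_dist T y z + e/2)" using lt[OF y z] e by simp
    have nn: "0 \<le> skorokhod_dist T x y" "0 \<le> skorokhod_dist T y z"
      unfolding skorokhod_dist_def using ne[of x y] ne[of y z] by (auto intro!: cInf_greatest)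
    have "skorokhod_dist T x y + e/2 + (skorokhod_dist T y z + e/2) \<in> ?S x z"
      using skorokhod_close_trans[OF 1 2] nn e by simp
    then have "Inf (?S x z) \<le> skorokhod_dist T x y + e/2 + (skorokhod_dist T y z + e/2)"
      by (rule cInf_lower[OF _ bdd])
    then show "skorokhod_dist T x z \<le> skorokhod_dist T x y + skorokhod_dist T y z + e"
      using x z by (simp add: skorokhod_dist_def[of T x z])
  qed
qed

definition skorokhod_topology :: "real \<Rightarrow> (real \<Rightarrow> 'v::metric_space) topology" where
  "skorokhod_topology T = Metric_space.mtopology (cadlag_space T) (skorokhod_dist T)"


section \<open>Weak convergence\<close>

definition borel_of :: "'x topology \<Rightarrow> 'x measure" where
  "borel_of S = sigma (topspace S) {U. openin S U}"

definition converges_in_law ::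
    "'x topology \<Rightarrow> 'a measure \<Rightarrow> (nat \<Rightarrow> 'a \<Rightarrow> 'x) \<Rightarrow> 'b measure \<Rightarrow> ('b \<Rightarrow> 'x) \<Rightarrow> bool" where
  "converges_in_law S M X P Y \<longleftrightarrow>
     (\<forall>n. X n \<in> M \<rightarrow>\<^sub>M borel_of S) \<and> Y \<in> P \<rightarrow>\<^sub>M borel_of S \<and>
     (\<forall>g. continuous_map S euclideanreal g \<and> bounded (g ` topspace S) \<longrightarrow>
        (\<lambda>n. \<integral>\<omega>. g (X n \<omega>) \<partial>M) \<longlonglongrightarrow> (\<integral>\<omega>. g (Y \<omega>) \<partial>P))"

definition process_path :: "real \<Rightarrow> (real \<Rightarrow> 'a \<Rightarrow> 'v) \<Rightarrow> 'a \<Rightarrow> (real \<Rightarrow> 'v)" where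
  "process_path T X \<omega> = restrict (\<lambda>t. X t \<omega>) {0..T}"

definition processes_converge_weakly ::
    "'a measure \<Rightarrow> (nat \<Rightarrow> real \<Rightarrow> 'a \<Rightarrow> 'v::metric_space) \<Rightarrow> 'b measure \<Rightarrow> (real \<Rightarrow> 'b \<Rightarrow> 'v) \<Rightarrow> bool" where
  "processes_converge_weakly M X P Y \<longleftrightarrow>
     (\<forall>T>0. converges_in_law (skorokhod_topology T)
              M (\<lambda>n. process_path T (X n)) P (process_path T Y))"


section \<open>The equation \<open>dY = - g dt - Y(t-) N(dt)\<close>\<close>

text \<open>Time runs through \<open>[0,\<infinity>)\<close>; filtrations are indexed by all reals only to match
  \<^locale>\<open>filtration\<close> (any filtration on \<open>[0,\<infinity>)\<close> extends by its value at \<open>0\<close>), and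
  processes are unconstrained at negative times.\<close>

definition poisson_process ::
    "real \<Rightarrow> 'w measure \<Rightarrow> (real \<Rightarrow> 'w measure) \<Rightarrow> (real \<Rightarrow> 'w \<Rightarrow> nat) \<Rightarrow> bool" where
  "poisson_process \<gamma> P F N \<longleftrightarrow>
     (\<forall>t\<ge>0. N t \<in> F t \<rightarrow>\<^sub>M count_space UNIV) \<and>
     (\<forall>\<omega>\<in>space P. N 0 \<omega> = 0 \<and> mono_on {0..} (\<lambda>t. N t \<omega>) \<and> cadlag_on {0..} (\<lambda>t. N t \<omega>)) \<and>
     (\<forall>s t. 0 \<le> s \<and> s < t \<longrightarrow>
        distr P (count_space UNIV) (\<lambda>\<omega>. N t \<omega> - N s \<omega>) = measure_pmf (poisson_pmf (\<gamma> * (t - s))) \<and>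
        prob_space.indep_set P (sets (F s)) {(\<lambda>\<omega>. N t \<omega> - N s \<omega>) -` B \<inter> space P | B. True})"

text \<open>Pathwise integral over \<open>(0,t]\<close> against a nondecreasing, right-continuous counting path.\<close>

definition counting_integral ::
    "(real \<Rightarrow> nat) \<Rightarrow> (real \<Rightarrow> 'v::real_vector) \<Rightarrow> real \<Rightarrow> 'v" where
  "counting_integral N H t =
     (\<Sum>s | 0 < s \<and> s \<le> t \<and> N s \<noteq> Lim (at_left s) N. real (N s - Lim (at_left s) N) *\<^sub>R H s)"

definition weak_solution ::
    "real \<Rightarrow> 'v::euclidean_space \<Rightarrow> 'w measure \<Rightarrow> (real \<Rightarrow> 'w measure) \<Rightarrow>
     (real \<Rightarrow> 'w \<Rightarrow> nat) \<Rightarrow> (real \<Rightarrow> 'w \<Rightarrow> 'v) \<Rightarrow> bool" where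
  "weak_solution \<gamma> g P F N Y \<longleftrightarrow>
     prob_space P \<and> filtration (space P) F \<and> (\<forall>t. sets (F t) \<subseteq> sets P) \<and>
     poisson_process \<gamma> P F N \<and>
     (\<forall>t\<ge>0. Y t \<in> F t \<rightarrow>\<^sub>M borel) \<and>
     (\<forall>\<omega>\<in>space P. cadlag_on {0..} (\<lambda>t. Y t \<omega>)) \<and>
     (AE \<omega> in P. \<forall>t\<ge>0. Y t \<omega> = Y 0 \<omega> - t *\<^sub>R g -
        counting_integral (\<lambda>s. N s \<omega>) (\<lambda>s. Lim (at_left s) (\<lambda>u. Y u \<omega>)) t)"

definition stationary_process :: "'w measure \<Rightarrow> (real \<Rightarrow> 'w \<Rightarrow> 'v::topological_space) \<Rightarrow> bool" where
  "stationary_process P Y \<longleftrightarrow>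
     (\<forall>J h. finite J \<and> J \<subseteq> {0..} \<and> 0 \<le> h \<longrightarrow>
        distr P (PiM J (\<lambda>_. borel)) (\<lambda>\<omega>. \<lambda>t\<in>J. Y (t + h) \<omega>) =
        distr P (PiM J (\<lambda>_. borel)) (\<lambda>\<omega>. \<lambda>t\<in>J. Y t \<omega>))"

text \<open>Invariance speaks about all weak solutions carried by a measure on the type \<open>'w\<close>.\<close>

definition invariant_distribution ::
    "'w itself \<Rightarrow> real \<Rightarrow> 'v::euclidean_space \<Rightarrow> 'v measure \<Rightarrow> bool" where
  "invariant_distribution (_ :: 'w itself) \<gamma> g \<nu> \<longleftrightarrow>
     prob_space \<nu> \<and> sets \<nu> = sets borel \<and>
     (\<forall>(P :: 'w measure) F N Y.
        weak_solution \<gamma> g P F N Y \<and> distr P borel (Y 0) = \<nu> \<longrightarrow>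
        (\<forall>t\<ge>0. distr P borel (Y t) = \<nu>))"

text \<open>A type rich enough to carry a weak solution with any initial law, needed because
  HOL does not quantify over types inside a formula.\<close>

type_synonym 'v canonical = "'v \<times> (nat \<Rightarrow> real)"

end

theory Submission
  imports Defs
begin

text \<open>Put \<open>b\<^sub>k = \<eta>\<^sub>k\<^sup>\<beta>\<close>. The rescaled component moves by \<open>- b\<^sub>k\<close> times a drift that tends to \<open>\<nabla>f(x\<^sup>\<star>)\<close> in
  \<open>L\<^sup>1\<close>, because the mean square distance of the iterates to \<open>x\<^sup>\<star>\<close> tends to \<open>0\<close>, plus martingale noise, and
  is reset to \<open>0\<close> with probability \<open>\<gamma> b\<^sub>k\<close>. On a time window of bounded length the accumulated drift error is
  small in \<open>L\<^sup>1\<close>, and the noise is small by Kolmogorov's maximal inequality, since the sum of the \<open>b\<^sub>k\<^sup>2\<close> over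
  the window tends to \<open>0\<close>. A window of length \<open>s\<close> in front of the time interval contains a reset with probability
  at least \<open>1 - exp (- \<gamma> s)\<close>, and a reset erases the past. Hence, up to a uniformly small error, the path is a
  deterministic functional of finitely many coins. A stationary solution of the equation, sampled on the same grid,
  is up to small errors the same functional of the indicators that the Poisson process jumps in the cells of the grid.
  Both families are independent, with success probabilities that differ by at most \<open>(\<gamma> b\<^sub>k)\<^sup>2\<close>, so the
  expectations of bounded Lipschitz functionals of the paths have the same limit. No tightness argument is needed.

  After time \<open>t\<close> a solution sits on the ray \<open>{- a g | a \<ge> c}\<close>, \<open>c \<le> t\<close>, exactly when there is no jump during the
  last \<open>c\<close> time units, up to an event of probability \<open>exp (- \<gamma> t)\<close>. This identifies the invariant distribution,
  because a distribution on the ray is determined by these probabilities.\<close>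

text \<open>The iterates and the limit live on different probability spaces, and nothing makes their
  jump times agree, so their paths cannot be matched directly. Sampling the solution at the knots of
  the step grid moves its jumps onto knots; this is a small perturbation in the Skorokhod metric
  because the mesh tends to 0, and once all jumps sit on common knots the sup distance suffices. A
  solution has no past before time 0, so stationarity is used to shift it by the length of the
  window, which gives it one. That distance tends to 0 because \<eta>/p is eventually
  \<eta>^(1-\<beta>)/\<gamma>. The parameters are fixed in this order: the tolerance
  \<open>\<epsilon>\<close> for noise and drift and the window length \<open>s\<close> first, then
  the bound \<open>\<theta>\<close> on the mesh and the bound \<open>\<rho>\<close> on the mean
  drift error, both of which depend on \<open>\<epsilon>\<close> and \<open>s\<close>.\<close>

section \<open>Borel sets of a topology\<close>

lemma topspace_borel_of: "space (borel_of S) = topspace S"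
  unfolding borel_of_def by (rule space_measure_of) (auto dest: openin_subset)

lemma sets_borel_of_openin: "openin S U \<Longrightarrow> U \<in> sets (borel_of S)"
  unfolding borel_of_def by (subst sets_measure_of) (auto dest: openin_subset)

lemma measurable_borel_ofI:
  assumes "\<And>\<omega>. \<omega> \<in> space N \<Longrightarrow> X \<omega> \<in> topspace S"
    and "\<And>U. openin S U \<Longrightarrow> X -` U \<inter> space N \<in> sets N"
  shows "X \<in> N \<rightarrow>\<^sub>M borel_of S"
  unfolding borel_of_def by (rule measurable_measure_of) (use assms in \<open>auto dest: openin_subset\<close>)

lemma continuous_map_measurable_borel_of:
  assumes "continuous_map S T h"
  shows "h \<in> borel_of S \<rightarrow>\<^sub>M borel_of T"
proof (rule measurable_borel_ofI)
  show "h \<omega> \<in> topspace T" if "\<omega> \<in> space (borel_of S)" for \<omega>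
    using that assms by (auto simp: topspace_borel_of continuous_map_def)
  fix U assume "openin T U"
  then have "openin S {x \<in> topspace S. h x \<in> U}"
    using assms by (simp add: continuous_map_def)
  then have "{x \<in> topspace S. h x \<in> U} \<in> sets (borel_of S)" by (rule sets_borel_of_openin)
  moreover have "{x \<in> topspace S. h x \<in> U} = h -` U \<inter> space (borel_of S)"
    by (auto simp: topspace_borel_of)
  ultimately show "h -` U \<inter> space (borel_of S) \<in> sets (borel_of S)" by simp
qed

lemma borel_of_euclidean: "borel_of euclidean = borel"
  by (simp add: borel_of_def borel_def)

lemma continuous_map_measurable_real:
  assumes "continuous_map S euclideanreal h"
  shows "h \<in> borel_measurable (borel_of S)"
  using continuous_map_measurable_borel_of[OF assms] by (simp add: borel_of_euclidean)

section \<open>Lipschitz test functions and measurable limits in a metric space\<close>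

context Metric_space
begin

lemma lipschitz_continuous_map_real:
  assumes "\<And>x y. x \<in> M \<Longrightarrow> y \<in> M \<Longrightarrow> \<bar>h x - h y\<bar> \<le> K * d x y"
  shows "continuous_map mtopology euclideanreal h"
proof -
  have "openin mtopology {x \<in> M. h x \<in> U}" if U: "open U" for U
    unfolding openin_mtopology
  proof (intro conjI allI impI)
    fix x assume "x \<in> {x \<in> M. h x \<in> U}"
    then have x: "x \<in> M" "h x \<in> U" by auto
    obtain e where e: "e > 0" "\<And>y. \<bar>y - h x\<bar> < e \<Longrightarrow> y \<in> U"
      using U x(2) unfolding open_dist dist_real_def by meson
    \<comment> \<open>\<open>K\<close> may be zero or negative, hence the divisor
      \<open>\<bar>K\<bar> + 1\<close>.\<close>
    have "mball x (e / (\<bar>K\<bar> + 1)) \<subseteq> {x \<in> M. h x \<in> U}"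
    proof
      fix y assume y: "y \<in> mball x (e / (\<bar>K\<bar> + 1))"
      then have "d x y * (\<bar>K\<bar> + 1) < e" by (simp add: field_simps add_nonneg_pos)
      moreover have "K * d x y \<le> \<bar>K\<bar> * d x y" by (intro mult_right_mono) auto
      ultimately have "K * d x y < e" using nonneg[of x y] by (simp add: algebra_simps del: nonneg)
      moreover have "\<bar>h x - h y\<bar> \<le> K * d x y" using assms y by auto
      ultimately have "h y \<in> U" by (intro e(2)) auto
      then show "y \<in> {x \<in> M. h x \<in> U}" using y by auto
    qed
    then show "\<exists>r>0. mball x r \<subseteq> {x \<in> M. h x \<in> U}"
      using e(1) by (intro exI[of _ "e / (\<bar>K\<bar> + 1)"]) (auto simp: add_nonneg_pos)
  qed auto
  then show ?thesis by (auto simp: continuous_map_def)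
qed

text \<open>The approximants are the Pasch-Hausdorff envelopes, infimal convolutions of
  \<open>h\<close> with \<open>k\<close> times the distance. They need neither separability nor
  completeness of the space.\<close>

lemma lipschitz_envelope:
  assumes cont: "continuous_map mtopology euclideanreal h" and B: "\<And>x. x \<in> M \<Longrightarrow> \<bar>h x\<bar> \<le> B"
    and ne: "M \<noteq> {}"
  obtains H :: "nat \<Rightarrow> 'a \<Rightarrow> real" where
    "\<And>k x y. x \<in> M \<Longrightarrow> y \<in> M \<Longrightarrow> \<bar>H k x - H k y\<bar> \<le> real k * d x y"
    "\<And>k x. x \<in> M \<Longrightarrow> \<bar>H k x\<bar> \<le> B"
    "\<And>k x. x \<in> M \<Longrightarrow> H k x \<le> h x"
    "\<And>x. x \<in> M \<Longrightarrow> (\<lambda>k. H k x) \<longlonglongrightarrow> h x"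
proof -
  define H where "H k x = (INF y\<in>M. h y + real k * d x y)" for k x
  have low: "- B \<le> h y + real k * d x y" if "y \<in> M" for k x y
    using B[OF that] by (intro order_trans[OF _ add_increasing2[OF _ order_refl]]) auto
  have bdd: "bdd_below ((\<lambda>y. h y + real k * d x y) ` M)" for k x
    using low by (intro bdd_belowI[of _ "-B"]) auto
  have upper: "H k x \<le> h y + real k * d x y" if "y \<in> M" for k x y
    unfolding H_def by (rule cINF_lower[OF bdd that])
  have lower: "c \<le> H k x" if "\<And>y. y \<in> M \<Longrightarrow> c \<le> h y + real k * d x y" for c k x
    unfolding H_def by (rule cINF_greatest[OF ne that])
  have H_le: "H k x \<le> h x" if "x \<in> M" for k x
    using upper[OF that, of k x] that by simp
  have Lip1: "H k x \<le> H k y + real k * d x y" if "x \<in> M" "y \<in> M" for k x y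
  proof -
    have "H k x - real k * d x y \<le> H k y"
    proof (rule lower)
      fix z assume z: "z \<in> M"
      have "real k * d x z \<le> real k * (d x y + d y z)"
        using triangle[OF that z] by (intro mult_left_mono) auto
      then show "H k x - real k * d x y \<le> h z + real k * d y z"
        using upper[OF z, of k x] by (simp add: algebra_simps)
    qed
    then show ?thesis by simp
  qed
  show ?thesis
  proof (rule that)
    show "\<bar>H k x - H k y\<bar> \<le> real k * d x y" if "x \<in> M" "y \<in> M" for k x y
      using Lip1[OF that, of k] Lip1[OF that(2,1), of k] by (simp add: commute abs_le_iff)
    show "\<bar>H k x\<bar> \<le> B" if "x \<in> M" for k x
      using H_le[OF that, of k] B[OF that] lower[of "-B" k x] low by (auto simp: abs_le_iff)
    show "H k x \<le> h x" if "x \<in> M" for k x by (rule H_le[OF that])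
    show "(\<lambda>k. H k x) \<longlonglongrightarrow> h x" if x: "x \<in> M" for x
    proof (rule LIMSEQ_I)
      fix e :: real assume e: "e > 0"
      have "openin mtopology {y \<in> M. h y \<in> {h x - e/2<..}}"
        using openin_continuous_map_preimage[OF cont, of "{h x - e/2<..}"] by simp
      then obtain r where r: "r > 0" "mball x r \<subseteq> {y \<in> M. h y \<in> {h x - e/2<..}}"
        unfolding openin_mtopology using x e by auto
      \<comment> \<open>Outside the ball of radius \<open>r\<close> the penalty then exceeds the
        oscillation \<open>2 * B\<close> of \<open>h\<close>, so only points of the ball, where
        \<open>h\<close> is close to \<open>h x\<close>, compete for the infimum.\<close>
      obtain k0 :: nat where k0: "real k0 * r > 2 * B"
        using reals_Archimedean3[OF r(1)] by (metis mult.commute)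
      have "h x - e/2 \<le> H k x" if k: "k \<ge> k0" for k
      proof (rule lower)
        fix y assume y: "y \<in> M"
        show "h x - e/2 \<le> h y + real k * d x y"
        proof (cases "d x y < r")
          case True
          then have "h x - e/2 < h y" using r(2) x y by (auto simp: subset_iff)
          then show ?thesis by (intro order_trans[OF _ add_increasing2[OF _ order_refl]]) auto
        next
          case False
          have "real k0 * r \<le> real k * d x y"
            using False k r(1) by (intro mult_mono) auto
          then show ?thesis using k0 B[OF x] B[OF y] e by (auto simp: abs_le_iff)
        qed
      qed
      then show "\<exists>no. \<forall>n\<ge>no. norm (H n x - h x) < e"
        using H_le[OF x] e by (intro exI[of _ k0] allI impI) (smt (verit) real_norm_def field_sum_of_halves)
    qed
  qed
qed

text \<open>Approximation from below yields only a lower bound on the integrals along the sequence;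
  the upper bound is the same statement for \<open>- h\<close>.\<close>

lemma converges_in_law_lipschitzI:
  fixes P :: "'p measure" and N :: "'n measure"
  assumes "prob_space P" "prob_space N"
    and X: "\<And>n. X n \<in> N \<rightarrow>\<^sub>M borel_of mtopology" and Y: "Y \<in> P \<rightarrow>\<^sub>M borel_of mtopology"
    and lim: "\<And>h K B. (\<And>x y. x \<in> M \<Longrightarrow> y \<in> M \<Longrightarrow> \<bar>h x - h y\<bar> \<le> K * d x y) \<Longrightarrow>
        (\<And>x. x \<in> M \<Longrightarrow> \<bar>h x\<bar> \<le> B) \<Longrightarrow> K \<ge> 0 \<Longrightarrow>
        (\<lambda>n. \<integral>\<omega>. h (X n \<omega>) \<partial>N) \<longlonglongrightarrow> (\<integral>\<omega>. h (Y \<omega>) \<partial>P)"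
  shows "converges_in_law mtopology N X P Y"
proof -
  interpret P: prob_space P by fact
  interpret N: prob_space N by fact
  have YM: "Y \<omega> \<in> M" if "\<omega> \<in> space P" for \<omega>
    using measurable_space[OF Y that] by (simp add: topspace_borel_of)
  have XM: "X n \<omega> \<in> M" if "\<omega> \<in> space N" for n \<omega>
    using measurable_space[OF X that] by (simp add: topspace_borel_of)
  have ne: "M \<noteq> {}" using YM P.not_empty by auto
  have half: "\<forall>\<^sub>F n in sequentially. (\<integral>\<omega>. h (Y \<omega>) \<partial>P) - e < (\<integral>\<omega>. h (X n \<omega>) \<partial>N)"
    if h: "continuous_map mtopology euclideanreal h" and B: "\<And>x. x \<in> M \<Longrightarrow> \<bar>h x\<bar> \<le> B"
      and e: "e > 0" for h B e
  proof -
    obtain H :: "nat \<Rightarrow> 'a \<Rightarrow> real" where H: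
      "\<And>k x y. x \<in> M \<Longrightarrow> y \<in> M \<Longrightarrow> \<bar>H k x - H k y\<bar> \<le> real k * d x y"
      "\<And>k x. x \<in> M \<Longrightarrow> \<bar>H k x\<bar> \<le> B"
      "\<And>k x. x \<in> M \<Longrightarrow> H k x \<le> h x"
      "\<And>x. x \<in> M \<Longrightarrow> (\<lambda>k. H k x) \<longlonglongrightarrow> h x"
      using lipschitz_envelope[OF h B ne] by blast
    have Hc: "continuous_map mtopology euclideanreal (H k)" for k
      by (rule lipschitz_continuous_map_real[OF H(1)])
    note mY = measurable_compose[OF Y continuous_map_measurable_real]
    note mX = measurable_compose[OF X continuous_map_measurable_real]
    have "(\<lambda>k. \<integral>\<omega>. H k (Y \<omega>) \<partial>P) \<longlonglongrightarrow> (\<integral>\<omega>. h (Y \<omega>) \<partial>P)"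
      by (rule integral_dominated_convergence[where w="\<lambda>_. B"])
        (use mY[OF h] mY[OF Hc] YM H in auto)
    then have "\<forall>\<^sub>F k in sequentially. (\<integral>\<omega>. h (Y \<omega>) \<partial>P) - e/2 < (\<integral>\<omega>. H k (Y \<omega>) \<partial>P)"
      by (rule order_tendstoD) (use e in simp)
    then obtain k where k: "(\<integral>\<omega>. h (Y \<omega>) \<partial>P) - e/2 < (\<integral>\<omega>. H k (Y \<omega>) \<partial>P)"
      by (auto simp: eventually_sequentially)
    have "(\<lambda>n. \<integral>\<omega>. H k (X n \<omega>) \<partial>N) \<longlonglongrightarrow> (\<integral>\<omega>. H k (Y \<omega>) \<partial>P)"
      by (rule lim[OF H(1,2)]) auto
    then have "\<forall>\<^sub>F n in sequentially. (\<integral>\<omega>. H k (Y \<omega>) \<partial>P) - e/2 < (\<integral>\<omega>. H k (X n \<omega>) \<partial>N)"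
      by (rule order_tendstoD) (use e in simp)
    then show ?thesis
    proof eventually_elim
      case (elim n)
      have "(\<integral>\<omega>. H k (X n \<omega>) \<partial>N) \<le> (\<integral>\<omega>. h (X n \<omega>) \<partial>N)"
        by (intro integral_mono N.integrable_const_bound[where B=B])
          (use mX[OF h] mX[OF Hc] XM H B in auto)
      then show ?case using elim k by simp
    qed
  qed
  show ?thesis unfolding converges_in_law_def
  proof (intro conjI allI impI)
    fix h assume "continuous_map mtopology euclideanreal h \<and> bounded (h ` topspace mtopology)"
    then obtain B where h: "continuous_map mtopology euclideanreal h"
      and B: "\<And>x. x \<in> M \<Longrightarrow> \<bar>h x\<bar> \<le> B"
      by (auto simp: bounded_iff)
    have h': "continuous_map mtopology euclideanreal (\<lambda>x. - h x)"
      using h by (rule continuous_map_minus)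
    have B': "\<And>x. x \<in> M \<Longrightarrow> \<bar>- h x\<bar> \<le> B" using B by simp
    show "(\<lambda>n. \<integral>\<omega>. h (X n \<omega>) \<partial>N) \<longlonglongrightarrow> (\<integral>\<omega>. h (Y \<omega>) \<partial>P)"
    proof (rule tendstoI)
      fix e :: real assume e: "e > 0"
      show "\<forall>\<^sub>F n in sequentially. dist (\<integral>\<omega>. h (X n \<omega>) \<partial>N) (\<integral>\<omega>. h (Y \<omega>) \<partial>P) < e"
      proof -
        have "\<forall>\<^sub>F n in sequentially. (\<integral>\<omega>. h (Y \<omega>) \<partial>P) - e < (\<integral>\<omega>. h (X n \<omega>) \<partial>N)"
          by (rule half[OF h, of B e]) (use B e in auto)
        moreover have "\<forall>\<^sub>F n in sequentially. (\<integral>\<omega>. - h (Y \<omega>) \<partial>P) - e < (\<integral>\<omega>. - h (X n \<omega>) \<partial>N)"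
          by (rule half[OF h', of B e]) (use B' e in auto)
        ultimately show ?thesis by eventually_elim (auto simp: dist_real_def)
      qed
    qed
  qed (use X Y in auto)
qed

text \<open>The space may fail to be separable, so the argument works with open sets alone: the
  limit lies in \<open>U\<close> iff for some \<open>m\<close> the approximants are eventually in
  \<open>V m\<close>, the points of \<open>U\<close> at distance at least \<open>1 / (m + 1)\<close>
  from the complement. \<open>V m\<close> is closed, being the complement of a union of balls, and
  the quantifiers are countable.\<close>

lemma measurable_limit_mtopology:
  assumes X: "\<And>k. X k \<in> N \<rightarrow>\<^sub>M borel_of mtopology" and Y: "\<And>\<omega>. \<omega> \<in> space N \<Longrightarrow> Y \<omega> \<in> M"
    and lim: "\<And>\<omega>. \<omega> \<in> space N \<Longrightarrow> (\<lambda>k. d (X k \<omega>) (Y \<omega>)) \<longlonglongrightarrow> 0"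
  shows "Y \<in> N \<rightarrow>\<^sub>M borel_of mtopology"
proof (rule measurable_borel_ofI)
  show "Y \<omega> \<in> topspace mtopology" if "\<omega> \<in> space N" for \<omega> using Y[OF that] by simp
  fix U assume U: "openin mtopology U"
  define V where "V m = {x \<in> M. mball x (inverse (real (Suc m))) \<subseteq> U}" for m
  have V: "V m \<in> sets (borel_of mtopology)" for m
  proof -
    have "openin mtopology (\<Union>y\<in>M - U. mball y (inverse (real (Suc m))))" by auto
    then have "(\<Union>y\<in>M - U. mball y (inverse (real (Suc m)))) \<in> sets (borel_of mtopology)"
      by (rule sets_borel_of_openin)
    then have "space (borel_of mtopology) - (\<Union>y\<in>M - U. mball y (inverse (real (Suc m)))) \<in> sets (borel_of mtopology)"
      by (rule sets.compl_sets)
    moreover have "V m = space (borel_of mtopology) - (\<Union>y\<in>M - U. mball y (inverse (real (Suc m))))"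
      using commute by (auto simp: V_def topspace_borel_of) 
    ultimately show ?thesis by simp
  qed
  have XM: "X n \<omega> \<in> M" if "\<omega> \<in> space N" for n \<omega>
    using measurable_space[OF X that] by (simp add: topspace_borel_of)
  have "Y \<omega> \<in> U \<longleftrightarrow> (\<exists>m k0. \<forall>k\<ge>k0. X k \<omega> \<in> V m)" if w: "\<omega> \<in> space N" for \<omega>
  proof
    assume "Y \<omega> \<in> U"
    then obtain r where r: "r > 0" "mball (Y \<omega>) r \<subseteq> U"
      using U unfolding openin_mtopology by auto
    obtain m where m: "inverse (real (Suc m)) < r / 2"
      using reals_Archimedean[of "r/2"] r(1) by auto
    have "\<forall>\<^sub>F k in sequentially. d (X k \<omega>) (Y \<omega>) < r / 2"
      using order_tendstoD(2)[OF lim[OF w], of "r/2"] r(1) by simp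
    then obtain k0 where k0: "\<And>k. k \<ge> k0 \<Longrightarrow> d (X k \<omega>) (Y \<omega>) < r / 2"
      by (auto simp: eventually_sequentially)
    have "X k \<omega> \<in> V m" if "k \<ge> k0" for k
    proof -
      have "mball (X k \<omega>) (inverse (real (Suc m))) \<subseteq> mball (Y \<omega>) r"
      proof
        fix z assume z: "z \<in> mball (X k \<omega>) (inverse (real (Suc m)))"
        then have "d (Y \<omega>) z \<le> d (Y \<omega>) (X k \<omega>) + d (X k \<omega>) z"
          using Y[OF w] XM[OF w] by (intro triangle) auto
        then show "z \<in> mball (Y \<omega>) r"
          using z m k0[OF that] Y[OF w] by (auto simp: commute)
      qed
      then show ?thesis using r(2) XM[OF w] by (auto simp: V_def)
    qed
    then show "\<exists>m k0. \<forall>k\<ge>k0. X k \<omega> \<in> V m" by blast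
  next
    assume "\<exists>m k0. \<forall>k\<ge>k0. X k \<omega> \<in> V m"
    then obtain m k0 where k: "\<And>k. k \<ge> k0 \<Longrightarrow> X k \<omega> \<in> V m" by blast
    have "\<forall>\<^sub>F k in sequentially. d (X k \<omega>) (Y \<omega>) < inverse (real (Suc m))"
      using order_tendstoD(2)[OF lim[OF w], of "inverse (real (Suc m))"] by simp
    then have "\<forall>\<^sub>F k in sequentially. d (X k \<omega>) (Y \<omega>) < inverse (real (Suc m)) \<and> k \<ge> k0"
      using eventually_ge_at_top by (rule eventually_conj)
    then obtain k1 where "d (X k1 \<omega>) (Y \<omega>) < inverse (real (Suc m))" "k1 \<ge> k0"
      by (auto simp: eventually_sequentially)
    then have "Y \<omega> \<in> mball (X k1 \<omega>) (inverse (real (Suc m)))"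
      using XM[OF w] Y[OF w] by auto
    then show "Y \<omega> \<in> U" using k[OF \<open>k1 \<ge> k0\<close>] by (auto simp: V_def)
  qed
  then have "Y -` U \<inter> space N = {\<omega> \<in> space N. \<exists>m k0. \<forall>k. k0 \<le> k \<longrightarrow> X k \<omega> \<in> V m}" by auto
  also have "\<dots> \<in> sets N"
  proof -
    have "{\<omega> \<in> space N. X k \<omega> \<in> V m} \<in> sets N" for k m
      using measurable_sets[OF X V, of k m] by (simp add: vimage_def Int_def conj_commute)
    then show ?thesis by (intro sets.sets_Collect)
  qed
  finally show "Y -` U \<inter> space N \<in> sets N" .
qed

end

section \<open>Skorokhod paths\<close>

interpretation skorokhod: Metric_space "cadlag_space T" "skorokhod_dist T" for T
  by (rule Metric_space_skorokhod)

lemma topspace_skorokhod [simp]: "topspace (skorokhod_topology T) = cadlag_space T"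
  by (simp add: skorokhod_topology_def)

lemma skorokhod_dist_le:
  assumes "x \<in> cadlag_space T" "y \<in> cadlag_space T" "skorokhod_close T x y e" "0 \<le> e"
  shows "skorokhod_dist T x y \<le> e"
\<comment> \<open>The infimum ranges over positive numbers only, while \<open>e\<close> may be
  \<open>0\<close>; hence the slack \<open>r\<close>.\<close>
proof (rule field_le_epsilon)
  fix r :: real assume "r > 0"
  then have "skorokhod_close T x y (e + r)"
    using assms(3) unfolding skorokhod_close_def by (meson add_increasing2 less_imp_le order_trans)
  then have "Inf {e. 0 < e \<and> skorokhod_close T x y e} \<le> e + r"
    using \<open>r > 0\<close> assms(4) by (intro cInf_lower bdd_belowI[of _ 0]) auto
  then show "skorokhod_dist T x y \<le> e + r" using assms by (simp add: skorokhod_dist_def)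
qed

lemma skorokhod_dist_le_sup:
  assumes "x \<in> cadlag_space T" "y \<in> cadlag_space T" "\<And>t. t \<in> {0..T} \<Longrightarrow> dist (x t) (y t) \<le> e" "0 \<le> e"
  shows "skorokhod_dist T x y \<le> e"
  using assms by (intro skorokhod_dist_le) (auto simp: skorokhod_close_def intro!: bexI[OF _ id_time_change])

lemma cadlag_on_cong:
  assumes "\<And>t. t \<in> S \<Longrightarrow> x t = y t"
  shows "cadlag_on S x \<longleftrightarrow> cadlag_on S y"
proof -
  have "(x \<longlongrightarrow> l) (at t within (S \<inter> A)) \<longleftrightarrow> (y \<longlongrightarrow> l) (at t within (S \<inter> A))" for t l A
    by (rule Lim_cong_within) (use assms in auto)
  then show ?thesis using assms by (simp add: cadlag_on_def)
qed

lemma restrict_cadlag_space: "restrict x {0..T} \<in> cadlag_space T \<longleftrightarrow> cadlag_on {0..T} x"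
  using cadlag_on_cong[of "{0..T}" "restrict x {0..T}" x] by (simp add: cadlag_space_def)

lemma cadlag_on_subset:
  assumes "cadlag_on S x" "S' \<subseteq> S"
  shows "cadlag_on S' x"
  unfolding cadlag_on_def
proof (intro ballI conjI)
  fix t assume "t \<in> S'"
  then have t: "t \<in> S" using assms by auto
  have "at t within (S' \<inter> A) \<le> at t within (S \<inter> A)" for A using assms by (intro at_le) auto
  then show "(x \<longlongrightarrow> x t) (at t within S' \<inter> {t<..})" "\<exists>l. (x \<longlongrightarrow> l) (at t within S' \<inter> {..<t})"
    using assms t unfolding cadlag_on_def by (meson tendsto_mono)+
qed

text \<open>Finitely many knots leave a one-sided neighbourhood of \<open>t\<close> free of knots.
  With its left-hand counterpart this gives all one-sided limits of paths that see time through the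
  set of knots already passed.\<close>

lemma eventually_finite_at_most_right:
  fixes t :: real assumes "finite H"
  shows "\<forall>\<^sub>F s in at t within (S \<inter> {t<..}). {u\<in>H. u \<le> s} = {u\<in>H. u \<le> t}"
proof -
  have "\<forall>\<^sub>F s in at t within (S \<inter> {t<..}). \<forall>u\<in>H. t < u \<longrightarrow> s < u"
    using assms
  proof (intro eventually_ball_finite ballI)
    fix u assume "u \<in> H"
    have "\<forall>\<^sub>F s in at t within (S \<inter> {t<..}). s < u" if "t < u"
      using that by (intro order_tendstoD(2)[OF tendsto_ident_at])
    then show "\<forall>\<^sub>F s in at t within S \<inter> {t<..}. t < u \<longrightarrow> s < u" by (cases "t < u") auto
  qed
  moreover have "\<forall>\<^sub>F s in at t within (S \<inter> {t<..}). t < s" by (auto simp: eventually_at_filter)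
  ultimately show ?thesis by eventually_elim (force simp: not_less)
qed

lemma eventually_finite_at_most_left:
  fixes t :: real assumes "finite H"
  shows "\<forall>\<^sub>F s in at t within (S \<inter> {..<t}). {u\<in>H. u \<le> s} = {u\<in>H. u < t}"
proof -
  have "\<forall>\<^sub>F s in at t within (S \<inter> {..<t}). \<forall>u\<in>H. u < t \<longrightarrow> u < s"
    using assms
  proof (intro eventually_ball_finite ballI)
    fix u assume "u \<in> H"
    have "\<forall>\<^sub>F s in at t within (S \<inter> {..<t}). u < s" if "u < t"
      using that by (intro order_tendstoD(1)[OF tendsto_ident_at])
    then show "\<forall>\<^sub>F s in at t within S \<inter> {..<t}. u < t \<longrightarrow> u < s" by (cases "u < t") auto
  qed
  moreover have "\<forall>\<^sub>F s in at t within (S \<inter> {..<t}). s < t" by (auto simp: eventually_at_filter)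
  ultimately show ?thesis by eventually_elim (force simp: not_less)
qed

text \<open>Coefficients that depend on the set of knots passed cover step paths
  (\<open>b = 0\<close>) and the piecewise linear interpolation at once.\<close>

lemma cadlag_on_finite_at_most:
  fixes a b :: "real set \<Rightarrow> 'v::real_normed_vector"
  assumes "finite H"
  shows "cadlag_on S (\<lambda>t. a {u\<in>H. u \<le> t} + t *\<^sub>R b {u\<in>H. u \<le> t})"
  unfolding cadlag_on_def
proof (intro ballI conjI exI)
  fix t
  have "((\<lambda>s. a {u\<in>H. u \<le> t} + s *\<^sub>R b {u\<in>H. u \<le> t}) \<longlongrightarrow> a {u\<in>H. u \<le> t} + t *\<^sub>R b {u\<in>H. u \<le> t})
     (at t within (S \<inter> {t<..}))"
    by (intro tendsto_intros)
  then show "((\<lambda>t. a {u\<in>H. u \<le> t} + t *\<^sub>R b {u\<in>H. u \<le> t}) \<longlongrightarrow> a {u\<in>H. u \<le> t} + t *\<^sub>R b {u\<in>H. u \<le> t})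
     (at t within (S \<inter> {t<..}))"
    by (rule Lim_transform_eventually)
      (use eventually_finite_at_most_right[OF assms] in eventually_elim, simp)
  have "((\<lambda>s. a {u\<in>H. u < t} + s *\<^sub>R b {u\<in>H. u < t}) \<longlongrightarrow> a {u\<in>H. u < t} + t *\<^sub>R b {u\<in>H. u < t})
     (at t within (S \<inter> {..<t}))"
    by (intro tendsto_intros)
  then show "((\<lambda>t. a {u\<in>H. u \<le> t} + t *\<^sub>R b {u\<in>H. u \<le> t}) \<longlongrightarrow> a {u\<in>H. u < t} + t *\<^sub>R b {u\<in>H. u < t})
     (at t within (S \<inter> {..<t}))"
    by (rule Lim_transform_eventually)
      (use eventually_finite_at_most_left[OF assms] in eventually_elim, simp)
qed

section \<open>Sampling a cadlag path at the last grid point\<close>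

definition grid_floor :: "real set \<Rightarrow> real \<Rightarrow> real" where
  "grid_floor H t = Max {u\<in>H. u \<le> t}"

definition grid_ceil :: "real set \<Rightarrow> real \<Rightarrow> real" where
  "grid_ceil H t = Min {u\<in>H. t \<le> u}"

definition is_grid :: "real \<Rightarrow> real \<Rightarrow> real set \<Rightarrow> bool" where
  "is_grid T \<delta> H \<longleftrightarrow> finite H \<and> H \<subseteq> {0..T} \<and> 0 \<in> H \<and> T \<in> H \<and> (\<forall>t\<in>{0..T}. \<exists>u\<in>H. t \<le> u \<and> u \<le> t + \<delta>)"

lemma cadlag_on_grid_floor:
  fixes x :: "real \<Rightarrow> 'v::real_normed_vector"
  assumes "finite H" shows "cadlag_on S (\<lambda>t. x (grid_floor H t))"
  using cadlag_on_finite_at_most[OF assms, of S "\<lambda>A. x (Max A)" "\<lambda>_. 0"] by (simp add: grid_floor_def)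

lemma grid_floor_mem:
  assumes "finite H" "0 \<in> H" "0 \<le> t"
  shows "grid_floor H t \<in> H" "grid_floor H t \<le> t"
proof -
  have "grid_floor H t \<in> {u\<in>H. u \<le> t}"
    unfolding grid_floor_def by (rule Max_in) (use assms in auto)
  then show "grid_floor H t \<in> H" "grid_floor H t \<le> t" by auto
qed

lemma grid_floor_ge: "finite H \<Longrightarrow> u \<in> H \<Longrightarrow> u \<le> t \<Longrightarrow> u \<le> grid_floor H t"
  by (auto simp: grid_floor_def)

lemma grid_ceil:
  assumes "is_grid T \<delta> H" "t \<in> {0..T}"
  shows "grid_ceil H t \<in> H" "t \<le> grid_ceil H t" "grid_ceil H t \<le> t + \<delta>" "grid_ceil H t \<le> T"
    and "\<And>u. u \<in> H \<Longrightarrow> t \<le> u \<Longrightarrow> grid_ceil H t \<le> u"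
proof -
  obtain u where u: "u \<in> H" "t \<le> u" "u \<le> t + \<delta>" using assms unfolding is_grid_def by blast
  have fin: "finite {u\<in>H. t \<le> u}" using assms by (auto simp: is_grid_def)
  have mem: "grid_ceil H t \<in> {u\<in>H. t \<le> u}" unfolding grid_ceil_def by (rule Min_in[OF fin]) (use u in auto)
  show le: "\<And>u. u \<in> H \<Longrightarrow> t \<le> u \<Longrightarrow> grid_ceil H t \<le> u" unfolding grid_ceil_def by (rule Min_le[OF fin]) auto
  show "grid_ceil H t \<in> H" "t \<le> grid_ceil H t" using mem by auto
  then show "grid_ceil H t \<le> T" using assms by (auto simp: is_grid_def)
  show "grid_ceil H t \<le> t + \<delta>" using le[OF u(1,2)] u(3) by simp
qed

text \<open>A piece of a time change over \<open>[a, b]\<close>. Its image has ends rounded up to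
  the grid, so that pieces over adjacent intervals can be glued; the values are compared on
  \<open>[a, b)\<close> only, because the path may jump at \<open>b\<close>.\<close>

definition disc_close :: "real \<Rightarrow> (real \<Rightarrow> 'v::metric_space) \<Rightarrow> real \<Rightarrow> real \<Rightarrow> real \<Rightarrow> real set \<Rightarrow> bool" where
  "disc_close T x e a b H \<longleftrightarrow> (\<exists>l. strict_mono_on {a..b} l \<and> l ` {a..b} = {grid_ceil H a..grid_ceil H b} \<and>
     (\<forall>t\<in>{a..b}. \<bar>l t - t\<bar> \<le> e) \<and> (\<forall>t\<in>{a..<b}. dist (x (grid_floor H (l t))) (x t) \<le> e))"

text \<open>A strictly increasing map onto an interval sends endpoints to endpoints. Both pieces
  therefore take the value \<open>grid_ceil H b\<close> at \<open>b\<close> and join there.\<close>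

lemma disc_close_trans:
  assumes "disc_close T x e a b H" "disc_close T x e b c H" "a < b" "b < c"
  shows "disc_close T x e a c H"
proof -
  obtain l where l: "strict_mono_on {a..b} l" "l ` {a..b} = {grid_ceil H a..grid_ceil H b}"
     "\<And>t. t \<in> {a..b} \<Longrightarrow> \<bar>l t - t\<bar> \<le> e" "\<And>t. t \<in> {a..<b} \<Longrightarrow> dist (x (grid_floor H (l t))) (x t) \<le> e"
    using assms(1) unfolding disc_close_def by blast
  obtain k where k: "strict_mono_on {b..c} k" "k ` {b..c} = {grid_ceil H b..grid_ceil H c}"
     "\<And>t. t \<in> {b..c} \<Longrightarrow> \<bar>k t - t\<bar> \<le> e" "\<And>t. t \<in> {b..<c} \<Longrightarrow> dist (x (grid_floor H (k t))) (x t) \<le> e"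
    using assms(2) unfolding disc_close_def by blast
  have lb: "l b = grid_ceil H b"
  proof (rule antisym)
    have "l b \<in> l ` {a..b}" using assms by simp
    then show le: "l b \<le> grid_ceil H b" unfolding l(2) by simp
    have "l a \<in> l ` {a..b}" using assms by simp
    then have "grid_ceil H b \<in> l ` {a..b}" unfolding l(2) by simp
    then obtain t where "t \<in> {a..b}" "l t = grid_ceil H b" by auto
    then show "grid_ceil H b \<le> l b" using l(1) strict_mono_on_leD[OF l(1), of t b] by auto
  qed
  have kb: "k b = grid_ceil H b"
  proof (rule antisym)
    have "k b \<in> k ` {b..c}" using assms by simp
    then show le: "grid_ceil H b \<le> k b" unfolding k(2) by simp
    have "k c \<in> k ` {b..c}" using assms by simp
    then have "grid_ceil H b \<in> k ` {b..c}" unfolding k(2) by simp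
    then obtain t where "t \<in> {b..c}" "k t = grid_ceil H b" by auto
    then show "k b \<le> grid_ceil H b" using strict_mono_on_leD[OF k(1), of b t] by auto
  qed
  define m where "m t = (if t \<le> b then l t else k t)" for t
  have m2: "m t = k t" if "b \<le> t" for t using that lb kb by (auto simp: m_def)
  have "strict_mono_on {a..c} m"
  proof (rule strict_mono_onI)
    fix r s assume rs: "r \<in> {a..c}" "s \<in> {a..c}" "r < s"
    consider "s \<le> b" | "b \<le> r" | "r < b" "b < s" by linarith
    then show "m r < m s"
    proof cases
      case 1 then show ?thesis using rs l(1) by (auto simp: m_def strict_mono_on_def)
    next
      case 2 then show ?thesis using rs k(1) by (auto simp: m2 strict_mono_on_def)
    next
      case 3
      then have "l r < l b" "k b < k s" using rs l(1) k(1) by (auto simp: strict_mono_on_def)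
      then show ?thesis using 3 lb kb by (simp add: m_def)
    qed
  qed
  moreover have "m ` {a..c} = {grid_ceil H a..grid_ceil H c}"
  proof -
    have "{a..c} = {a..b} \<union> {b..c}" using assms by auto
    moreover have "m ` {a..b} = l ` {a..b}" by (rule image_cong) (auto simp: m_def)
    moreover have "m ` {b..c} = k ` {b..c}" by (rule image_cong) (auto simp: m2)
    ultimately have "m ` {a..c} = l ` {a..b} \<union> k ` {b..c}" by (simp add: image_Un)
    moreover have "l a \<in> l ` {a..b}" "k c \<in> k ` {b..c}" using assms by auto
    ultimately show ?thesis unfolding l(2) k(2) by auto
  qed
  moreover have "\<bar>m t - t\<bar> \<le> e" if "t \<in> {a..c}" for t
    using that l(3) k(3) by (auto simp: m_def)
  moreover have "dist (x (grid_floor H (m t))) (x t) \<le> e" if "t \<in> {a..<c}" for t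
    using that l(4) k(4) m2[of t] by (cases "t < b") (auto simp: m_def)
  ultimately show ?thesis unfolding disc_close_def by blast
qed

text \<open>The time change is the affine map onto the interval between the rounded ends. No grid
  point lies in \<open>[b, grid_ceil H b)\<close>, so every sampling point that occurs stays in
  \<open>[a, b)\<close>, where the oscillation is at most \<open>e\<close>.\<close>

lemma disc_close_osc:
  assumes osc: "\<And>s t. s \<in> {a..<b} \<Longrightarrow> t \<in> {a..<b} \<Longrightarrow> dist (x s) (x t) \<le> e"
    and H: "is_grid T \<delta> H" and ab: "0 \<le> a" "a < b" "b \<le> T" and \<delta>: "\<delta> < b - a" "\<delta> \<le> e"
  shows "disc_close T x e a b H"
proof -
  let ?A = "grid_ceil H a" and ?B = "grid_ceil H b"
  note A = grid_ceil[OF H, of a] and B = grid_ceil[OF H, of b]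
  have AB: "?A < ?B" "a \<le> ?A" "?A \<le> a + \<delta>" "b \<le> ?B" "?B \<le> b + \<delta>" "?A < b"
    using A(1-3) B(1-3) ab \<delta> by auto
  define l where "l t = ?A + (t - a) / (b - a) * (?B - ?A)" for t
  have "strict_mono_on {a..b} l"
    using AB ab by (auto simp: strict_mono_on_def l_def divide_strict_right_mono)
  moreover have "l ` {a..b} = {?A..?B}"
  proof (intro equalityI subsetI)
    fix s assume "s \<in> l ` {a..b}"
    then obtain t where t: "t \<in> {a..b}" "s = l t" by auto
    define r where "r = (t - a) / (b - a)"
    have "0 \<le> r" "r \<le> 1" using t ab by (auto simp: r_def)
    then have "0 \<le> r * (?B - ?A)" "r * (?B - ?A) \<le> 1 * (?B - ?A)"
      using AB by (auto intro!: mult_right_mono simp del: mult_1)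
    then show "s \<in> {?A..?B}" using t by (auto simp: l_def r_def)
  next
    fix s assume s: "s \<in> {?A..?B}"
    define r where "r = (s - ?A) / (?B - ?A)"
    have r: "0 \<le> r" "r \<le> 1" using s AB by (auto simp: r_def)
    have "r * (b - a) \<le> 1 * (b - a)" using r ab by (intro mult_right_mono) auto
    moreover have "0 \<le> r * (b - a)" using r ab by simp
    ultimately have "a + r * (b - a) \<in> {a..b}" by simp
    moreover have "l (a + r * (b - a)) = s" using AB ab by (simp add: l_def r_def)
    ultimately show "s \<in> l ` {a..b}" by (metis imageI)
  qed
  moreover have "\<bar>l t - t\<bar> \<le> e" if t: "t \<in> {a..b}" for t
  proof -
    define r where "r = (t - a) / (b - a)"
    have r: "0 \<le> r" "r \<le> 1" using t ab by (auto simp: r_def)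
    have t': "t = a + r * (b - a)" using ab by (simp add: r_def)
    \<comment> \<open>The displacement is a convex combination of those at the two ends, and each of
      these lies in \<open>[0, \<delta>]\<close>.\<close>
    have eq: "l t - t = (1 - r) * (?A - a) + r * (?B - b)"
    proof -
      have "l t = ?A + r * (?B - ?A)" by (simp add: l_def r_def)
      with t' have "l t - t = ?A + r * (?B - ?A) - (a + r * (b - a))" by linarith
      also have "\<dots> = (1 - r) * (?A - a) + r * (?B - b)" by (simp add: algebra_simps)
      finally show ?thesis .
    qed
    have "(1 - r) * (?A - a) + r * (?B - b) \<le> (1 - r) * \<delta> + r * \<delta>"
      using r AB by (intro add_mono mult_left_mono) auto
    moreover have "0 \<le> (1 - r) * (?A - a) + r * (?B - b)" using r AB by auto
    ultimately show ?thesis using \<delta> by (simp add: eq algebra_simps)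
  qed
  moreover have "dist (x (grid_floor H (l t))) (x t) \<le> e" if t: "t \<in> {a..<b}" for t
  proof (rule osc)
    have H': "finite H" "0 \<in> H" using H by (auto simp: is_grid_def)
    define r where "r = (t - a) / (b - a)"
    have "r < 1" "0 \<le> r" using t ab by (auto simp: r_def)
    then have "r * (?B - ?A) < 1 * (?B - ?A)" "0 \<le> r * (?B - ?A)"
      using AB by (auto intro!: mult_strict_right_mono simp del: mult_1)
    then have lt: "?A \<le> l t" "l t < ?B" by (auto simp: l_def r_def)
    have l0: "0 \<le> l t" using lt AB ab by simp
    have "?A \<le> grid_floor H (l t)" using H'(1) A(1) lt ab by (intro grid_floor_ge) auto
    moreover have "grid_floor H (l t) < b"
    proof (rule ccontr)
      assume "\<not> grid_floor H (l t) < b"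
      then have "?B \<le> grid_floor H (l t)" using grid_floor_mem[OF H' l0] B(5) ab by auto
      then show False using lt grid_floor_mem[OF H' l0] by auto
    qed
    ultimately show "grid_floor H (l t) \<in> {a..<b}" using AB by auto
    show "t \<in> {a..<b}" by (rule t)
  qed
  ultimately show ?thesis unfolding disc_close_def by blast
qed

text \<open>The endpoint \<open>T\<close> has to belong to the grid, because time changes fix it.\<close>

lemma skorokhod_close_grid_floor:
  assumes x: "cadlag_on {0..T} x" and T: "T > 0" and e: "e > 0"
  obtains \<delta> where "\<delta> > 0" "\<And>H. is_grid T \<delta> H \<Longrightarrow> skorokhod_close T (\<lambda>t. x (grid_floor H t)) x e"
proof -
  define P where "P a b \<longleftrightarrow> (0 \<le> a \<and> a < b \<and> b \<le> T \<longrightarrow>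
      (\<exists>\<delta>>0. \<forall>\<delta>' H. \<delta>' \<le> \<delta> \<and> is_grid T \<delta>' H \<longrightarrow> disc_close T x e a b H))" for a b
  have trans: "P a c" if "P a b" "P b c" "a \<le> b" "b \<le> c" for a b c
  proof (cases "0 \<le> a \<and> a < b \<and> b < c \<and> c \<le> T")
    case True
    then obtain d1 d2 where d: "d1 > 0" "\<And>\<delta>' H. \<delta>' \<le> d1 \<Longrightarrow> is_grid T \<delta>' H \<Longrightarrow> disc_close T x e a b H"
      "d2 > 0" "\<And>\<delta>' H. \<delta>' \<le> d2 \<Longrightarrow> is_grid T \<delta>' H \<Longrightarrow> disc_close T x e b c H"
      using \<open>P a b\<close> \<open>P b c\<close> unfolding P_def by fastforce
    have "disc_close T x e a c H" if "\<delta>' \<le> min d1 d2" "is_grid T \<delta>' H" for \<delta>' H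
      using disc_close_trans[OF d(2)[of \<delta>' H] d(4)[of \<delta>' H]] that True by auto
    moreover have "min d1 d2 > 0" using d by simp
    ultimately show ?thesis unfolding P_def by blast
  next
    case False
    then show ?thesis using that by (cases "a = b"; cases "b = c") (auto simp: P_def)
  qed
  have base: "P a b" if "\<And>s t. s \<in> {a..<b} \<Longrightarrow> t \<in> {a..<b} \<Longrightarrow> s \<in> {0..T} \<Longrightarrow> t \<in> {0..T} \<Longrightarrow> dist (x s) (x t) \<le> e" for a b
    unfolding P_def
  proof (intro impI exI[of _ "min e ((b - a) / 2)"] conjI allI)
    fix \<delta>' H assume ab: "0 \<le> a \<and> a < b \<and> b \<le> T" and H: "\<delta>' \<le> min e ((b - a) / 2) \<and> is_grid T \<delta>' H"
    show "disc_close T x e a b H"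
      by (rule disc_close_osc[where \<delta>=\<delta>']) (use ab H that in auto)
  qed (use e in auto)
  \<comment> \<open>Left limits and right continuity give small oscillation on short half-open
    intervals on either side of each \<open>c\<close>; Bolzano's principle turns this local
    statement into a finite partition of \<open>[0, T]\<close>.\<close>
  have "P 0 T"
  proof (rule Bolzano)
    show "0 \<le> T" using T by simp
    show "P a c" if "P a b" "P b c" "a \<le> b" "b \<le> c" for a b c using trans that by blast
    fix c assume c: "0 \<le> c" "c \<le> T"
    obtain l where l: "(x \<longlongrightarrow> l) (at c within ({0..T} \<inter> {..<c}))"
      and r: "(x \<longlongrightarrow> x c) (at c within ({0..T} \<inter> {c<..}))"
      using x c unfolding cadlag_on_def by (meson atLeastAtMost_iff)
    have "\<forall>\<^sub>F s in at c within ({0..T} \<inter> {..<c}). dist (x s) l < e / 2"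
      using l by (rule tendstoD) (use e in simp)
    then obtain d1 where d1: "d1 > 0"
       "\<And>s. s \<in> {0..T} \<Longrightarrow> s < c \<Longrightarrow> dist s c < d1 \<Longrightarrow> dist (x s) l < e / 2"
      unfolding eventually_at by auto
    have "\<forall>\<^sub>F s in at c within ({0..T} \<inter> {c<..}). dist (x s) (x c) < e / 2"
      using r by (rule tendstoD) (use e in simp)
    then obtain d2 where d2': "d2 > 0"
       "\<And>s. s \<in> {0..T} \<Longrightarrow> c < s \<Longrightarrow> dist s c < d2 \<Longrightarrow> dist (x s) (x c) < e / 2"
      unfolding eventually_at by auto
    have d2: "dist (x s) (x c) < e / 2" if "s \<in> {0..T}" "c \<le> s" "dist s c < d2" for s
      using d2'(2)[of s] that e by (cases "s = c") auto
    show "\<exists>d>0. \<forall>a b. a \<le> c \<and> c \<le> b \<and> b - a < d \<longrightarrow> P a b"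
    proof (intro exI[of _ "min d1 d2"] conjI allI impI)
      fix a b assume ab: "a \<le> c \<and> c \<le> b \<and> b - a < min d1 d2"
      have "P a c"
      proof (rule base)
        fix s t assume "s \<in> {a..<c}" "t \<in> {a..<c}" "s \<in> {0..T}" "t \<in> {0..T}"
        then have "dist (x s) l < e / 2" "dist (x t) l < e / 2" using d1(2) ab by (auto simp: dist_real_def)
        then show "dist (x s) (x t) \<le> e" using dist_triangle_half_l by (metis less_imp_le)
      qed
      moreover have "P c b"
      proof (rule base)
        fix s t assume "s \<in> {c..<b}" "t \<in> {c..<b}" "s \<in> {0..T}" "t \<in> {0..T}"
        then have "dist (x s) (x c) < e / 2" "dist (x t) (x c) < e / 2" using d2 ab by (auto simp: dist_real_def)
        then show "dist (x s) (x t) \<le> e" using dist_triangle_half_l by (metis less_imp_le)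
      qed
      ultimately show "P a b" using trans ab by blast
    qed (use d1 d2' in auto)
  qed
  then obtain \<delta> where \<delta>: "\<delta> > 0" "\<And>H. is_grid T \<delta> H \<Longrightarrow> disc_close T x e 0 T H"
    unfolding P_def using T by auto
  show ?thesis
  proof (rule that[OF \<delta>(1)])
    fix H assume H: "is_grid T \<delta> H"
    \<comment> \<open>Both ends are grid points, so rounding leaves them alone and the piece over
      \<open>[0, T]\<close> is a genuine time change.\<close>
    have c: "grid_ceil H 0 = 0" "grid_ceil H T = T"
      using grid_ceil(2,4,5)[OF H, of 0] grid_ceil(2,4)[OF H, of T] H T
      by (force simp: is_grid_def)+
    obtain l where l: "strict_mono_on {0..T} l" "l ` {0..T} = {0..T}"
     "\<And>t. t \<in> {0..T} \<Longrightarrow> \<bar>l t - t\<bar> \<le> e" "\<And>t. t \<in> {0..<T} \<Longrightarrow> dist (x (grid_floor H (l t))) (x t) \<le> e"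
      using \<delta>(2)[OF H] unfolding disc_close_def c by blast
    have lT: "l T = T"
    proof -
      have "l T \<in> l ` {0..T}" using T by simp
      moreover have "T \<in> l ` {0..T}" using T l(2) by simp
      then obtain t where "t \<in> {0..T}" "l t = T" by auto
      ultimately show ?thesis using strict_mono_on_leD[OF l(1), of t T] l(2) by auto
    qed
    have "grid_floor H T = T"
      using grid_floor_mem[of H T] grid_floor_ge[of H T T] H T by (auto simp: is_grid_def)
    then have "dist (x (grid_floor H (l t))) (x t) \<le> e" if "t \<in> {0..T}" for t
      using that l(4)[of t] lT e by (cases "t = T") auto
    then show "skorokhod_close T (\<lambda>t. x (grid_floor H t)) x e"
      unfolding skorokhod_close_def using l
      by (intro bexI[of _ l]) (auto simp: time_changes_def)
  qed
qed

lemma skorokhod_dist_grid_floor_tendsto: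
  fixes x :: "real \<Rightarrow> 'v::real_normed_vector"
  assumes x: "cadlag_on {0..T} x" and T: "T > 0"
    and H: "\<And>n. \<forall>\<^sub>F k in sequentially. is_grid T (inverse (real (Suc n))) (H k)" "\<And>k. finite (H k)"
  shows "(\<lambda>k. skorokhod_dist T (\<lambda>t\<in>{0..T}. x (grid_floor (H k) t)) (restrict x {0..T})) \<longlonglongrightarrow> 0"
proof (rule tendstoI)
  fix e :: real assume e: "e > 0"
  obtain \<delta> where \<delta>: "\<delta> > 0" "\<And>H. is_grid T \<delta> H \<Longrightarrow> skorokhod_close T (\<lambda>t. x (grid_floor H t)) x (e / 2)"
    using skorokhod_close_grid_floor[OF x T, of "e/2"] e by auto
  obtain n where n: "inverse (real (Suc n)) < \<delta>" using reals_Archimedean[OF \<delta>(1)] by auto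
  show "\<forall>\<^sub>F k in sequentially. dist (skorokhod_dist T (\<lambda>t\<in>{0..T}. x (grid_floor (H k) t)) (restrict x {0..T})) 0 < e"
    using H(1)[of n]
  proof eventually_elim
    case (elim k)
    have "is_grid T \<delta> (H k)"
      using elim n unfolding is_grid_def by (meson add_left_mono less_imp_le order_trans)
    note c = \<delta>(2)[OF this]
    have mem: "l t \<in> {0..T}" if "l \<in> time_changes T" "t \<in> {0..T}" for l t
      using that unfolding time_changes_def by blast
    have "skorokhod_close T (\<lambda>t\<in>{0..T}. x (grid_floor (H k) t)) (restrict x {0..T}) (e/2)"
      using c mem unfolding skorokhod_close_def by simp
    then have "skorokhod_dist T (\<lambda>t\<in>{0..T}. x (grid_floor (H k) t)) (restrict x {0..T}) \<le> e / 2"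
      using e x by (intro skorokhod_dist_le) (auto simp: restrict_cadlag_space intro!: cadlag_on_grid_floor H)
    then show ?case using e by simp
  qed
qed

section \<open>Measurability of random paths\<close>

text \<open>By \<open>lip\<close> the map \<open>\<Phi>\<close> is continuous from the product
  topology into the Skorokhod space. The coordinates are indexed by naturals because for a countable
  product the Borel sets are those of the product sigma-algebra.\<close>

lemma measurable_path_of_finitely_many:
  fixes X :: "nat \<Rightarrow> 'a \<Rightarrow> 'v::euclidean_space" and \<Phi> :: "(nat \<Rightarrow> 'v) \<Rightarrow> real \<Rightarrow> 'v"
  assumes X: "\<And>i. X i \<in> borel_measurable N"
    and cad: "\<And>y. cadlag_on {0..T} (\<Phi> y)" and I: "finite I" and C: "C \<ge> 0"
    and lip: "\<And>y z t. t \<in> {0..T} \<Longrightarrow> norm (\<Phi> y t - \<Phi> z t) \<le> C * (\<Sum>i\<in>I. norm (y i - z i))"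
  shows "(\<lambda>\<omega>. restrict (\<Phi> (\<lambda>i. X i \<omega>)) {0..T}) \<in> N \<rightarrow>\<^sub>M borel_of (skorokhod_topology T)"
proof (rule measurable_borel_ofI)
  fix U :: "(real \<Rightarrow> 'v) set" assume U: "openin (skorokhod_topology T) U"
  define V where "V = {y. restrict (\<Phi> y) {0..T} \<in> U}"
  have "open V"
  proof (subst open_subopen, intro ballI)
    fix y assume y: "y \<in> V"
    then obtain r where r: "r > 0" "skorokhod.mball T (restrict (\<Phi> y) {0..T}) r \<subseteq> U"
      using U unfolding skorokhod_topology_def skorokhod.openin_mtopology V_def by auto
    let ?W = "{z. C * (\<Sum>i\<in>I. norm (y i - z i)) < r}"
    have "open ?W"
      by (intro open_Collect_less continuous_intros continuous_on_product_coordinates)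
    moreover have "y \<in> ?W" using r by simp
    moreover have "?W \<subseteq> V"
    proof
      fix z assume z: "z \<in> ?W"
      have "skorokhod_dist T (restrict (\<Phi> y) {0..T}) (restrict (\<Phi> z) {0..T}) \<le> C * (\<Sum>i\<in>I. norm (y i - z i))"
        using cad lip C by (intro skorokhod_dist_le_sup) (auto simp: restrict_cadlag_space dist_norm intro!: mult_nonneg_nonneg sum_nonneg)
      then have "restrict (\<Phi> z) {0..T} \<in> skorokhod.mball T (restrict (\<Phi> y) {0..T}) r"
        using z cad by (auto simp: restrict_cadlag_space)
      then show "z \<in> V" using r(2) unfolding V_def by blast
    qed
    ultimately show "\<exists>W. open W \<and> y \<in> W \<and> W \<subseteq> V" by blast
  qed
  then have "V \<in> sets (PiM UNIV (\<lambda>_. borel))" unfolding sets_PiM_equal_borel by simp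
  moreover have "(\<lambda>\<omega>. (\<lambda>i. X i \<omega>)) \<in> N \<rightarrow>\<^sub>M PiM UNIV (\<lambda>_. borel)"
    by (rule measurable_PiM_single') (use X in auto)
  ultimately have "(\<lambda>\<omega>. (\<lambda>i. X i \<omega>)) -` V \<inter> space N \<in> sets N" by (rule measurable_sets[rotated])
  then show "(\<lambda>\<omega>. restrict (\<Phi> (\<lambda>i. X i \<omega>)) {0..T}) -` U \<inter> space N \<in> sets N"
    by (simp add: V_def vimage_def)
qed (use cad in \<open>simp add: restrict_cadlag_space\<close>)

lemma measurable_path_grid_floor:
  fixes Y :: "real \<Rightarrow> 'a \<Rightarrow> 'v::euclidean_space"
  assumes Y: "\<And>t. t \<in> H \<Longrightarrow> Y t \<in> borel_measurable N" and H: "finite H" "0 \<in> H"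
  shows "process_path T (\<lambda>t. Y (grid_floor H t)) \<in> N \<rightarrow>\<^sub>M borel_of (skorokhod_topology T)"
proof -
  \<comment> \<open>The grid points are numbered by naturals, and the remaining coordinates are
    padded with \<open>0\<close>.\<close>
  define X where "X i = (if i \<in> to_nat_on H ` H then Y (from_nat_into H i) else (\<lambda>_. 0))" for i
  have cnt: "countable H" using H by (simp add: countable_finite)
  have "(\<lambda>\<omega>. restrict ((\<lambda>y t. y (to_nat_on H (grid_floor H t))) (\<lambda>i. X i \<omega>)) {0..T})
      \<in> N \<rightarrow>\<^sub>M borel_of (skorokhod_topology T)"
  proof (rule measurable_path_of_finitely_many[where I="to_nat_on H ` H" and C=1])
    show "X i \<in> borel_measurable N" for i
      using Y cnt by (auto simp: X_def)
    show "cadlag_on {0..T} (\<lambda>t. y (to_nat_on H (grid_floor H t)))" for y :: "nat \<Rightarrow> 'v"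
      by (rule cadlag_on_grid_floor[OF H(1), of _ "\<lambda>u. y (to_nat_on H u)"])
    show "norm (y (to_nat_on H (grid_floor H t)) - z (to_nat_on H (grid_floor H t)))
       \<le> 1 * (\<Sum>i\<in>to_nat_on H ` H. norm (y i - z i))" if "t \<in> {0..T}" for y z :: "nat \<Rightarrow> 'v" and t
      using member_le_sum[of "to_nat_on H (grid_floor H t)" "to_nat_on H ` H" "\<lambda>i. norm (y i - z i)"]
        grid_floor_mem[OF H, of t] that H(1) by auto
  qed (use H in auto)
  moreover have "X (to_nat_on H (grid_floor H t)) \<omega> = Y (grid_floor H t) \<omega>" if "t \<in> {0..T}" for t \<omega>
    using grid_floor_mem[OF H, of t] that cnt by (simp add: X_def)
  ultimately show ?thesis
    by (simp add: process_path_def[abs_def] cong: restrict_cong)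
qed

definition uniform_grid :: "real \<Rightarrow> nat \<Rightarrow> real set" where
  "uniform_grid T k = (\<lambda>j. real j * T / real (Suc k)) ` {..Suc k}"

lemma is_grid_mono: "is_grid T a H \<Longrightarrow> a \<le> b \<Longrightarrow> is_grid T b H"
  unfolding is_grid_def by (meson add_left_mono order_trans)

lemma is_grid_uniform_grid:
  assumes "T > 0" shows "is_grid T (T / real (Suc k)) (uniform_grid T k)"
  unfolding is_grid_def
proof (intro conjI ballI)
  show "uniform_grid T k \<subseteq> {0..T}"
    using assms by (auto simp: uniform_grid_def field_simps simp del: of_nat_Suc) 
  show "0 \<in> uniform_grid T k"
    unfolding uniform_grid_def by (rule image_eqI[of _ _ 0]) auto
  show "T \<in> uniform_grid T k"
    unfolding uniform_grid_def by (rule image_eqI[of _ _ "Suc k"]) (auto simp del: of_nat_Suc)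
  fix t assume t: "t \<in> {0..T}"
  define j where "j = nat \<lceil>t * real (Suc k) / T\<rceil>"
  have 0: "0 \<le> t * real (Suc k) / T" using t assms by simp
  then have j: "t * real (Suc k) / T \<le> real j" "real j \<le> t * real (Suc k) / T + 1"
    unfolding j_def by linarith+
  have "t * real (Suc k) / T \<le> real (Suc k)" using t assms by (simp add: divide_le_eq mult.commute mult_right_mono del: of_nat_Suc)
  then have "j \<le> Suc k" unfolding j_def by (simp add: nat_le_iff ceiling_le_iff)
  then show "\<exists>u\<in>uniform_grid T k. t \<le> u \<and> u \<le> t + T / real (Suc k)"
    using j assms by (intro bexI[of _ "real j * T / real (Suc k)"]) (auto simp: uniform_grid_def field_simps simp del: of_nat_Suc)
qed (simp add: uniform_grid_def)

text \<open>The path is the pointwise Skorokhod limit of its samples along finer and finer grids,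
  and each sample depends on finitely many coordinates.\<close>

lemma measurable_process_path:
  fixes Y :: "real \<Rightarrow> 'a \<Rightarrow> 'v::euclidean_space"
  assumes Y: "\<And>t. t \<in> {0..T} \<Longrightarrow> Y t \<in> borel_measurable N" and T: "T > 0"
    and cad: "\<And>\<omega>. \<omega> \<in> space N \<Longrightarrow> cadlag_on {0..T} (\<lambda>t. Y t \<omega>)"
  shows "process_path T Y \<in> N \<rightarrow>\<^sub>M borel_of (skorokhod_topology T)"
  unfolding skorokhod_topology_def
proof (rule skorokhod.measurable_limit_mtopology)
  show "process_path T (\<lambda>t. Y (grid_floor (uniform_grid T k) t)) \<in> N \<rightarrow>\<^sub>M borel_of (skorokhod.mtopology T)" for k
    unfolding skorokhod_topology_def[symmetric] using is_grid_uniform_grid[OF T, of k] Y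
    by (intro measurable_path_grid_floor) (auto simp: is_grid_def)
  fix \<omega> assume w: "\<omega> \<in> space N"
  then show "process_path T Y \<omega> \<in> cadlag_space T"
    using cad by (simp add: process_path_def restrict_cadlag_space)
  have "(\<lambda>k. T / real (Suc k)) \<longlonglongrightarrow> 0"
    using tendsto_mult[OF tendsto_const[of T] LIMSEQ_inverse_real_of_nat] by (simp add: divide_inverse)
  then have "\<forall>\<^sub>F k in sequentially. T / real (Suc k) < inverse (real (Suc n))" for n
    by (rule order_tendstoD(2)) simp
  then have "\<forall>\<^sub>F k in sequentially. is_grid T (inverse (real (Suc n))) (uniform_grid T k)" for n
    by (rule eventually_mono) (rule is_grid_mono[OF is_grid_uniform_grid[OF T] less_imp_le])
  then have "(\<lambda>k. skorokhod_dist T (\<lambda>t\<in>{0..T}. Y (grid_floor (uniform_grid T k) t) \<omega>) (restrict (\<lambda>t. Y t \<omega>) {0..T})) \<longlonglongrightarrow> 0"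
    by (rule skorokhod_dist_grid_floor_tendsto[OF cad[OF w] T]) (simp add: uniform_grid_def)
  then show "(\<lambda>k. skorokhod_dist T (process_path T (\<lambda>t. Y (grid_floor (uniform_grid T k) t)) \<omega>) (process_path T Y \<omega>)) \<longlonglongrightarrow> 0"
    by (simp add: process_path_def)
qed

section \<open>Counting paths and the equation path by path\<close>

lemma at_left_within_nonneg: "0 < t \<Longrightarrow> at t within ({0..} \<inter> {..<t}) = at_left (t::real)"
  by (rule at_within_nhd[of _ "{0<..}"]) auto

lemma at_right_within_nonneg: "0 \<le> t \<Longrightarrow> at t within ({0..} \<inter> {t<..}) = at_right (t::real)"
  by (rule arg_cong[where f="\<lambda>S. at t within S"]) auto

lemma cadlag_on_nonneg_left:
  fixes x :: "real \<Rightarrow> 'v::t2_space"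
  assumes "cadlag_on {0..} x" "0 < t"
  shows "(x \<longlongrightarrow> Lim (at_left t) x) (at_left t)"
proof -
  obtain l where "(x \<longlongrightarrow> l) (at_left t)"
    using assms unfolding cadlag_on_def by (metis atLeast_iff at_left_within_nonneg less_imp_le)
  moreover from this have "Lim (at_left t) x = l" by (intro tendsto_Lim) auto
  ultimately show ?thesis by simp
qed

lemma cadlag_on_nonneg_right:
  assumes "cadlag_on {0..} x" "0 \<le> t"
  shows "(x \<longlongrightarrow> x t) (at_right t)"
  using assms unfolding cadlag_on_def by (metis atLeast_iff at_right_within_nonneg)

lemma cadlag_onI_nonneg:
  assumes "\<And>t. 0 \<le> t \<Longrightarrow> (x \<longlongrightarrow> x t) (at_right t)" "\<And>t. 0 < t \<Longrightarrow> \<exists>l. (x \<longlongrightarrow> l) (at_left t)"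
  shows "cadlag_on {0..} x"
  unfolding cadlag_on_def
proof (intro ballI conjI)
  fix t :: real assume t: "t \<in> {0..}"
  show "(x \<longlongrightarrow> x t) (at t within {0..} \<inter> {t<..})" using assms t by (simp add: at_right_within_nonneg)
  show "\<exists>l. (x \<longlongrightarrow> l) (at t within {0..} \<inter> {..<t})"
  proof (cases "t = 0")
    case True
    then have "{0..} \<inter> {..<t} = {}" by auto
    then show ?thesis by simp
  qed (use assms t in \<open>simp add: at_left_within_nonneg\<close>)
qed

locale counting_path =
  fixes n :: "real \<Rightarrow> nat"
  assumes mono: "mono_on {0..} n" and cadlag: "cadlag_on {0..} n"
begin

lemma le: "0 \<le> s \<Longrightarrow> s \<le> t \<Longrightarrow> n s \<le> n t"
  using mono by (auto simp: mono_on_def)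

text \<open>Naturals are discrete, so a one-sided limit is attained on a one-sided neighbourhood;
  jumps are therefore isolated.\<close>

lemma right_const:
  assumes "0 \<le> t" shows "\<exists>e>0. \<forall>s. t \<le> s \<and> s < t + e \<longrightarrow> n s = n t"
proof -
  have "\<forall>\<^sub>F s in at_right t. n s = n t"
    using cadlag_on_nonneg_right[OF cadlag assms] by (simp add: tendsto_discrete)
  then obtain b where b: "t < b" "\<forall>s. t < s \<and> s < b \<longrightarrow> n s = n t"
    unfolding eventually_at_right_field by blast
  show ?thesis
  proof (intro exI[of _ "b - t"] conjI allI impI)
    fix s assume "t \<le> s \<and> s < t + (b - t)"
    then show "n s = n t" using b(2) by (cases "s = t") auto
  qed (use b in auto)
qed

lemma left_const:
  assumes "0 < t" shows "\<exists>e>0. e \<le> t \<and> (\<forall>s. t - e \<le> s \<and> s < t \<longrightarrow> n s = Lim (at_left t) n)"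
proof -
  have "\<forall>\<^sub>F s in at_left t. n s = Lim (at_left t) n"
    using cadlag_on_nonneg_left[OF cadlag assms] by (simp add: tendsto_discrete)
  then obtain b where b: "b < t" "\<And>s. b < s \<Longrightarrow> s < t \<Longrightarrow> n s = Lim (at_left t) n"
    unfolding eventually_at_left_field by blast
  \<comment> \<open>The midpoint makes the left end \<open>t - e\<close> itself admissible, and the
    minimum keeps it nonnegative.\<close>
  define e where "e = min (t - (b + t) / 2) t"
  show ?thesis
  proof (intro exI[of _ e] conjI allI impI)
    fix s assume "t - e \<le> s \<and> s < t"
    moreover have "b < t - e" using b(1) by (auto simp: e_def min_def field_simps)
    ultimately show "n s = Lim (at_left t) n" by (intro b(2)) auto
  qed (use b assms in \<open>auto simp: e_def\<close>)
qed

lemma left_le: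
  assumes "0 \<le> s" "s < t" shows "n s \<le> Lim (at_left t) n" "Lim (at_left t) n \<le> n t"
proof -
  obtain e where e: "e > 0" "e \<le> t" "\<And>s. t - e \<le> s \<Longrightarrow> s < t \<Longrightarrow> n s = Lim (at_left t) n"
    using left_const[of t] assms by (auto; blast)
  have "n (max s (t - e)) = Lim (at_left t) n" by (rule e(3)) (use e assms in auto)
  moreover have "n s \<le> n (max s (t - e))" "n (max s (t - e)) \<le> n t" by (intro le; use assms e in auto)+
  ultimately show "n s \<le> Lim (at_left t) n" "Lim (at_left t) n \<le> n t" by auto
qed

lemma no_jump:
  assumes "0 \<le> u" "u < r" "r \<le> t" "n u = n t" shows "n r = Lim (at_left r) n"
  using left_le[OF assms(1,2)] le[of r t] assms by auto

text \<open>The witness is the infimum of the times at which the path already has its final value.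
  Right continuity puts the infimum into that set, and just before it the value differs.\<close>

lemma last_jump:
  assumes "0 \<le> s" "s < t" "n s \<noteq> n t"
  shows "\<exists>L. s < L \<and> L \<le> t \<and> n L = n t \<and> n L \<noteq> Lim (at_left L) n"
proof -
  define S where "S = {u. s \<le> u \<and> u \<le> t \<and> n u = n t}"
  define L where "L = Inf S"
  have S: "S \<noteq> {}" "bdd_below S" using assms by (auto simp: S_def intro!: bdd_belowI[of _ s])
  have sL: "s \<le> L" unfolding L_def using S by (intro cInf_greatest) (auto simp: S_def)
  have Lt: "L \<le> t" unfolding L_def using S assms by (intro cInf_lower) (auto simp: S_def)
  obtain e where e: "e > 0" "\<And>r. L \<le> r \<Longrightarrow> r < L + e \<Longrightarrow> n r = n L"
    using right_const[of L] sL assms by (auto; blast)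
  have "\<exists>u\<in>S. u < L + e" using cInf_lessD[OF S(1), of "L + e"] e(1) by (auto simp: L_def)
  then obtain u where u: "u \<in> S" "u < L + e" by auto
  have "L \<le> u" unfolding L_def using S u by (intro cInf_lower)
  then have nL: "n L = n t" using e(2)[of u] u by (auto simp: S_def)
  have less: "n u \<noteq> n t" if "s \<le> u" "u < L" for u
  proof
    assume "n u = n t"
    then have "u \<in> S" using that Lt by (auto simp: S_def)
    then have "L \<le> u" unfolding L_def using S by (intro cInf_lower)
    then show False using that by simp
  qed
  have "s < L" using sL nL assms by (cases "s = L") auto
  obtain d where d: "d > 0" "d \<le> L" "\<And>s. L - d \<le> s \<Longrightarrow> s < L \<Longrightarrow> n s = Lim (at_left L) n"
    using left_const[of L] \<open>s < L\<close> assms by (auto; blast)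
  have "n (max s (L - d)) = Lim (at_left L) n" by (rule d(3)) (use d \<open>s < L\<close> in auto)
  moreover have "n (max s (L - d)) \<noteq> n t" by (rule less) (use d \<open>s < L\<close> in auto)
  ultimately have "n L \<noteq> Lim (at_left L) n" using nL by simp
  then show ?thesis using \<open>s < L\<close> Lt nL by blast
qed

definition jumps :: "real \<Rightarrow> real set" where
  "jumps t = {s. 0 < s \<and> s \<le> t \<and> n s \<noteq> Lim (at_left s) n}"

text \<open>Every jump raises the count, so the path is injective on its jump times, with values at
  most \<open>n t\<close>.\<close>

lemma finite_jumps: "finite (jumps t)"
proof (rule inj_on_finite[where f=n and B="{..n t}"])
  have "n r < n s" if "r \<in> jumps t" "s \<in> jumps t" "r < s" for r s
  proof -
    have "n r \<le> Lim (at_left s) n" "Lim (at_left s) n \<le> n s"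
      using left_le[of r s] that by (auto simp: jumps_def)
    then show ?thesis using that by (auto simp: jumps_def)
  qed
  then show "inj_on n (jumps t)" by (intro linorder_inj_onI) (auto dest: less_imp_neq)
  show "n ` jumps t \<subseteq> {..n t}" using le by (auto simp: jumps_def)
qed simp

lemma counting_integral_eq:
  "counting_integral n H t = (\<Sum>s\<in>jumps t. real (n s - Lim (at_left s) n) *\<^sub>R H s)"
  by (simp add: counting_integral_def jumps_def)

lemma counting_integral_const:
  assumes "0 \<le> s" "s \<le> t" "n s = n t"
  shows "counting_integral n H t = counting_integral n H s"
proof -
  have "jumps t = jumps s"
  proof (intro equalityI subsetI)
    fix r assume r: "r \<in> jumps t"
    have "\<not> s < r" using no_jump[of s r t] r assms by (auto simp: jumps_def)
    then show "r \<in> jumps s" using r by (auto simp: jumps_def)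
  qed (use assms in \<open>auto simp: jumps_def\<close>)
  then show ?thesis by (simp add: counting_integral_eq)
qed

text \<open>Jumps are isolated, so from a time shortly before \<open>s\<close> the integral gains
  just the atom at \<open>s\<close>.\<close>

lemma counting_integral_jump:
  assumes "0 < s" "n s \<noteq> Lim (at_left s) n"
  shows "\<exists>e>0. e \<le> s \<and> (\<forall>u. s - e \<le> u \<and> u < s \<longrightarrow> n u < n s \<and>
      counting_integral n H s = counting_integral n H u + real (n s - Lim (at_left s) n) *\<^sub>R H s)"
proof -
  obtain e where e: "e > 0" "e \<le> s" "\<And>r. s - e \<le> r \<Longrightarrow> r < s \<Longrightarrow> n r = Lim (at_left s) n"
    using left_const[OF assms(1)] by blast
  show ?thesis
  proof (intro exI[of _ e] conjI allI impI)
    fix u assume u: "s - e \<le> u \<and> u < s"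
    then show "n u < n s" using left_le[of u s] e assms by auto
    have "r \<notin> jumps s" if "u < r" "r < s" for r
      using no_jump[of u r r] e(3)[of u] e(3)[of r] that u e(2) by (auto simp: jumps_def)
    then have "r \<in> jumps s \<longleftrightarrow> r = s \<or> r \<in> jumps u" for r
      using u assms by (cases r u rule: linorder_cases; cases r s rule: linorder_cases) (auto simp: jumps_def)
    then have "jumps s = insert s (jumps u)" by auto
    moreover have "s \<notin> jumps u" using u by (auto simp: jumps_def)
    ultimately show "counting_integral n H s
        = counting_integral n H u + real (n s - Lim (at_left s) n) *\<^sub>R H s"
      by (simp add: counting_integral_eq finite_jumps)
  qed (use e in auto)
qed

end

text \<open>The pathwise content of the equation, free of the stochastic integral.\<close>

definition reset_drift :: "'v::real_vector \<Rightarrow> (real \<Rightarrow> nat) \<Rightarrow> (real \<Rightarrow> 'v) \<Rightarrow> bool" where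
  "reset_drift g n y \<longleftrightarrow> (\<forall>s t. 0 \<le> s \<and> s < t \<longrightarrow>
     (n s = n t \<longrightarrow> y t = y s - (t - s) *\<^sub>R g) \<and>
     (n s \<noteq> n t \<longrightarrow> (\<exists>a. 0 \<le> a \<and> a < t - s \<and> y t = - (a *\<^sub>R g))))"

text \<open>The integral is constant between jumps, which leaves the linear drift. At a unit jump it
  removes exactly the left limit, so the value there is \<open>0\<close>, as letting
  \<open>u\<close> increase to \<open>s\<close> in the equation shows. For
  \<open>n s \<noteq> n t\<close> the last jump \<open>L\<close> gives
  \<open>a = t - L\<close>.\<close>

lemma (in counting_path) reset_driftI:
  fixes y :: "real \<Rightarrow> 'v::real_normed_vector"
  assumes unit: "\<And>s. 0 < s \<Longrightarrow> n s - Lim (at_left s) n \<le> 1" and y: "cadlag_on {0..} y"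
    and eq: "\<And>t. 0 \<le> t \<Longrightarrow> y t = y 0 - t *\<^sub>R g - counting_integral n (\<lambda>s. Lim (at_left s) y) t"
  shows "reset_drift g n y"
proof -
  have same: "y t = y s - (t - s) *\<^sub>R g" if "0 \<le> s" "s \<le> t" "n s = n t" for s t
  proof -
    let ?C = "counting_integral n (\<lambda>s. Lim (at_left s) y) s"
    have t: "y t = y 0 - t *\<^sub>R g - ?C"
      using eq[of t] counting_integral_const[OF that, of "\<lambda>s. Lim (at_left s) y"] that by simp
    have s: "y s = y 0 - s *\<^sub>R g - ?C" using eq[of s] that by simp
    show ?thesis by (subst t, subst s) (simp add: algebra_simps)
  qed
  have zero: "y s = 0" if s: "0 < s" "n s \<noteq> Lim (at_left s) n" for s
  proof -
    obtain e where e: "e > 0" "e \<le> s" "\<And>u. s - e \<le> u \<Longrightarrow> u < s \<Longrightarrow>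
      counting_integral n (\<lambda>s. Lim (at_left s) y) s = counting_integral n (\<lambda>s. Lim (at_left s) y) u
          + real (n s - Lim (at_left s) n) *\<^sub>R Lim (at_left s) y"
      using counting_integral_jump[OF s, where H="\<lambda>s. Lim (at_left s) y"] by blast
    \<comment> \<open>A jump of size 2 would subtract the left limit twice and reflect the path
      instead of resetting it.\<close>
    have one: "n s - Lim (at_left s) n = 1" using unit[OF s(1)] s(2) left_le[of 0 s] s(1) by auto
    have "y u - (s - u) *\<^sub>R g - Lim (at_left s) y = y s" if "s - e \<le> u" "u < s" for u
    proof -
      let ?C = "counting_integral n (\<lambda>s. Lim (at_left s) y) u"
      have t: "y s = y 0 - s *\<^sub>R g - (?C + Lim (at_left s) y)" using eq[of s] e(3)[OF that] one s(1) by simp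
      have u: "y u = y 0 - u *\<^sub>R g - ?C" using eq[of u] that e(2) by simp
      show ?thesis by (subst t, subst u) (simp add: algebra_simps)
    qed
    then have ev: "\<forall>\<^sub>F u in at_left s. y u - (s - u) *\<^sub>R g - Lim (at_left s) y = y s"
      using e(1) unfolding eventually_at_left_field by (intro exI[of _ "s - e"]) auto
    have "((\<lambda>u. y u - (s - u) *\<^sub>R g - Lim (at_left s) y) \<longlongrightarrow> Lim (at_left s) y - (s - s) *\<^sub>R g - Lim (at_left s) y) (at_left s)"
      by (intro tendsto_intros cadlag_on_nonneg_left[OF y s(1)])
    then have "((\<lambda>u. y s) \<longlongrightarrow> 0) (at_left s)"
      using Lim_transform_eventually[OF _ ev] by simp
    then show ?thesis by (simp add: tendsto_const_iff)
  qed
  show ?thesis unfolding reset_drift_def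
  proof (intro allI impI conjI)
    fix s t :: real assume st: "0 \<le> s \<and> s < t"
    show "y t = y s - (t - s) *\<^sub>R g" if "n s = n t" using same st that by auto
    assume "n s \<noteq> n t"
    then obtain L where L: "s < L" "L \<le> t" "n L = n t" "n L \<noteq> Lim (at_left L) n"
      using last_jump[of s t] st by blast
    have "y t = - ((t - L) *\<^sub>R g)" using same[of L t] zero[of L] L st by auto
    then show "\<exists>a. 0 \<le> a \<and> a < t - s \<and> y t = - (a *\<^sub>R g)" using L by (intro exI[of _ "t - L"]) auto
  qed
qed

text \<open>On a one-sided neighbourhood the count is constant and the path affine.\<close>

lemma (in counting_path) reset_drift_cadlag:
  fixes y :: "real \<Rightarrow> 'v::real_normed_vector"
  assumes R: "reset_drift g n y"
  shows "cadlag_on {0..} y"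
proof (rule cadlag_onI_nonneg)
  have same: "y t = y s - (t - s) *\<^sub>R g" if "0 \<le> s" "s \<le> t" "n s = n t" for s t
    using R that unfolding reset_drift_def by (cases "s = t") auto
  fix t :: real
  {
    assume t: "0 \<le> t"
    obtain e where e: "e > 0" "\<And>s. t \<le> s \<Longrightarrow> s < t + e \<Longrightarrow> n s = n t" using right_const[OF t] by blast
    have "y t - (s - t) *\<^sub>R g = y s" if "t < s" "s < t + e" for s
      by (rule same[symmetric]) (use e(2)[of s] that t in auto)
    then have "\<forall>\<^sub>F s in at_right t. y t - (s - t) *\<^sub>R g = y s"
      using e(1) unfolding eventually_at_right_field by (intro exI[of _ "t + e"]) auto
    moreover have "((\<lambda>s. y t - (s - t) *\<^sub>R g) \<longlongrightarrow> y t - (t - t) *\<^sub>R g) (at_right t)"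
      by (intro tendsto_intros)
    ultimately show "(y \<longlongrightarrow> y t) (at_right t)" using Lim_transform_eventually by force
  next
    assume t: "0 < t"
    obtain e where e: "e > 0" "e \<le> t" "\<And>s. t - e \<le> s \<Longrightarrow> s < t \<Longrightarrow> n s = Lim (at_left t) n"
      using left_const[OF t] by blast
    have "y (t - e) - (s - (t - e)) *\<^sub>R g = y s" if "t - e < s" "s < t" for s
      by (rule same[symmetric]) (use e(1,2) e(3)[of s] e(3)[of "t - e"] that t in auto)
    then have "\<forall>\<^sub>F s in at_left t. y (t - e) - (s - (t - e)) *\<^sub>R g = y s"
      using e(1) unfolding eventually_at_left_field by (intro exI[of _ "t - e"]) auto
    moreover have "((\<lambda>s. y (t - e) - (s - (t - e)) *\<^sub>R g) \<longlongrightarrow> y (t - e) - (t - (t - e)) *\<^sub>R g) (at_left t)"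
      by (intro tendsto_intros)
    ultimately show "\<exists>l. (y \<longlongrightarrow> l) (at_left t)" using Lim_transform_eventually by blast
  }
qed

lemma (in counting_path) reset_drift_eq:
  fixes y :: "real \<Rightarrow> 'v::real_normed_vector"
  assumes R: "reset_drift g n y" and unit: "\<And>s. 0 < s \<Longrightarrow> n s - Lim (at_left s) n \<le> 1" and t: "0 \<le> t"
  shows "y t = y 0 - t *\<^sub>R g - counting_integral n (\<lambda>s. Lim (at_left s) y) t"
proof -
  define C where "C = counting_integral n (\<lambda>s. Lim (at_left s) y)"
  have y: "cadlag_on {0..} y" by (rule reset_drift_cadlag[OF R])
  have same: "y t = y s - (t - s) *\<^sub>R g" if "0 \<le> s" "s \<le> t" "n s = n t" for s t
    using R that unfolding reset_drift_def by (cases "s = t") auto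
  have C0: "C 0 = 0"
  proof -
    have "jumps 0 = {}" by (auto simp: jumps_def)
    then show ?thesis by (simp add: C_def counting_integral_eq)
  qed
  \<comment> \<open>This quantity is conserved. The induction runs over the number of jumps: the
    last jump \<open>L\<close> is approached by times \<open>u < L\<close>, at which fewer jumps
    have occurred.\<close>
  have "y t + t *\<^sub>R g + C t = y 0" using t
  proof (induction "n t" arbitrary: t rule: less_induct)
    case less
    show ?case
    proof (cases "n 0 = n t")
      case True
      then show ?thesis
        using same[of 0 t] counting_integral_const[of 0 t "\<lambda>s. Lim (at_left s) y"] less.prems C0
        by (simp add: C_def algebra_simps)
    next
      case False
      then have "0 < t" using less.prems by (cases "t = 0") auto
      obtain L where L: "0 < L" "L \<le> t" "n L = n t" "n L \<noteq> Lim (at_left L) n"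
        using last_jump[of 0 t] False \<open>0 < t\<close> by blast
      obtain e where e: "e > 0" "e \<le> L" "\<And>u. L - e \<le> u \<Longrightarrow> u < L \<Longrightarrow> n u < n L"
        "\<And>u. L - e \<le> u \<Longrightarrow> u < L \<Longrightarrow>
          C L = C u + real (n L - Lim (at_left L) n) *\<^sub>R Lim (at_left L) y"
        using counting_integral_jump[OF L(1,4), where H="\<lambda>s. Lim (at_left s) y"] unfolding C_def by blast
      have one: "n L - Lim (at_left L) n = 1" using unit[OF L(1)] L(4) left_le[of 0 L] L(1) by auto
      have y_L: "\<exists>a. 0 \<le> a \<and> a < L - u \<and> y L = - (a *\<^sub>R g)" if "L - e \<le> u" "u < L" for u
        using R e(3)[OF that] that e(2) unfolding reset_drift_def by auto
      \<comment> \<open>The reset clause gives only \<open>norm (y L) \<le> d * norm g\<close>, but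
        for every small \<open>d\<close>.\<close>
      have yL: "y L = 0"
      proof -
        have "norm (y L) \<le> d * norm g" if d: "0 < d" "d < e" for d
        proof -
          obtain a where a: "0 \<le> a" "a < d" "y L = - (a *\<^sub>R g)" using y_L[of "L - d"] d by auto
          then show ?thesis by (auto intro!: mult_right_mono)
        qed
        then have "\<forall>\<^sub>F d in at_right 0. norm (y L) \<le> d * norm g"
          using e(1) unfolding eventually_at_right_field by (intro exI[of _ e]) auto
        moreover have "((\<lambda>d. d * norm g) \<longlongrightarrow> 0 * norm g) (at_right 0)" by (intro tendsto_intros)
        ultimately have "norm (y L) \<le> 0 * norm g"
          by (intro tendsto_lowerbound[of _ _ "at_right 0"]) auto
        then show ?thesis by simp
      qed
      have "y u + u *\<^sub>R g + (C L - Lim (at_left L) y) = y 0" if "L - e \<le> u" "u < L" for u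
      proof -
        have "C L - Lim (at_left L) y = C u" using e(4)[OF that, unfolded one] by simp
        then show ?thesis using less.hyps[of u] e(3)[OF that] that e(2) L(3) by auto
      qed
      then have ev: "\<forall>\<^sub>F u in at_left L. y u + u *\<^sub>R g + (C L - Lim (at_left L) y) = y 0"
        using e(1) unfolding eventually_at_left_field by (intro exI[of _ "L - e"]) auto
      have "((\<lambda>u. y u + u *\<^sub>R g + (C L - Lim (at_left L) y)) \<longlongrightarrow>
            Lim (at_left L) y + L *\<^sub>R g + (C L - Lim (at_left L) y)) (at_left L)"
        by (intro tendsto_intros cadlag_on_nonneg_left[OF y L(1)])
      then have "((\<lambda>u. y 0) \<longlongrightarrow> L *\<^sub>R g + C L) (at_left L)"
        using Lim_transform_eventually[OF _ ev] by (simp add: algebra_simps)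
      then have "y 0 = L *\<^sub>R g + C L" by (simp add: tendsto_const_iff)
      moreover have "C t = C L" unfolding C_def by (rule counting_integral_const) (use L in auto)
      ultimately show ?thesis using same[of L t] L yL by (simp add: algebra_simps)
    qed
  qed
  then show ?thesis unfolding C_def by (simp add: algebra_simps eq_diff_eq)
qed

text \<open>This is \<open>0\<close> if there is no jump up to time \<open>t\<close>.\<close>

definition last_jump_time :: "(real \<Rightarrow> nat) \<Rightarrow> real \<Rightarrow> real" where
  "last_jump_time n t = Inf {u. 0 \<le> u \<and> u \<le> t \<and> n u = n t}"

lemma (in counting_path) last_jump_time:
  assumes "0 \<le> t"
  shows "0 \<le> last_jump_time n t" "last_jump_time n t \<le> t" "n (last_jump_time n t) = n t"
    and "\<And>u. 0 \<le> u \<Longrightarrow> u \<le> t \<Longrightarrow> last_jump_time n t \<le> u \<longleftrightarrow> n u = n t"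
proof -
  let ?S = "{u. 0 \<le> u \<and> u \<le> t \<and> n u = n t}"
  have S: "t \<in> ?S" "bdd_below ?S" using assms by (auto intro!: bdd_belowI[of _ 0])
  show 0: "0 \<le> last_jump_time n t" unfolding last_jump_time_def using S by (intro cInf_greatest) auto
  show t: "last_jump_time n t \<le> t" unfolding last_jump_time_def by (rule cInf_lower[OF S])
  obtain e where e: "e > 0" "\<And>r. last_jump_time n t \<le> r \<Longrightarrow> r < last_jump_time n t + e \<Longrightarrow> n r = n (last_jump_time n t)"
    using right_const[OF 0] by blast
  have "\<exists>u\<in>?S. u < last_jump_time n t + e"
    using cInf_lessD[of ?S "last_jump_time n t + e"] S(1) e(1) unfolding last_jump_time_def by force
  then obtain u where u: "u \<in> ?S" "u < last_jump_time n t + e" by auto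
  have "last_jump_time n t \<le> u" unfolding last_jump_time_def by (rule cInf_lower[OF u(1) S(2)])
  then show eq: "n (last_jump_time n t) = n t" using e(2)[of u] u by auto
  fix u assume u: "0 \<le> u" "u \<le> t"
  show "last_jump_time n t \<le> u \<longleftrightarrow> n u = n t"
  proof
    assume "last_jump_time n t \<le> u"
    then show "n u = n t" using le[OF 0, of u] le[OF u] eq by auto
  next
    assume "n u = n t"
    then show "last_jump_time n t \<le> u"
      unfolding last_jump_time_def using u by (intro cInf_lower S) auto
  qed
qed

text \<open>The solution in closed form: the initial value survives until the first jump, and from
  then on the position is the time since the last jump times \<open>- g\<close>.\<close>

lemma (in counting_path) reset_drift_last_jump_time:
  assumes n0: "n 0 = 0"
  shows "reset_drift g n (\<lambda>t. (if n t = 0 then y0 else 0) - (t - last_jump_time n t) *\<^sub>R g)"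
  unfolding reset_drift_def
proof (intro allI impI conjI)
  fix s t :: real assume st: "0 \<le> s \<and> s < t"
  note s = last_jump_time[of s] and t = last_jump_time[of t]
  {
    assume eq: "n s = n t"
    have "last_jump_time n s = last_jump_time n t"
    proof (rule antisym)
      have "last_jump_time n t \<le> s" using t(4)[of s] eq st by auto
      then show "last_jump_time n s \<le> last_jump_time n t"
        using s(4)[of "last_jump_time n t"] t(1,3) eq st by auto
      show "last_jump_time n t \<le> last_jump_time n s"
        using t(4)[of "last_jump_time n s"] s(1-3) eq st by auto
    qed
    then show "(if n t = 0 then y0 else 0) - (t - last_jump_time n t) *\<^sub>R g =
          (if n s = 0 then y0 else 0) - (s - last_jump_time n s) *\<^sub>R g - (t - s) *\<^sub>R g"
      using eq by (simp add: algebra_simps)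
  next
    assume neq: "n s \<noteq> n t"
    then have "n t \<noteq> 0" using le[of s t] st by auto
    moreover have "\<not> last_jump_time n t \<le> s" using t(4)[of s] neq st by auto
    ultimately show "\<exists>a\<ge>0. a < t - s \<and> (if n t = 0 then y0 else 0) - (t - last_jump_time n t) *\<^sub>R g = - (a *\<^sub>R g)"
      using t(2) st by (intro exI[of _ "t - last_jump_time n t"]) auto
  }
qed

section \<open>Orthants and rays determine measures\<close>

text \<open>Multivariate distribution functions determine the law: closed upper orthants are stable
  under intersection and generate the product sigma-algebra.\<close>

lemma measure_eq_PiM_atLeastI:
  fixes P Q :: "('i \<Rightarrow> real) measure"
  assumes J: "finite J" and P: "prob_space P" "sets P = sets (PiM J (\<lambda>_. borel))"
    and Q: "prob_space Q" "sets Q = sets (PiM J (\<lambda>_. borel))"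
    and eq: "\<And>c. measure P (PiE J (\<lambda>j. {c j..})) = measure Q (PiE J (\<lambda>j. {c j..}))"
  shows "P = Q"
proof -
  interpret P: prob_space P by fact
  interpret Q: prob_space Q by fact
  define \<Omega> where "\<Omega> = (PiE J (\<lambda>_. UNIV) :: ('i \<Rightarrow> real) set)"
  define E where "E = range (\<lambda>c::'i \<Rightarrow> real. PiE J (\<lambda>j. {c j..}))"
  have sub: "E \<subseteq> Pow \<Omega>" by (auto simp: E_def \<Omega>_def PiE_def)
  have "sets (PiM J (\<lambda>_. borel)) = sigma_sets \<Omega> E"
  proof (rule antisym)
    let ?S = "sigma \<Omega> E"
    have S: "sets ?S = sigma_sets \<Omega> E" "space ?S = \<Omega>" using sub by (auto simp: sets_measure_of space_measure_of)
    have coord: "(\<lambda>f. f i) \<in> borel_measurable ?S" if i: "i \<in> J" for i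
      unfolding borel_measurable_iff_ge S(2)
    proof
      fix c :: real
      \<comment> \<open>A half-space is exhausted by orthants whose other corners are
        \<open>- m\<close>; finiteness of \<open>J\<close> provides one \<open>m\<close> for all
        coordinates.\<close>
      have "{f \<in> \<Omega>. c \<le> f i} = (\<Union>m::nat. PiE J (\<lambda>j. {(if j = i then c else - real m)..}))"
      proof (intro equalityI subsetI)
        fix f assume f: "f \<in> {f \<in> \<Omega>. c \<le> f i}"
        obtain m :: nat where m: "(\<Sum>j\<in>J. \<bar>f j\<bar>) \<le> real m" using real_arch_simple by blast
        have "- real m \<le> f j" if "j \<in> J" for j
          using m member_le_sum[of j J "\<lambda>j. \<bar>f j\<bar>"] J that by auto
        then show "f \<in> (\<Union>m::nat. PiE J (\<lambda>j. {(if j = i then c else - real m)..}))"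
          using f i by (intro UN_I[of m]) (auto simp: \<Omega>_def PiE_def Pi_def)
      qed (use i in \<open>auto simp: \<Omega>_def PiE_def Pi_def split: if_splits\<close>)
      also have "\<dots> \<in> sets ?S"
      proof (intro sets.countable_UN subsetI)
        fix A assume "A \<in> range (\<lambda>m::nat. PiE J (\<lambda>j. {(if j = i then c else - real m)..}))"
        then obtain m :: nat where "A = PiE J (\<lambda>j. {(if j = i then c else - real m)..})" by auto
        then have "A \<in> E"
          unfolding E_def by (intro range_eqI[of _ _ "\<lambda>j. if j = i then c else - real m"])
        then show "A \<in> sets ?S" unfolding S(1) by (rule sigma_sets.Basic)
      qed
      finally show "{f \<in> \<Omega>. c \<le> f i} \<in> sets ?S" .
    qed
    have "{f \<in> \<Omega>. f i \<in> A} \<in> sets ?S" if "i \<in> J" "A \<in> sets borel" for i A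
      using measurable_sets[OF coord[OF that(1)] that(2)] by (simp add: S vimage_def Int_def conj_commute)
    then have "{{f \<in> \<Omega>. f i \<in> A} |i A. i \<in> J \<and> A \<in> sets borel} \<subseteq> sets ?S" by blast
    from sets.sigma_sets_subset[OF this]
    have "sigma_sets \<Omega> {{f \<in> \<Omega>. f i \<in> A} |i A. i \<in> J \<and> A \<in> sets borel} \<subseteq> sigma_sets \<Omega> E"
      by (simp only: S)
    then show "sets (PiM J (\<lambda>_. borel)) \<subseteq> sigma_sets \<Omega> E"
      unfolding sets_PiM_single by (simp add: \<Omega>_def)
    have "E \<subseteq> sets (PiM J (\<lambda>_. borel))" unfolding E_def using J by (auto intro!: sets_PiM_I_finite)
    then show "sigma_sets \<Omega> E \<subseteq> sets (PiM J (\<lambda>_. borel))"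
      using sets.sigma_sets_subset[of E "PiM J (\<lambda>_. borel)"] by (simp add: space_PiM \<Omega>_def)
  qed
  note sets = this
  show ?thesis
  proof (rule measure_eqI_generator_eq[where A="\<lambda>m. PiE J (\<lambda>j. {- real m..})"])
    show "Int_stable E"
    proof (rule Int_stableI)
      fix a b assume "a \<in> E" "b \<in> E"
      then obtain c c' where "a = PiE J (\<lambda>j. {c j..})" "b = PiE J (\<lambda>j. {c' j..})" by (auto simp: E_def)
      then have "a \<inter> b = PiE J (\<lambda>j. {max (c j) (c' j)..})" by (auto simp: PiE_def Pi_def)
      then show "a \<inter> b \<in> E" by (auto simp: E_def)
    qed
    show "emeasure P X = emeasure Q X" if "X \<in> E" for X
      using that eq by (auto simp: E_def P.emeasure_eq_measure Q.emeasure_eq_measure)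
    show "(\<Union>m. PiE J (\<lambda>j. {- real m..})) = \<Omega>"
    proof (intro equalityI subsetI)
      fix f assume f: "f \<in> \<Omega>"
      obtain m :: nat where m: "(\<Sum>j\<in>J. \<bar>f j\<bar>) \<le> real m" using real_arch_simple by blast
      have "- real m \<le> f j" if "j \<in> J" for j
        using m member_le_sum[of j J "\<lambda>j. \<bar>f j\<bar>"] J that by auto
      then show "f \<in> (\<Union>m. PiE J (\<lambda>j. {- real m..}))"
        using f by (intro UN_I[of m]) (auto simp: \<Omega>_def PiE_def Pi_def)
    qed (auto simp: \<Omega>_def PiE_def)
  qed (use sub sets P Q in \<open>auto simp: E_def\<close>)
qed

section \<open>Laws on a ray\<close>

text \<open>The parameter is an age: a solution at \<open>- (a *\<^sub>R g)\<close> after a reset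
  has drifted for time \<open>a\<close> since then. Membership means age at least
  \<open>c\<close>.\<close>

definition ray :: "'v::real_vector \<Rightarrow> real \<Rightarrow> 'v set" where
  "ray g c = {- (a *\<^sub>R g) | a. c \<le> a}"

text \<open>The age on the ray, extended to the whole space by orthogonal projection so that it is
  Borel everywhere.\<close>

definition ray_coord :: "'v::real_inner \<Rightarrow> 'v \<Rightarrow> real" where
  "ray_coord g y = - (y \<bullet> g) / (g \<bullet> g)"

lemma ray_coord_ray [simp]: "g \<noteq> 0 \<Longrightarrow> ray_coord g (- (a *\<^sub>R g)) = a"
  by (simp add: ray_coord_def)

lemma ray_mem [simp]: "g \<noteq> 0 \<Longrightarrow> - (a *\<^sub>R g) \<in> ray g c \<longleftrightarrow> c \<le> a"
  by (auto simp: ray_def)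

lemma ray_eq: "g \<noteq> 0 \<Longrightarrow> ray g c = {y. y = - (ray_coord g y *\<^sub>R g) \<and> c \<le> ray_coord g y}"
  unfolding ray_def by (auto; metis ray_coord_ray)

lemma ray_coord_measurable [measurable]: "ray_coord (g::'v::euclidean_space) \<in> borel_measurable borel"
  unfolding ray_coord_def[abs_def] by measurable

lemma ray_borel [measurable]: "ray (g::'v::euclidean_space) c \<in> sets borel"
proof (cases "g = 0")
  case True
  then have "ray g c = {0}" by (auto simp: ray_def)
  then show ?thesis by simp
next
  case False
  show ?thesis unfolding ray_eq[OF False] by measurable
qed

lemma ray_coord_scaleR: "g \<noteq> 0 \<Longrightarrow> y \<in> ray g c \<Longrightarrow> - (ray_coord g y *\<^sub>R g) = y"
  by (auto simp: ray_def)

lemma ray_mem_coord: "g \<noteq> 0 \<Longrightarrow> y \<in> ray g 0 \<Longrightarrow> y \<in> ray g c \<longleftrightarrow> c \<le> ray_coord g y"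
  by (auto simp: ray_def)

lemma ray_Int: "g \<noteq> 0 \<Longrightarrow> ray g a \<inter> ray g b = ray g (max a b)"
  by (auto simp: ray_def)

text \<open>Both laws live on the ray, where \<open>ray_coord\<close> is invertible. They are
  transported to a single real coordinate (index set \<open>{()}\<close>), identified by their
  tails, and transported back.\<close>

lemma measure_eq_rayI:
  fixes g :: "'v::euclidean_space"
  assumes g: "g \<noteq> 0" and P: "prob_space P" "sets P = sets borel" and Q: "prob_space Q" "sets Q = sets borel"
    and eq: "\<And>c. 0 \<le> c \<Longrightarrow> measure P (ray g c) = measure Q (ray g c)" and one: "measure Q (ray g 0) = 1"
  shows "P = Q"
proof -
  let ?D = "\<lambda>R. distr R (PiM {()} (\<lambda>_. borel)) (\<lambda>y. \<lambda>j\<in>{()}. ray_coord g y)"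
  let ?h = "\<lambda>f::unit \<Rightarrow> real. - (f () *\<^sub>R g)"
  have recover: "distr (?D R) borel ?h = R"
    and cyl: "measure (?D R) (PiE {()} (\<lambda>j. {c j..})) = measure R (ray g (max 0 (c ())))"
    and psp: "prob_space (?D R)"
    if R: "prob_space R" "sets R = sets borel" "measure R (ray g 0) = 1"
    for R :: "'v measure" and c :: "unit \<Rightarrow> real"
  proof -
    interpret R: prob_space R by fact
    note [measurable_cong] = R(2)
    have m: "(\<lambda>y. \<lambda>j\<in>{()}. ray_coord g y) \<in> R \<rightarrow>\<^sub>M PiM {()} (\<lambda>_. borel)" by measurable
    have AE: "AE y in R. y \<in> ray g 0" by (rule R.AE_prob_1) (use R in simp)
    have "distr (?D R) borel ?h = distr R borel (\<lambda>y. y)"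
      by (subst distr_distr[OF _ m]) (use AE in \<open>auto intro!: distr_cong_AE elim!: eventually_mono simp: ray_coord_scaleR[OF g]\<close>)
    also have "\<dots> = R" using R(2) by (intro distr_id2) simp
    finally show "distr (?D R) borel ?h = R" .
    show "prob_space (?D R)" by (rule R.prob_space_distr[OF m])
    have "measure (?D R) (PiE {()} (\<lambda>j. {c j..})) = measure R ((\<lambda>y. \<lambda>j\<in>{()}. ray_coord g y) -` PiE {()} (\<lambda>j. {c j..}) \<inter> space R)"
      by (rule measure_distr[OF m]) (auto intro!: sets_PiM_I_finite)
    also have "\<dots> = measure R (ray g (max 0 (c ())))"
    proof (rule R.finite_measure_eq_AE)
      show "AE x in R. (x \<in> (\<lambda>y. \<lambda>j\<in>{()}. ray_coord g y) -` PiE {()} (\<lambda>j. {c j..}) \<inter> space R) = (x \<in> ray g (max 0 (c ())))"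
        using AE AE_space by eventually_elim (auto simp: ray_mem_coord[OF g] ray_mem_coord[OF g, of _ 0, THEN iffD1] PiE_def Pi_def extensional_def)
      show "(\<lambda>y. \<lambda>j\<in>{()}. ray_coord g y) -` PiE {()} (\<lambda>j. {c j..}) \<inter> space R \<in> R.events"
        by (rule measurable_sets[OF m]) (auto intro!: sets_PiM_I_finite)
    qed (use R in simp)
    finally show "measure (?D R) (PiE {()} (\<lambda>j. {c j..})) = measure R (ray g (max 0 (c ())))" .
  qed
  have one': "measure P (ray g 0) = 1" using eq[of 0] one by simp
  have "?D P = ?D Q"
    by (rule measure_eq_PiM_atLeastI[of "{()}"])
      (simp_all add: cyl[OF P one'] cyl[OF Q one] psp[OF P one'] psp[OF Q one] eq)
  then show ?thesis using recover[OF P one'] recover[OF Q one] by metis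
qed

text \<open>Normalising by \<open>norm g\<close> turns the rate \<open>\<gamma> / norm g\<close> into \<open>\<gamma>\<close>.\<close>

definition exp_ray :: "real \<Rightarrow> 'v::euclidean_space \<Rightarrow> 'v measure" where
  "exp_ray \<gamma> g = distr (density lborel (exponential_density (\<gamma> / norm g))) borel (\<lambda>e. - (e / norm g) *\<^sub>R g)"

lemma exp_ray:
  fixes g :: "'v::euclidean_space"
  assumes g: "g \<noteq> 0" and \<gamma>: "\<gamma> > 0"
  shows "prob_space (exp_ray \<gamma> g)" "sets (exp_ray \<gamma> g) = sets borel"
    and "\<And>c. 0 \<le> c \<Longrightarrow> measure (exp_ray \<gamma> g) (ray g c) = exp (- \<gamma> * c)"
proof -
  let ?l = "\<gamma> / norm g"
  let ?E = "density lborel (exponential_density ?l)"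
  have l: "?l > 0" using g \<gamma> by simp
  interpret E: prob_space ?E by (rule prob_space_exponential_density[OF l])
  have m: "(\<lambda>e. - (e / norm g) *\<^sub>R g) \<in> ?E \<rightarrow>\<^sub>M borel" by measurable
  show "prob_space (exp_ray \<gamma> g)" unfolding exp_ray_def by (rule E.prob_space_distr[OF m])
  show "sets (exp_ray \<gamma> g) = sets borel" by (simp add: exp_ray_def)
  fix c :: real assume c: "0 \<le> c"
  have D: "distributed ?E lborel (\<lambda>x. x) (exponential_density ?l)"
    unfolding distributed_def by (simp add: distr_id2)
  have "measure (exp_ray \<gamma> g) (ray g c) = E.prob ((\<lambda>e. - (e / norm g) *\<^sub>R g) -` ray g c \<inter> space ?E)"
    unfolding exp_ray_def by (rule measure_distr[OF m]) simp
  also have "(\<lambda>e. - (e / norm g) *\<^sub>R g) -` ray g c \<inter> space ?E = {e. c * norm g \<le> e}"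
    using ray_mem[OF g, of _ c] g by (auto simp: field_simps)
  \<comment> \<open>The exponential tail formula is for strict inequality; the extra point is a null
    set.\<close>
  also have "E.prob {e. c * norm g \<le> e} = E.prob {e \<in> space ?E. c * norm g < e}"
  proof (rule E.finite_measure_eq_AE)
    have "AE e in lborel. e \<noteq> c * norm g" by (rule AE_lborel_singleton)
    then show "AE e in ?E. (e \<in> {e. c * norm g \<le> e}) = (e \<in> {e \<in> space ?E. c * norm g < e})"
      by (subst AE_density) auto
  qed auto
  also have "\<dots> = exp (- (c * norm g) * ?l)"
    by (rule E.exponential_distributedD_gt[OF D _ l]) (use c in simp)
  finally show "measure (exp_ray \<gamma> g) (ray g c) = exp (- \<gamma> * c)" using g by simp
qed

section \<open>Weak solutions\<close>

locale poisson_driver = prob_space P + filtration "space P" F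
  for P :: "'w measure" and F :: "real \<Rightarrow> 'w measure" +
  fixes \<gamma> :: real and N :: "real \<Rightarrow> 'w \<Rightarrow> nat"
  assumes sets_F_le: "\<And>t. sets (F t) \<subseteq> events" and \<gamma>: "0 < \<gamma>" and poisson: "poisson_process \<gamma> P F N"
begin

lemma measurable_F: "h \<in> F t \<rightarrow>\<^sub>M X \<Longrightarrow> h \<in> P \<rightarrow>\<^sub>M X"
  by (rule measurable_from_subalg[of P "F t"]) (auto simp: subalgebra_def space_F sets_F_le)

lemma measurable_F_mono: "h \<in> F s \<rightarrow>\<^sub>M X \<Longrightarrow> s \<le> t \<Longrightarrow> h \<in> F t \<rightarrow>\<^sub>M X"
  by (rule measurable_from_subalg[of "F t" "F s"]) (auto simp: subalgebra_def space_F sets_F_mono[THEN subsetD])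

lemma N_F: "0 \<le> t \<Longrightarrow> N t \<in> F t \<rightarrow>\<^sub>M count_space UNIV"
  using poisson unfolding poisson_process_def by blast

lemma N_measurable: "0 \<le> t \<Longrightarrow> N t \<in> P \<rightarrow>\<^sub>M count_space UNIV"
  by (rule measurable_F[OF N_F])

lemma N_0: "\<omega> \<in> space P \<Longrightarrow> N 0 \<omega> = 0"
  using poisson by (auto simp: poisson_process_def)

lemma counting: "\<omega> \<in> space P \<Longrightarrow> counting_path (\<lambda>t. N t \<omega>)"
  using poisson by (auto simp: poisson_process_def counting_path_def)

lemma N_le: "\<omega> \<in> space P \<Longrightarrow> 0 \<le> s \<Longrightarrow> s \<le> t \<Longrightarrow> N s \<omega> \<le> N t \<omega>"
  using counting_path.le[OF counting] .

lemma N_eq_event_F: "0 \<le> s \<Longrightarrow> s \<le> t \<Longrightarrow> {\<omega> \<in> space P. N s \<omega> = N t \<omega>} \<in> sets (F t)"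
proof -
  assume st: "0 \<le> s" "s \<le> t"
  have m: "N s \<in> F t \<rightarrow>\<^sub>M count_space UNIV" "N t \<in> F t \<rightarrow>\<^sub>M count_space UNIV"
    using N_F[of t] measurable_F_mono[OF N_F, of s t] st by auto
  have "{\<omega> \<in> space P. N s \<omega> = N t \<omega>} = (\<Union>j. (N s -` {j} \<inter> space (F t)) \<inter> (N t -` {j} \<inter> space (F t)))"
    by (auto simp: space_F)
  also have "\<dots> \<in> sets (F t)" by (intro sets.countable_UN'' sets.Int measurable_sets[OF m(1)] measurable_sets[OF m(2)]) auto
  finally show ?thesis .
qed

lemma N_eq_event [measurable]: "0 \<le> s \<Longrightarrow> s \<le> t \<Longrightarrow> {\<omega> \<in> space P. N s \<omega> = N t \<omega>} \<in> events"
  using N_eq_event_F sets_F_le by blast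

lemma prob_increment:
  assumes "0 \<le> s" "s < t"
  shows "prob {\<omega> \<in> space P. N t \<omega> - N s \<omega> = j} = (\<gamma> * (t - s)) ^ j / fact j * exp (- (\<gamma> * (t - s)))"
proof -
  have [measurable]: "N s \<in> P \<rightarrow>\<^sub>M count_space UNIV" "N t \<in> P \<rightarrow>\<^sub>M count_space UNIV"
    using N_measurable assms by auto
  have "prob {\<omega> \<in> space P. N t \<omega> - N s \<omega> = j} = measure (distr P (count_space UNIV) (\<lambda>\<omega>. N t \<omega> - N s \<omega>)) {j}"
    by (subst measure_distr) (auto intro!: arg_cong[where f=prob])
  also have "\<dots> = measure (measure_pmf (poisson_pmf (\<gamma> * (t - s)))) {j}"
    using poisson assms by (simp add: poisson_process_def)
  also have "\<dots> = (\<gamma> * (t - s)) ^ j / fact j * exp (- (\<gamma> * (t - s)))"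
    using \<gamma> assms by (simp add: measure_pmf_single)
  finally show ?thesis .
qed

lemma indep_eq:
  assumes A: "A \<in> sets (F s)" and st: "0 \<le> s" "s \<le> u" "u \<le> t"
  shows "prob (A \<inter> {\<omega> \<in> space P. N u \<omega> = N t \<omega>}) = prob A * exp (- (\<gamma> * (t - u)))"
proof (cases "u = t")
  case True
  have "A \<subseteq> space P" using A sets.sets_into_space[OF A] by (simp add: space_F)
  then have "A \<inter> {\<omega> \<in> space P. N u \<omega> = N t \<omega>} = A" using True by auto
  then show ?thesis using True by simp
next
  case False
  have A': "A \<in> sets (F u)" using A sets_F_mono st by blast
  \<comment> \<open>Subtraction of naturals truncates; monotonicity of the paths makes increment
    \<open>0\<close> mean equality.\<close>
  have eq: "{\<omega> \<in> space P. N u \<omega> = N t \<omega>} = (\<lambda>\<omega>. N t \<omega> - N u \<omega>) -` {0} \<inter> space P"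
    using N_le[of _ u t] st by force
  have "indep_set (sets (F u)) {(\<lambda>\<omega>. N t \<omega> - N u \<omega>) -` B \<inter> space P |B. True}"
    using poisson st False by (auto simp: poisson_process_def)
  from indep_setD[OF this A', of "(\<lambda>\<omega>. N t \<omega> - N u \<omega>) -` {0} \<inter> space P"]
  have "prob (A \<inter> ((\<lambda>\<omega>. N t \<omega> - N u \<omega>) -` {0} \<inter> space P))
      = prob A * prob ((\<lambda>\<omega>. N t \<omega> - N u \<omega>) -` {0} \<inter> space P)" by blast
  moreover have "prob ((\<lambda>\<omega>. N t \<omega> - N u \<omega>) -` {0} \<inter> space P) = exp (- (\<gamma> * (t - u)))"
    using prob_increment[of u t 0] st False by (simp add: vimage_def Int_def conj_commute)
  ultimately show ?thesis by (simp add: eq)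
qed

lemma prob_eq: "0 \<le> s \<Longrightarrow> s \<le> t \<Longrightarrow> prob {\<omega> \<in> space P. N s \<omega> = N t \<omega>} = exp (- (\<gamma> * (t - s)))"
  using indep_eq[of "space P" s s t] sets.top[of "F s"] by (simp add: space_F prob_space Int_def)

lemma prob_increment_ge_2:
  assumes "0 \<le> s" "s < t"
  shows "prob {\<omega> \<in> space P. 2 \<le> N t \<omega> - N s \<omega>} \<le> (\<gamma> * (t - s))\<^sup>2"
proof -
  have [measurable]: "N s \<in> P \<rightarrow>\<^sub>M count_space UNIV" "N t \<in> P \<rightarrow>\<^sub>M count_space UNIV"
    using N_measurable assms by auto
  let ?l = "\<gamma> * (t - s)" and ?A = "\<lambda>j. {\<omega> \<in> space P. N t \<omega> - N s \<omega> = j}"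
  have A: "?A j \<in> events" for j by measurable
  have "{\<omega> \<in> space P. 2 \<le> N t \<omega> - N s \<omega>} = space P - (?A 0 \<union> ?A 1)" by auto
  then have "prob {\<omega> \<in> space P. 2 \<le> N t \<omega> - N s \<omega>} = prob (space P - (?A 0 \<union> ?A 1))" by (rule arg_cong)
  also have "\<dots> = 1 - prob (?A 0 \<union> ?A 1)" by (intro prob_compl sets.Un A)
  also have "prob (?A 0 \<union> ?A 1) = prob (?A 0) + prob (?A 1)" by (rule finite_measure_Union[OF A A]) auto
  also have "\<dots> = (1 + ?l) * exp (- ?l)"
    using prob_increment[OF assms, of 0] prob_increment[OF assms, of 1] by (simp add: algebra_simps)
  also have "1 - (1 + ?l) * exp (- ?l) \<le> 1 - (1 + ?l) * (1 - ?l)"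
    using exp_ge_add_one_self[of "- ?l"] \<gamma> assms by (intro diff_left_mono mult_left_mono) auto
  finally show ?thesis by (simp add: algebra_simps power2_eq_square)
qed

text \<open>A jump of size at least 2 is seen by its cell in every equidistant partition of
  \<open>(0, T]\<close>. With \<open>m + 1\<close> cells, the probability that some cell has an
  increment of at least 2 is at most \<open>(\<gamma> * T)\<^sup>2 / (m + 1)\<close>, by
  \<open>prob_increment_ge_2\<close>.\<close>

lemma AE_unit_jumps: "AE \<omega> in P. \<forall>s>0. N s \<omega> - Lim (at_left s) (\<lambda>u. N u \<omega>) \<le> 1"
proof -
  have "AE \<omega> in P. \<forall>s. 0 < s \<and> s \<le> T \<longrightarrow> N s \<omega> - Lim (at_left s) (\<lambda>u. N u \<omega>) \<le> 1" if T: "0 < T" for T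
  proof -
    define I where "I m j = {\<omega> \<in> space P. 2 \<le> N (real (Suc j) * T / real (Suc m)) \<omega> - N (real j * T / real (Suc m)) \<omega>}" for m j
    define B where "B = (\<Inter>m. \<Union>j\<le>m. I m j)"
    have meas: "I m j \<in> events" for m j
    proof -
      have [measurable]: "N (real (Suc j) * T / real (Suc m)) \<in> P \<rightarrow>\<^sub>M count_space UNIV"
        "N (real j * T / real (Suc m)) \<in> P \<rightarrow>\<^sub>M count_space UNIV"
        using T by (auto intro!: N_measurable divide_nonneg_nonneg simp del: of_nat_Suc)
      show ?thesis unfolding I_def by measurable
    qed
    have B: "B \<in> events" unfolding B_def using meas by (intro sets.countable_INT' sets.finite_UN) auto
    have "prob B \<le> (\<gamma> * T)\<^sup>2 * inverse (real (Suc m))" for m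
    proof -
      have "prob B \<le> prob (\<Union>j\<le>m. I m j)" using B meas by (intro finite_measure_mono) (auto simp: B_def)
      also have "\<dots> \<le> (\<Sum>j\<le>m. prob (I m j))" using meas by (intro finite_measure_subadditive_finite) auto
      also have "\<dots> \<le> (\<Sum>j\<le>m. (\<gamma> * (T / real (Suc m)))\<^sup>2)"
      proof (rule sum_mono)
        fix j
        have "prob (I m j) \<le> (\<gamma> * (real (Suc j) * T / real (Suc m) - real j * T / real (Suc m)))\<^sup>2"
          unfolding I_def
        proof (rule prob_increment_ge_2)
          show "0 \<le> real j * T / real (Suc m)" using T by simp
          show "real j * T / real (Suc m) < real (Suc j) * T / real (Suc m)"
            using T by (intro divide_strict_right_mono mult_strict_right_mono) auto
        qed
        also have "real (Suc j) * T / real (Suc m) - real j * T / real (Suc m) = T / real (Suc m)"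
          by (simp add: diff_divide_distrib[symmetric] algebra_simps)
        finally show "prob (I m j) \<le> (\<gamma> * (T / real (Suc m)))\<^sup>2" .
      qed
      also have "\<dots> = (\<gamma> * T)\<^sup>2 * inverse (real (Suc m))"
        by (simp add: power2_eq_square divide_simps del: of_nat_Suc)
      finally show ?thesis .
    qed
    then have "prob B \<le> 0"
      using tendsto_mult_right_zero[OF LIMSEQ_inverse_real_of_nat, of "(\<gamma> * T)\<^sup>2"]
      by (intro LIMSEQ_le_const[of _ 0]) auto
    then have "prob B = 0" using measure_nonneg[of P B] by linarith
    then have null: "B \<in> null_sets P" using B by (simp add: null_sets_def emeasure_eq_measure)
    show ?thesis
    proof (rule AE_I'[OF null], rule subsetI)
      fix \<omega> assume "\<omega> \<in> {\<omega> \<in> space P. \<not> (\<forall>s. 0 < s \<and> s \<le> T \<longrightarrow> N s \<omega> - Lim (at_left s) (\<lambda>u. N u \<omega>) \<le> 1)}"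
      then obtain s where w: "\<omega> \<in> space P" and s: "0 < s" "s \<le> T" and big: "2 \<le> N s \<omega> - Lim (at_left s) (\<lambda>u. N u \<omega>)"
        by force
      interpret counting_path "\<lambda>t. N t \<omega>" by (rule counting[OF w])
      have "\<exists>j\<le>m. \<omega> \<in> I m j" for m
      proof -
        \<comment> \<open>The cell of \<open>s\<close> is half-open,
          \<open>(j * T / (m + 1), (j + 1) * T / (m + 1)]\<close>; its left end is strictly before
          \<open>s\<close>, so the count there is at most the left limit at
          \<open>s\<close>.\<close>
        define k where "k = nat \<lceil>s * real (Suc m) / T\<rceil>"
        have pos: "0 < s * real (Suc m) / T" using s T by simp
        then have k: "s * real (Suc m) / T \<le> real k" "real k < s * real (Suc m) / T + 1" "0 < k"
          unfolding k_def by linarith+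
        have "s * real (Suc m) / T \<le> real (Suc m)" using s T by (simp add: divide_le_eq mult.commute mult_right_mono del: of_nat_Suc)
        then have "real k < real (Suc m) + 1" using k by linarith
        then have km: "k \<le> Suc m" by linarith
        obtain j where j: "k = Suc j" using k(3) by (cases k) auto
        have 1: "s \<le> real (Suc j) * T / real (Suc m)" and 2: "real j * T / real (Suc m) < s"
          using k(1,2) T unfolding j by (auto simp: field_simps)
        have "N s \<omega> \<le> N (real (Suc j) * T / real (Suc m)) \<omega>" using le[OF _ 1] s by simp
        moreover have "N (real j * T / real (Suc m)) \<omega> \<le> Lim (at_left s) (\<lambda>u. N u \<omega>)"
          using left_le(1)[OF _ 2] T by simp
        ultimately have "\<omega> \<in> I m j" using big w by (simp add: I_def)
        then show ?thesis using km j by auto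
      qed
      then show "\<omega> \<in> B" unfolding B_def by auto
    qed
  qed
  then have "AE \<omega> in P. \<forall>n::nat. \<forall>s. 0 < s \<and> s \<le> real (Suc n) \<longrightarrow> N s \<omega> - Lim (at_left s) (\<lambda>u. N u \<omega>) \<le> 1"
    by (subst AE_all_countable) simp
  then show ?thesis
  proof eventually_elim
    case (elim \<omega>)
    show ?case
    proof (intro allI impI)
      fix s :: real assume "0 < s"
      obtain n where "s \<le> real n" using real_arch_simple by blast
      then show "N s \<omega> - Lim (at_left s) (\<lambda>u. N u \<omega>) \<le> 1"
        using elim[rule_format, of s n] \<open>0 < s\<close> by simp
    qed
  qed
qed

text \<open>The closed form solves the equation on every path with unit jumps. It is adapted because
  \<open>last_jump_time\<close> is at most \<open>r\<close> exactly on \<open>N r = N t\<close>, an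
  event of \<open>F t\<close> for \<open>r \<le> t\<close>.\<close>

lemma weak_solution_exists:
  fixes g :: "'v::euclidean_space"
  assumes y0: "y0 \<in> F 0 \<rightarrow>\<^sub>M borel"
  shows "\<exists>Y. weak_solution \<gamma> g P F N Y \<and> (\<forall>\<omega>\<in>space P. Y 0 \<omega> = y0 \<omega>)"
proof -
  define Y where "Y t \<omega> = (if N t \<omega> = 0 then y0 \<omega> else 0) - (t - last_jump_time (\<lambda>u. N u \<omega>) t) *\<^sub>R g" for t \<omega>
  have R: "reset_drift g (\<lambda>t. N t \<omega>) (\<lambda>t. Y t \<omega>)" if "\<omega> \<in> space P" for \<omega>
    unfolding Y_def using counting_path.reset_drift_last_jump_time[OF counting[OF that]] N_0[OF that] by blast
  have L: "(\<lambda>\<omega>. last_jump_time (\<lambda>u. N u \<omega>) t) \<in> borel_measurable (F t)" if t: "0 \<le> t" for t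
    unfolding borel_measurable_iff_le space_F
  proof
    fix r :: real
    note lj = counting_path.last_jump_time[OF counting t]
    consider "r < 0" | "0 \<le> r" "r \<le> t" | "t < r" by linarith
    then show "{\<omega> \<in> space P. last_jump_time (\<lambda>u. N u \<omega>) t \<le> r} \<in> sets (F t)"
    proof cases
      case 1
      then have "{\<omega> \<in> space P. last_jump_time (\<lambda>u. N u \<omega>) t \<le> r} = {}" using lj(1) by force
      then show ?thesis by (simp only: sets.empty_sets)
    next
      case 2
      then have "{\<omega> \<in> space P. last_jump_time (\<lambda>u. N u \<omega>) t \<le> r} = {\<omega> \<in> space P. N r \<omega> = N t \<omega>}"
        using lj(4) by auto
      then show ?thesis using N_eq_event_F[OF 2] by simp
    next
      case 3
      then have "{\<omega> \<in> space P. last_jump_time (\<lambda>u. N u \<omega>) t \<le> r} = space (F t)" using lj(2) by (force simp: space_F)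
      then show ?thesis by (simp only: sets.top)
    qed
  qed
  have "Y t \<in> borel_measurable (F t)" if t: "0 \<le> t" for t
  proof -
    note [measurable] = L[OF t] N_F[OF t] measurable_F_mono[OF y0 t]
    show ?thesis unfolding Y_def[abs_def] by measurable
  qed
  moreover have "AE \<omega> in P. \<forall>t\<ge>0. Y t \<omega> = Y 0 \<omega> - t *\<^sub>R g -
        counting_integral (\<lambda>s. N s \<omega>) (\<lambda>s. Lim (at_left s) (\<lambda>u. Y u \<omega>)) t"
    using AE_unit_jumps AE_space
  proof eventually_elim
    case (elim \<omega>)
    interpret counting_path "\<lambda>t. N t \<omega>" by (rule counting) (rule elim)
    show ?case using reset_drift_eq[OF R] elim by blast
  qed
  moreover have "Y 0 \<omega> = y0 \<omega>" if w: "\<omega> \<in> space P" for \<omega>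
  proof -
    have "last_jump_time (\<lambda>u. N u \<omega>) 0 = 0"
      using counting_path.last_jump_time(1,2)[OF counting[OF w], of 0] by simp
    then show ?thesis using N_0[OF w] by (simp add: Y_def)
  qed
  ultimately show ?thesis
    using R counting_path.reset_drift_cadlag[OF counting R] prob_space_axioms filtration_axioms sets_F_le poisson
    unfolding weak_solution_def by (intro exI[of _ Y]) auto
qed

end

locale reset_solution =
  fixes \<gamma> :: real and g :: "'v::euclidean_space" and P :: "'w measure" and F N Y
  assumes sol: "weak_solution \<gamma> g P F N Y" and pos: "0 < \<gamma>" and g: "g \<noteq> 0"
begin

sublocale poisson_driver P F \<gamma> N
proof -
  have "prob_space P" "filtration (space P) F" using sol by (auto simp: weak_solution_def)
  then interpret prob_space P + filtration "space P" F .
  show "poisson_driver P F \<gamma> N"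
    by unfold_locales (use sol pos in \<open>auto simp: weak_solution_def\<close>)
qed

lemma Y_F: "0 \<le> t \<Longrightarrow> Y t \<in> borel_measurable (F t)"
  using sol by (auto simp: weak_solution_def)

lemma Y_measurable: "0 \<le> t \<Longrightarrow> Y t \<in> borel_measurable P"
  by (rule measurable_F[OF Y_F])

lemma Y_cadlag: "\<omega> \<in> space P \<Longrightarrow> cadlag_on {0..} (\<lambda>t. Y t \<omega>)"
  using sol by (auto simp: weak_solution_def)

lemma AE_reset_drift: "AE \<omega> in P. reset_drift g (\<lambda>t. N t \<omega>) (\<lambda>t. Y t \<omega>)"
proof -
  have "AE \<omega> in P. \<forall>t\<ge>0. Y t \<omega> = Y 0 \<omega> - t *\<^sub>R g -
        counting_integral (\<lambda>s. N s \<omega>) (\<lambda>s. Lim (at_left s) (\<lambda>u. Y u \<omega>)) t"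
    using sol by (auto simp: weak_solution_def)
  then show ?thesis using AE_unit_jumps AE_space
  proof eventually_elim
    case (elim \<omega>)
    interpret counting_path "\<lambda>t. N t \<omega>" by (rule counting) (rule elim)
    show ?case
    proof (rule reset_driftI)
      show "cadlag_on {0..} (\<lambda>t. Y t \<omega>)" by (rule Y_cadlag) (rule elim)
    qed (use elim in blast)+
  qed
qed

lemma ray_F: "0 \<le> t \<Longrightarrow> {\<omega> \<in> space P. Y t \<omega> \<in> ray g c} \<in> sets (F t)"
  using measurable_sets[OF Y_F ray_borel[of g c], of t] by (simp add: space_F vimage_def Int_def conj_commute)

lemma ray_event: "0 \<le> t \<Longrightarrow> {\<omega> \<in> space P. Y t \<omega> \<in> ray g c} \<in> events"
  using ray_F sets_F_le by blast

text \<open>The law of \<open>Y 0\<close> is arbitrary here, which is what uniqueness of the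
  invariant law requires. Off \<open>?C\<close> a jump has occurred, so the position is an age that
  no longer depends on \<open>Y 0\<close>.\<close>

lemma prob_ray_approx:
  assumes c: "0 \<le> c" "c \<le> t"
  shows "\<bar>prob {\<omega> \<in> space P. Y t \<omega> \<in> ray g c} - exp (- (\<gamma> * c))\<bar> \<le> exp (- (\<gamma> * t))"
proof -
  let ?A = "{\<omega> \<in> space P. Y t \<omega> \<in> ray g c}" and ?B = "{\<omega> \<in> space P. N (t - c) \<omega> = N t \<omega>}"
    and ?C = "{\<omega> \<in> space P. N 0 \<omega> = N t \<omega>}"
  have AE: "AE \<omega> in P. \<omega> \<notin> ?C \<longrightarrow> (\<omega> \<in> ?A \<longleftrightarrow> \<omega> \<in> ?B)"
    using AE_reset_drift AE_space
  proof eventually_elim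
    case (elim \<omega>)
    show ?case
    proof
      assume "\<omega> \<notin> ?C"
      then have nt: "N 0 \<omega> \<noteq> N t \<omega>" using elim by auto
      then have t: "0 < t" using c by (cases "t = 0") auto
      show "\<omega> \<in> ?A \<longleftrightarrow> \<omega> \<in> ?B"
      proof (cases "c = 0")
        case True
        obtain a where "0 \<le> a" "Y t \<omega> = - (a *\<^sub>R g)"
          using elim(1) nt t unfolding reset_drift_def by blast
        then show ?thesis using True elim g by auto
      next
        case False
        then have tc: "t - c < t" "0 \<le> t - c" using c by auto
        show ?thesis
        proof (cases "N (t - c) \<omega> = N t \<omega>")
          case True
          then have "t - c \<noteq> 0" using nt by metis
          then have "0 < t - c" using tc by simp
          then obtain a where a: "0 \<le> a" "Y (t - c) \<omega> = - (a *\<^sub>R g)"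
            using elim(1) nt True unfolding reset_drift_def by (metis order_refl)
          have "Y t \<omega> = Y (t - c) \<omega> - (t - (t - c)) *\<^sub>R g"
            using elim(1) True tc unfolding reset_drift_def by blast
          then have "Y t \<omega> = - ((a + c) *\<^sub>R g)" using a by (simp add: algebra_simps)
          then show ?thesis using True a g elim by simp
        next
          case False
          obtain a where "0 \<le> a" "a < t - (t - c)" "Y t \<omega> = - (a *\<^sub>R g)"
            using elim(1) False tc unfolding reset_drift_def by blast
          then show ?thesis using False g by simp
        qed
      qed
    qed
  qed
  have [measurable]: "?A \<in> events" "?B \<in> events" "?C \<in> events"
    using ray_event N_eq_event c by auto
  have "prob ?A \<le> prob (?B \<union> ?C)" using AE by (intro finite_measure_mono_AE) auto
  also have "\<dots> \<le> prob ?B + prob ?C" by (rule measure_Un_le) auto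
  finally have 1: "prob ?A \<le> prob ?B + prob ?C" .
  have "prob ?B \<le> prob (?A \<union> ?C)" using AE by (intro finite_measure_mono_AE) auto
  also have "\<dots> \<le> prob ?A + prob ?C" by (rule measure_Un_le) auto
  finally show ?thesis using 1 prob_eq[of "t - c" t] prob_eq[of 0 t] c by simp
qed

text \<open>Started on the ray, a solution is an age process. The last clause is its Markov
  recursion: age at least \<open>c\<close> at \<open>t\<close> means no jump since \<open>s\<close>
  and age at least \<open>c - (t - s)\<close> at \<open>s\<close>.\<close>

lemma AE_stays_on_ray:
  assumes "AE \<omega> in P. Y 0 \<omega> \<in> ray g 0"
  shows "AE \<omega> in P. (\<forall>t\<ge>0. Y t \<omega> \<in> ray g 0) \<and>
    (\<forall>c t. 0 \<le> c \<and> c \<le> t \<longrightarrow> (Y t \<omega> \<in> ray g c \<longleftrightarrow> N (t - c) \<omega> = N t \<omega>)) \<and>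
    (\<forall>s t c. 0 \<le> s \<and> s \<le> t \<and> t - s \<le> c \<longrightarrow>
       (Y t \<omega> \<in> ray g c \<longleftrightarrow> N s \<omega> = N t \<omega> \<and> Y s \<omega> \<in> ray g (c - (t - s))))"
  using assms AE_reset_drift AE_space
proof eventually_elim
  case (elim \<omega>)
  have all: "Y t \<omega> \<in> ray g 0" if t: "0 \<le> t" for t
  proof (cases "t = 0")
    case False
    then have t: "0 < t" using t by simp
    show ?thesis
    proof (cases "N 0 \<omega> = N t \<omega>")
      case True
      obtain a where a: "0 \<le> a" "Y 0 \<omega> = - (a *\<^sub>R g)" using elim(1) by (auto simp: ray_def)
      have "Y t \<omega> = Y 0 \<omega> - (t - 0) *\<^sub>R g" using elim(2) t True unfolding reset_drift_def by blast
      then have "Y t \<omega> = - ((a + t) *\<^sub>R g)" using a by (simp add: algebra_simps)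
      then show ?thesis using a t g by simp
    next
      case False
      then obtain a where "0 \<le> a" "Y t \<omega> = - (a *\<^sub>R g)" using elim(2) t unfolding reset_drift_def by blast
      then show ?thesis using g by simp
    qed
  qed (use elim in simp)
  have shift: "Y t \<omega> \<in> ray g c \<longleftrightarrow> N s \<omega> = N t \<omega> \<and> Y s \<omega> \<in> ray g (c - (t - s))"
    if st: "0 \<le> s" "s \<le> t" "t - s \<le> c" for s t c
  proof (cases "s = t")
    case False
    then have lt: "s < t" using st by simp
    show ?thesis
    proof (cases "N s \<omega> = N t \<omega>")
      case True
      obtain a where a: "0 \<le> a" "Y s \<omega> = - (a *\<^sub>R g)" using all[OF st(1)] by (auto simp: ray_def)
      have "Y t \<omega> = Y s \<omega> - (t - s) *\<^sub>R g" using elim(2) st lt True unfolding reset_drift_def by blast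
      then have "Y t \<omega> = - ((a + (t - s)) *\<^sub>R g)" using a by (simp add: algebra_simps)
      then show ?thesis using True a g by (simp, linarith)
    next
      case False
      then obtain a where "a < t - s" "Y t \<omega> = - (a *\<^sub>R g)"
        using elim(2) st lt unfolding reset_drift_def by blast
      then show ?thesis using False st g by simp
    qed
  qed simp
  have age: "Y t \<omega> \<in> ray g c \<longleftrightarrow> N (t - c) \<omega> = N t \<omega>" if "0 \<le> c" "c \<le> t" for c t
    using shift[of "t - c" t c] all[of "t - c"] that by simp
  show ?case
  proof (intro conjI allI impI)
    fix s t c :: real
    show "Y t \<omega> \<in> ray g 0" if "0 \<le> t" using all[OF that] .
    show "Y t \<omega> \<in> ray g c \<longleftrightarrow> N (t - c) \<omega> = N t \<omega>" if "0 \<le> c \<and> c \<le> t" using age that by blast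
    show "Y t \<omega> \<in> ray g c \<longleftrightarrow> N s \<omega> = N t \<omega> \<and> Y s \<omega> \<in> ray g (c - (t - s))"
      if "0 \<le> s \<and> s \<le> t \<and> t - s \<le> c" by (rule shift) (use that in auto)
  qed
qed

lemma AE_initial_ray:
  assumes "distr P borel (Y 0) = exp_ray \<gamma> g"
  shows "AE \<omega> in P. Y 0 \<omega> \<in> ray g 0"
proof -
  have "prob (Y 0 -` ray g 0 \<inter> space P) = measure (distr P borel (Y 0)) (ray g 0)"
    using Y_measurable by (intro measure_distr[symmetric]) auto
  also have "\<dots> = 1" using exp_ray(3)[OF g pos, of 0] assms by simp
  finally have "AE \<omega> in P. \<omega> \<in> Y 0 -` ray g 0 \<inter> space P" by (rule AE_prob_1)
  then show ?thesis by (rule eventually_mono) auto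
qed

text \<open>For \<open>c \<le> t\<close> the tail is the probability of no jump during time
  \<open>c\<close>. For \<open>c > t\<close> it is the initial tail at \<open>c - t\<close> times
  the probability of no jump up to \<open>t\<close>, and the exponents add up to the same
  value.\<close>

lemma exp_ray_invariant:
  assumes init: "distr P borel (Y 0) = exp_ray \<gamma> g" and t: "0 \<le> t"
  shows "distr P borel (Y t) = exp_ray \<gamma> g"
proof (rule measure_eq_rayI[OF g])
  show "prob_space (distr P borel (Y t))" by (rule prob_space_distr[OF Y_measurable[OF t]])
  show "measure (exp_ray \<gamma> g) (ray g 0) = 1" using exp_ray(3)[OF g pos, of 0] by simp
  fix c :: real assume c: "0 \<le> c"
  note AE = AE_stays_on_ray[OF AE_initial_ray[OF init]]
  have dis: "measure (distr P borel (Y s)) (ray g a) = prob {\<omega> \<in> space P. Y s \<omega> \<in> ray g a}" if "0 \<le> s" for s a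
    by (subst measure_distr[OF Y_measurable[OF that]]) (auto intro!: arg_cong[where f=prob])
  have "prob {\<omega> \<in> space P. Y t \<omega> \<in> ray g c} = exp (- (\<gamma> * c))"
  proof (cases "c \<le> t")
    case True
    have "prob {\<omega> \<in> space P. Y t \<omega> \<in> ray g c} = prob {\<omega> \<in> space P. N (t - c) \<omega> = N t \<omega>}"
    proof (rule finite_measure_eq_AE)
      show "AE \<omega> in P. (\<omega> \<in> {\<omega> \<in> space P. Y t \<omega> \<in> ray g c}) = (\<omega> \<in> {\<omega> \<in> space P. N (t - c) \<omega> = N t \<omega>})"
        using AE by eventually_elim (use c True in auto)
    qed (use ray_event N_eq_event c t True in auto)
    then show ?thesis using prob_eq[of "t - c" t] True c by simp
  next
    case False
    have "prob {\<omega> \<in> space P. Y t \<omega> \<in> ray g c}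
        = prob ({\<omega> \<in> space P. Y 0 \<omega> \<in> ray g (c - t)} \<inter> {\<omega> \<in> space P. N 0 \<omega> = N t \<omega>})"
    proof (rule finite_measure_eq_AE)
      show "AE \<omega> in P. (\<omega> \<in> {\<omega> \<in> space P. Y t \<omega> \<in> ray g c}) =
         (\<omega> \<in> {\<omega> \<in> space P. Y 0 \<omega> \<in> ray g (c - t)} \<inter> {\<omega> \<in> space P. N 0 \<omega> = N t \<omega>})"
        using AE
      proof eventually_elim
        case (elim \<omega>)
        have "Y t \<omega> \<in> ray g c \<longleftrightarrow> N 0 \<omega> = N t \<omega> \<and> Y 0 \<omega> \<in> ray g (c - (t - 0))"
          using elim[THEN conjunct2, THEN conjunct2, rule_format, of 0 t c] t False by simp
        then show ?case by auto
      qed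
    qed (use ray_event N_eq_event t in auto)
    also have "\<dots> = prob {\<omega> \<in> space P. Y 0 \<omega> \<in> ray g (c - t)} * exp (- (\<gamma> * (t - 0)))"
      by (rule indep_eq[OF ray_F]) (use t in auto)
    also have "\<dots> = exp (- (\<gamma> * c))"
    proof -
      have e: "prob {\<omega> \<in> space P. Y 0 \<omega> \<in> ray g (c - t)} = exp (- \<gamma> * (c - t))"
        using dis[of 0 "c - t"] exp_ray(3)[OF g pos, of "c - t"] init False by simp
      show ?thesis unfolding e exp_add[symmetric] by (simp add: algebra_simps)
    qed
    finally show ?thesis .
  qed
  then show "measure (distr P borel (Y t)) (ray g c) = measure (exp_ray \<gamma> g) (ray g c)"
    using dis[OF t] exp_ray(3)[OF g pos c] by simp
qed (use exp_ray[OF g pos] in auto)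

text \<open>Peel off the largest time \<open>t\<close>, with predecessor \<open>s\<close>. If
  \<open>c t \<le> t - s\<close>, its condition is a jump-free stretch after \<open>s\<close>;
  otherwise it is a jump-free stretch from \<open>s\<close> to \<open>t\<close> together with a
  higher threshold \<open>c'\<close> at \<open>s\<close>. Either way independence splits off a
  factor free of \<open>h\<close>, and the thresholds stay general for the induction.\<close>

lemma prob_rays_stationary:
  assumes init: "distr P borel (Y 0) = exp_ray \<gamma> g" and J: "finite J" "J \<subseteq> {0..}" and h: "0 \<le> h"
    and c: "\<And>j. 0 \<le> c j"
  shows "prob {\<omega> \<in> space P. \<forall>j\<in>J. Y (j + h) \<omega> \<in> ray g (c j)} = prob {\<omega> \<in> space P. \<forall>j\<in>J. Y j \<omega> \<in> ray g (c j)}"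
  using J c
proof (induction J arbitrary: c rule: finite_linorder_max_induct)
  case (insert t J)
  note AE = AE_stays_on_ray[OF AE_initial_ray[OF init]]
  have t0: "0 \<le> t" and J0: "J \<subseteq> {0..}" using insert.prems by auto
  show ?case
  proof (cases "J = {}")
    case True
    have "prob {\<omega> \<in> space P. Y r \<omega> \<in> ray g a} = measure (exp_ray \<gamma> g) (ray g a)" if "0 \<le> r" for r a
      unfolding exp_ray_invariant[OF init that, symmetric]
      by (subst measure_distr[OF Y_measurable[OF that]]) (auto intro!: arg_cong[where f=prob])
    then show ?thesis using True t0 h by simp
  next
    case False
    define s where "s = Max J"
    have s: "s \<in> J" "\<And>j. j \<in> J \<Longrightarrow> j \<le> s" using False insert.hyps by (auto simp: s_def)
    have s0: "0 \<le> s" "s \<le> t" using s(1) J0 insert.hyps by auto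
    define E where "E c h = {\<omega> \<in> space P. \<forall>j\<in>J. Y (j + h) \<omega> \<in> ray g (c j)}" for c h
    have E: "E c h \<in> sets (F (s + h))" if h: "0 \<le> h" for c h
    proof -
      have "E c h = (\<Inter>j\<in>J. {\<omega> \<in> space P. Y (j + h) \<omega> \<in> ray g (c j)})" using False by (auto simp: E_def)
      moreover have "{\<omega> \<in> space P. Y (j + h) \<omega> \<in> ray g (c j)} \<in> sets (F (s + h))" if "j \<in> J" for j
      proof (rule subsetD[OF sets_F_mono])
        show "j + h \<le> s + h" using s(2)[OF that] by simp
        show "{\<omega> \<in> space P. Y (j + h) \<omega> \<in> ray g (c j)} \<in> sets (F (j + h))"
          by (rule ray_F) (use that J0 h in auto)
      qed
      ultimately show ?thesis using False insert.hyps(1) by (auto intro!: sets.finite_INT)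
    qed
    have Ev: "{\<omega> \<in> space P. \<forall>j\<in>insert t J. Y (j + h) \<omega> \<in> ray g (c j)} \<in> events" if h: "0 \<le> h" for h
    proof -
      have "{\<omega> \<in> space P. \<forall>j\<in>insert t J. Y (j + h) \<omega> \<in> ray g (c j)} = E c h \<inter> {\<omega> \<in> space P. Y (t + h) \<omega> \<in> ray g (c t)}"
        by (auto simp: E_def)
      moreover have "E c h \<in> events" using E[OF h] sets_F_le by blast
      moreover have "{\<omega> \<in> space P. Y (t + h) \<omega> \<in> ray g (c t)} \<in> events" using h t0 by (intro ray_event) auto
      ultimately show ?thesis by (metis sets.Int)
    qed
    show ?thesis
    proof (cases "c t \<le> t - s")
      case True
      have *: "prob {\<omega> \<in> space P. \<forall>j\<in>insert t J. Y (j + h) \<omega> \<in> ray g (c j)} = prob (E c h) * exp (- (\<gamma> * c t))"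
        if h: "0 \<le> h" for h
      proof -
        have "prob {\<omega> \<in> space P. \<forall>j\<in>insert t J. Y (j + h) \<omega> \<in> ray g (c j)}
            = prob (E c h \<inter> {\<omega> \<in> space P. N (t + h - c t) \<omega> = N (t + h) \<omega>})"
        proof (rule finite_measure_eq_AE)
          show "AE \<omega> in P. (\<omega> \<in> {\<omega> \<in> space P. \<forall>j\<in>insert t J. Y (j + h) \<omega> \<in> ray g (c j)}) =
              (\<omega> \<in> E c h \<inter> {\<omega> \<in> space P. N (t + h - c t) \<omega> = N (t + h) \<omega>})"
            using AE
          proof eventually_elim
            case (elim \<omega>)
            then have "Y (t + h) \<omega> \<in> ray g (c t) \<longleftrightarrow> N (t + h - c t) \<omega> = N (t + h) \<omega>"
              using insert.prems(2) True s0 h by auto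
            then show ?case by (auto simp: E_def)
          qed
          show "E c h \<inter> {\<omega> \<in> space P. N (t + h - c t) \<omega> = N (t + h) \<omega>} \<in> events"
            using subsetD[OF sets_F_le E[OF h]] N_eq_event[of "t + h - c t" "t + h"] insert.prems(2)[of t] True s0 h
            by (intro sets.Int) auto
        qed (rule Ev[OF h])
        also have "\<dots> = prob (E c h) * exp (- (\<gamma> * (t + h - (t + h - c t))))"
          by (rule indep_eq[OF E[OF h]]) (use insert.prems(2)[of t] True s0 h in auto)
        finally show ?thesis by simp
      qed
      show ?thesis using *[OF h] *[of 0] insert.IH[OF J0, of c] insert.prems(2) by (simp add: E_def)
    next
      case False
      define c' where "c' = c(s := max (c s) (c t - (t - s)))"
      have c': "0 \<le> c' j" for j using insert.prems(2) by (auto simp: c'_def le_max_iff_disj)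
      have *: "prob {\<omega> \<in> space P. \<forall>j\<in>insert t J. Y (j + h) \<omega> \<in> ray g (c j)} = prob (E c' h) * exp (- (\<gamma> * (t - s)))"
        if h: "0 \<le> h" for h
      proof -
        have "prob {\<omega> \<in> space P. \<forall>j\<in>insert t J. Y (j + h) \<omega> \<in> ray g (c j)}
            = prob (E c' h \<inter> {\<omega> \<in> space P. N (s + h) \<omega> = N (t + h) \<omega>})"
        proof (rule finite_measure_eq_AE)
          show "AE \<omega> in P. (\<omega> \<in> {\<omega> \<in> space P. \<forall>j\<in>insert t J. Y (j + h) \<omega> \<in> ray g (c j)}) =
              (\<omega> \<in> E c' h \<inter> {\<omega> \<in> space P. N (s + h) \<omega> = N (t + h) \<omega>})"
            using AE
          proof eventually_elim
            case (elim \<omega>)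
            have sh: "Y (t + h) \<omega> \<in> ray g (c t) \<longleftrightarrow> N (s + h) \<omega> = N (t + h) \<omega> \<and> Y (s + h) \<omega> \<in> ray g (c t - (t + h - (s + h)))"
              using elim[THEN conjunct2, THEN conjunct2, rule_format, of "s + h" "t + h" "c t"] False s0 h by simp
            have "Y (s + h) \<omega> \<in> ray g (c' s) \<longleftrightarrow> Y (s + h) \<omega> \<in> ray g (c s) \<and> Y (s + h) \<omega> \<in> ray g (c t - (t - s))"
              by (simp add: c'_def ray_Int[OF g, symmetric])
            then have "(\<forall>j\<in>J. Y (j + h) \<omega> \<in> ray g (c' j)) \<longleftrightarrow>
                (\<forall>j\<in>J. Y (j + h) \<omega> \<in> ray g (c j)) \<and> Y (s + h) \<omega> \<in> ray g (c t - (t - s))"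
              using s(1) by (auto simp: c'_def)
            then show ?case using sh by (auto simp: E_def)
          qed
          show "E c' h \<inter> {\<omega> \<in> space P. N (s + h) \<omega> = N (t + h) \<omega>} \<in> events"
            using subsetD[OF sets_F_le E[OF h]] N_eq_event[of "s + h" "t + h"] s0 h by (intro sets.Int) auto
        qed (rule Ev[OF h])
        also have "\<dots> = prob (E c' h) * exp (- (\<gamma> * (t + h - (s + h))))"
          by (rule indep_eq[OF E[OF h]]) (use s0 h in auto)
        finally show ?thesis by simp
      qed
      show ?thesis using *[OF h] *[of 0] insert.IH[OF J0 c'] by (simp add: E_def)
    qed
  qed
qed simp

text \<open>Finite-dimensional laws are compared in ray coordinates, where orthants determine them;
  passing to coordinates loses nothing because the solution stays on the ray.\<close>

lemma stationary:
  assumes init: "distr P borel (Y 0) = exp_ray \<gamma> g"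
  shows "stationary_process P Y"
  unfolding stationary_process_def
proof (intro allI impI)
  fix J :: "real set" and h :: real assume J: "finite J \<and> J \<subseteq> {0..} \<and> 0 \<le> h"
  note AE = AE_stays_on_ray[OF AE_initial_ray[OF init]]
  define X where "X h \<omega> = (\<lambda>t\<in>J. ray_coord g (Y (t + h) \<omega>))" for h \<omega>
  have X: "X h \<in> P \<rightarrow>\<^sub>M PiM J (\<lambda>_. borel)" if "0 \<le> h" for h
    unfolding X_def[abs_def] using J that
    by (intro measurable_restrict measurable_compose[OF Y_measurable ray_coord_measurable]) auto
  have Y: "distr P (PiM J (\<lambda>_. borel)) (\<lambda>\<omega>. \<lambda>t\<in>J. Y (t + h) \<omega>)
      = distr (distr P (PiM J (\<lambda>_. borel)) (X h)) (PiM J (\<lambda>_. borel)) (\<lambda>f. \<lambda>t\<in>J. - (f t *\<^sub>R g))" if h: "0 \<le> h" for h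
  proof -
    have "AE \<omega> in P. (\<lambda>t\<in>J. Y (t + h) \<omega>) = (\<lambda>t\<in>J. - (X h \<omega> t *\<^sub>R g))"
      using AE
    proof eventually_elim
      case (elim \<omega>)
      have "Y (t + h) \<omega> = - (X h \<omega> t *\<^sub>R g)" if "t \<in> J" for t
      proof -
        have "Y (t + h) \<omega> \<in> ray g 0" using elim that J h by auto
        then show ?thesis using ray_coord_scaleR[OF g] that by (simp add: X_def)
      qed
      then show ?case by auto
    qed
    moreover have "(\<lambda>\<omega>. \<lambda>t\<in>J. Y (t + h) \<omega>) \<in> P \<rightarrow>\<^sub>M PiM J (\<lambda>_. borel)"
      using J h by (intro measurable_restrict Y_measurable) auto
    moreover have m: "(\<lambda>f. \<lambda>t\<in>J. - (f t *\<^sub>R g)) \<in> PiM J (\<lambda>_. borel) \<rightarrow>\<^sub>M PiM J (\<lambda>_. borel)" by measurable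
    ultimately show ?thesis using measurable_compose[OF X[OF h] m]
      by (subst distr_distr[OF m X[OF h]]) (auto intro!: distr_cong_AE simp: comp_def)
  qed
  have "distr P (PiM J (\<lambda>_. borel)) (X h) = distr P (PiM J (\<lambda>_. borel)) (X 0)"
  proof (rule measure_eq_PiM_atLeastI)
    fix c :: "real \<Rightarrow> real"
    have meas: "measure (distr P (PiM J (\<lambda>_. borel)) (X h)) (PiE J (\<lambda>j. {c j..}))
        = prob {\<omega> \<in> space P. \<forall>j\<in>J. Y (j + h) \<omega> \<in> ray g (max 0 (c j))}" if h: "0 \<le> h" for h
    proof -
      have "measure (distr P (PiM J (\<lambda>_. borel)) (X h)) (PiE J (\<lambda>j. {c j..})) = prob (X h -` (PiE J (\<lambda>j. {c j..})) \<inter> space P)"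
        by (rule measure_distr[OF X[OF h]]) (use J in \<open>auto intro!: sets_PiM_I_finite\<close>)
      also have "\<dots> = prob {\<omega> \<in> space P. \<forall>j\<in>J. Y (j + h) \<omega> \<in> ray g (max 0 (c j))}"
      proof (rule finite_measure_eq_AE)
        show "AE \<omega> in P. (\<omega> \<in> X h -` (PiE J (\<lambda>j. {c j..})) \<inter> space P) =
            (\<omega> \<in> {\<omega> \<in> space P. \<forall>j\<in>J. Y (j + h) \<omega> \<in> ray g (max 0 (c j))})"
          using AE AE_space
        proof eventually_elim
          case (elim \<omega>)
          have "Y (j + h) \<omega> \<in> ray g (max 0 (c j)) \<longleftrightarrow> c j \<le> ray_coord g (Y (j + h) \<omega>)" if "j \<in> J" for j
          proof -
            have "Y (j + h) \<omega> \<in> ray g 0" using elim that J h by auto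
            then show ?thesis using ray_mem_coord[OF g, of "Y (j + h) \<omega>"] by (auto simp: max_def)
          qed
          then show ?case using elim by (auto simp: X_def PiE_def Pi_def)
        qed
        show "X h -` (PiE J (\<lambda>j. {c j..})) \<inter> space P \<in> events"
          by (rule measurable_sets[OF X[OF h]]) (use J in \<open>auto intro!: sets_PiM_I_finite\<close>)
        have "{\<omega> \<in> space P. \<forall>j\<in>J. Y (j + h) \<omega> \<in> ray g (max 0 (c j))}
          = space P - (\<Union>j\<in>J. space P - {\<omega> \<in> space P. Y (j + h) \<omega> \<in> ray g (max 0 (c j))})" by auto
        also have "\<dots> \<in> events" using J h by (intro sets.Diff sets.top sets.finite_UN ray_event) auto
        finally show "{\<omega> \<in> space P. \<forall>j\<in>J. Y (j + h) \<omega> \<in> ray g (max 0 (c j))} \<in> events" .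
      qed
      finally show ?thesis .
    qed
    show "measure (distr P (PiM J (\<lambda>_. borel)) (X h)) (PiE J (\<lambda>j. {c j..})) =
          measure (distr P (PiM J (\<lambda>_. borel)) (X 0)) (PiE J (\<lambda>j. {c j..}))"
      using meas[of h] meas[of 0] prob_rays_stationary[OF init, of J h "\<lambda>j. max 0 (c j)"] J by simp
  qed (use J X prob_space_distr in auto)
  then show "distr P (PiM J (\<lambda>_. borel)) (\<lambda>\<omega>. \<lambda>t\<in>J. Y (t + h) \<omega>) =
        distr P (PiM J (\<lambda>_. borel)) (\<lambda>\<omega>. \<lambda>t\<in>J. Y t \<omega>)"
    using Y[of h] Y[of 0] J by simp
qed

end

lemma exp_ray_invariant_distribution:
  fixes g :: "'v::euclidean_space"
  assumes "0 < \<gamma>" "g \<noteq> 0"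
  shows "invariant_distribution TYPE('w) \<gamma> g (exp_ray \<gamma> g)"
  unfolding invariant_distribution_def
  using exp_ray[OF assms(2,1)] assms by (auto intro!: reset_solution.exp_ray_invariant reset_solution.intro)

section \<open>A Poisson process from exponential waiting times\<close>

definition arrival :: "(nat \<Rightarrow> real) \<Rightarrow> nat \<Rightarrow> real" where
  "arrival w k = (\<Sum>i\<le>k. w i)"

definition arrivals_ok :: "(nat \<Rightarrow> real) \<Rightarrow> bool" where
  "arrivals_ok w \<longleftrightarrow> (\<forall>i. 0 < w i) \<and> (\<forall>n::nat. \<exists>k. real n < arrival w k)"

text \<open>The value \<open>0\<close> for bad sequences makes every path, not just almost every
  one, monotone and cadlag, as \<open>poisson_process\<close> demands.\<close>

definition renewal_count :: "(nat \<Rightarrow> real) \<Rightarrow> real \<Rightarrow> nat" where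
  "renewal_count w t = (if arrivals_ok w then card {k. arrival w k \<le> t} else 0)"

lemma arrival_case_nat:
  "arrival (case_nat x w) 0 = x" "arrival (case_nat x w) (Suc k) = x + arrival w k"
  by (simp_all add: arrival_def sum.atMost_Suc_shift del: sum.atMost_Suc)

lemma arrival_strict_mono: "arrivals_ok w \<Longrightarrow> strict_mono (arrival w)"
  by (rule strict_monoI_Suc) (simp add: arrivals_ok_def arrival_def)

lemma arrival_pos: "arrivals_ok w \<Longrightarrow> 0 < arrival w k"
  by (auto simp: arrivals_ok_def arrival_def intro!: sum_pos)

lemma finite_arrivals: "arrivals_ok w \<Longrightarrow> finite {k. arrival w k \<le> t}"
proof -
  assume w: "arrivals_ok w"
  obtain n :: nat where n: "t \<le> real n" using real_arch_simple by blast
  obtain k0 where "real n < arrival w k0" using w by (auto simp: arrivals_ok_def)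
  then have "\<not> k0 < k" if "arrival w k \<le> t" for k
    using n strict_mono_less[OF arrival_strict_mono[OF w], of k0 k] that by linarith
  then have "{k. arrival w k \<le> t} \<subseteq> {..k0}" by (auto simp: not_less)
  then show ?thesis using finite_subset by blast
qed

lemma arrivals_ok_case_nat: "0 < x \<Longrightarrow> arrivals_ok w \<Longrightarrow> arrivals_ok (case_nat x w)"
  unfolding arrivals_ok_def
proof (intro conjI allI)
  assume x: "0 < x" and w: "(\<forall>i. 0 < w i) \<and> (\<forall>n::nat. \<exists>k. real n < arrival w k)"
  show "0 < (case i of 0 \<Rightarrow> x | Suc j \<Rightarrow> w j)" for i using x w by (cases i) auto
  fix n :: nat
  obtain k where "real n < arrival w k" using w by auto
  then show "\<exists>k. real n < arrival (case_nat x w) k"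
    using x by (intro exI[of _ "Suc k"]) (simp add: arrival_case_nat)
qed

text \<open>The renewal recursion at the first arrival; all laws of the count are derived from
  it.\<close>

lemma renewal_count_case_nat:
  assumes "0 < x" "arrivals_ok w"
  shows "renewal_count (case_nat x w) t = (if x \<le> t then Suc (renewal_count w (t - x)) else 0)"
proof -
  have eq: "{k. arrival (case_nat x w) k \<le> t} = (if x \<le> t then insert 0 (Suc ` {k. arrival w k \<le> t - x}) else {})"
  proof -
    have "arrival (case_nat x w) k \<le> t \<longleftrightarrow> x \<le> t \<and> (k = 0 \<or> (\<exists>j. k = Suc j \<and> arrival w j \<le> t - x))" for k
      using arrival_pos[OF assms(2), of "k - 1"] by (cases k) (auto simp: arrival_case_nat)
    then show ?thesis by auto
  qed
  show ?thesis
    using arrivals_ok_case_nat[OF assms] assms(2) finite_arrivals[OF assms(2)]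
    by (simp add: renewal_count_def eq card_image)
qed

lemma renewal_count_0: "t \<le> 0 \<Longrightarrow> renewal_count w t = 0"
proof -
  assume "t \<le> 0"
  then have "{k. arrival w k \<le> t} = {}" if "arrivals_ok w"
    using arrival_pos[OF that] by (auto simp: not_le intro: less_le_trans order.strict_trans1)
  then show ?thesis by (simp add: renewal_count_def)
qed

lemma renewal_count_mono: "s \<le> t \<Longrightarrow> renewal_count w s \<le> renewal_count w t"
  by (auto simp: renewal_count_def intro!: card_mono finite_arrivals)

lemma cadlag_renewal_count: "cadlag_on {0..} (renewal_count w)"
proof (cases "arrivals_ok w")
  case False
  then have "renewal_count w = (\<lambda>_. 0)" by (simp add: renewal_count_def fun_eq_iff)
  then show ?thesis unfolding cadlag_on_def by (auto intro!: exI[of _ 0])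
next
  case True
  show ?thesis
  proof (rule cadlag_onI_nonneg)
    fix t :: real
    define K where "K = {k. arrival w k \<le> t + 1}"
    have K: "finite (arrival w ` K)" using finite_arrivals[OF True] by (simp add: K_def)
    have eq: "renewal_count w s = card {k \<in> K. arrival w k \<in> {u \<in> arrival w ` K. u \<le> s}}" if "s \<le> t + 1" for s
      using that True by (auto simp: renewal_count_def K_def intro!: arg_cong[where f=card])
    have "\<forall>\<^sub>F s in at_right t. s \<le> t + 1" unfolding eventually_at_right_field by (intro exI[of _ "t + 1"]) auto
    then have "\<forall>\<^sub>F s in at_right t. renewal_count w s = renewal_count w t"
      using eventually_finite_at_most_right[OF K, of t UNIV, simplified]
    proof eventually_elim
      case (elim s)
      then show ?case using eq[of s] eq[of t] by simp
    qed
    then show "(renewal_count w \<longlongrightarrow> renewal_count w t) (at_right t)" by (rule tendsto_eventually)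
    have "\<forall>\<^sub>F s in at_left t. s \<le> t + 1" unfolding eventually_at_left_field by (intro exI[of _ "t - 1"]) auto
    then have "\<forall>\<^sub>F s in at_left t. renewal_count w s = card {k \<in> K. arrival w k \<in> {u \<in> arrival w ` K. u < t}}"
      using eventually_finite_at_most_left[OF K, of t UNIV, simplified]
    proof eventually_elim
      case (elim s)
      then show ?case using eq[of s] by simp
    qed
    then show "\<exists>l. (renewal_count w \<longlongrightarrow> l) (at_left t)" using tendsto_eventually by blast
  qed
qed

locale exponential_waiting =
  fixes \<gamma> :: real assumes \<gamma>: "0 < \<gamma>"
begin

definition E :: "real measure" where "E = density lborel (exponential_density \<gamma>)"

sublocale E: prob_space E unfolding E_def by (rule prob_space_exponential_density[OF \<gamma>])

lemma sets_E [measurable_cong, simp]: "sets E = sets borel" and space_E [simp]: "space E = UNIV"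
  by (auto simp: E_def)

sublocale W: sequence_space E by unfold_locales

abbreviation W where "W \<equiv> PiM UNIV (\<lambda>_::nat. E)"

lemma space_W [simp]: "space W = UNIV" by (simp add: space_PiM)

lemma measurable_coord [measurable]: "(\<lambda>w. w i) \<in> borel_measurable W"
  using measurable_component_singleton[of i UNIV "\<lambda>_. E"] by (simp add: measurable_cong_sets[OF refl sets_E])

lemma measurable_arrival [measurable]: "(\<lambda>w. arrival w k) \<in> borel_measurable W"
  unfolding arrival_def by measurable

lemma measurable_arrivals_ok [measurable]: "Measurable.pred W arrivals_ok"
  unfolding arrivals_ok_def[abs_def] by measurable

lemma measurable_renewal_count [measurable]: "(\<lambda>w. renewal_count w t) \<in> W \<rightarrow>\<^sub>M count_space UNIV"
  unfolding renewal_count_def by measurable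

lemma measurable_case_nat [measurable]: "(\<lambda>w. case_nat x w) \<in> W \<rightarrow>\<^sub>M W"
  by (rule measurable_PiM_single') (auto split: nat.split intro: measurable_coord[unfolded measurable_cong_sets[OF refl sets_E[symmetric]]])

lemma case_nat_pair [measurable]: "(\<lambda>(x, w). case_nat x w) \<in> E \<Otimes>\<^sub>M W \<rightarrow>\<^sub>M W"
  by (rule measurable_PiM_single') (auto split: nat.split simp: split_beta')

text \<open>Prepending an independent exponential term to the sequence of waiting times reproduces
  its law.\<close>

lemma emeasure_first_step:
  assumes A: "A \<in> sets W"
  shows "emeasure W A = (\<integral>\<^sup>+x. emeasure W {w. case_nat x w \<in> A} \<partial>E)"
proof -
  have "emeasure W A = emeasure (distr (E \<Otimes>\<^sub>M W) W (\<lambda>(x, w). case_nat x w)) A" by (simp add: W.PiM_iter)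
  also have "\<dots> = emeasure (E \<Otimes>\<^sub>M W) ((\<lambda>(x, w). case_nat x w) -` A \<inter> space (E \<Otimes>\<^sub>M W))"
    by (rule emeasure_distr[OF case_nat_pair A])
  also have "\<dots> = (\<integral>\<^sup>+x. emeasure W (Pair x -` ((\<lambda>(x, w). case_nat x w) -` A \<inter> space (E \<Otimes>\<^sub>M W))) \<partial>E)"
    by (rule W.P.emeasure_pair_measure_alt[OF measurable_sets[OF case_nat_pair A]])
  finally show ?thesis by (simp add: vimage_def space_pair_measure)
qed

lemma AE_E_pos: "AE x in E. 0 < x"
proof -
  have "AE x in lborel. x \<noteq> (0::real)" by (rule AE_lborel_singleton)
  then show ?thesis unfolding E_def by (subst AE_density) (auto simp: exponential_density_def)
qed

lemma memoryless:
  assumes "0 \<le> s" and h [measurable]: "h \<in> borel_measurable borel"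
  shows "(\<integral>\<^sup>+x. (if s < x then h (x - s) else 0) \<partial>E) = ennreal (exp (- (\<gamma> * s))) * (\<integral>\<^sup>+x. h x \<partial>E)"
proof -
  have "(\<integral>\<^sup>+x. (if s < x then h (x - s) else 0) \<partial>E)
      = (\<integral>\<^sup>+x. ennreal (exponential_density \<gamma> x) * (if s < x then h (x - s) else 0) \<partial>lborel)"
    unfolding E_def by (rule nn_integral_density) auto
  also have "\<dots> = (\<integral>\<^sup>+x. ennreal (exponential_density \<gamma> (s + x)) * (if 0 < x then h x else 0) \<partial>lborel)"
    by (subst nn_integral_real_affine[where c=1 and t=s]) (auto intro!: nn_integral_cong)
  also have "\<dots> = (\<integral>\<^sup>+x. ennreal (exp (- (\<gamma> * s))) * (ennreal (exponential_density \<gamma> x) * h x) \<partial>lborel)"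
  proof (rule nn_integral_cong_AE)
    \<comment> \<open>At \<open>x = 0\<close> the strict inequality removes the left-hand side,
      while the density on the right is positive.\<close>
    have "AE x in lborel. x \<noteq> (0::real)" by (rule AE_lborel_singleton)
    then show "AE x in lborel. ennreal (exponential_density \<gamma> (s + x)) * (if 0 < x then h x else 0)
        = ennreal (exp (- (\<gamma> * s))) * (ennreal (exponential_density \<gamma> x) * h x)"
    proof eventually_elim
      case (elim x)
      have "exponential_density \<gamma> (s + x) = exp (- (\<gamma> * s)) * exponential_density \<gamma> x" if "0 < x"
        using that assms(1) \<gamma> by (simp add: exponential_density_def exp_add[symmetric] algebra_simps)
      then show ?case
        using elim by (auto simp: exponential_density_def ennreal_mult' mult.assoc)
    qed
  qed
  also have "\<dots> = ennreal (exp (- (\<gamma> * s))) * (\<integral>\<^sup>+x. ennreal (exponential_density \<gamma> x) * h x \<partial>lborel)"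
    by (rule nn_integral_cmult) auto
  also have "(\<integral>\<^sup>+x. ennreal (exponential_density \<gamma> x) * h x \<partial>lborel) = (\<integral>\<^sup>+x. h x \<partial>E)"
    unfolding E_def by (rule nn_integral_density[symmetric]) auto
  finally show ?thesis .
qed

text \<open>Conditioning on the first term, the probability that all waiting times are at most
  \<open>n\<close> equals itself times \<open>1 - exp (- (\<gamma> * n))\<close>, hence is
  \<open>0\<close>. Unbounded waiting times already force unbounded arrival times.\<close>

lemma AE_arrivals_ok: "AE w in W. arrivals_ok w"
proof -
  have pos: "AE w in W. \<forall>i. 0 < w i"
    unfolding AE_all_countable using AE_E_pos by (intro allI AE_PiM_component E.prob_space_axioms) auto
  have "AE w in W. \<not> (\<forall>i. w i \<le> real n)" for n :: nat
  proof -
    define A where "A = {w. \<forall>i::nat. w i \<le> real n}"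
    have A: "A \<in> sets W"
    proof -
      have "{w \<in> space W. \<forall>i::nat. w i \<le> real n} \<in> sets W" by measurable
      then show ?thesis by (simp add: A_def)
    qed
    have "{w. case_nat x w \<in> A} = (if x \<le> real n then A else {})" for x
      by (auto simp: A_def split: nat.split)
    then have "emeasure W A = (\<integral>\<^sup>+x. emeasure W A * indicator {..real n} x \<partial>E)"
      by (subst emeasure_first_step[OF A]) (auto intro!: nn_integral_cong simp: indicator_def)
    also have "\<dots> = emeasure W A * emeasure E {..real n}" by (subst nn_integral_cmult_indicator) auto
    also have "emeasure E {..real n} = ennreal (1 - exp (- (\<gamma> * real n)))"
      using emeasure_erlang_density[OF \<gamma>, of 0 "real n"] \<gamma> by (simp add: E_def erlang_CDF_0)
    finally have "W.prob A = W.prob A * (1 - exp (- (\<gamma> * real n)))"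
      using \<gamma> by (simp add: W.emeasure_eq_measure ennreal_mult'[symmetric])
    then have "W.prob A = 0" by (simp add: algebra_simps)
    then have "A \<in> null_sets W" using A by (simp add: null_sets_def W.emeasure_eq_measure)
    then have "AE w in W. w \<notin> A" by (rule AE_not_in)
    then show ?thesis by (simp add: A_def)
  qed
  then have "AE w in W. \<forall>n::nat. \<not> (\<forall>i. w i \<le> real n)" by (simp add: AE_all_countable)
  then show ?thesis using pos
  proof eventually_elim
    case (elim w)
    have "\<exists>k. real n < arrival w k" for n :: nat
    proof -
      obtain i where i: "real n < w i" using elim(1)[rule_format, of n] by (auto simp: not_le)
      have "w i \<le> arrival w i" unfolding arrival_def using elim(2) by (intro member_le_sum) (auto intro: less_imp_le)
      then show ?thesis using i by (intro exI[of _ i]) simp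
    qed
    then show ?case using elim(2) by (simp add: arrivals_ok_def)
  qed
qed

text \<open>Conditioning on the first arrival, with the event rewritten by the renewal recursion on
  good sequences. The factor \<open>c\<close> is carried along so that a product can be folded back
  into \<open>Q\<close> without measurability of the integrand written with
  \<open>R\<close>.\<close>

lemma emeasure_renewal_step_mult:
  assumes Q: "{w. Q w} \<in> sets W"
    and step: "\<And>x w. 0 < x \<Longrightarrow> arrivals_ok w \<Longrightarrow> Q (case_nat x w) \<longleftrightarrow> R x w"
    and R: "\<And>x. {w. R x w} \<in> sets W"
  shows "emeasure W {w. Q w} * c = (\<integral>\<^sup>+x. emeasure W {w. R x w} * c \<partial>E)"
proof -
  have "(\<lambda>(x, w). case_nat x w) -` {w. Q w} \<inter> space (E \<Otimes>\<^sub>M W) \<in> sets (E \<Otimes>\<^sub>M W)"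
    by (rule measurable_sets[OF case_nat_pair Q])
  from W.measurable_emeasure_Pair[OF this]
  have m: "(\<lambda>x. emeasure W {w. case_nat x w \<in> {w. Q w}}) \<in> borel_measurable E"
    by (simp add: vimage_def space_pair_measure)
  have "emeasure W {w. Q w} * c = (\<integral>\<^sup>+x. emeasure W {w. case_nat x w \<in> {w. Q w}} * c \<partial>E)"
    unfolding emeasure_first_step[OF Q] by (rule nn_integral_multc[OF m, symmetric])
  also have "\<dots> = (\<integral>\<^sup>+x. emeasure W {w. R x w} * c \<partial>E)"
  proof (rule nn_integral_cong_AE, use AE_E_pos in eventually_elim)
    fix x :: real assume x: "0 < x"
    have "emeasure W {w. case_nat x w \<in> {w. Q w}} = emeasure W {w. R x w}"
    proof (rule emeasure_eq_AE)
      show "AE w in W. (w \<in> {w. case_nat x w \<in> {w. Q w}}) = (w \<in> {w. R x w})"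
        using AE_arrivals_ok by eventually_elim (use step[OF x] in auto)
      show "{w. case_nat x w \<in> {w. Q w}} \<in> sets W"
        using measurable_sets[OF measurable_case_nat Q, of x] by (simp add: vimage_def)
    qed (rule R)
    then show "emeasure W {w. case_nat x w \<in> {w. Q w}} * c = emeasure W {w. R x w} * c" by simp
  qed
  finally show ?thesis .
qed

lemmas emeasure_renewal_step = emeasure_renewal_step_mult[where c=1, simplified mult_1_right]

lemma event_count [measurable]: "{w. renewal_count w t = j} \<in> sets W"
proof -
  have "{w \<in> space W. renewal_count w t = j} \<in> sets W" by measurable
  then show ?thesis by simp
qed

lemma event_counts: "finite U \<Longrightarrow> {w. \<forall>u\<in>U. renewal_count w u = c u} \<in> sets W"
proof -
  assume "finite U"
  then have "{w \<in> space W. \<forall>u\<in>U. renewal_count w u = c u} \<in> sets W" by measurable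
  then show ?thesis by simp
qed

lemma event_counts_conj: "finite U \<Longrightarrow> {w. (\<forall>u\<in>U. renewal_count w u = c u) \<and> renewal_count w t = j} \<in> sets W"
  using event_counts[of "U" c] event_count[of t j] by (auto simp: Collect_conj_eq)

section \<open>Poisson law and independent increments of the renewal count\<close>

lemma emeasure_no_arrival: "0 \<le> s \<Longrightarrow> emeasure W {w. renewal_count w s = 0} = ennreal (exp (- (\<gamma> * s)))"
proof -
  assume s: "0 \<le> s"
  have "emeasure W {w. renewal_count w s = 0} = (\<integral>\<^sup>+x. emeasure W {w. s < x} \<partial>E)"
    by (rule emeasure_renewal_step) (auto simp: renewal_count_case_nat simp flip: space_W)
  also have "\<dots> = (\<integral>\<^sup>+x. (if s < x then 1 else 0) \<partial>E)"
    using W.emeasure_space_1 by (intro nn_integral_cong) simp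
  also have "\<dots> = ennreal (exp (- (\<gamma> * s)))"
    using memoryless[OF s, of "\<lambda>_. 1"] E.emeasure_space_1 by simp
  finally show ?thesis .
qed

lemma emeasure_count:
  "0 \<le> t \<Longrightarrow> emeasure W {w. renewal_count w t = j} = ennreal ((\<gamma> * t) ^ j / fact j * exp (- (\<gamma> * t)))"
proof (induction j arbitrary: t)
  case 0 then show ?case by (simp add: emeasure_no_arrival)
next
  case (Suc j)
  \<comment> \<open>The exponentials of the waiting time and of the Poisson weight multiply to
    \<open>exp (- (\<gamma> * t))\<close>, independent of \<open>x\<close>; what remains under the
    integral is the polynomial \<open>k * (t - x) ^ j\<close> on \<open>[0, t]\<close>.\<close>
  define k where "k = \<gamma> ^ Suc j * exp (- (\<gamma> * t)) / fact j"
  have k: "0 \<le> k" using \<gamma> by (simp add: k_def)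
  have "emeasure W {w. renewal_count w t = Suc j} = (\<integral>\<^sup>+x. emeasure W {w. x \<le> t \<and> renewal_count w (t - x) = j} \<partial>E)"
  proof (rule emeasure_renewal_step)
    show "{w. x \<le> t \<and> renewal_count w (t - x) = j} \<in> sets W" for x by (cases "x \<le> t") auto
  qed (auto simp: renewal_count_case_nat)
  also have "\<dots> = (\<integral>\<^sup>+x. (if x \<le> t then ennreal ((\<gamma> * (t - x)) ^ j / fact j * exp (- (\<gamma> * (t - x)))) else 0) \<partial>E)"
    using Suc.IH by (intro nn_integral_cong) auto
  also have "\<dots> = (\<integral>\<^sup>+x. ennreal (exponential_density \<gamma> x) *
       (if x \<le> t then ennreal ((\<gamma> * (t - x)) ^ j / fact j * exp (- (\<gamma> * (t - x)))) else 0) \<partial>lborel)"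
    unfolding E_def by (rule nn_integral_density) auto
  also have "\<dots> = (\<integral>\<^sup>+x. ennreal (k * (t - x) ^ j) * indicator {0..t} x \<partial>lborel)"
  proof (rule nn_integral_cong)
    fix x :: real
    have "exponential_density \<gamma> x * ((\<gamma> * (t - x)) ^ j / fact j * exp (- (\<gamma> * (t - x)))) = k * (t - x) ^ j" if "0 \<le> x"
    proof -
      have "exp (- x * \<gamma>) * exp (- (\<gamma> * (t - x))) = exp (- (\<gamma> * t))"
        unfolding exp_add[symmetric] by (simp add: algebra_simps)
      moreover have "exponential_density \<gamma> x * ((\<gamma> * (t - x)) ^ j / fact j * exp (- (\<gamma> * (t - x))))
          = \<gamma> ^ Suc j * (t - x) ^ j / fact j * (exp (- x * \<gamma>) * exp (- (\<gamma> * (t - x))))"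
        using that unfolding power_mult_distrib by (simp add: exponential_density_def)
      ultimately show ?thesis by (simp add: k_def)
    qed
    then show "ennreal (exponential_density \<gamma> x) *
       (if x \<le> t then ennreal ((\<gamma> * (t - x)) ^ j / fact j * exp (- (\<gamma> * (t - x)))) else 0)
       = ennreal (k * (t - x) ^ j) * indicator {0..t} x"
      using \<gamma> by (auto simp: indicator_def exponential_density_def ennreal_mult'[symmetric])
  qed
  also have "\<dots> = ennreal (- k / real (Suc j) * (t - t) ^ Suc j - (- k / real (Suc j) * (t - 0) ^ Suc j))"
  proof (rule nn_integral_FTC_Icc[where F="\<lambda>x. - k / real (Suc j) * (t - x) ^ Suc j"])
    fix x :: real assume x: "x \<in> {0..t}"
    have "((\<lambda>x. - k / real (Suc j) * (t - x) ^ Suc j) has_real_derivative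
        - k / real (Suc j) * (real (Suc j) * ((0 - 1) * (t - x) ^ (Suc j - Suc 0)))) (at x)"
      by (intro DERIV_cmult DERIV_power DERIV_diff DERIV_const DERIV_ident)
    then show "((\<lambda>x. - k / real (Suc j) * (t - x) ^ Suc j) has_real_derivative k * (t - x) ^ j) (at x)"
      by (simp del: of_nat_Suc power_Suc)
    show "0 \<le> k * (t - x) ^ j" using k x by simp
  qed (use Suc.prems in auto)
  also have "- k / real (Suc j) * (t - t) ^ Suc j - (- k / real (Suc j) * (t - 0) ^ Suc j)
      = (\<gamma> * t) ^ Suc j / fact (Suc j) * exp (- (\<gamma> * t))"
    by (simp add: k_def power_mult_distrib field_simps)
  finally show ?case .
qed

text \<open>Induction on the number of arrivals up to \<open>s\<close>, the latest observation time.
  If there is none, the residual waiting time after \<open>s\<close> is again exponential by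
  \<open>memoryless\<close>. Otherwise the first arrival is removed and all observation times move
  back by it.\<close>

lemma emeasure_counts_increment:
  assumes "finite U" "U \<subseteq> {..s}" "s \<in> U" "0 \<le> s" "s < t"
  shows "emeasure W {w. (\<forall>u\<in>U. renewal_count w u = c u) \<and> renewal_count w t = c s + j}
    = emeasure W {w. \<forall>u\<in>U. renewal_count w u = c u} * emeasure W {w. renewal_count w (t - s) = j}"
  using assms
proof (induction "c s" arbitrary: U s t c)
  case 0
  show ?case
  proof (cases "\<forall>u\<in>U. c u = 0")
    case True
    have eq: "(\<forall>u\<in>U. renewal_count w u = c u) \<longleftrightarrow> renewal_count w s = 0" for w
      using True 0 renewal_count_mono[of _ s w] by (auto simp: subset_iff)
    \<comment> \<open>The conditional probability of \<open>j\<close> arrivals within time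
      \<open>t - s\<close>, given that the first comes at \<open>x\<close>.\<close>
    define h where "h x = emeasure W {w. (if x \<le> t - s then Suc (renewal_count w (t - s - x)) else 0) = j}" for x
    have h: "emeasure W {w. renewal_count w (t - s) = j} = (\<integral>\<^sup>+x. h x \<partial>E)"
      unfolding h_def
    proof (rule emeasure_renewal_step)
      show "{w. (if x \<le> t - s then Suc (renewal_count w (t - s - x)) else 0) = j} \<in> sets W" for x
      proof -
        have "{w \<in> space W. (if x \<le> t - s then Suc (renewal_count w (t - s - x)) else 0) = j} \<in> sets W" by measurable
        then show ?thesis by simp
      qed
    qed (auto simp: renewal_count_case_nat)
    have h_meas: "h \<in> borel_measurable borel"
    proof -
      have eq: "h x = (if x \<le> t - s then (if j = 0 then 0 else ennreal ((\<gamma> * (t - s - x)) ^ (j - 1) / fact (j - 1) * exp (- (\<gamma> * (t - s - x)))))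
          else (if j = 0 then 1 else 0))" for x
        using emeasure_count[of "t - s - x" "j - 1"] W.emeasure_space_1 unfolding h_def by (cases j) auto
      show ?thesis unfolding eq[abs_def] by measurable
    qed
    have "emeasure W {w. renewal_count w s = 0 \<and> renewal_count w t = j} = (\<integral>\<^sup>+x. emeasure W {w. s < x \<and> (if x - s \<le> t - s then Suc (renewal_count w (t - s - (x - s))) else 0) = j} \<partial>E)"
    proof (rule emeasure_renewal_step)
      show "{w. renewal_count w s = 0 \<and> renewal_count w t = j} \<in> sets W" by (auto simp: Collect_conj_eq)
      show "{w. s < x \<and> (if x - s \<le> t - s then Suc (renewal_count w (t - s - (x - s))) else 0) = j} \<in> sets W" for x
      proof -
        have "{w \<in> space W. s < x \<and> (if x - s \<le> t - s then Suc (renewal_count w (t - s - (x - s))) else 0) = j} \<in> sets W" by measurable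
        then show ?thesis by simp
      qed
    qed (auto simp: renewal_count_case_nat)
    also have "\<dots> = (\<integral>\<^sup>+x. (if s < x then h (x - s) else 0) \<partial>E)"
      by (intro nn_integral_cong) (simp add: h_def)
    also have "\<dots> = ennreal (exp (- (\<gamma> * s))) * emeasure W {w. renewal_count w (t - s) = j}"
      unfolding h by (rule memoryless[OF \<open>0 \<le> s\<close> h_meas])
    finally show ?thesis using emeasure_no_arrival[OF \<open>0 \<le> s\<close>] 0 by (simp add: eq)
  next
    case False
    then obtain u where u: "u \<in> U" "c u \<noteq> 0" by auto
    have no: "\<not> (\<forall>u\<in>U. renewal_count w u = c u)" for w
    proof
      assume *: "\<forall>u\<in>U. renewal_count w u = c u"
      have "renewal_count w u \<le> renewal_count w s" using u 0 by (intro renewal_count_mono) auto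
      then show False using *[rule_format, OF u(1)] *[rule_format, OF \<open>s \<in> U\<close>] u(2) 0 by simp
    qed
    have e: "{w. (\<forall>u\<in>U. renewal_count w u = c u) \<and> renewal_count w t = c s + j} = {}"
      "{w. \<forall>u\<in>U. renewal_count w u = c u} = {}" using no by blast+
    show ?thesis unfolding e by simp
  qed
next
  case (Suc k)
  \<comment> \<open>Once the first arrival at \<open>x\<close> is removed, the observation times
    from \<open>x\<close> on are shifted by \<open>x\<close> and their counts drop by one;
    \<open>ok x\<close> says that an arrival at \<open>x\<close> is compatible with the prescribed
    counts.\<close>
  define U' where "U' x = (\<lambda>u. u - x) ` {u\<in>U. x \<le> u}" for x
  define c' where "c' x u = c (u + x) - 1" for x u
  define ok where "ok x \<longleftrightarrow> x \<le> s \<and> (\<forall>u\<in>U. if x \<le> u then c u \<noteq> 0 else c u = 0)" for x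
  have fin: "finite (U' x)" for x using Suc.prems by (simp add: U'_def)
  have split: "(\<forall>u\<in>U. renewal_count (case_nat x w) u = c u) \<longleftrightarrow> ok x \<and> (\<forall>u\<in>U' x. renewal_count w u = c' x u)"
    if x: "0 < x" and w: "arrivals_ok w" for x w
  proof
    assume *: "\<forall>u\<in>U. renewal_count (case_nat x w) u = c u"
    then have "renewal_count (case_nat x w) s = Suc k" using *[rule_format, of s] Suc.hyps(2) Suc.prems(3) by simp
    then have "x \<le> s" by (auto simp: renewal_count_case_nat[OF that] split: if_splits)
    moreover have "if x \<le> u then c u \<noteq> 0 else c u = 0" if "u \<in> U" for u
      using *[rule_format, OF that, symmetric] by (simp add: renewal_count_case_nat[OF x w])
    moreover have "renewal_count w u = c' x u" if "u \<in> U' x" for u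
      using that * by (auto simp: U'_def c'_def renewal_count_case_nat[OF x w])
    ultimately show "ok x \<and> (\<forall>u\<in>U' x. renewal_count w u = c' x u)" by (simp add: ok_def)
  next
    assume *: "ok x \<and> (\<forall>u\<in>U' x. renewal_count w u = c' x u)"
    show "\<forall>u\<in>U. renewal_count (case_nat x w) u = c u"
    proof
      fix u assume u: "u \<in> U"
      show "renewal_count (case_nat x w) u = c u"
      proof (cases "x \<le> u")
        case True
        then have "u - x \<in> U' x" using u by (auto simp: U'_def)
        then have "renewal_count w (u - x) = c u - 1" using * by (auto simp: c'_def)
        moreover have "c u \<noteq> 0" using * u True by (auto simp: ok_def)
        ultimately show ?thesis using True by (simp add: renewal_count_case_nat[OF that])
      next
        case False
        then show ?thesis using * u by (auto simp: ok_def renewal_count_case_nat[OF that])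
      qed
    qed
  qed
  have ev: "{w. ok x \<and> (\<forall>u\<in>U' x. renewal_count w u = c' x u)} \<in> sets W" for x
    using event_counts[OF fin, of x "c' x"] by (cases "ok x") auto
  have "emeasure W {w. (\<forall>u\<in>U. renewal_count w u = c u) \<and> renewal_count w t = c s + j} =
      (\<integral>\<^sup>+x. emeasure W {w. ok x \<and> (\<forall>u\<in>U' x. renewal_count w u = c' x u) \<and> renewal_count w (t - x) = c' x (s - x) + j} \<partial>E)"
  proof (rule emeasure_renewal_step[OF event_counts_conj])
    fix x :: real and w assume x: "0 < x" and w: "arrivals_ok w"
    have "renewal_count (case_nat x w) t = c s + j \<longleftrightarrow> renewal_count w (t - x) = c' x (s - x) + j" if "ok x"
      using that Suc.hyps(2) Suc.prems(5) by (auto simp: ok_def c'_def renewal_count_case_nat[OF x w])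
    then show "(\<forall>u\<in>U. renewal_count (case_nat x w) u = c u) \<and> renewal_count (case_nat x w) t = c s + j \<longleftrightarrow>
        ok x \<and> (\<forall>u\<in>U' x. renewal_count w u = c' x u) \<and> renewal_count w (t - x) = c' x (s - x) + j"
      unfolding split[OF x w] by blast
  next
    show "{w. ok x \<and> (\<forall>u\<in>U' x. renewal_count w u = c' x u) \<and> renewal_count w (t - x) = c' x (s - x) + j} \<in> sets W" for x
      using event_counts_conj[OF fin, of x "c' x" "t - x" "c' x (s - x) + j"] by (cases "ok x") auto
  qed (use Suc.prems in auto)
  also have "\<dots> = (\<integral>\<^sup>+x. emeasure W {w. ok x \<and> (\<forall>u\<in>U' x. renewal_count w u = c' x u)} * emeasure W {w. renewal_count w (t - s) = j} \<partial>E)"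
  proof (rule nn_integral_cong)
    fix x :: real
    show "emeasure W {w. ok x \<and> (\<forall>u\<in>U' x. renewal_count w u = c' x u) \<and> renewal_count w (t - x) = c' x (s - x) + j}
       = emeasure W {w. ok x \<and> (\<forall>u\<in>U' x. renewal_count w u = c' x u)} * emeasure W {w. renewal_count w (t - s) = j}"
    proof (cases "ok x")
      case True
      have "emeasure W {w. (\<forall>u\<in>U' x. renewal_count w u = c' x u) \<and> renewal_count w (t - x) = c' x (s - x) + j}
         = emeasure W {w. \<forall>u\<in>U' x. renewal_count w u = c' x u} * emeasure W {w. renewal_count w (t - x - (s - x)) = j}"
      proof (rule Suc.hyps(1))
        show "k = c' x (s - x)" using Suc.hyps(2) by (simp add: c'_def)
        show "U' x \<subseteq> {..s - x}" using Suc.prems by (auto simp: U'_def)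
        show "s - x \<in> U' x" using Suc.prems True by (auto simp: U'_def ok_def)
      qed (use fin True Suc.prems in \<open>auto simp: ok_def\<close>)
      then show ?thesis using True by simp
    qed simp
  qed
  also have "\<dots> = emeasure W {w. \<forall>u\<in>U. renewal_count w u = c u} * emeasure W {w. renewal_count w (t - s) = j}"
    by (rule emeasure_renewal_step_mult[OF event_counts split ev, symmetric]) (use Suc.prems in auto)
  finally show ?case .
qed

text \<open>\<open>emeasure_counts_increment\<close> needs the count at \<open>s\<close> to be
  prescribed; when it is not, the possible values \<open>m\<close> are summed up.\<close>

lemma emeasure_counts_increment_diff:
  assumes U: "finite U" "U \<subseteq> {..s}" and st: "0 \<le> s" "s < t"
  shows "emeasure W {w. (\<forall>u\<in>U. renewal_count w u = c u) \<and> renewal_count w t - renewal_count w s = j}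
    = emeasure W {w. \<forall>u\<in>U. renewal_count w u = c u} * ennreal ((\<gamma> * (t - s)) ^ j / fact j * exp (- (\<gamma> * (t - s))))"
proof -
  let ?q = "ennreal ((\<gamma> * (t - s)) ^ j / fact j * exp (- (\<gamma> * (t - s))))"
  have q: "emeasure W {w. renewal_count w (t - s) = j} = ?q" by (rule emeasure_count) (use st in simp)
  have inc: "renewal_count w t - renewal_count w s = j \<longleftrightarrow> renewal_count w t = renewal_count w s + j" for w
    using renewal_count_mono[of s t w] st by auto
  show ?thesis
  proof (cases "s \<in> U")
    case True
    have "{w. (\<forall>u\<in>U. renewal_count w u = c u) \<and> renewal_count w t - renewal_count w s = j}
        = {w. (\<forall>u\<in>U. renewal_count w u = c u) \<and> renewal_count w t = c s + j}"
      using True by (auto simp: inc)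
    then show ?thesis using emeasure_counts_increment[OF U True st, of c j] q by simp
  next
    case False
    let ?V = "insert s U" and ?c = "\<lambda>m. c(s := m)"
    have V: "(\<forall>u\<in>?V. renewal_count w u = ?c m u) \<longleftrightarrow> (\<forall>u\<in>U. renewal_count w u = c u) \<and> renewal_count w s = m" for m w
      using False by auto
    have meas: "{w. \<forall>u\<in>?V. renewal_count w u = ?c m u} \<in> sets W"
      "{w. (\<forall>u\<in>?V. renewal_count w u = ?c m u) \<and> renewal_count w t = ?c m s + j} \<in> sets W" for m
      using event_counts[of ?V "?c m"] event_counts_conj[of ?V "?c m" t "?c m s + j"] U by auto
    have "emeasure W {w. (\<forall>u\<in>U. renewal_count w u = c u) \<and> renewal_count w t - renewal_count w s = j}
        = emeasure W (\<Union>m. {w. (\<forall>u\<in>?V. renewal_count w u = ?c m u) \<and> renewal_count w t = ?c m s + j})"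
      unfolding V by (intro arg_cong[where f="emeasure W"]) (auto simp: inc)
    also have "\<dots> = (\<Sum>m. emeasure W {w. (\<forall>u\<in>?V. renewal_count w u = ?c m u) \<and> renewal_count w t = ?c m s + j})"
      by (intro suminf_emeasure[symmetric] image_subsetI meas(2)) (auto simp: disjoint_family_on_def)
    also have "\<dots> = (\<Sum>m. emeasure W {w. \<forall>u\<in>?V. renewal_count w u = ?c m u} * ?q)"
      unfolding q[symmetric] by (intro suminf_cong emeasure_counts_increment) (use U st in auto)
    also have "\<dots> = (\<Sum>m. emeasure W {w. \<forall>u\<in>?V. renewal_count w u = ?c m u}) * ?q"
      by (rule ennreal_suminf_multc)
    also have "(\<Sum>m. emeasure W {w. \<forall>u\<in>?V. renewal_count w u = ?c m u}) = emeasure W (\<Union>m. {w. \<forall>u\<in>?V. renewal_count w u = ?c m u})"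
      by (intro suminf_emeasure image_subsetI meas(1)) (auto simp: disjoint_family_on_def)
    also have "(\<Union>m. {w. \<forall>u\<in>?V. renewal_count w u = ?c m u}) = {w. \<forall>u\<in>U. renewal_count w u = c u}"
      unfolding V by auto
    finally show ?thesis .
  qed
qed

text \<open>A generating system, stable under intersections, of the filtration of the initial value and the counting process.\<close>

definition cylinders :: "real \<Rightarrow> ('v::euclidean_space \<times> (nat \<Rightarrow> real)) set set" where
  "cylinders t = {B \<times> {w. \<forall>u\<in>U. renewal_count w u = c u} | B U c. B \<in> sets borel \<and> finite U \<and> U \<subseteq> {..t}}"

text \<open>The initial value is an independent factor, known to the filtration from the start.
  Independence of increments from the past is checked on cylinders against the level sets of the
  increment, two families stable under intersection, and extended to the generated
  sigma-algebras.\<close>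

lemma poisson_driver_exists:
  fixes \<nu> :: "'v::euclidean_space measure"
  assumes nu: "prob_space \<nu>" "sets \<nu> = sets borel"
  shows "\<exists>P F N. poisson_driver (P :: ('v \<times> (nat \<Rightarrow> real)) measure) F \<gamma> N \<and> fst \<in> F 0 \<rightarrow>\<^sub>M borel \<and> distr P borel fst = \<nu>"
proof -
  interpret nu: prob_space \<nu> by fact
  note [measurable_cong] = nu(2)
  have sp: "space \<nu> = UNIV" using nu(2) sets_eq_imp_space_eq by fastforce
  define P where "P = \<nu> \<Otimes>\<^sub>M W"
  interpret P: pair_prob_space \<nu> W ..
  have spP: "space P = UNIV" by (simp add: P_def space_pair_measure sp)
  define F where "F t = sigma UNIV (cylinders t :: ('v \<times> (nat \<Rightarrow> real)) set set)" for t
  define N where "N t \<omega> = renewal_count (snd \<omega>) t" for t and \<omega> :: "'v \<times> (nat \<Rightarrow> real)"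
  have F: "sets (F t) = sigma_sets UNIV (cylinders t)" "space (F t) = UNIV" for t
    by (auto simp: F_def sets_measure_of space_measure_of)
  have cyl: "emeasure P (B \<times> A) = emeasure \<nu> B * emeasure W A" if "B \<in> sets borel" "A \<in> sets W" for B A
    unfolding P_def using that nu(2) by (intro W.emeasure_pair_measure_Times) auto
  have cyl_P: "cylinders t \<subseteq> sets P" for t
  proof
    fix X :: "('v \<times> (nat \<Rightarrow> real)) set" assume "X \<in> cylinders t"
    then obtain B U c where "X = B \<times> {w. \<forall>u\<in>U. renewal_count w u = c u}" "B \<in> sets borel" "finite U"
      by (auto simp: cylinders_def)
    then show "X \<in> sets P" unfolding P_def using nu(2) event_counts[of U c] by (auto intro!: pair_measureI)
  qed
  have F_P: "sets (F t) \<subseteq> sets P" for t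
    using sets.sigma_sets_subset[OF cyl_P] by (simp add: F spP)
  have N_P: "N t \<in> P \<rightarrow>\<^sub>M count_space UNIV" for t
    unfolding N_def[abs_def] P_def by measurable
  have inc_event: "{\<omega>. N t \<omega> - N s \<omega> = j} \<in> sets P" for s t j
  proof -
    have [measurable]: "N t \<in> P \<rightarrow>\<^sub>M count_space UNIV" "N s \<in> P \<rightarrow>\<^sub>M count_space UNIV" by (rule N_P)+
    have "{\<omega> \<in> space P. N t \<omega> - N s \<omega> = j} \<in> sets P" by measurable
    then show ?thesis by (simp add: spP)
  qed
  have prod: "emeasure P (X \<inter> {\<omega>. N t \<omega> - N s \<omega> = j}) = emeasure P X * ennreal ((\<gamma> * (t - s)) ^ j / fact j * exp (- (\<gamma> * (t - s))))"
    if X: "X \<in> cylinders s" and st: "0 \<le> s" "s < t" for X s t j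
  proof -
    obtain B U c where X: "X = B \<times> {w. \<forall>u\<in>U. renewal_count w u = c u}" "B \<in> sets borel" "finite U" "U \<subseteq> {..s}"
      using X by (auto simp: cylinders_def)
    have "X \<inter> {\<omega>. N t \<omega> - N s \<omega> = j} = B \<times> {w. (\<forall>u\<in>U. renewal_count w u = c u) \<and> renewal_count w t - renewal_count w s = j}"
      by (auto simp: X N_def)
    moreover have "{w. (\<forall>u\<in>U. renewal_count w u = c u) \<and> renewal_count w t - renewal_count w s = j} \<in> sets W"
    proof -
      have "{w \<in> space W. (\<forall>u\<in>U. renewal_count w u = c u) \<and> renewal_count w t - renewal_count w s = j} \<in> sets W"
        using X(3) by measurable
      then show ?thesis by simp
    qed
    ultimately show ?thesis
      using emeasure_counts_increment_diff[OF X(3,4) st, of c j] cyl[OF X(2)] event_counts[OF X(3), of c]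
      by (simp add: X(1) mult.assoc)
  qed
  have UNIV_cyl: "UNIV \<in> cylinders s" for s
    unfolding cylinders_def by (rule CollectI, rule exI[of _ UNIV], rule exI[of _ "{}"]) auto
  have one: "emeasure P UNIV = 1" using P.P.emeasure_space_1 spP by (simp add: P_def)
  have inc: "emeasure P {\<omega>. N t \<omega> - N s \<omega> = j} = ennreal ((\<gamma> * (t - s)) ^ j / fact j * exp (- (\<gamma> * (t - s))))"
    if "0 \<le> s" "s < t" for s t j
    using prod[OF UNIV_cyl that, of j] one by simp
  have PP: "prob_space P" unfolding P_def by (rule P.P.prob_space_axioms)
  then interpret PP: prob_space P .
  have N_F: "N t \<in> F t \<rightarrow>\<^sub>M count_space UNIV" for t
    unfolding measurable_count_space_eq2_countable
  proof (intro conjI ballI)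
    fix j :: nat
    have "N t -` {j} \<inter> space (F t) = UNIV \<times> {w. \<forall>u\<in>{t}. renewal_count w u = (\<lambda>_. j) u}" by (auto simp: N_def F)
    also have "\<dots> \<in> cylinders t"
      unfolding cylinders_def by (intro CollectI exI[of _ UNIV] exI[of _ "{t}"] exI[of _ "\<lambda>_. j"]) auto
    finally show "N t -` {j} \<inter> space (F t) \<in> sets (F t)" unfolding F by (rule sigma_sets.Basic)
  qed auto
  have fst_F: "fst \<in> F 0 \<rightarrow>\<^sub>M borel"
  proof (rule measurableI)
    fix B :: "'v set" assume B: "B \<in> sets borel"
    have "fst -` B \<inter> space (F 0) = B \<times> {w. \<forall>u\<in>{}. renewal_count w u = (\<lambda>_. 0) u}" by (auto simp: F)
    also have "\<dots> \<in> cylinders 0"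
      unfolding cylinders_def using B by (intro CollectI exI[of _ B] exI[of _ "{}"] exI[of _ "\<lambda>_. 0"]) auto
    finally show "fst -` B \<inter> space (F 0) \<in> sets (F 0)" unfolding F by (rule sigma_sets.Basic)
  qed simp
  have Int_cyl: "Int_stable (cylinders t :: ('v \<times> (nat \<Rightarrow> real)) set set)" for t
  proof (rule Int_stableI)
    fix X X' :: "('v \<times> (nat \<Rightarrow> real)) set" assume "X \<in> cylinders t" "X' \<in> cylinders t"
    then obtain B U c B' U' c' where X: "X = B \<times> {w. \<forall>u\<in>U. renewal_count w u = c u}" "B \<in> sets borel" "finite U" "U \<subseteq> {..t}"
      and X': "X' = B' \<times> {w. \<forall>u\<in>U'. renewal_count w u = c' u}" "B' \<in> sets borel" "finite U'" "U' \<subseteq> {..t}"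
      unfolding cylinders_def by blast
    \<comment> \<open>Contradictory prescriptions at a common time make the intersection empty; an
      empty base encodes this.\<close>
    define B'' where "B'' = (if \<forall>u\<in>U \<inter> U'. c u = c' u then B \<inter> B' else {})"
    have "X \<inter> X' = B'' \<times> {w. \<forall>u\<in>U \<union> U'. renewal_count w u = (if u \<in> U then c u else c' u)}"
      unfolding X X' B''_def by (auto; metis)
    moreover have "B'' \<in> sets borel" using X X' by (simp add: B''_def)
    ultimately show "X \<inter> X' \<in> cylinders t"
      unfolding cylinders_def using X X'
      by (intro CollectI exI[of _ B''] exI[of _ "U \<union> U'"] exI[of _ "\<lambda>u. if u \<in> U then c u else c' u"]) auto
  qed
  have indep: "PP.indep_set (sets (F s)) {(\<lambda>\<omega>. N t \<omega> - N s \<omega>) -` B \<inter> space P |B. True}" if st: "0 \<le> s" "s < t" for s t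
  proof -
    \<comment> \<open>Distinct level sets are disjoint, so the empty set is added for stability
      under intersection.\<close>
    define C where "C = insert {} (range (\<lambda>j. {\<omega>. N t \<omega> - N s \<omega> = j}))"
    have "PP.indep_set (cylinders s) C"
    proof (rule PP.indep_setI)
      show "cylinders s \<subseteq> PP.events" by (rule cyl_P)
      show "C \<subseteq> PP.events" using inc_event by (auto simp: C_def)
      fix X b :: "('v \<times> (nat \<Rightarrow> real)) set" assume X: "X \<in> cylinders s" and b: "b \<in> C"
      show "PP.prob (X \<inter> b) = PP.prob X * PP.prob b"
      proof (cases "b = {}")
        case False
        then obtain j where "b = {\<omega>. N t \<omega> - N s \<omega> = j}" using b by (auto simp: C_def)
        then have "emeasure P (X \<inter> b) = emeasure P X * emeasure P b" using prod[OF X st, of j] inc[OF st, of j] by simp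
        then show ?thesis by (simp add: PP.emeasure_eq_measure ennreal_mult'[symmetric])
      qed simp
    qed
    moreover have "Int_stable C"
      unfolding C_def by (rule Int_stableI) auto
    ultimately have "PP.indep_set (sigma_sets (space P) (cylinders s)) (sigma_sets (space P) C)"
      using Int_cyl by (intro PP.indep_set_sigma_sets)
    then have ind: "PP.indep_set (sets (F s)) (sigma_sets UNIV C)" by (simp add: F spP)
    have sub: "{(\<lambda>\<omega>. N t \<omega> - N s \<omega>) -` B \<inter> space P |B. True} \<subseteq> sigma_sets UNIV C"
    proof
      fix X assume "X \<in> {(\<lambda>\<omega>. N t \<omega> - N s \<omega>) -` B \<inter> space P |B. True}"
      then obtain B where X: "X = (\<lambda>\<omega>. N t \<omega> - N s \<omega>) -` B" by (auto simp: spP)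
      have "X = (\<Union>j. if j \<in> B then {\<omega>. N t \<omega> - N s \<omega> = j} else {})" by (auto simp: X)
      also have "\<dots> \<in> sigma_sets UNIV C" by (intro sigma_sets.Union) (auto simp: C_def intro!: sigma_sets.Basic sigma_sets.Empty)
      finally show "X \<in> sigma_sets UNIV C" .
    qed
    show ?thesis
      using ind unfolding PP.indep_set_def
      by (rule PP.indep_sets_mono_sets) (use sub in \<open>auto split: bool.split\<close>)
  qed
  have dist: "distr P (count_space UNIV) (\<lambda>\<omega>. N t \<omega> - N s \<omega>) = measure_pmf (poisson_pmf (\<gamma> * (t - s)))"
    if st: "0 \<le> s" "s < t" for s t
  proof (rule measure_eqI_countable[where A=UNIV])
    have [measurable]: "N t \<in> P \<rightarrow>\<^sub>M count_space UNIV" "N s \<in> P \<rightarrow>\<^sub>M count_space UNIV" by (rule N_P)+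
    fix j :: nat
    have "emeasure (distr P (count_space UNIV) (\<lambda>\<omega>. N t \<omega> - N s \<omega>)) {j} = emeasure P {\<omega>. N t \<omega> - N s \<omega> = j}"
      by (subst emeasure_distr) (auto simp: spP vimage_def)
    also have "\<dots> = emeasure (measure_pmf (poisson_pmf (\<gamma> * (t - s)))) {j}"
      using inc[OF st, of j] st \<gamma> by (simp add: emeasure_pmf_single)
    finally show "emeasure (distr P (count_space UNIV) (\<lambda>\<omega>. N t \<omega> - N s \<omega>)) {j} = emeasure (measure_pmf (poisson_pmf (\<gamma> * (t - s)))) {j}" .
  qed auto
  have filt: "filtration (space P) F"
  proof
    show "space (F t) = space P" for t by (simp add: F spP)
    show "sets (F s) \<subseteq> sets (F t)" if "s \<le> t" for s t
      unfolding F by (rule sigma_sets_mono') (use that in \<open>auto simp: cylinders_def; fastforce\<close>)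
  qed
  have "poisson_process \<gamma> P F N"
    unfolding poisson_process_def
    using N_F indep dist cadlag_renewal_count renewal_count_0 renewal_count_mono
    by (auto simp: N_def[abs_def] mono_on_def)
  then have "poisson_driver P F \<gamma> N"
    using PP filt F_P \<gamma> by (auto simp: poisson_driver_def poisson_driver_axioms_def)
  moreover have "distr P borel fst = \<nu>"
  proof -
    have "distr P borel fst = distr P \<nu> fst" by (rule distr_cong) (auto simp: nu(2))
    also have "\<dots> = \<nu>" unfolding P_def by (rule W.distr_pair_fst)
    finally show ?thesis .
  qed
  ultimately show ?thesis using fst_F by blast
qed

end

lemma weak_solution_canonical:
  fixes \<nu> :: "'v::euclidean_space measure"
  assumes "0 < \<gamma>" "prob_space \<nu>" "sets \<nu> = sets borel"
  shows "\<exists>(P :: 'v canonical measure) F N Y. weak_solution \<gamma> g P F N Y \<and> distr P borel (Y 0) = \<nu>"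
proof -
  interpret exponential_waiting \<gamma> by unfold_locales fact
  obtain P F N where P: "poisson_driver (P :: ('v \<times> (nat \<Rightarrow> real)) measure) F \<gamma> N" "fst \<in> F 0 \<rightarrow>\<^sub>M borel" "distr P borel fst = \<nu>"
    using poisson_driver_exists[OF assms(2,3)] by blast
  obtain Y where Y: "weak_solution \<gamma> g P F N Y" "\<forall>\<omega>\<in>space P. Y 0 \<omega> = fst \<omega>"
    using poisson_driver.weak_solution_exists[OF P(1,2)] by blast
  have "distr P borel (Y 0) = distr P borel fst" by (rule distr_cong) (use Y in auto)
  then show ?thesis using Y P(3) by blast
qed

text \<open>Started from \<open>\<nu>\<close>, a solution has law \<open>\<nu>\<close> at every
  time, so the error \<open>exp (- (\<gamma> * t))\<close> of \<open>prob_ray_approx\<close> can be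
  sent to \<open>0\<close>. This is where a solution with arbitrary initial law must exist.\<close>

lemma invariant_distribution_unique:
  fixes g :: "'v::euclidean_space" and \<nu> :: "'v measure"
  assumes \<gamma>: "0 < \<gamma>" and g: "g \<noteq> 0" and inv: "invariant_distribution TYPE('v canonical) \<gamma> g \<nu>"
  shows "\<nu> = exp_ray \<gamma> g"
proof (rule measure_eq_rayI[OF g])
  show nu: "prob_space \<nu>" "sets \<nu> = sets borel" using inv by (auto simp: invariant_distribution_def)
  obtain P :: "'v canonical measure" and F N Y where
    W: "weak_solution \<gamma> g P F N Y" "distr P borel (Y 0) = \<nu>"
    using weak_solution_canonical[OF \<gamma> nu] by blast
  interpret reset_solution \<gamma> g P F N Y by unfold_locales (use W \<gamma> g in auto)
  fix c :: real assume c: "0 \<le> c"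
  have "\<bar>measure \<nu> (ray g c) - exp (- (\<gamma> * c))\<bar> \<le> exp (- (\<gamma> * t))" if t: "c \<le> t" for t
  proof -
    have "distr P borel (Y t) = \<nu>" using inv W t c unfolding invariant_distribution_def by auto
    then have "measure \<nu> (ray g c) = prob {\<omega> \<in> space P. Y t \<omega> \<in> ray g c}"
      using measure_distr[OF Y_measurable, of t "ray g c"] t c by (auto simp: vimage_def Int_def conj_commute)
    then show ?thesis using prob_ray_approx[OF c t] by simp
  qed
  then have "\<forall>\<^sub>F t in at_top. \<bar>measure \<nu> (ray g c) - exp (- (\<gamma> * c))\<bar> \<le> exp (- (\<gamma> * t))"
    using eventually_ge_at_top[of c] by (rule eventually_mono[rotated])
  moreover have "((\<lambda>t. exp (- (\<gamma> * t))) \<longlongrightarrow> 0) at_top"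
  proof -
    have "filterlim (\<lambda>t. \<gamma> * t) at_top at_top" using \<gamma> by (intro filterlim_tendsto_pos_mult_at_top[OF tendsto_const]) (auto simp: filterlim_ident)
    then have "filterlim (\<lambda>t. - (\<gamma> * t)) at_bot at_top" by (simp add: filterlim_uminus_at_bot)
    then show ?thesis by (rule filterlim_compose[OF exp_at_bot])
  qed
  ultimately have "\<bar>measure \<nu> (ray g c) - exp (- (\<gamma> * c))\<bar> \<le> 0"
    by (intro tendsto_lowerbound[of _ _ at_top]) auto
  then show "measure \<nu> (ray g c) = measure (exp_ray \<gamma> g) (ray g c)" using exp_ray(3)[OF g \<gamma> c] by simp
qed (use exp_ray[OF g \<gamma>] in auto)

section \<open>The iterates: independence, moments and the distance to the minimiser\<close>

lemma integrable_inner_of_squares: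
  fixes X Y :: "'a \<Rightarrow> 'v::euclidean_space"
  assumes "integrable M (\<lambda>\<omega>. (norm (X \<omega>))\<^sup>2)" "integrable M (\<lambda>\<omega>. (norm (Y \<omega>))\<^sup>2)"
    and [measurable]: "X \<in> borel_measurable M" "Y \<in> borel_measurable M"
  shows "integrable M (\<lambda>\<omega>. X \<omega> \<bullet> Y \<omega>)"
proof (rule Bochner_Integration.integrable_bound[OF Bochner_Integration.integrable_add[OF assms(1,2)]])
  show "AE \<omega> in M. norm (X \<omega> \<bullet> Y \<omega>) \<le> norm ((norm (X \<omega>))\<^sup>2 + (norm (Y \<omega>))\<^sup>2)"
  proof (rule AE_I2)
    fix \<omega>
    have nn: "0 \<le> norm (X \<omega>) * norm (Y \<omega>)" by simp
    have "\<bar>X \<omega> \<bullet> Y \<omega>\<bar> \<le> norm (X \<omega>) * norm (Y \<omega>)" by (rule Cauchy_Schwarz_ineq2)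
    also have "\<dots> \<le> (norm (X \<omega>))\<^sup>2 + (norm (Y \<omega>))\<^sup>2"
      using sum_squares_bound[of "norm (X \<omega>)" "norm (Y \<omega>)"] nn by linarith
    finally show "norm (X \<omega> \<bullet> Y \<omega>) \<le> norm ((norm (X \<omega>))\<^sup>2 + (norm (Y \<omega>))\<^sup>2)" by simp
  qed
qed simp

lemma integrable_square_add:
  fixes X Y :: "'a \<Rightarrow> 'v::euclidean_space"
  assumes "integrable M (\<lambda>\<omega>. (norm (X \<omega>))\<^sup>2)" "integrable M (\<lambda>\<omega>. (norm (Y \<omega>))\<^sup>2)"
    and "X \<in> borel_measurable M" "Y \<in> borel_measurable M"
  shows "integrable M (\<lambda>\<omega>. (norm (X \<omega> + Y \<omega>))\<^sup>2)"
  using integrable_inner_of_squares[OF assms] assms(1,2)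
  by (simp add: power2_norm_eq_inner inner_add_left inner_add_right inner_commute)

lemma integrable_square_bound:
  fixes X :: "'a \<Rightarrow> 'v::euclidean_space" and Y :: "'a \<Rightarrow> 'w::euclidean_space"
  assumes "integrable M (\<lambda>\<omega>. (norm (Y \<omega>))\<^sup>2)" "X \<in> borel_measurable M" "\<And>\<omega>. norm (X \<omega>) \<le> c * norm (Y \<omega>)"
  shows "integrable M (\<lambda>\<omega>. (norm (X \<omega>))\<^sup>2)"
proof (rule Bochner_Integration.integrable_bound[OF integrable_mult_right[OF assms(1), of "c\<^sup>2"]])
  show "AE \<omega> in M. norm ((norm (X \<omega>))\<^sup>2) \<le> norm (c\<^sup>2 * (norm (Y \<omega>))\<^sup>2)"
    using power_mono[OF assms(3) norm_ge_zero, of _ 2] by (auto simp: power_mult_distrib)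
qed (use assms(2) in measurable)

text \<open>Of the constrained problem only its algebra is kept: \<open>PA_orth\<close> is
  self-adjointness given idempotence, \<open>PA_xstar\<close> is feasibility, and
  \<open>PA_g\<close> is the Lagrange condition at the minimiser.\<close>

locale lpsa = M: prob_space M + D: prob_space D for M :: "'a measure" and D :: "'z measure" +
  fixes PA :: "'v::euclidean_space \<Rightarrow> 'v" and gradf :: "'v \<Rightarrow> 'v" and G :: "'v \<Rightarrow> 'z \<Rightarrow> 'v"
    and \<zeta> :: "nat \<Rightarrow> 'a \<Rightarrow> 'z" and coin :: "nat \<Rightarrow> 'a \<Rightarrow> bool" and x :: "nat \<Rightarrow> 'a \<Rightarrow> 'v"
    and x1 xstar :: 'v and \<eta> p :: "nat \<Rightarrow> real" and L \<mu> \<sigma> :: real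
  assumes PA_linear: "linear PA" and PA_idem: "PA (PA y) = PA y" and PA_orth: "PA y \<bullet> z = PA y \<bullet> PA z"
    and PA_xstar: "PA xstar = 0" and PA_g: "PA (gradf xstar) = gradf xstar"
    and G_meas: "(\<lambda>(y, z). G y z) \<in> borel \<Otimes>\<^sub>M D \<rightarrow>\<^sub>M borel"
    and G_int: "integrable D (G y)" and G_mean: "(\<integral>z. G y z \<partial>D) = gradf y"
    and lip: "norm (gradf y - gradf z) \<le> L * norm (y - z)"
    and strong: "(gradf y - gradf z) \<bullet> (y - z) \<ge> \<mu> * (norm (y - z))\<^sup>2" and \<mu>: "0 < \<mu>" and L: "0 \<le> L"
    and \<eta>_pos: "0 < \<eta> n" and p: "0 < p n" "p n \<le> 1"
    and \<zeta>_meas: "n \<ge> 1 \<Longrightarrow> \<zeta> n \<in> M \<rightarrow>\<^sub>M D" and \<zeta>_distr: "n \<ge> 1 \<Longrightarrow> distr M D (\<zeta> n) = D"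
    and coin_meas: "n \<ge> 1 \<Longrightarrow> coin n \<in> M \<rightarrow>\<^sub>M count_space UNIV"
    and coin_prob: "n \<ge> 1 \<Longrightarrow> M.prob {\<omega> \<in> space M. coin n \<omega>} = p n"
    and indep: "M.indep_sets
           (case_sum (\<lambda>n. {\<zeta> n -` B \<inter> space M | B. B \<in> sets D})
                     (\<lambda>n. {coin n -` B \<inter> space M | B. True})) ({1..} <+> {1..})"
    and x_1: "x 1 \<omega> = x1"
    and x_Suc: "n \<ge> 1 \<Longrightarrow> x (Suc n) \<omega> = (let h = x n \<omega> - \<eta> n *\<^sub>R G (x n \<omega>) (\<zeta> n \<omega>) in if coin n \<omega> then h - PA h else h)"
    and \<sigma>: "0 \<le> \<sigma>"
    and noise: "n \<ge> 1 \<Longrightarrow> (\<integral>\<^sup>+\<omega>. ennreal ((norm (gradf (x n \<omega>) - G (x n \<omega>) (\<zeta> n \<omega>)))\<^sup>2) \<partial>M) \<le> ennreal \<sigma>"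
begin

interpretation PA: linear PA by (rule PA_linear)

definition gen :: "nat + nat \<Rightarrow> 'a set set" where
  "gen = case_sum (\<lambda>n. {\<zeta> n -` B \<inter> space M | B. B \<in> sets D}) (\<lambda>n. {coin n -` B \<inter> space M | B. True})"

definition sub_algebra :: "(nat + nat) set \<Rightarrow> 'a measure" where
  "sub_algebra I = sigma (space M) (\<Union>i\<in>I. gen i)"

text \<open>The inputs that determine \<open>x n\<close>; the sigma-algebra they generate is the
  filtration F_n of the setting.\<close>

definition past :: "nat \<Rightarrow> (nat + nat) set" where
  "past n = {1..<n} <+> {1..<n}"

definition xi :: "nat \<Rightarrow> 'a \<Rightarrow> 'v" where
  "xi n \<omega> = gradf (x n \<omega>) - G (x n \<omega>) (\<zeta> n \<omega>)"

lemma gen_events: "i \<in> {1..} <+> {1..} \<Longrightarrow> gen i \<subseteq> M.events"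
  using indep unfolding gen_def M.indep_sets_def by blast

lemma gen_space: "gen i \<subseteq> Pow (space M)"
  by (cases i) (auto simp: gen_def)

lemma sub_algebra:
  "space (sub_algebra I) = space M" "sets (sub_algebra I) = sigma_sets (space M) (\<Union>i\<in>I. gen i)"
proof -
  have "(\<Union>i\<in>I. gen i) \<subseteq> Pow (space M)" using gen_space by blast
  then show "space (sub_algebra I) = space M" "sets (sub_algebra I) = sigma_sets (space M) (\<Union>i\<in>I. gen i)"
    by (auto simp: sub_algebra_def space_measure_of sets_measure_of)
qed

lemma sub_algebra_mono: "I \<subseteq> J \<Longrightarrow> sets (sub_algebra I) \<subseteq> sets (sub_algebra J)"
  unfolding sub_algebra by (rule sigma_sets_mono') auto

lemma sub_algebra_events: "I \<subseteq> {1..} <+> {1..} \<Longrightarrow> sets (sub_algebra I) \<subseteq> M.events"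
  unfolding sub_algebra by (rule sets.sigma_sets_subset) (use gen_events in blast)

lemma measurable_sub_algebra_mono: "h \<in> sub_algebra I \<rightarrow>\<^sub>M X \<Longrightarrow> I \<subseteq> J \<Longrightarrow> h \<in> sub_algebra J \<rightarrow>\<^sub>M X"
  by (rule measurable_from_subalg[of "sub_algebra J" "sub_algebra I"])
    (auto simp: subalgebra_def sub_algebra(1) sub_algebra_mono[THEN subsetD])

lemma measurable_sub_algebra: "h \<in> sub_algebra I \<rightarrow>\<^sub>M X \<Longrightarrow> I \<subseteq> {1..} <+> {1..} \<Longrightarrow> h \<in> M \<rightarrow>\<^sub>M X"
  by (rule measurable_from_subalg[of M "sub_algebra I"])
    (auto simp: subalgebra_def sub_algebra(1) sub_algebra_events[THEN subsetD])

lemma past_subset: "past n \<subseteq> {1..} <+> {1..}"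
  by (auto simp: past_def)

lemma past_mono: "m \<le> n \<Longrightarrow> past m \<subseteq> past n"
  by (auto simp: past_def)

lemma \<zeta>_sub_algebra: "Inl n \<in> I \<Longrightarrow> n \<ge> 1 \<Longrightarrow> \<zeta> n \<in> sub_algebra I \<rightarrow>\<^sub>M D"
proof (rule measurableI)
  assume n: "Inl n \<in> I" "n \<ge> 1"
  show "\<zeta> n \<omega> \<in> space D" if "\<omega> \<in> space (sub_algebra I)" for \<omega>
    using measurable_space[OF \<zeta>_meas[OF n(2)]] that by (simp add: sub_algebra)
  fix B assume "B \<in> sets D"
  then have "\<zeta> n -` B \<inter> space M \<in> gen (Inl n)" by (auto simp: gen_def)
  then show "\<zeta> n -` B \<inter> space (sub_algebra I) \<in> sets (sub_algebra I)"
    unfolding sub_algebra using n by (intro sigma_sets.Basic) auto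
qed

lemma coin_sub_algebra: "Inr n \<in> I \<Longrightarrow> coin n \<in> sub_algebra I \<rightarrow>\<^sub>M count_space UNIV"
proof (rule measurableI)
  assume n: "Inr n \<in> I"
  fix B
  have "coin n -` B \<inter> space M \<in> gen (Inr n)" by (auto simp: gen_def)
  then show "coin n -` B \<inter> space (sub_algebra I) \<in> sets (sub_algebra I)"
    unfolding sub_algebra using n by (intro sigma_sets.Basic) auto
qed simp

lemma gradf_continuous: "continuous_on UNIV gradf"
proof (rule lipschitz_on_continuous_on)
  show "L-lipschitz_on UNIV gradf" using lip L by (auto simp: lipschitz_on_def dist_norm)
qed

lemma gradf_measurable [measurable]: "gradf \<in> borel_measurable borel"
  by (rule borel_measurable_continuous_onI[OF gradf_continuous])

lemma PA_measurable [measurable]: "PA \<in> borel_measurable borel"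
  by (rule borel_measurable_continuous_onI[OF linear_continuous_on[OF PA_linear[THEN linear_conv_bounded_linear[THEN iffD1]]]])

lemma x_past: "n \<ge> 1 \<Longrightarrow> x n \<in> sub_algebra (past n) \<rightarrow>\<^sub>M borel"
proof (induction n rule: nat_induct_at_least)
  case base
  have "x 1 = (\<lambda>_. x1)" using x_1 by auto
  then show ?case by simp
next
  case (Suc n)
  have x: "x n \<in> sub_algebra (past (Suc n)) \<rightarrow>\<^sub>M borel"
    by (rule measurable_sub_algebra_mono[OF Suc.IH past_mono]) simp
  have z: "\<zeta> n \<in> sub_algebra (past (Suc n)) \<rightarrow>\<^sub>M D"
    using Suc.hyps by (intro \<zeta>_sub_algebra) (auto simp: past_def)
  have c: "coin n \<in> sub_algebra (past (Suc n)) \<rightarrow>\<^sub>M count_space UNIV"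
    using Suc.hyps by (intro coin_sub_algebra) (auto simp: past_def)
  have Gm: "(\<lambda>\<omega>. G (x n \<omega>) (\<zeta> n \<omega>)) \<in> sub_algebra (past (Suc n)) \<rightarrow>\<^sub>M borel"
    using measurable_compose[OF measurable_Pair[OF x z] G_meas] by simp
  note [measurable] = x c Gm
  have "x (Suc n) = (\<lambda>\<omega>. let h = x n \<omega> - \<eta> n *\<^sub>R G (x n \<omega>) (\<zeta> n \<omega>) in if coin n \<omega> then h - PA h else h)"
    using x_Suc[OF Suc.hyps] by auto
  moreover have "\<dots> \<in> sub_algebra (past (Suc n)) \<rightarrow>\<^sub>M borel" unfolding Let_def by measurable
  ultimately show ?case by simp
qed

lemma x_measurable: "n \<ge> 1 \<Longrightarrow> x n \<in> borel_measurable M"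
  by (rule measurable_sub_algebra[OF x_past past_subset])

lemma xi_sub_algebra: "n \<ge> 1 \<Longrightarrow> past n \<subseteq> I \<Longrightarrow> Inl n \<in> I \<Longrightarrow> xi n \<in> sub_algebra I \<rightarrow>\<^sub>M borel"
proof -
  assume n: "n \<ge> 1" "past n \<subseteq> I" "Inl n \<in> I"
  note x = measurable_sub_algebra_mono[OF x_past[OF n(1)] n(2)] and z = \<zeta>_sub_algebra[OF n(3,1)]
  have "(\<lambda>\<omega>. G (x n \<omega>) (\<zeta> n \<omega>)) \<in> sub_algebra I \<rightarrow>\<^sub>M borel"
    using measurable_compose[OF measurable_Pair[OF x z] G_meas] by simp
  with x show ?thesis unfolding xi_def by measurable
qed

lemma xi_measurable: "n \<ge> 1 \<Longrightarrow> xi n \<in> borel_measurable M"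
  by (rule measurable_sub_algebra[OF xi_sub_algebra[of n "past (Suc n)"]]) (auto simp: past_def)

lemma xi_square_integrable: "n \<ge> 1 \<Longrightarrow> integrable M (\<lambda>\<omega>. (norm (xi n \<omega>))\<^sup>2)"
  and xi_square: "n \<ge> 1 \<Longrightarrow> (\<integral>\<omega>. (norm (xi n \<omega>))\<^sup>2 \<partial>M) \<le> \<sigma>"
proof -
  assume n: "n \<ge> 1"
  have le: "(\<integral>\<^sup>+\<omega>. ennreal ((norm (xi n \<omega>))\<^sup>2) \<partial>M) \<le> ennreal \<sigma>" using noise[OF n] by (simp add: xi_def)
  show I: "integrable M (\<lambda>\<omega>. (norm (xi n \<omega>))\<^sup>2)"
    using le xi_measurable[OF n] by (intro integrableI_bounded) (auto simp: less_top[symmetric] top_unique)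
  have "ennreal (\<integral>\<omega>. (norm (xi n \<omega>))\<^sup>2 \<partial>M) \<le> ennreal \<sigma>"
    using nn_integral_eq_integral[OF I] le by simp
  then show "(\<integral>\<omega>. (norm (xi n \<omega>))\<^sup>2 \<partial>M) \<le> \<sigma>" using \<sigma> by (simp add: ennreal_le_iff)
qed

text \<open>Disjoint blocks of independent families that are stable under intersection generate
  independent sigma-algebras.\<close>

lemma indep_sub_algebras:
  assumes "I \<subseteq> {1..} <+> {1..}" "J \<subseteq> {1..} <+> {1..}" "I \<inter> J = {}"
  shows "M.indep_set (sets (sub_algebra I)) (sets (sub_algebra J))"
proof -
  have "M.indep_sets gen ({1..} <+> {1..})" using indep by (simp only: gen_def)
  moreover have "(\<Union>b\<in>UNIV. case_bool I J b) = I \<union> J" by (simp add: UNIV_bool Un_commute)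
  then have "(\<Union>b\<in>UNIV. case_bool I J b) \<subseteq> {1..} <+> {1..}" using assms by blast
  ultimately have "M.indep_sets gen (\<Union>b\<in>UNIV. case_bool I J b)" by (metis M.indep_sets_mono_index)
  moreover have "Int_stable (gen i)" for i
  proof (rule Int_stableI)
    fix a b assume ab: "a \<in> gen i" "b \<in> gen i"
    show "a \<inter> b \<in> gen i"
    proof (cases i)
      case (Inl n)
      then obtain A B where "a = \<zeta> n -` A \<inter> space M" "A \<in> sets D" "b = \<zeta> n -` B \<inter> space M" "B \<in> sets D"
        using ab by (auto simp: gen_def)
      then have "a \<inter> b = \<zeta> n -` (A \<inter> B) \<inter> space M" "A \<inter> B \<in> sets D" by auto
      then show ?thesis unfolding Inl gen_def sum.case by blast
    next
      case (Inr n)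
      then obtain A B where "a = coin n -` A \<inter> space M" "b = coin n -` B \<inter> space M"
        using ab by (auto simp: gen_def)
      then have "a \<inter> b = coin n -` (A \<inter> B) \<inter> space M" by auto
      then show ?thesis unfolding Inr gen_def sum.case by blast
    qed
  qed
  ultimately have "M.indep_sets (\<lambda>b. sigma_sets (space M) (\<Union>i\<in>case_bool I J b. gen i)) UNIV"
  proof (intro M.indep_sets_collect_sigma)
    show "disjoint_family_on (case_bool I J) UNIV"
      unfolding disjoint_family_on_def
    proof (intro ballI impI)
      fix a b :: bool assume "a \<noteq> b"
      then show "case_bool I J a \<inter> case_bool I J b = {}" using assms(3) by (cases a; cases b) auto
    qed
  qed
  then show ?thesis
    unfolding M.indep_set_def sub_algebra
    by (rule M.indep_sets_mono_sets) (auto split: bool.splits)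
qed

lemma indep_var_sub_algebras:
  assumes IJ: "I \<subseteq> {1..} <+> {1..}" "J \<subseteq> {1..} <+> {1..}" "I \<inter> J = {}"
    and X: "X \<in> sub_algebra I \<rightarrow>\<^sub>M S" and Y: "Y \<in> sub_algebra J \<rightarrow>\<^sub>M T"
  shows "M.indep_var S X T Y"
proof -
  have sub: "sigma_sets (space M) {Z -` A \<inter> space M |A. A \<in> sets R} \<subseteq> sets (sub_algebra K)"
    if "Z \<in> sub_algebra K \<rightarrow>\<^sub>M R" for Z R K
  proof -
    have "{Z -` A \<inter> space M |A. A \<in> sets R} \<subseteq> sets (sub_algebra K)"
      using measurable_sets[OF that] by (auto simp: sub_algebra(1))
    from sets.sigma_sets_subset[OF this] show ?thesis by (simp add: sub_algebra(1))
  qed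
  have "M.indep_set (sigma_sets (space M) {X -` A \<inter> space M |A. A \<in> sets S}) (sigma_sets (space M) {Y -` A \<inter> space M |A. A \<in> sets T})"
    using indep_sub_algebras[OF IJ] unfolding M.indep_set_def
    by (rule M.indep_sets_mono_sets) (use sub[OF X] sub[OF Y] in \<open>auto split: bool.split\<close>)
  then show ?thesis
    unfolding M.indep_var_eq using measurable_sub_algebra[OF X IJ(1)] measurable_sub_algebra[OF Y IJ(2)] by auto
qed

text \<open>The martingale property without conditional expectations: the past and
  \<open>\<zeta> n\<close> are independent, so Fubini integrates over \<open>\<zeta> n\<close> first
  with the past frozen, and \<open>G_mean\<close> makes the inner integral vanish.\<close>

lemma xi_orthogonal:
  assumes n: "n \<ge> 1" and \<Phi>: "\<Phi> \<in> sub_algebra (past n) \<rightarrow>\<^sub>M borel"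
    and sq: "integrable M (\<lambda>\<omega>. (norm (\<Phi> \<omega>))\<^sup>2)"
  shows "(\<integral>\<omega>. \<Phi> \<omega> \<bullet> xi n \<omega> \<partial>M) = 0"
proof -
  let ?F = "sub_algebra (past n)"
  have IJ: "past n \<subseteq> {1..} <+> {1..}" "{Inl n} \<subseteq> {1..} <+> {1..}" "past n \<inter> {Inl n} = {}"
    using n by (auto simp: past_def)
  have id: "(\<lambda>\<omega>. \<omega>) \<in> ?F \<rightarrow>\<^sub>M ?F" by simp
  have z: "\<zeta> n \<in> sub_algebra {Inl n} \<rightarrow>\<^sub>M D" using n by (intro \<zeta>_sub_algebra) auto
  \<comment> \<open>The identity, viewed as a random variable with values in the space of the past,
    allows every past-measurable function to be frozen at once.\<close>
  let ?Q = "distr M ?F (\<lambda>\<omega>. \<omega>)"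
  have idM: "(\<lambda>\<omega>. \<omega>) \<in> M \<rightarrow>\<^sub>M ?F" by (rule measurable_sub_algebra[OF id IJ(1)])
  interpret Q: prob_space ?Q by (rule M.prob_space_distr[OF idM])
  interpret QD: pair_prob_space ?Q D ..
  have joint: "?Q \<Otimes>\<^sub>M D = distr M (?F \<Otimes>\<^sub>M D) (\<lambda>\<omega>. (\<omega>, \<zeta> n \<omega>))"
  proof (rule pair_measure_eqI)
    have m: "(\<lambda>\<omega>. (\<omega>, \<zeta> n \<omega>)) \<in> M \<rightarrow>\<^sub>M ?F \<Otimes>\<^sub>M D" using idM \<zeta>_meas[OF n] by measurable
    fix A B assume "A \<in> sets ?Q" and B: "B \<in> sets D"
    then have A: "A \<in> sets ?F" by simp
    have AM: "A \<in> M.events" using A sub_algebra_events[OF IJ(1)] by blast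
    have BM: "\<zeta> n -` B \<inter> space M \<in> M.events" by (rule measurable_sets[OF \<zeta>_meas[OF n] B])
    have Bz: "\<zeta> n -` B \<inter> space M \<in> sets (sub_algebra {Inl n})" using measurable_sets[OF z B] by (simp add: sub_algebra(1))
    have eq: "(\<lambda>\<omega>. (\<omega>, \<zeta> n \<omega>)) -` (A \<times> B) \<inter> space M = A \<inter> (\<zeta> n -` B \<inter> space M)" by auto
    have "emeasure ?Q A = emeasure M A"
      using sets.sets_into_space[OF AM] by (subst emeasure_distr[OF idM A]) (simp add: Int_absorb2)
    moreover have "emeasure D B = emeasure M (\<zeta> n -` B \<inter> space M)"
      by (subst \<zeta>_distr[OF n, symmetric]) (rule emeasure_distr[OF \<zeta>_meas[OF n] B])
    moreover have "emeasure (distr M (?F \<Otimes>\<^sub>M D) (\<lambda>\<omega>. (\<omega>, \<zeta> n \<omega>))) (A \<times> B) = emeasure M (A \<inter> (\<zeta> n -` B \<inter> space M))"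
      by (subst emeasure_distr[OF m pair_measureI[OF A B]]) (simp only: eq)
    moreover have "M.prob (A \<inter> (\<zeta> n -` B \<inter> space M)) = M.prob A * M.prob (\<zeta> n -` B \<inter> space M)"
      by (rule M.indep_setD[OF indep_sub_algebras[OF IJ] A Bz])
    ultimately show "emeasure ?Q A * emeasure D B = emeasure (distr M (?F \<Otimes>\<^sub>M D) (\<lambda>\<omega>. (\<omega>, \<zeta> n \<omega>))) (A \<times> B)"
      by (simp add: M.emeasure_eq_measure ennreal_mult)
  qed (use Q.sigma_finite_measure_axioms D.sigma_finite_measure_axioms in \<open>auto intro!: sets_pair_measure_cong\<close>)
  define H where "H = (\<lambda>(\<omega>, z). \<Phi> \<omega> \<bullet> (gradf (x n \<omega>) - G (x n \<omega>) z))"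
  have pair: "(\<lambda>\<omega>. (\<omega>, \<zeta> n \<omega>)) \<in> M \<rightarrow>\<^sub>M ?F \<Otimes>\<^sub>M D" using idM \<zeta>_meas[OF n] by measurable
  have H: "H \<in> borel_measurable (?F \<Otimes>\<^sub>M D)"
  proof -
    have [measurable]: "x n \<in> ?F \<rightarrow>\<^sub>M borel" "\<Phi> \<in> ?F \<rightarrow>\<^sub>M borel" using x_past[OF n] \<Phi> by auto
    have "(\<lambda>u. (x n (fst u), snd u)) \<in> ?F \<Otimes>\<^sub>M D \<rightarrow>\<^sub>M borel \<Otimes>\<^sub>M D" by measurable
    from measurable_compose[OF this G_meas]
    have [measurable]: "(\<lambda>u. G (x n (fst u)) (snd u)) \<in> ?F \<Otimes>\<^sub>M D \<rightarrow>\<^sub>M borel" by simp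
    show ?thesis unfolding H_def split_beta' by measurable
  qed
  have int: "integrable M (\<lambda>\<omega>. \<Phi> \<omega> \<bullet> xi n \<omega>)"
    by (rule integrable_inner_of_squares[OF sq xi_square_integrable[OF n] measurable_sub_algebra[OF \<Phi> past_subset] xi_measurable[OF n]])
  have intH: "integrable (?Q \<Otimes>\<^sub>M D) H"
    unfolding joint using int by (subst integrable_distr_eq[OF pair H]) (simp add: H_def xi_def)
  have "(\<integral>\<omega>. \<Phi> \<omega> \<bullet> xi n \<omega> \<partial>M) = (\<integral>u. H u \<partial>(?Q \<Otimes>\<^sub>M D))"
    unfolding joint by (subst integral_distr[OF pair H]) (simp add: H_def xi_def)
  also have "\<dots> = (\<integral>\<omega>. (\<integral>z. H (\<omega>, z) \<partial>D) \<partial>?Q)" by (rule QD.integral_fst'[OF intH, symmetric])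
  also have "\<dots> = (\<integral>\<omega>. 0 \<partial>?Q)"
    using G_int G_mean by (intro Bochner_Integration.integral_cong) (simp_all add: H_def D.prob_space)
  finally show ?thesis by simp
qed

text \<open>Meant for \<open>h\<close> the squared column-space component of the half step, which
  sees \<open>\<zeta> n\<close> but not the coin at \<open>n\<close>.\<close>

lemma coin_independent:
  assumes n: "n \<ge> 1" and h: "h \<in> sub_algebra (insert (Inl n) (past n)) \<rightarrow>\<^sub>M borel" and int: "integrable M (h :: 'a \<Rightarrow> real)"
  shows "integrable M (\<lambda>\<omega>. if coin n \<omega> then 0 else h \<omega>)"
    "(\<integral>\<omega>. (if coin n \<omega> then 0 else h \<omega>) \<partial>M) = (1 - p n) * (\<integral>\<omega>. h \<omega> \<partial>M)"
proof -
  let ?k = "\<lambda>\<omega>. if coin n \<omega> then 0 else 1 :: real"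
  have c: "coin n \<in> sub_algebra {Inr n} \<rightarrow>\<^sub>M count_space UNIV" by (rule coin_sub_algebra) simp
  have k: "?k \<in> sub_algebra {Inr n} \<rightarrow>\<^sub>M borel" using c by measurable
  have ind: "M.indep_var borel ?k borel h"
    by (rule indep_var_sub_algebras[of "{Inr n}" "insert (Inl n) (past n)"]) (use n k h in \<open>auto simp: past_def\<close>)
  have cM: "coin n \<in> M \<rightarrow>\<^sub>M count_space UNIV" by (rule coin_meas[OF n])
  have C: "{\<omega> \<in> space M. coin n \<omega>} \<in> M.events" using cM by measurable
  have ki: "integrable M ?k" using cM by (intro M.integrable_const_bound[of _ 1]) auto
  have "(\<integral>\<omega>. ?k \<omega> \<partial>M) = (\<integral>\<omega>. indicator (space M - {\<omega> \<in> space M. coin n \<omega>}) \<omega> \<partial>M)"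
    by (rule Bochner_Integration.integral_cong) auto
  also have "\<dots> = M.prob (space M - {\<omega> \<in> space M. coin n \<omega>})"
    by (subst Bochner_Integration.integral_indicator) (auto intro!: arg_cong[where f=M.prob])
  also have "\<dots> = 1 - p n" using M.prob_compl[OF C] coin_prob[OF n] by simp
  finally have kint: "(\<integral>\<omega>. ?k \<omega> \<partial>M) = 1 - p n" .
  have eq: "(\<lambda>\<omega>. if coin n \<omega> then 0 else h \<omega>) = (\<lambda>\<omega>. ?k \<omega> * h \<omega>)" by auto
  show "integrable M (\<lambda>\<omega>. if coin n \<omega> then 0 else h \<omega>)" unfolding eq by (rule M.indep_var_integrable[OF ind ki int])
  show "(\<integral>\<omega>. (if coin n \<omega> then 0 else h \<omega>) \<partial>M) = (1 - p n) * (\<integral>\<omega>. h \<omega> \<partial>M)"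
    unfolding eq M.indep_var_lebesgue_integral[OF ind ki int] kint ..
qed

end

section \<open>Mean square distance to the minimiser\<close>

context lpsa begin

interpretation PA: linear PA by (rule PA_linear)

lemma PA_diff: "PA (y - z) = PA y - PA z" and PA_add: "PA (y + z) = PA y + PA z" and PA_scaleR: "PA (c *\<^sub>R y) = c *\<^sub>R PA y"
  by (rule PA.diff PA.add PA.scaleR)+

lemma PA_self_adjoint: "y \<bullet> PA z = PA y \<bullet> z"
  using PA_orth[of z y] PA_orth[of y z] by (simp add: inner_commute)

lemma PA_pythagoras: "(norm (y - PA y))\<^sup>2 + (norm (PA y))\<^sup>2 = (norm y)\<^sup>2"
  using PA_orth[of y y] by (simp add: power2_norm_eq_inner inner_diff_left inner_diff_right inner_commute)

lemma norm_PA_le: "norm (PA y) \<le> norm y" and norm_PA_compl_le: "norm (y - PA y) \<le> norm y"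
proof -
  have "(norm (PA y))\<^sup>2 \<le> (norm y)\<^sup>2" "(norm (y - PA y))\<^sup>2 \<le> (norm y)\<^sup>2"
    using PA_pythagoras[of y] zero_le_power2[of "norm (PA y)"] zero_le_power2[of "norm (y - PA y)"] by linarith+
  then show "norm (PA y) \<le> norm y" "norm (y - PA y) \<le> norm y" by (simp_all add: power2_le_iff_abs_le)
qed

text \<open>The component orthogonal to the column space contracts at rate \<open>\<eta> \<mu>\<close>; what it loses to the
  other component is absorbed by the projections, because \<open>\<eta>\<close> is eventually much smaller than \<open>p\<close>.\<close>

lemma drift_inequality:
  fixes y :: 'v
  assumes e: "0 < e" "e * L\<^sup>2 \<le> \<mu> / 4" "4 * (e / r) * L\<^sup>2 \<le> \<mu> / 4" "2 * L\<^sup>2 * e / \<mu> \<le> r / 2" and r: "0 < r" "r \<le> 1"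
  defines "c \<equiv> y - xstar - e *\<^sub>R gradf y"
  shows "(norm (c - PA c))\<^sup>2 + (1 - r) * (norm (PA c))\<^sup>2
    \<le> (1 - \<mu> * e) * (norm (y - xstar))\<^sup>2 + 4 * (e\<^sup>2 / r) * (norm (gradf xstar))\<^sup>2"
proof -
  define d where "d = y - xstar"
  define u where "u = d - PA d"
  define v where "v = PA d"
  define n where "n = gradf y"
  define g where "g = gradf xstar"
  have n_g: "norm (n - g) \<le> L * norm d" using lip[of y xstar] by (simp add: n_def g_def d_def)
  have PAg: "PA g = g" using PA_g by (simp add: g_def)
  have PAu: "PA u = 0" by (simp add: u_def PA_diff PA_idem)
  have cQ: "c - PA c = u - e *\<^sub>R (n - PA n)" and cP: "PA c = v - e *\<^sub>R PA n"
    by (simp_all add: c_def u_def v_def n_def d_def PA_diff PA_add PA_scaleR algebra_simps)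
  have "norm (n - PA n) = norm ((n - g) - PA (n - g))" by (simp add: PA_diff PAg)
  then have Qn: "norm (n - PA n) \<le> L * norm d" using norm_PA_compl_le[of "n - g"] n_g by simp
  \<comment> \<open>\<open>u\<close> is orthogonal to the range of \<open>PA\<close>, which contains
    \<open>g\<close>, so \<open>g\<close> may be subtracted freely.\<close>
  have "u \<bullet> (n - PA n) = u \<bullet> (n - g)"
    using PA_self_adjoint[of u n] PA_self_adjoint[of u g] PAu PAg by (simp add: inner_diff_right)
  also have "\<dots> = (n - g) \<bullet> d - v \<bullet> (n - g)" by (simp add: u_def v_def inner_diff_left inner_diff_right inner_commute)
  finally have un: "u \<bullet> (n - PA n) = (n - g) \<bullet> d - v \<bullet> (n - g)" .
  have "\<mu> * (norm d)\<^sup>2 \<le> (n - g) \<bullet> d" using strong[of y xstar] by (simp add: n_def g_def d_def)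
  moreover have "v \<bullet> (n - g) \<le> norm v * (L * norm d)"
    using norm_cauchy_schwarz[of v "n - g"] n_g by (meson mult_left_mono norm_ge_zero order_trans)
  ultimately have un_ge: "\<mu> * (norm d)\<^sup>2 - norm v * (L * norm d) \<le> u \<bullet> (n - PA n)" using un by simp
  have amgm: "2 * (norm v * (L * norm d)) \<le> \<mu> / 2 * (norm d)\<^sup>2 + 2 * L\<^sup>2 / \<mu> * (norm v)\<^sup>2"
  proof -
    have "0 \<le> (\<mu> * norm d - 2 * L * norm v)\<^sup>2 / (2 * \<mu>)" using \<mu> by simp
    also have "\<dots> = \<mu> / 2 * (norm d)\<^sup>2 + 2 * L\<^sup>2 / \<mu> * (norm v)\<^sup>2 - 2 * (norm v * (L * norm d))"
      using \<mu> by (simp add: power2_eq_square field_simps)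
    finally show ?thesis by simp
  qed
  have "(norm (c - PA c))\<^sup>2 = (norm u)\<^sup>2 - 2 * e * (u \<bullet> (n - PA n)) + e\<^sup>2 * (norm (n - PA n))\<^sup>2"
    unfolding cQ power2_norm_eq_inner by (simp add: inner_diff_left inner_diff_right inner_commute power2_eq_square algebra_simps)
  also have "\<dots> \<le> (norm u)\<^sup>2 - 2 * e * (\<mu> * (norm d)\<^sup>2 - norm v * (L * norm d)) + e\<^sup>2 * (L * norm d)\<^sup>2"
    using un_ge e(1) Qn by (intro add_mono diff_left_mono mult_left_mono power_mono) auto
  also have "\<dots> \<le> (norm u)\<^sup>2 - 2 * e * \<mu> * (norm d)\<^sup>2 + e * (\<mu> / 2 * (norm d)\<^sup>2 + 2 * L\<^sup>2 / \<mu> * (norm v)\<^sup>2) + e\<^sup>2 * (L * norm d)\<^sup>2"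
    using mult_left_mono[OF amgm, of e] e(1) by (simp add: algebra_simps)
  finally have 1: "(norm (c - PA c))\<^sup>2 \<le> (norm u)\<^sup>2 - 2 * e * \<mu> * (norm d)\<^sup>2
      + e * (\<mu> / 2 * (norm d)\<^sup>2 + 2 * L\<^sup>2 / \<mu> * (norm v)\<^sup>2) + e\<^sup>2 * (L * norm d)\<^sup>2" .
  define w where "w = e * norm (PA n)"
  have w: "0 \<le> w" using e by (simp add: w_def)
  have n_sq: "(norm n)\<^sup>2 \<le> 2 * (norm g)\<^sup>2 + 2 * L\<^sup>2 * (norm d)\<^sup>2"
  proof -
    have "norm n \<le> norm g + L * norm d" using norm_triangle_sub[of n g] n_g by linarith
    then have "(norm n)\<^sup>2 \<le> (norm g + L * norm d)\<^sup>2" by (intro power_mono) auto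
    also have "\<dots> \<le> 2 * (norm g)\<^sup>2 + 2 * (L * norm d)\<^sup>2"
      using sum_squares_bound[of "norm g" "L * norm d"] by (simp add: power2_sum)
    finally show ?thesis by (simp add: power_mult_distrib)
  qed
  have "(norm (PA c))\<^sup>2 \<le> (norm v + w)\<^sup>2"
  proof (rule power_mono)
    show "norm (PA c) \<le> norm v + w"
      unfolding cP w_def using norm_triangle_ineq4[of v "e *\<^sub>R PA n"] e(1) by simp
  qed simp
  \<comment> \<open>Young's inequality with weight \<open>r / 2\<close>: after multiplication by
    \<open>1 - r\<close> a loss of at least \<open>r / 2\<close> is still left on the
    \<open>v\<close> term.\<close>
  also have "\<dots> \<le> (1 + r / 2) * (norm v)\<^sup>2 + (1 + 2 / r) * w\<^sup>2"
  proof -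
    have "0 \<le> (r * norm v - 2 * w)\<^sup>2 / (2 * r)" using r by simp
    also have "\<dots> = r / 2 * (norm v)\<^sup>2 + 2 / r * w\<^sup>2 - 2 * norm v * w"
      using r by (simp add: power2_eq_square field_simps)
    finally show ?thesis by (simp add: power2_sum algebra_simps)
  qed
  finally have "(1 - r) * (norm (PA c))\<^sup>2 \<le> (1 - r) * ((1 + r / 2) * (norm v)\<^sup>2 + (1 + 2 / r) * w\<^sup>2)"
    using r by (intro mult_left_mono) auto
  also have "\<dots> = (1 - r / 2 - r\<^sup>2 / 2) * (norm v)\<^sup>2 + (2 / r - 1 - r) * w\<^sup>2"
    using r by (simp add: power2_eq_square field_simps)
  also have "\<dots> \<le> (1 - r / 2) * (norm v)\<^sup>2 + 2 / r * w\<^sup>2"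
    using r by (intro add_mono mult_right_mono) auto
  also have "2 / r * w\<^sup>2 \<le> 2 / r * (e\<^sup>2 * (2 * (norm g)\<^sup>2 + 2 * L\<^sup>2 * (norm d)\<^sup>2))"
  proof (rule mult_left_mono)
    have "(norm (PA n))\<^sup>2 \<le> 2 * (norm g)\<^sup>2 + 2 * L\<^sup>2 * (norm d)\<^sup>2"
      using n_sq power_mono[OF norm_PA_le norm_ge_zero, of n 2] by linarith
    then show "w\<^sup>2 \<le> e\<^sup>2 * (2 * (norm g)\<^sup>2 + 2 * L\<^sup>2 * (norm d)\<^sup>2)"
      unfolding w_def power_mult_distrib by (rule mult_left_mono) simp
  qed (use r in simp)
  finally have 2: "(1 - r) * (norm (PA c))\<^sup>2 \<le> (1 - r / 2) * (norm v)\<^sup>2 + 2 / r * (e\<^sup>2 * (2 * (norm g)\<^sup>2 + 2 * L\<^sup>2 * (norm d)\<^sup>2))"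
    by simp
  have uv: "(norm u)\<^sup>2 + (norm v)\<^sup>2 = (norm d)\<^sup>2" using PA_pythagoras[of d] by (simp add: u_def v_def)
  \<comment> \<open>The budget: of the gain \<open>2 * e * \<mu>\<close> in the squared norm of
    \<open>d\<close>, \<open>amgm\<close> costs \<open>e * \<mu> / 2\<close> and \<open>k1\<close>,
    \<open>k2\<close> cost \<open>e * \<mu> / 4\<close> each, leaving \<open>e * \<mu>\<close>. The
    \<open>v\<close> term of \<open>amgm\<close> is paid by \<open>k3\<close> out of the loss
    \<open>r / 2\<close>.\<close>
  have k1: "e * (e * L\<^sup>2) * (norm d)\<^sup>2 \<le> e * (\<mu> / 4) * (norm d)\<^sup>2"
    using e by (intro mult_right_mono mult_left_mono) auto
  have k2: "e * (4 * (e / r) * L\<^sup>2) * (norm d)\<^sup>2 \<le> e * (\<mu> / 4) * (norm d)\<^sup>2"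
    using e by (intro mult_right_mono mult_left_mono) auto
  have k3: "2 * L\<^sup>2 * e / \<mu> * (norm v)\<^sup>2 \<le> r / 2 * (norm v)\<^sup>2"
    using e by (intro mult_right_mono) auto
  have e1: "e * (\<mu> / 2 * (norm d)\<^sup>2 + 2 * L\<^sup>2 / \<mu> * (norm v)\<^sup>2) = e * (\<mu> / 2) * (norm d)\<^sup>2 + 2 * L\<^sup>2 * e / \<mu> * (norm v)\<^sup>2"
    by (simp add: algebra_simps)
  have e2: "e\<^sup>2 * (L * norm d)\<^sup>2 = e * (e * L\<^sup>2) * (norm d)\<^sup>2" by (simp add: power2_eq_square)
  have e3: "2 / r * (e\<^sup>2 * (2 * (norm g)\<^sup>2 + 2 * L\<^sup>2 * (norm d)\<^sup>2))
      = 4 * (e\<^sup>2 / r) * (norm g)\<^sup>2 + e * (4 * (e / r) * L\<^sup>2) * (norm d)\<^sup>2"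
    using r by (simp add: power2_eq_square field_simps)
  have e4: "(1 - r / 2) * (norm v)\<^sup>2 = (norm v)\<^sup>2 - r / 2 * (norm v)\<^sup>2" by (simp add: left_diff_distrib)
  have collect: "A + B \<le> U + V - s + m + k + k + H"
    if "A \<le> U - s + X1 + X2" "B \<le> V' + X3" "X1 = m + K3" "X2 = K1" "X3 = H + K2" "V' = V - h" "K1 \<le> k" "K2 \<le> k" "K3 \<le> h"
    for A B U V V' s m k h H X1 X2 X3 K1 K2 K3 :: real using that by linarith
  have "(norm (c - PA c))\<^sup>2 + (1 - r) * (norm (PA c))\<^sup>2
     \<le> (norm u)\<^sup>2 + (norm v)\<^sup>2 - 2 * e * \<mu> * (norm d)\<^sup>2 + e * (\<mu> / 2) * (norm d)\<^sup>2
       + e * (\<mu> / 4) * (norm d)\<^sup>2 + e * (\<mu> / 4) * (norm d)\<^sup>2 + 4 * (e\<^sup>2 / r) * (norm g)\<^sup>2"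
    by (rule collect[OF 1 2 e1 e2 e3 e4 k1 k2 k3])
  also have "\<dots> = (1 - \<mu> * e) * (norm d)\<^sup>2 + 4 * (e\<^sup>2 / r) * (norm g)\<^sup>2"
    unfolding uv by (simp add: algebra_simps)
  finally show ?thesis by (simp add: d_def g_def)
qed

text \<open>A projection removes exactly the \<open>PA\<close> component, so by Pythagoras the coin
  multiplies only that component's squared norm.\<close>

lemma x_Suc_split:
  assumes n: "n \<ge> 1"
  defines "c \<equiv> (\<lambda>\<omega>. x n \<omega> - xstar - \<eta> n *\<^sub>R gradf (x n \<omega>))"
  defines "h \<equiv> (\<lambda>\<omega>. c \<omega> + \<eta> n *\<^sub>R xi n \<omega>)"
  shows "(norm (x (Suc n) \<omega> - xstar))\<^sup>2 = (norm (h \<omega> - PA (h \<omega>)))\<^sup>2 + (if coin n \<omega> then 0 else (norm (PA (h \<omega>)))\<^sup>2)"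
proof -
  have h: "h \<omega> = x n \<omega> - \<eta> n *\<^sub>R G (x n \<omega>) (\<zeta> n \<omega>) - xstar"
    by (simp add: h_def c_def xi_def algebra_simps)
  have "x (Suc n) \<omega> - xstar = (if coin n \<omega> then h \<omega> - PA (h \<omega>) else h \<omega>)"
    unfolding x_Suc[OF n] h by (simp add: Let_def PA_diff PA_xstar)
  then show ?thesis using PA_pythagoras[of "h \<omega>"] by simp
qed

lemma c_past: "n \<ge> 1 \<Longrightarrow> (\<lambda>\<omega>. x n \<omega> - xstar - \<eta> n *\<^sub>R gradf (x n \<omega>)) \<in> borel_measurable (sub_algebra (past n))"
proof -
  assume n: "n \<ge> 1"
  note [measurable] = x_past[OF n]
  show ?thesis by measurable
qed

lemma x_square_integrable: "n \<ge> 1 \<Longrightarrow> integrable M (\<lambda>\<omega>. (norm (x n \<omega> - xstar))\<^sup>2)"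
  and c_square_integrable: "n \<ge> 1 \<Longrightarrow> integrable M (\<lambda>\<omega>. (norm (x n \<omega> - xstar - \<eta> n *\<^sub>R gradf (x n \<omega>)))\<^sup>2)"
proof -
  have c: "integrable M (\<lambda>\<omega>. (norm (x n \<omega> - xstar - \<eta> n *\<^sub>R gradf (x n \<omega>)))\<^sup>2)"
    if n: "n \<ge> 1" and I: "integrable M (\<lambda>\<omega>. (norm (x n \<omega> - xstar))\<^sup>2)" for n
  proof -
    note [measurable] = x_measurable[OF n]
    have A: "integrable M (\<lambda>\<omega>. (norm (- \<eta> n *\<^sub>R (gradf (x n \<omega>) - gradf xstar)))\<^sup>2)"
      using lip[of _ xstar] \<eta>_pos[of n]
      by (intro integrable_square_bound[OF I, of _ "\<eta> n * L"]) (auto simp: mult.assoc)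
    have B: "integrable M (\<lambda>\<omega>. (norm (- \<eta> n *\<^sub>R (gradf (x n \<omega>) - gradf xstar) + - \<eta> n *\<^sub>R gradf xstar))\<^sup>2)"
      by (rule integrable_square_add[OF A]) auto
    have "integrable M (\<lambda>\<omega>. (norm (x n \<omega> - xstar + (- \<eta> n *\<^sub>R (gradf (x n \<omega>) - gradf xstar) + - \<eta> n *\<^sub>R gradf xstar)))\<^sup>2)"
      by (rule integrable_square_add[OF I B]) auto
    then show ?thesis by (simp add: algebra_simps)
  qed
  show I: "integrable M (\<lambda>\<omega>. (norm (x n \<omega> - xstar))\<^sup>2)" if "n \<ge> 1" for n
    using that
  proof (induction n rule: nat_induct_at_least)
    case base
    then show ?case using x_1 by simp
  next
    case (Suc n)
    let ?h = "\<lambda>\<omega>. x n \<omega> - xstar - \<eta> n *\<^sub>R gradf (x n \<omega>) + \<eta> n *\<^sub>R xi n \<omega>"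
    note [measurable] = x_measurable[OF Suc.hyps] xi_measurable[OF Suc.hyps]
    have "integrable M (\<lambda>\<omega>. (norm (\<eta> n *\<^sub>R xi n \<omega>))\<^sup>2)"
      using xi_square_integrable[OF Suc.hyps] by (simp add: power_mult_distrib)
    then have h: "integrable M (\<lambda>\<omega>. (norm (?h \<omega>))\<^sup>2)"
      by (rule integrable_square_add[OF c[OF Suc.hyps Suc.IH]]) auto
    show ?case
    proof (rule integrable_square_bound[OF h, of _ 1])
      show "(\<lambda>\<omega>. x (Suc n) \<omega> - xstar) \<in> borel_measurable M" using x_measurable[of "Suc n"] by measurable
      fix \<omega>
      have "(norm (x (Suc n) \<omega> - xstar))\<^sup>2 \<le> (norm (?h \<omega>))\<^sup>2"
        unfolding x_Suc_split[OF Suc.hyps] using PA_pythagoras[of "?h \<omega>"] norm_PA_compl_le[of "?h \<omega>"] by auto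
      then show "norm (x (Suc n) \<omega> - xstar) \<le> 1 * norm (?h \<omega>)" by (simp add: power2_le_iff_abs_le)
    qed
  qed
  show "n \<ge> 1 \<Longrightarrow> integrable M (\<lambda>\<omega>. (norm (x n \<omega> - xstar - \<eta> n *\<^sub>R gradf (x n \<omega>)))\<^sup>2)" using c I by blast
qed

definition gap :: "nat \<Rightarrow> real" where
  "gap n = (\<integral>\<omega>. (norm (x n \<omega> - xstar))\<^sup>2 \<partial>M)"

text \<open>The cross term with the noise vanishes in each component separately, the coin
  contributes the factor \<open>1 - p n\<close>, and the noise-free part is
  \<open>drift_inequality\<close>.\<close>

lemma gap_Suc:
  assumes n: "n \<ge> 1" and e: "\<eta> n * L\<^sup>2 \<le> \<mu> / 4" "4 * (\<eta> n / p n) * L\<^sup>2 \<le> \<mu> / 4" "2 * L\<^sup>2 * \<eta> n / \<mu> \<le> p n / 2"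
  shows "gap (Suc n) \<le> (1 - \<mu> * \<eta> n) * gap n + \<eta> n * (4 * (\<eta> n / p n) * (norm (gradf xstar))\<^sup>2 + \<eta> n * \<sigma>)"
proof -
  define c where "c = (\<lambda>\<omega>. x n \<omega> - xstar - \<eta> n *\<^sub>R gradf (x n \<omega>))"
  define h where "h = (\<lambda>\<omega>. c \<omega> + \<eta> n *\<^sub>R xi n \<omega>)"
  have cp: "c \<in> borel_measurable (sub_algebra (past n))" unfolding c_def by (rule c_past[OF n])
  have cM [measurable]: "c \<in> borel_measurable M" by (rule measurable_sub_algebra[OF cp past_subset])
  have xM [measurable]: "xi n \<in> borel_measurable M" by (rule xi_measurable[OF n])
  have csq: "integrable M (\<lambda>\<omega>. (norm (c \<omega>))\<^sup>2)" unfolding c_def by (rule c_square_integrable[OF n])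
  note xsq = xi_square_integrable[OF n]
  \<comment> \<open>One computation for both components: \<open>T\<close> stands for
    \<open>PA\<close> and for its complement, and the last assumption is that \<open>T\<close> is an
    orthogonal projection.\<close>
  have split: "(\<integral>\<omega>. (norm (T (h \<omega>)))\<^sup>2 \<partial>M) = (\<integral>\<omega>. (norm (T (c \<omega>)))\<^sup>2 \<partial>M) + (\<eta> n)\<^sup>2 * (\<integral>\<omega>. (norm (T (xi n \<omega>)))\<^sup>2 \<partial>M)"
    and int: "integrable M (\<lambda>\<omega>. (norm (T (h \<omega>)))\<^sup>2)" "integrable M (\<lambda>\<omega>. (norm (T (c \<omega>)))\<^sup>2)" "integrable M (\<lambda>\<omega>. (norm (T (xi n \<omega>)))\<^sup>2)"
    if T: "\<And>y z. T (y + z) = T y + T z" "\<And>a y. T (a *\<^sub>R y) = a *\<^sub>R T y" "\<And>y. norm (T y) \<le> norm y" "\<And>y z. T y \<bullet> T z = T y \<bullet> z"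
      and Tm [measurable]: "T \<in> borel_measurable borel" for T :: "'v \<Rightarrow> 'v"
  proof -
    show Tc: "integrable M (\<lambda>\<omega>. (norm (T (c \<omega>)))\<^sup>2)"
      by (rule integrable_square_bound[OF csq, of _ 1]) (use T(3) in auto)
    show Tx: "integrable M (\<lambda>\<omega>. (norm (T (xi n \<omega>)))\<^sup>2)"
      by (rule integrable_square_bound[OF xsq, of _ 1]) (use T(3) in auto)
    have eq: "(norm (T (h \<omega>)))\<^sup>2 = (norm (T (c \<omega>)))\<^sup>2 + (\<eta> n)\<^sup>2 * (norm (T (xi n \<omega>)))\<^sup>2 + 2 * \<eta> n * (T (c \<omega>) \<bullet> xi n \<omega>)" for \<omega>
      unfolding h_def T(1,2) power2_norm_eq_inner using T(4)[of "c \<omega>" "xi n \<omega>"]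
      by (simp add: inner_add_left inner_add_right inner_commute power2_eq_square algebra_simps)
    have cross: "integrable M (\<lambda>\<omega>. T (c \<omega>) \<bullet> xi n \<omega>)"
      by (rule integrable_inner_of_squares[OF Tc xsq]) auto
    have zero: "(\<integral>\<omega>. T (c \<omega>) \<bullet> xi n \<omega> \<partial>M) = 0"
      by (rule xi_orthogonal[OF n _ Tc]) (use measurable_compose[OF cp Tm] in simp)
    show "integrable M (\<lambda>\<omega>. (norm (T (h \<omega>)))\<^sup>2)" unfolding eq using Tc Tx cross by simp
    show "(\<integral>\<omega>. (norm (T (h \<omega>)))\<^sup>2 \<partial>M) = (\<integral>\<omega>. (norm (T (c \<omega>)))\<^sup>2 \<partial>M) + (\<eta> n)\<^sup>2 * (\<integral>\<omega>. (norm (T (xi n \<omega>)))\<^sup>2 \<partial>M)"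
      unfolding eq using Tc Tx cross zero by simp
  qed
  have TP: "\<And>y z. PA y \<bullet> PA z = PA y \<bullet> z" using PA_orth by simp
  have TQ: "\<And>y z. (y - PA y) \<bullet> (z - PA z) = (y - PA y) \<bullet> z"
  proof -
    fix y z
    have "(y - PA y) \<bullet> PA z = 0" using PA_self_adjoint[of "y - PA y" z] by (simp add: PA_diff PA_idem)
    then show "(y - PA y) \<bullet> (z - PA z) = (y - PA y) \<bullet> z" by (simp add: inner_diff_right)
  qed
  note P = split[of PA, OF PA_add PA_scaleR norm_PA_le TP PA_measurable]
    int[of PA, OF PA_add PA_scaleR norm_PA_le TP PA_measurable]
  have Qm: "(\<lambda>y. y - PA y) \<in> borel_measurable borel" by measurable
  have Qa: "\<And>y z. y + z - PA (y + z) = (y - PA y) + (z - PA z)" and Qs: "\<And>a y. a *\<^sub>R y - PA (a *\<^sub>R y) = a *\<^sub>R (y - PA y)"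
    by (simp_all add: PA_add PA_scaleR algebra_simps)
  note Q = split[of "\<lambda>y. y - PA y", OF Qa Qs norm_PA_compl_le TQ Qm]
    int[of "\<lambda>y. y - PA y", OF Qa Qs norm_PA_compl_le TQ Qm]
  have hm: "(\<lambda>\<omega>. (norm (PA (h \<omega>)))\<^sup>2) \<in> sub_algebra (insert (Inl n) (past n)) \<rightarrow>\<^sub>M borel"
  proof -
    have [measurable]: "c \<in> borel_measurable (sub_algebra (insert (Inl n) (past n)))"
      "xi n \<in> borel_measurable (sub_algebra (insert (Inl n) (past n)))"
      by (rule measurable_sub_algebra_mono[OF cp], blast) (rule xi_sub_algebra[OF n], auto)
    show ?thesis unfolding h_def by measurable
  qed
  note coin = coin_independent[OF n hm P(2)]
  have "gap (Suc n) = (\<integral>\<omega>. (norm (h \<omega> - PA (h \<omega>)))\<^sup>2 + (if coin n \<omega> then 0 else (norm (PA (h \<omega>)))\<^sup>2) \<partial>M)"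
    unfolding gap_def h_def c_def by (subst x_Suc_split[OF n]) simp
  also have "\<dots> = (\<integral>\<omega>. (norm (h \<omega> - PA (h \<omega>)))\<^sup>2 \<partial>M) + (1 - p n) * (\<integral>\<omega>. (norm (PA (h \<omega>)))\<^sup>2 \<partial>M)"
    using Q(2) coin by simp
  also have "\<dots> = ((\<integral>\<omega>. (norm (c \<omega> - PA (c \<omega>)))\<^sup>2 \<partial>M) + (1 - p n) * (\<integral>\<omega>. (norm (PA (c \<omega>)))\<^sup>2 \<partial>M))
      + (\<eta> n)\<^sup>2 * ((\<integral>\<omega>. (norm (xi n \<omega> - PA (xi n \<omega>)))\<^sup>2 \<partial>M) + (1 - p n) * (\<integral>\<omega>. (norm (PA (xi n \<omega>)))\<^sup>2 \<partial>M))"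
    unfolding P(1) Q(1) by (simp add: algebra_simps)
  also have "\<dots> \<le> ((1 - \<mu> * \<eta> n) * gap n + 4 * ((\<eta> n)\<^sup>2 / p n) * (norm (gradf xstar))\<^sup>2) + (\<eta> n)\<^sup>2 * \<sigma>"
  proof (rule add_mono)
    have "(\<integral>\<omega>. (norm (c \<omega> - PA (c \<omega>)))\<^sup>2 \<partial>M) + (1 - p n) * (\<integral>\<omega>. (norm (PA (c \<omega>)))\<^sup>2 \<partial>M)
        = (\<integral>\<omega>. (norm (c \<omega> - PA (c \<omega>)))\<^sup>2 + (1 - p n) * (norm (PA (c \<omega>)))\<^sup>2 \<partial>M)"
      using P(3) Q(3) by simp
    also have "\<dots> \<le> (\<integral>\<omega>. (1 - \<mu> * \<eta> n) * (norm (x n \<omega> - xstar))\<^sup>2 + 4 * ((\<eta> n)\<^sup>2 / p n) * (norm (gradf xstar))\<^sup>2 \<partial>M)"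
      using P(3) Q(3) x_square_integrable[OF n] drift_inequality[OF \<eta>_pos e p]
      by (intro integral_mono) (auto simp: c_def)
    also have "\<dots> = (1 - \<mu> * \<eta> n) * gap n + 4 * ((\<eta> n)\<^sup>2 / p n) * (norm (gradf xstar))\<^sup>2"
      using x_square_integrable[OF n] by (simp add: gap_def M.prob_space)
    finally show "(\<integral>\<omega>. (norm (c \<omega> - PA (c \<omega>)))\<^sup>2 \<partial>M) + (1 - p n) * (\<integral>\<omega>. (norm (PA (c \<omega>)))\<^sup>2 \<partial>M)
      \<le> (1 - \<mu> * \<eta> n) * gap n + 4 * ((\<eta> n)\<^sup>2 / p n) * (norm (gradf xstar))\<^sup>2" .
    have "(1 - p n) * (\<integral>\<omega>. (norm (PA (xi n \<omega>)))\<^sup>2 \<partial>M) \<le> 1 * (\<integral>\<omega>. (norm (PA (xi n \<omega>)))\<^sup>2 \<partial>M)"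
      using p(1)[of n] by (intro mult_right_mono) auto
    then have "(\<integral>\<omega>. (norm (xi n \<omega> - PA (xi n \<omega>)))\<^sup>2 \<partial>M) + (1 - p n) * (\<integral>\<omega>. (norm (PA (xi n \<omega>)))\<^sup>2 \<partial>M)
      \<le> (\<integral>\<omega>. (norm (xi n \<omega> - PA (xi n \<omega>)))\<^sup>2 + (norm (PA (xi n \<omega>)))\<^sup>2 \<partial>M)"
      using P(4) Q(4) by simp
    also have "\<dots> \<le> \<sigma>" unfolding PA_pythagoras by (rule xi_square[OF n])
    finally have "(\<integral>\<omega>. (norm (xi n \<omega> - PA (xi n \<omega>)))\<^sup>2 \<partial>M) + (1 - p n) * (\<integral>\<omega>. (norm (PA (xi n \<omega>)))\<^sup>2 \<partial>M) \<le> \<sigma>" .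
    from mult_left_mono[OF this, of "(\<eta> n)\<^sup>2"]
    show "(\<eta> n)\<^sup>2 * ((\<integral>\<omega>. (norm (xi n \<omega> - PA (xi n \<omega>)))\<^sup>2 \<partial>M) + (1 - p n) * (\<integral>\<omega>. (norm (PA (xi n \<omega>)))\<^sup>2 \<partial>M)) \<le> (\<eta> n)\<^sup>2 * \<sigma>"
      by simp
  qed
  also have "\<dots> = (1 - \<mu> * \<eta> n) * gap n + \<eta> n * (4 * (\<eta> n / p n) * (norm (gradf xstar))\<^sup>2 + \<eta> n * \<sigma>)"
    by (simp add: power2_eq_square algebra_simps)
  finally show ?thesis .
qed

end

text \<open>Once \<open>r n\<close> is below \<open>\<mu> * \<epsilon> / 2\<close>, the excess of
  \<open>w\<close> over \<open>\<epsilon> / 2\<close> is multiplied by at most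
  \<open>1 - \<mu> * e n \<le> exp (- (\<mu> * e n))\<close> per step, and the exponents
  diverge.\<close>

lemma recursive_bound_tendsto_0:
  fixes w e r :: "nat \<Rightarrow> real"
  assumes w: "\<And>n. 0 \<le> w n" and e: "\<And>n. 0 < e n" "e \<longlonglongrightarrow> 0" "\<not> summable e" and r: "r \<longlonglongrightarrow> 0" and \<mu>: "0 < \<mu>"
    and rec: "\<forall>\<^sub>F n in sequentially. w (Suc n) \<le> (1 - \<mu> * e n) * w n + e n * r n"
  shows "w \<longlonglongrightarrow> 0"
proof (rule LIMSEQ_I)
  fix \<epsilon> :: real assume \<epsilon>: "0 < \<epsilon>"
  have "\<forall>\<^sub>F n in sequentially. r n < \<mu> * (\<epsilon> / 2)" by (rule order_tendstoD(2)[OF r]) (use \<mu> \<epsilon> in simp)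
  moreover have "\<forall>\<^sub>F n in sequentially. e n < 1 / \<mu>" by (rule order_tendstoD(2)[OF e(2)]) (use \<mu> in simp)
  ultimately have "\<forall>\<^sub>F n in sequentially. w (Suc n) - \<epsilon> / 2 \<le> (1 - \<mu> * e n) * (w n - \<epsilon> / 2) \<and> e n < 1 / \<mu>"
    using rec
  proof eventually_elim
    case (elim n)
    have "e n * r n \<le> e n * (\<mu> * (\<epsilon> / 2))" using elim e(1)[of n] by (intro mult_left_mono) auto
    then show ?case using elim by (simp add: algebra_simps)
  qed
  then obtain m where m: "\<And>n. n \<ge> m \<Longrightarrow> w (Suc n) - \<epsilon> / 2 \<le> (1 - \<mu> * e n) * (w n - \<epsilon> / 2)" "\<And>n. n \<ge> m \<Longrightarrow> e n < 1 / \<mu>"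
    by (auto simp: eventually_sequentially)
  \<comment> \<open>The excess may be negative; \<open>c\<close> must not be, since a factor of the
    product is enlarged to an exponential.\<close>
  define c where "c = max 0 (w m - \<epsilon> / 2)"
  have bound: "w (m + k) - \<epsilon> / 2 \<le> c * exp (- (\<mu> * (\<Sum>i<k. e (m + i))))" for k
  proof (induction k)
    case (Suc k)
    have nn: "0 \<le> 1 - \<mu> * e (m + k)" using m(2)[of "m + k"] \<mu> by (simp add: field_simps)
    have "w (m + Suc k) - \<epsilon> / 2 \<le> (1 - \<mu> * e (m + k)) * (w (m + k) - \<epsilon> / 2)" using m(1)[of "m + k"] by simp
    also have "\<dots> \<le> (1 - \<mu> * e (m + k)) * (c * exp (- (\<mu> * (\<Sum>i<k. e (m + i)))))" using Suc.IH nn by (rule mult_left_mono)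
    also have "\<dots> \<le> exp (- (\<mu> * e (m + k))) * (c * exp (- (\<mu> * (\<Sum>i<k. e (m + i)))))"
      using exp_ge_add_one_self[of "- (\<mu> * e (m + k))"] by (intro mult_right_mono) (auto simp: c_def)
    also have "\<dots> = c * exp (- (\<mu> * (\<Sum>i<Suc k. e (m + i))))" by (simp add: exp_add[symmetric] algebra_simps)
    finally show ?case .
  qed (simp add: c_def)
  have nsum: "\<not> summable (\<lambda>i. e (m + i))" using e(3) summable_iff_shift[of e m] by (simp add: add.commute)
  have "filterlim (\<lambda>k. \<Sum>i<k. e (m + i)) at_top sequentially"
  proof -
    let ?S = "\<lambda>k. \<Sum>i<k. e (m + i)"
    have inc: "incseq ?S" using e(1) by (intro incseq_SucI) (simp add: less_imp_le)
    have "\<not> Bseq ?S"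
      using nsum Bseq_monoseq_convergent[OF _ incseq_imp_monoseq[OF inc]] by (auto simp: summable_iff_convergent)
    have "\<exists>k. B \<le> ?S k" for B
    proof (rule ccontr)
      assume "\<nexists>k. B \<le> ?S k"
      then have "norm (?S k) \<le> B" for k
        using e(1) sum_nonneg[of "{..<k}" "\<lambda>i. e (m + i)"] by (force simp: not_le less_imp_le)
      then have "Bseq ?S" by (rule BseqI')
      then show False using \<open>\<not> Bseq ?S\<close> by contradiction
    qed
    then show ?thesis unfolding filterlim_at_top eventually_sequentially
      using incseqD[OF inc] by (meson order_trans)
  qed
  then have "filterlim (\<lambda>k. - (\<mu> * (\<Sum>i<k. e (m + i)))) at_bot sequentially"
    using \<mu> by (simp add: filterlim_uminus_at_bot filterlim_tendsto_pos_mult_at_top[OF tendsto_const])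
  then have "(\<lambda>k. c * exp (- (\<mu> * (\<Sum>i<k. e (m + i))))) \<longlonglongrightarrow> c * 0"
    by (intro tendsto_mult tendsto_const filterlim_compose[OF exp_at_bot])
  then have "\<forall>\<^sub>F k in sequentially. c * exp (- (\<mu> * (\<Sum>i<k. e (m + i)))) < \<epsilon> / 2"
    by (rule order_tendstoD(2)) (use \<epsilon> in simp)
  then obtain k0 where k0: "\<And>k. k \<ge> k0 \<Longrightarrow> c * exp (- (\<mu> * (\<Sum>i<k. e (m + i)))) < \<epsilon> / 2"
    by (auto simp: eventually_sequentially)
  then have "w n < \<epsilon>" if "n \<ge> m + k0" for n
  proof -
    have "c * exp (- (\<mu> * (\<Sum>i<n - m. e (m + i)))) < \<epsilon> / 2" using k0 that by simp
    then show ?thesis using bound[of "n - m"] that by simp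
  qed
  then show "\<exists>no. \<forall>n\<ge>no. norm (w n - 0) < \<epsilon>" using w by (intro exI[of _ "m + k0"]) auto
qed

section \<open>Vanishing distance, drift error and noise\<close>

context lpsa begin

interpretation PA: linear PA by (rule PA_linear)

lemma gap_nonneg: "0 \<le> gap n"
  unfolding gap_def by simp

lemma gap_tendsto_0:
  assumes "\<eta> \<longlonglongrightarrow> 0" "(\<lambda>n. \<eta> n / p n) \<longlonglongrightarrow> 0" "\<not> summable \<eta>"
  shows "gap \<longlonglongrightarrow> 0"
proof (rule recursive_bound_tendsto_0[OF gap_nonneg \<eta>_pos assms(1,3) _ \<mu>])
  have "(\<lambda>n. 4 * (\<eta> n / p n) * (norm (gradf xstar))\<^sup>2 + \<eta> n * \<sigma>) \<longlonglongrightarrow> 4 * 0 * (norm (gradf xstar))\<^sup>2 + 0 * \<sigma>"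
    by (intro tendsto_intros assms)
  then show "(\<lambda>n. 4 * (\<eta> n / p n) * (norm (gradf xstar))\<^sup>2 + \<eta> n * \<sigma>) \<longlonglongrightarrow> 0" by simp
  have "(\<lambda>n. \<eta> n * L\<^sup>2) \<longlonglongrightarrow> 0 * L\<^sup>2" by (intro tendsto_intros assms)
  then have 1: "\<forall>\<^sub>F n in sequentially. \<eta> n * L\<^sup>2 < \<mu> / 4" by (rule order_tendstoD(2)) (use \<mu> in simp)
  have "(\<lambda>n. 4 * (\<eta> n / p n) * L\<^sup>2) \<longlonglongrightarrow> 4 * 0 * L\<^sup>2" by (intro tendsto_intros assms)
  then have 2: "\<forall>\<^sub>F n in sequentially. 4 * (\<eta> n / p n) * L\<^sup>2 < \<mu> / 4" by (rule order_tendstoD(2)) (use \<mu> in simp)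
  have "(\<lambda>n. 2 * L\<^sup>2 / \<mu> * (\<eta> n / p n)) \<longlonglongrightarrow> 2 * L\<^sup>2 / \<mu> * 0" by (intro tendsto_intros assms)
  then have 3: "\<forall>\<^sub>F n in sequentially. 2 * L\<^sup>2 / \<mu> * (\<eta> n / p n) < 1 / 2" by (rule order_tendstoD(2)) simp
  show "\<forall>\<^sub>F n in sequentially. gap (Suc n) \<le> (1 - \<mu> * \<eta> n) * gap n + \<eta> n * (4 * (\<eta> n / p n) * (norm (gradf xstar))\<^sup>2 + \<eta> n * \<sigma>)"
    using 1 2 3 eventually_ge_at_top[of 1]
  proof eventually_elim
    case (elim n)
    have "2 * L\<^sup>2 / \<mu> * (\<eta> n / p n) * p n \<le> 1 / 2 * p n"
      using elim(3) p(1)[of n] by (intro mult_right_mono) auto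
    then have "2 * L\<^sup>2 * \<eta> n / \<mu> \<le> p n / 2" using p(1)[of n] by simp
    then show ?case using elim by (intro gap_Suc) auto
  qed
qed

lemma expectation_distance_le:
  assumes n: "n \<ge> 1"
  shows "integrable M (\<lambda>\<omega>. norm (x n \<omega> - xstar))" "(\<integral>\<omega>. norm (x n \<omega> - xstar) \<partial>M) \<le> sqrt (gap n)"
proof -
  note [measurable] = x_measurable[OF n]
  show I: "integrable M (\<lambda>\<omega>. norm (x n \<omega> - xstar))"
    by (rule M.square_integrable_imp_integrable) (use x_square_integrable[OF n] in simp_all)
  have "0 \<le> gap n - (\<integral>\<omega>. norm (x n \<omega> - xstar) \<partial>M)\<^sup>2"
    using M.variance_positive[of "\<lambda>\<omega>. norm (x n \<omega> - xstar)"]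
    unfolding M.variance_eq[OF I x_square_integrable[OF n]] gap_def .
  then show "(\<integral>\<omega>. norm (x n \<omega> - xstar) \<partial>M) \<le> sqrt (gap n)" by (intro real_le_rsqrt) simp
qed

text \<open>The form of the drift \<open>d n\<close>, with \<open>k\<close> the relative change of
  the scaling factor. At \<open>xstar\<close> it equals \<open>gradf xstar\<close> by
  \<open>PA_g\<close> and \<open>PA_xstar\<close>, so its error is Lipschitz in the distance to
  \<open>xstar\<close>.\<close>

lemma expectation_drift_error:
  assumes n: "n \<ge> 1"
  shows "integrable M (\<lambda>\<omega>. norm (gradf xstar - (PA (gradf (x n \<omega>)) - k *\<^sub>R PA (x n \<omega>))))"
    "(\<integral>\<omega>. norm (gradf xstar - (PA (gradf (x n \<omega>)) - k *\<^sub>R PA (x n \<omega>))) \<partial>M) \<le> (L + \<bar>k\<bar>) * sqrt (gap n)"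
proof -
  note [measurable] = x_measurable[OF n]
  note e = expectation_distance_le[OF n]
  have le: "norm (gradf xstar - (PA (gradf y) - k *\<^sub>R PA y)) \<le> (L + \<bar>k\<bar>) * norm (y - xstar)" for y
  proof -
    have "gradf xstar - (PA (gradf y) - k *\<^sub>R PA y) = - PA (gradf y - gradf xstar) + k *\<^sub>R PA (y - xstar)"
      by (simp add: PA_diff PA_g PA_xstar)
    also have "norm \<dots> \<le> norm (PA (gradf y - gradf xstar)) + \<bar>k\<bar> * norm (PA (y - xstar))"
      by (rule order_trans[OF norm_triangle_ineq]) simp
    also have "\<dots> \<le> L * norm (y - xstar) + \<bar>k\<bar> * norm (y - xstar)"
      using norm_PA_le[of "gradf y - gradf xstar"] lip[of y xstar] norm_PA_le[of "y - xstar"]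
      by (intro add_mono mult_left_mono) auto
    finally show ?thesis by (simp add: algebra_simps)
  qed
  show I: "integrable M (\<lambda>\<omega>. norm (gradf xstar - (PA (gradf (x n \<omega>)) - k *\<^sub>R PA (x n \<omega>))))"
    by (rule Bochner_Integration.integrable_bound[OF integrable_mult_right[OF e(1), of "L + \<bar>k\<bar>"]])
      (use le L in \<open>auto simp: abs_mult\<close>)
  have "(\<integral>\<omega>. norm (gradf xstar - (PA (gradf (x n \<omega>)) - k *\<^sub>R PA (x n \<omega>))) \<partial>M) \<le> (\<integral>\<omega>. (L + \<bar>k\<bar>) * norm (x n \<omega> - xstar) \<partial>M)"
    using I e(1) le by (intro integral_mono) auto
  also have "\<dots> \<le> (L + \<bar>k\<bar>) * sqrt (gap n)" using e(2) L by (simp add: mult_left_mono)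
  finally show "(\<integral>\<omega>. norm (gradf xstar - (PA (gradf (x n \<omega>)) - k *\<^sub>R PA (x n \<omega>))) \<partial>M) \<le> (L + \<bar>k\<bar>) * sqrt (gap n)" .
qed

definition noise_sum :: "(nat \<Rightarrow> real) \<Rightarrow> nat \<Rightarrow> nat \<Rightarrow> 'a \<Rightarrow> 'v" where
  "noise_sum b m j \<omega> = (\<Sum>i=m..<j. b i *\<^sub>R PA (xi i \<omega>))"

lemma noise_sum_past: "1 \<le> m \<Longrightarrow> j \<le> k \<Longrightarrow> noise_sum b m j \<in> borel_measurable (sub_algebra (past k))"
  unfolding noise_sum_def
proof (rule borel_measurable_sum)
  fix i assume "1 \<le> m" "j \<le> k" "i \<in> {m..<j}"
  then have [measurable]: "xi i \<in> borel_measurable (sub_algebra (past k))"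
    by (intro xi_sub_algebra) (auto simp: past_def)
  show "(\<lambda>\<omega>. b i *\<^sub>R PA (xi i \<omega>)) \<in> borel_measurable (sub_algebra (past k))" by measurable
qed

text \<open>Kolmogorov's argument: stop the martingale at the first time it is large.\<close>

lemma noise_maximal_inequality:
  assumes m: "1 \<le> m" and \<epsilon>: "0 < \<epsilon>"
  shows "M.prob {\<omega> \<in> space M. \<exists>j\<in>{m..K}. \<epsilon> \<le> norm (noise_sum b m j \<omega>)} \<le> (\<Sum>i=m..<K. (b i)\<^sup>2) * \<sigma> / \<epsilon>\<^sup>2"
proof -
  \<comment> \<open>\<open>noise_sum b m j\<close> uses only indices below \<open>j\<close>, so
    \<open>H i\<close> is known before the noise at \<open>i\<close> is drawn; \<open>T\<close> is
    then a martingale transform and its increments stay orthogonal.\<close>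
  define H where "H i \<omega> = (if \<forall>j\<in>{m..i}. norm (noise_sum b m j \<omega>) < \<epsilon> then 1 else 0 :: real)" for i \<omega>
  define T where "T j \<omega> = (\<Sum>i=m..<j. (b i * H i \<omega>) *\<^sub>R PA (xi i \<omega>))" for j \<omega>
  have H_past: "H i \<in> borel_measurable (sub_algebra (past k))" if "i \<le> k" for i k
  proof -
    have "Measurable.pred (sub_algebra (past k)) (\<lambda>\<omega>. \<forall>j\<in>{m..i}. norm (noise_sum b m j \<omega>) < \<epsilon>)"
    proof (rule pred_intros_finite)
      fix j assume "j \<in> {m..i}"
      then have [measurable]: "noise_sum b m j \<in> borel_measurable (sub_algebra (past k))"
        using that m by (intro noise_sum_past) auto
      show "Measurable.pred (sub_algebra (past k)) (\<lambda>\<omega>. norm (noise_sum b m j \<omega>) < \<epsilon>)" by measurable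
    qed simp
    then show ?thesis unfolding H_def by measurable
  qed
  have T_past: "T j \<in> borel_measurable (sub_algebra (past j))" for j
    unfolding T_def
  proof (rule borel_measurable_sum)
    fix i assume i: "i \<in> {m..<j}"
    then have [measurable]: "xi i \<in> borel_measurable (sub_algebra (past j))"
      using m by (intro xi_sub_algebra) (auto simp: past_def)
    have [measurable]: "H i \<in> borel_measurable (sub_algebra (past j))" using i by (intro H_past) auto
    show "(\<lambda>\<omega>. (b i * H i \<omega>) *\<^sub>R PA (xi i \<omega>)) \<in> borel_measurable (sub_algebra (past j))" by measurable
  qed
  have T_M [measurable]: "T j \<in> borel_measurable M" for j by (rule measurable_sub_algebra[OF T_past past_subset])
  have H_01: "H i \<omega> = 0 \<or> H i \<omega> = 1" for i \<omega> by (simp add: H_def)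
  have "integrable M (\<lambda>\<omega>. (norm (T j \<omega>))\<^sup>2) \<and> (\<integral>\<omega>. (norm (T j \<omega>))\<^sup>2 \<partial>M) \<le> (\<Sum>i=m..<j. (b i)\<^sup>2) * \<sigma>" if "m \<le> j" for j
    using that
  proof (induction j rule: dec_induct)
    case base
    then show ?case by (simp add: T_def)
  next
    case (step j)
    have j: "j \<ge> 1" using step.hyps m by simp
    note xsq = xi_square_integrable[OF j]
    note [measurable] = xi_measurable[OF j]
    have Pxi: "integrable M (\<lambda>\<omega>. (norm (PA (xi j \<omega>)))\<^sup>2)"
      by (rule integrable_square_bound[OF xsq, of _ 1]) (use norm_PA_le in auto)
    have [measurable]: "H j \<in> borel_measurable M" by (rule measurable_sub_algebra[OF H_past[OF order_refl] past_subset])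
    have Hxi: "integrable M (\<lambda>\<omega>. H j \<omega> * (norm (PA (xi j \<omega>)))\<^sup>2)"
    proof (rule Bochner_Integration.integrable_bound[OF Pxi _ AE_I2])
      show "norm (H j \<omega> * (norm (PA (xi j \<omega>)))\<^sup>2) \<le> norm ((norm (PA (xi j \<omega>)))\<^sup>2)" for \<omega>
        using H_01[of j \<omega>] by auto
    qed measurable
    define \<Phi> where "\<Phi> \<omega> = H j \<omega> *\<^sub>R PA (T j \<omega>)" for \<omega>
    have \<Phi>_past: "\<Phi> \<in> borel_measurable (sub_algebra (past j))"
    proof -
      note [measurable] = H_past[OF order_refl, of j] T_past[of j]
      show ?thesis unfolding \<Phi>_def by measurable
    qed
    have [measurable]: "\<Phi> \<in> borel_measurable M" by (rule measurable_sub_algebra[OF \<Phi>_past past_subset])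
    have \<Phi>_sq: "integrable M (\<lambda>\<omega>. (norm (\<Phi> \<omega>))\<^sup>2)"
    proof (rule integrable_square_bound[OF step.IH[THEN conjunct1], of _ 1])
      show "norm (\<Phi> \<omega>) \<le> 1 * norm (T j \<omega>)" for \<omega>
        using H_01[of j \<omega>] norm_PA_le[of "T j \<omega>"] by (auto simp: \<Phi>_def)
    qed measurable
    have cross: "integrable M (\<lambda>\<omega>. \<Phi> \<omega> \<bullet> xi j \<omega>)" by (rule integrable_inner_of_squares[OF \<Phi>_sq xsq]) auto
    have eq: "(norm (T (Suc j) \<omega>))\<^sup>2 = (norm (T j \<omega>))\<^sup>2 + 2 * b j * (\<Phi> \<omega> \<bullet> xi j \<omega>) + (b j)\<^sup>2 * (H j \<omega> * (norm (PA (xi j \<omega>)))\<^sup>2)" for \<omega>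
    proof -
      have "T (Suc j) \<omega> = T j \<omega> + (b j * H j \<omega>) *\<^sub>R PA (xi j \<omega>)" using step.hyps by (simp add: T_def)
      then show ?thesis
        using H_01[of j \<omega>] PA_self_adjoint[of "T j \<omega>" "xi j \<omega>"] unfolding power2_norm_eq_inner
        by (auto simp: \<Phi>_def inner_add_left inner_add_right inner_commute power2_eq_square algebra_simps)
    qed
    have "(\<integral>\<omega>. (norm (T (Suc j) \<omega>))\<^sup>2 \<partial>M) = (\<integral>\<omega>. (norm (T j \<omega>))\<^sup>2 \<partial>M) + (b j)\<^sup>2 * (\<integral>\<omega>. H j \<omega> * (norm (PA (xi j \<omega>)))\<^sup>2 \<partial>M)"
      unfolding eq using step.IH cross Hxi xi_orthogonal[OF j \<Phi>_past \<Phi>_sq] by simp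
    also have "\<dots> \<le> (\<Sum>i=m..<j. (b i)\<^sup>2) * \<sigma> + (b j)\<^sup>2 * \<sigma>"
    proof (intro add_mono mult_left_mono)
      have "(\<integral>\<omega>. H j \<omega> * (norm (PA (xi j \<omega>)))\<^sup>2 \<partial>M) \<le> (\<integral>\<omega>. (norm (xi j \<omega>))\<^sup>2 \<partial>M)"
      proof (rule integral_mono[OF Hxi xsq])
        fix \<omega>
        show "H j \<omega> * (norm (PA (xi j \<omega>)))\<^sup>2 \<le> (norm (xi j \<omega>))\<^sup>2"
          using H_01[of j \<omega>] power_mono[OF norm_PA_le[of "xi j \<omega>"] norm_ge_zero, of 2] by auto
      qed
      also have "\<dots> \<le> \<sigma>" by (rule xi_square[OF j])
      finally show "(\<integral>\<omega>. H j \<omega> * (norm (PA (xi j \<omega>)))\<^sup>2 \<partial>M) \<le> \<sigma>" .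
    qed (use step.IH in auto)
    also have "\<dots> = (\<Sum>i=m..<Suc j. (b i)\<^sup>2) * \<sigma>" using step.hyps by (simp add: distrib_right)
    finally have "(\<integral>\<omega>. (norm (T (Suc j) \<omega>))\<^sup>2 \<partial>M) \<le> (\<Sum>i=m..<Suc j. (b i)\<^sup>2) * \<sigma>" .
    moreover have "integrable M (\<lambda>\<omega>. (norm (T (Suc j) \<omega>))\<^sup>2)"
      unfolding eq using step.IH cross Hxi by (intro Bochner_Integration.integrable_add integrable_mult_right) auto
    ultimately show ?case by blast
  qed
  note T = this
  show ?thesis
  proof (cases "m \<le> K")
    case False
    then show ?thesis by simp
  next
    case True
    have "M.prob {\<omega> \<in> space M. \<exists>j\<in>{m..K}. \<epsilon> \<le> norm (noise_sum b m j \<omega>)} \<le> M.prob {\<omega> \<in> space M. \<epsilon>\<^sup>2 \<le> (norm (T K \<omega>))\<^sup>2}"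
    proof (rule M.finite_measure_mono, rule subsetI)
      fix \<omega> assume w: "\<omega> \<in> {\<omega> \<in> space M. \<exists>j\<in>{m..K}. \<epsilon> \<le> norm (noise_sum b m j \<omega>)}"
      define j where "j = (LEAST j. m \<le> j \<and> j \<le> K \<and> \<epsilon> \<le> norm (noise_sum b m j \<omega>))"
      have j: "m \<le> j \<and> j \<le> K \<and> \<epsilon> \<le> norm (noise_sum b m j \<omega>)"
        unfolding j_def by (rule LeastI_ex) (use w in auto)
      have less: "norm (noise_sum b m i \<omega>) < \<epsilon>" if "m \<le> i" "i < j" for i
      proof (rule ccontr)
        assume "\<not> norm (noise_sum b m i \<omega>) < \<epsilon>"
        then have "j \<le> i" unfolding j_def using that j by (intro Least_le) auto
        then show False using that by simp
      qed
      have H1: "H i \<omega> = 1" if "i \<in> {m..<j}" for i using that less by (auto simp: H_def)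
      have H0: "H i \<omega> = 0" if "i \<in> {j..<K}" for i using that j by (force simp: H_def)
      have "T K \<omega> = (\<Sum>i=m..<j. (b i * H i \<omega>) *\<^sub>R PA (xi i \<omega>)) + (\<Sum>i=j..<K. (b i * H i \<omega>) *\<^sub>R PA (xi i \<omega>))"
        unfolding T_def using j by (simp add: sum.atLeastLessThan_concat)
      also have "\<dots> = noise_sum b m j \<omega>" unfolding noise_sum_def using H1 H0 by simp
      finally have "\<epsilon> \<le> norm (T K \<omega>)" using j by simp
      then show "\<omega> \<in> {\<omega> \<in> space M. \<epsilon>\<^sup>2 \<le> (norm (T K \<omega>))\<^sup>2}" using w \<epsilon> by (auto intro: power_mono)
    qed measurable
    also have "\<dots> \<le> (\<integral>\<omega>. (norm (T K \<omega>))\<^sup>2 \<partial>M) / \<epsilon>\<^sup>2"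
      using T[OF True] \<epsilon> by (intro integral_Markov_inequality_measure[where A="{}"]) auto
    also have "\<dots> \<le> (\<Sum>i=m..<K. (b i)\<^sup>2) * \<sigma> / \<epsilon>\<^sup>2"
      using T[OF True] by (intro divide_right_mono) auto
    finally show ?thesis .
  qed
qed

text \<open>Of the threshold \<open>2 * \<epsilon>\<close> one half goes to the drift errors,
  dominated for all \<open>j\<close> by the single sum \<open>A\<close> and Markov's inequality, and
  the other to the noise with its maximal inequality.\<close>

lemma drift_noise_sum_bound:
  fixes d :: "nat \<Rightarrow> 'a \<Rightarrow> 'v" and b :: "nat \<Rightarrow> real"
  assumes m: "1 \<le> m" and \<epsilon>: "0 < \<epsilon>" and b: "\<And>i. 0 \<le> b i"
    and d: "\<And>i. m \<le> i \<Longrightarrow> integrable M (\<lambda>\<omega>. norm (g - d i \<omega>))" "\<And>i. m \<le> i \<Longrightarrow> d i \<in> borel_measurable M"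
      "\<And>i. m \<le> i \<Longrightarrow> (\<integral>\<omega>. norm (g - d i \<omega>) \<partial>M) \<le> r"
  defines "T \<equiv> (\<lambda>j \<omega>. \<Sum>i=m..<j. b i *\<^sub>R (g - d i \<omega> + PA (xi i \<omega>)))"
  shows "{\<omega> \<in> space M. \<exists>j\<in>{m..K}. 2 * \<epsilon> \<le> norm (T j \<omega>)} \<in> M.events"
    "M.prob {\<omega> \<in> space M. \<exists>j\<in>{m..K}. 2 * \<epsilon> \<le> norm (T j \<omega>)} \<le> (\<Sum>i=m..<K. b i) * r / \<epsilon> + (\<Sum>i=m..<K. (b i)\<^sup>2) * \<sigma> / \<epsilon>\<^sup>2"
proof -
  have xi_m: "xi i \<in> borel_measurable M" if "m \<le> i" for i using that m by (intro xi_measurable) simp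
  have T_M: "T j \<in> borel_measurable M" for j
    unfolding T_def
  proof (rule borel_measurable_sum)
    fix i assume "i \<in> {m..<j}"
    then have [measurable]: "xi i \<in> borel_measurable M" "d i \<in> borel_measurable M" using xi_m d(2) by auto
    show "(\<lambda>\<omega>. b i *\<^sub>R (g - d i \<omega> + PA (xi i \<omega>))) \<in> borel_measurable M" by measurable
  qed
  have S_M: "noise_sum b m j \<in> borel_measurable M" for j
    by (rule measurable_sub_algebra[OF noise_sum_past[OF m order_refl] past_subset])
  note [measurable] = T_M S_M
  show ev: "{\<omega> \<in> space M. \<exists>j\<in>{m..K}. 2 * \<epsilon> \<le> norm (T j \<omega>)} \<in> M.events" by measurable
  define A where "A \<omega> = (\<Sum>i=m..<K. b i * norm (g - d i \<omega>))" for \<omega>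
  have A_int: "integrable M A" unfolding A_def using d(1) by (intro Bochner_Integration.integrable_sum integrable_mult_right) auto
  have "(\<integral>\<omega>. A \<omega> \<partial>M) = (\<Sum>i=m..<K. b i * (\<integral>\<omega>. norm (g - d i \<omega>) \<partial>M))"
    unfolding A_def using d(1) by (subst Bochner_Integration.integral_sum) auto
  also have "\<dots> \<le> (\<Sum>i=m..<K. b i * r)" using b d(3) by (intro sum_mono mult_left_mono) auto
  finally have A_le: "(\<integral>\<omega>. A \<omega> \<partial>M) \<le> (\<Sum>i=m..<K. b i) * r" by (simp add: sum_distrib_right)
  let ?B1 = "{\<omega> \<in> space M. \<epsilon> \<le> A \<omega>}" and ?B2 = "{\<omega> \<in> space M. \<exists>j\<in>{m..K}. \<epsilon> \<le> norm (noise_sum b m j \<omega>)}"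
  have B: "?B1 \<in> M.events" "?B2 \<in> M.events" using borel_measurable_integrable[OF A_int] by measurable
  have "M.prob {\<omega> \<in> space M. \<exists>j\<in>{m..K}. 2 * \<epsilon> \<le> norm (T j \<omega>)} \<le> M.prob (?B1 \<union> ?B2)"
  proof (rule M.finite_measure_mono, rule subsetI)
    fix \<omega> assume w: "\<omega> \<in> {\<omega> \<in> space M. \<exists>j\<in>{m..K}. 2 * \<epsilon> \<le> norm (T j \<omega>)}"
    then obtain j where j: "m \<le> j" "j \<le> K" "2 * \<epsilon> \<le> norm (T j \<omega>)" by auto
    have "T j \<omega> = (\<Sum>i=m..<j. b i *\<^sub>R (g - d i \<omega>)) + noise_sum b m j \<omega>"
      unfolding T_def noise_sum_def by (simp add: sum.distrib scaleR_add_right)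
    then have "norm (T j \<omega>) \<le> norm (\<Sum>i=m..<j. b i *\<^sub>R (g - d i \<omega>)) + norm (noise_sum b m j \<omega>)"
      by (simp add: norm_triangle_ineq)
    also have "norm (\<Sum>i=m..<j. b i *\<^sub>R (g - d i \<omega>)) \<le> (\<Sum>i=m..<j. b i * norm (g - d i \<omega>))"
      by (rule order_trans[OF norm_sum]) (use b in \<open>simp add: abs_of_nonneg\<close>)
    also have "\<dots> \<le> A \<omega>" unfolding A_def using j b by (intro sum_mono2) auto
    finally have "2 * \<epsilon> \<le> A \<omega> + norm (noise_sum b m j \<omega>)" using j(3) by simp
    then have "\<epsilon> \<le> A \<omega> \<or> \<epsilon> \<le> norm (noise_sum b m j \<omega>)" by linarith
    then show "\<omega> \<in> ?B1 \<union> ?B2" using w j by auto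
  qed (use B in auto)
  also have "\<dots> \<le> M.prob ?B1 + M.prob ?B2" by (rule measure_Un_le) (use B in auto)
  also have "M.prob ?B1 \<le> (\<integral>\<omega>. A \<omega> \<partial>M) / \<epsilon>"
    by (rule integral_Markov_inequality_measure[OF A_int, of "{}"]) (use b \<epsilon> in \<open>auto simp: A_def intro!: sum_nonneg\<close>)
  also have "\<dots> \<le> (\<Sum>i=m..<K. b i) * r / \<epsilon>" using A_le \<epsilon> by (intro divide_right_mono) auto
  also have "M.prob ?B2 \<le> (\<Sum>i=m..<K. (b i)\<^sup>2) * \<sigma> / \<epsilon>\<^sup>2" by (rule noise_maximal_inequality[OF m \<epsilon>])
  finally show "M.prob {\<omega> \<in> space M. \<exists>j\<in>{m..K}. 2 * \<epsilon> \<le> norm (T j \<omega>)} \<le> (\<Sum>i=m..<K. b i) * r / \<epsilon> + (\<Sum>i=m..<K. (b i)\<^sup>2) * \<sigma> / \<epsilon>\<^sup>2"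
    by simp
qed

lemma prob_coins:
  assumes I: "finite I" "I \<subseteq> {1..}"
  shows "M.prob {\<omega> \<in> space M. \<forall>i\<in>I. coin i \<omega> = c i} = (\<Prod>i\<in>I. if c i then p i else 1 - p i)"
proof (cases "I = {}")
  case True
  then show ?thesis by (simp add: M.prob_space)
next
  case False
  define A where "A i = coin i -` {c i} \<inter> space M" for i
  have single: "M.prob (A i) = (if c i then p i else 1 - p i)" if "i \<in> I" for i
  proof -
    have i: "i \<ge> 1" using that I by auto
    have ev: "{\<omega> \<in> space M. coin i \<omega>} \<in> M.events" using coin_meas[OF i] by measurable
    show ?thesis
    proof (cases "c i")
      case True
      then have "A i = {\<omega> \<in> space M. coin i \<omega>}" by (auto simp: A_def)
      then show ?thesis using coin_prob[OF i] True by simp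
    next
      case False
      then have "A i = space M - {\<omega> \<in> space M. coin i \<omega>}" by (auto simp: A_def)
      then show ?thesis using coin_prob[OF i] M.prob_compl[OF ev] False by simp
    qed
  qed
  have "M.prob (\<Inter>i\<in>Inr ` I. case_sum (\<lambda>_::nat. {}) A i) = (\<Prod>i\<in>Inr ` I. M.prob (case_sum (\<lambda>_::nat. {}) A i))"
  proof (rule M.indep_setsD[OF indep])
    show "\<forall>j\<in>Inr ` I. case_sum (\<lambda>_::nat. {}) A j \<in> case_sum (\<lambda>n. {\<zeta> n -` B \<inter> space M |B. B \<in> sets D}) (\<lambda>n. {coin n -` B \<inter> space M |B. True}) j"
    proof
      fix j :: "nat + nat" assume "j \<in> Inr ` I"
      then obtain i where "j = Inr i" by auto
      moreover have "A i \<in> {coin i -` B \<inter> space M |B. True}" unfolding A_def by blast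
      ultimately show "case_sum (\<lambda>_::nat. {}) A j \<in> case_sum (\<lambda>n. {\<zeta> n -` B \<inter> space M |B. B \<in> sets D}) (\<lambda>n. {coin n -` B \<inter> space M |B. True}) j"
        by simp
    qed
  qed (use I False in auto)
  also have "\<dots> = (\<Prod>i\<in>I. M.prob (A i))" by (subst prod.reindex) auto
  also have "(\<Inter>i\<in>Inr ` I. case_sum (\<lambda>_::nat. {}) A i) = {\<omega> \<in> space M. \<forall>i\<in>I. coin i \<omega> = c i}"
    using False by (auto simp: A_def)
  finally show ?thesis using single by simp
qed

end

section \<open>Comparing finitely many coins\<close>

definition bern :: "(nat \<Rightarrow> real) \<Rightarrow> nat set \<Rightarrow> (nat \<Rightarrow> bool) \<Rightarrow> real" where
  "bern a I c = (\<Prod>i\<in>I. if c i then a i else 1 - a i)"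

lemma sum_PiE_insert_bool:
  assumes "finite I" "i \<notin> I"
  shows "(\<Sum>c\<in>PiE (insert i I) (\<lambda>_. UNIV :: bool set). f c) = (\<Sum>c\<in>PiE I (\<lambda>_. UNIV). f (c(i := True)) + f (c(i := False)))"
proof -
  have "(\<Sum>c\<in>PiE (insert i I) (\<lambda>_. UNIV :: bool set). f c) = (\<Sum>(b, c)\<in>UNIV \<times> PiE I (\<lambda>_. UNIV). f (c(i := b)))"
    unfolding PiE_insert_eq using inj_combinator[OF assms(2), of "\<lambda>_. UNIV :: bool set"]
    by (subst sum.reindex) (auto intro!: sum.cong)
  also have "\<dots> = (\<Sum>b\<in>UNIV. \<Sum>c\<in>PiE I (\<lambda>_. UNIV). f (c(i := b)))"
    by (rule sum.cartesian_product[symmetric])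
  finally show ?thesis by (simp add: UNIV_bool sum.distrib add.commute)
qed

lemma bern_insert:
  assumes "finite I" "i \<notin> I"
  shows "bern a (insert i I) (c(i := b)) = (if b then a i else 1 - a i) * bern a I c"
proof -
  have "(\<Prod>j\<in>I. if (c(i := b)) j then a j else 1 - a j) = (\<Prod>j\<in>I. if c j then a j else 1 - a j)"
    by (rule prod.cong) (use assms in auto)
  then show ?thesis using assms by (simp add: bern_def)
qed

lemma sum_bern:
  "finite I \<Longrightarrow> (\<Sum>c\<in>PiE I (\<lambda>_. UNIV). bern a I c) = 1"
proof (induction I rule: finite_induct)
  case (insert i I)
  then show ?case
    by (subst sum_PiE_insert_bool) (simp_all add: bern_insert distrib_right[symmetric])
qed (simp add: bern_def)

lemma bern_nonneg: "(\<And>i. i \<in> I \<Longrightarrow> 0 \<le> a i \<and> a i \<le> 1) \<Longrightarrow> 0 \<le> bern a I c"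
  unfolding bern_def by (intro prod_nonneg) auto

text \<open>Total variation is subadditive over the factors of product measures; \<open>step\<close>
  exchanges one factor at a time.\<close>

lemma bern_total_variation:
  assumes "finite I" "\<And>i. i \<in> I \<Longrightarrow> 0 \<le> a i \<and> a i \<le> 1" "\<And>i. i \<in> I \<Longrightarrow> 0 \<le> b i \<and> b i \<le> 1"
  shows "(\<Sum>c\<in>PiE I (\<lambda>_. UNIV). \<bar>bern a I c - bern b I c\<bar>) \<le> 2 * (\<Sum>i\<in>I. \<bar>a i - b i\<bar>)"
  using assms
proof (induction I rule: finite_induct)
  case (insert i I)
  have step: "\<bar>s * u - t * v\<bar> \<le> s * \<bar>u - v\<bar> + \<bar>s - t\<bar> * v" if "0 \<le> s" "0 \<le> v" for s t u v :: real
  proof -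
    have "s * u - t * v = s * (u - v) + (s - t) * v" by (simp add: algebra_simps)
    then have "\<bar>s * u - t * v\<bar> \<le> \<bar>s * (u - v)\<bar> + \<bar>(s - t) * v\<bar>" using abs_triangle_ineq by metis
    then show ?thesis using that by (simp add: abs_mult)
  qed
  have a: "0 \<le> a i" "a i \<le> 1" using insert.prems by auto
  have "(\<Sum>c\<in>PiE (insert i I) (\<lambda>_. UNIV). \<bar>bern a (insert i I) c - bern b (insert i I) c\<bar>)
     = (\<Sum>c\<in>PiE I (\<lambda>_. UNIV). \<bar>a i * bern a I c - b i * bern b I c\<bar> + \<bar>(1 - a i) * bern a I c - (1 - b i) * bern b I c\<bar>)"
    using insert.hyps by (subst sum_PiE_insert_bool) (simp_all add: bern_insert)
  also have "\<dots> \<le> (\<Sum>c\<in>PiE I (\<lambda>_. UNIV). (a i * \<bar>bern a I c - bern b I c\<bar> + \<bar>a i - b i\<bar> * bern b I c)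
      + ((1 - a i) * \<bar>bern a I c - bern b I c\<bar> + \<bar>(1 - a i) - (1 - b i)\<bar> * bern b I c))"
    using a insert.prems by (intro sum_mono add_mono step bern_nonneg) auto
  also have "\<dots> = (\<Sum>c\<in>PiE I (\<lambda>_. UNIV). \<bar>bern a I c - bern b I c\<bar> + 2 * \<bar>a i - b i\<bar> * bern b I c)"
    by (intro sum.cong) (auto simp: algebra_simps abs_minus_commute)
  also have "\<dots> = (\<Sum>c\<in>PiE I (\<lambda>_. UNIV). \<bar>bern a I c - bern b I c\<bar>) + 2 * \<bar>a i - b i\<bar> * (\<Sum>c\<in>PiE I (\<lambda>_. UNIV). bern b I c)"
    by (simp add: sum.distrib sum_distrib_left)
  also have "\<dots> \<le> 2 * (\<Sum>i\<in>I. \<bar>a i - b i\<bar>) + 2 * \<bar>a i - b i\<bar>"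
    using insert.IH insert.prems sum_bern[OF insert.hyps(1), of b] by simp
  finally show ?case using insert.hyps by simp
qed (simp add: bern_def)

lemma (in prob_space) finite_coins:
  fixes \<phi> :: "(nat \<Rightarrow> bool) \<Rightarrow> real"
  assumes I: "finite I" and C: "\<And>i. i \<in> I \<Longrightarrow> C i \<in> M \<rightarrow>\<^sub>M count_space UNIV"
  shows "(\<lambda>\<omega>. \<phi> (\<lambda>i\<in>I. C i \<omega>)) \<in> borel_measurable M"
    "(\<integral>\<omega>. \<phi> (\<lambda>i\<in>I. C i \<omega>) \<partial>M) = (\<Sum>c\<in>PiE I (\<lambda>_. UNIV). \<phi> c * prob {\<omega> \<in> space M. \<forall>i\<in>I. C i \<omega> = c i})"
proof -
  let ?E = "\<lambda>c. {\<omega> \<in> space M. \<forall>i\<in>I. C i \<omega> = c i}"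
  have E: "?E c \<in> events" for c
  proof (rule sets.sets_Collect_finite_All[OF _ I])
    fix i assume "i \<in> I"
    have "C i -` {c i} \<inter> space M \<in> events" by (rule measurable_sets[OF C[OF \<open>i \<in> I\<close>]]) simp
    then show "{\<omega> \<in> space M. C i \<omega> = c i} \<in> events" by (simp add: vimage_def Int_def conj_commute)
  qed
  have fin: "finite (PiE I (\<lambda>_. UNIV :: bool set))" using I by (intro finite_PiE) auto
  have eq: "\<phi> (\<lambda>i\<in>I. C i \<omega>) = (\<Sum>c\<in>PiE I (\<lambda>_. UNIV). \<phi> c * indicator (?E c) \<omega>)" if w: "\<omega> \<in> space M" for \<omega>
  proof -
    have "(\<Sum>c\<in>PiE I (\<lambda>_. UNIV). \<phi> c * indicator (?E c) \<omega>) = (\<Sum>c\<in>{\<lambda>i\<in>I. C i \<omega>}. \<phi> c * indicator (?E c) \<omega>)"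
    proof (rule sum.mono_neutral_right[OF fin])
      show "\<forall>c\<in>PiE I (\<lambda>_. UNIV) - {\<lambda>i\<in>I. C i \<omega>}. \<phi> c * indicator (?E c) \<omega> = 0"
      proof
        fix c assume c: "c \<in> PiE I (\<lambda>_. UNIV) - {\<lambda>i\<in>I. C i \<omega>}"
        have "\<omega> \<notin> ?E c"
        proof
          assume "\<omega> \<in> ?E c"
          then have "c = (\<lambda>i\<in>I. C i \<omega>)" using c by (auto simp: PiE_def extensional_def fun_eq_iff)
          then show False using c by simp
        qed
        then show "\<phi> c * indicator (?E c) \<omega> = 0" by simp
      qed
    qed auto
    then show ?thesis using w by (simp add: indicator_def)
  qed
  show "(\<lambda>\<omega>. \<phi> (\<lambda>i\<in>I. C i \<omega>)) \<in> borel_measurable M"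
    by (subst measurable_cong[OF eq]) (use E in measurable)
  have "(\<integral>\<omega>. \<phi> (\<lambda>i\<in>I. C i \<omega>) \<partial>M) = (\<integral>\<omega>. (\<Sum>c\<in>PiE I (\<lambda>_. UNIV). \<phi> c * indicator (?E c) \<omega>) \<partial>M)"
    by (rule Bochner_Integration.integral_cong) (use eq in auto)
  also have "\<dots> = (\<Sum>c\<in>PiE I (\<lambda>_. UNIV). \<phi> c * prob (?E c))"
    using E by (subst Bochner_Integration.integral_sum) (auto intro!: sum.cong simp: emeasure_eq_measure Int_absorb2 subset_eq)
  finally show "(\<integral>\<omega>. \<phi> (\<lambda>i\<in>I. C i \<omega>) \<partial>M) = (\<Sum>c\<in>PiE I (\<lambda>_. UNIV). \<phi> c * prob (?E c))" .
qed

lemma coins_expectation_close: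
  fixes \<phi> :: "(nat \<Rightarrow> bool) \<Rightarrow> real"
  assumes "prob_space M" "prob_space P" and I: "finite I" and B: "\<And>c. \<bar>\<phi> c\<bar> \<le> B"
    and C: "\<And>i. i \<in> I \<Longrightarrow> C i \<in> M \<rightarrow>\<^sub>M count_space UNIV" "\<And>c. measure M {\<omega> \<in> space M. \<forall>i\<in>I. C i \<omega> = c i} = bern a I c"
    and C': "\<And>i. i \<in> I \<Longrightarrow> C' i \<in> P \<rightarrow>\<^sub>M count_space UNIV" "\<And>c. measure P {\<omega> \<in> space P. \<forall>i\<in>I. C' i \<omega> = c i} = bern b I c"
    and ab: "\<And>i. i \<in> I \<Longrightarrow> 0 \<le> a i \<and> a i \<le> 1" "\<And>i. i \<in> I \<Longrightarrow> 0 \<le> b i \<and> b i \<le> 1"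
  shows "\<bar>(\<integral>\<omega>. \<phi> (\<lambda>i\<in>I. C i \<omega>) \<partial>M) - (\<integral>\<omega>. \<phi> (\<lambda>i\<in>I. C' i \<omega>) \<partial>P)\<bar> \<le> 2 * B * (\<Sum>i\<in>I. \<bar>a i - b i\<bar>)"
proof -
  have "(\<integral>\<omega>. \<phi> (\<lambda>i\<in>I. C i \<omega>) \<partial>M) - (\<integral>\<omega>. \<phi> (\<lambda>i\<in>I. C' i \<omega>) \<partial>P) = (\<Sum>c\<in>PiE I (\<lambda>_. UNIV). \<phi> c * (bern a I c - bern b I c))"
    using prob_space.finite_coins(2)[OF assms(1) I C(1), where \<phi>=\<phi>] prob_space.finite_coins(2)[OF assms(2) I C'(1), where \<phi>=\<phi>] C(2) C'(2)
    by (simp add: sum_subtractf right_diff_distrib)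
  also have "\<bar>\<dots>\<bar> \<le> (\<Sum>c\<in>PiE I (\<lambda>_. UNIV). B * \<bar>bern a I c - bern b I c\<bar>)"
    using B by (intro order_trans[OF sum_abs] sum_mono) (auto simp: abs_mult intro!: mult_right_mono)
  also have "\<dots> \<le> B * (2 * (\<Sum>i\<in>I. \<bar>a i - b i\<bar>))"
    unfolding sum_distrib_left[symmetric] using bern_total_variation[OF I ab] B[of undefined]
    by (intro mult_left_mono) auto
  finally show ?thesis by (simp add: algebra_simps)
qed

lemma (in prob_space) expectation_close:
  fixes X Y :: "'a \<Rightarrow> real"
  assumes [measurable]: "X \<in> borel_measurable M" "Y \<in> borel_measurable M" and A: "A \<in> events"
    and B: "\<And>\<omega>. \<omega> \<in> space M \<Longrightarrow> \<bar>X \<omega>\<bar> \<le> B" "\<And>\<omega>. \<omega> \<in> space M \<Longrightarrow> \<bar>Y \<omega>\<bar> \<le> B"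
    and close: "AE \<omega> in M. \<omega> \<notin> A \<longrightarrow> \<bar>X \<omega> - Y \<omega>\<bar> \<le> e" and e: "0 \<le> e"
  shows "\<bar>(\<integral>\<omega>. X \<omega> \<partial>M) - (\<integral>\<omega>. Y \<omega> \<partial>M)\<bar> \<le> e + 2 * B * prob A"
proof -
  have I: "integrable M X" "integrable M Y"
    by (rule integrable_const_bound[of _ B]; use B in auto)+
  have "\<bar>(\<integral>\<omega>. X \<omega> \<partial>M) - (\<integral>\<omega>. Y \<omega> \<partial>M)\<bar> = \<bar>\<integral>\<omega>. X \<omega> - Y \<omega> \<partial>M\<bar>" using I by simp
  also have "\<dots> \<le> (\<integral>\<omega>. \<bar>X \<omega> - Y \<omega>\<bar> \<partial>M)" by (rule integral_abs_bound)
  also have "\<dots> \<le> (\<integral>\<omega>. e + 2 * B * indicator A \<omega> \<partial>M)"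
  proof (rule integral_mono_AE)
    show "AE \<omega> in M. \<bar>X \<omega> - Y \<omega>\<bar> \<le> e + 2 * B * indicator A \<omega>"
      using close AE_space
    proof eventually_elim
      case (elim \<omega>)
      have "\<bar>X \<omega> - Y \<omega>\<bar> \<le> 2 * B" using B[of \<omega>] elim by linarith
      then show ?case using elim e by (auto simp: indicator_def)
    qed
  qed (use I A in \<open>auto simp: emeasure_eq_measure\<close>)
  also have "\<dots> = e + 2 * B * prob A"
    using A by (subst Bochner_Integration.integral_add) (auto simp: prob_space emeasure_eq_measure)
  finally show ?thesis .
qed

section \<open>Resetting sequences and the interpolation grid\<close>

text \<open>The noise-free dynamics from index \<open>m\<close> on. The start at \<open>0\<close> is
  an arbitrary choice that the first reset erases.\<close>

primrec reset_seq :: "(nat \<Rightarrow> real) \<Rightarrow> 'v::real_vector \<Rightarrow> nat \<Rightarrow> (nat \<Rightarrow> bool) \<Rightarrow> nat \<Rightarrow> 'v" where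
  "reset_seq b g m c 0 = 0"
| "reset_seq b g m c (Suc i) = (if c (m + i) then 0 else reset_seq b g m c i - b (m + i) *\<^sub>R g)"

lemma reset_seq_cong:
  "(\<And>k. m \<le> k \<Longrightarrow> k < m + i \<Longrightarrow> c k = c' k) \<Longrightarrow> reset_seq b g m c i = reset_seq b g m c' i"
  by (induction i) auto

text \<open>Every reset synchronises the two sequences again, so only the errors since the last
  reset remain. They form a difference of two partial sums, which a maximal inequality controls
  without knowledge of the reset times; \<open>j\<close> is one past the last reset.\<close>

lemma reset_seq_difference:
  fixes V e :: "nat \<Rightarrow> 'v::real_vector"
  assumes V: "\<And>k. m \<le> k \<Longrightarrow> V (Suc k) = (if c k then 0 else V k - b k *\<^sub>R (g - e k))"
    and k0: "c k0" "m \<le> k0" and k: "k0 < k"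
  shows "\<exists>j\<in>{m..k}. V k - reset_seq b g m c (k - m) = (\<Sum>i=m..<k. b i *\<^sub>R e i) - (\<Sum>i=m..<j. b i *\<^sub>R e i)"
  using k
proof (induction k)
  case 0 then show ?case by simp
next
  case (Suc k)
  have km: "m \<le> k" using Suc.prems k0 by simp
  then have z: "reset_seq b g m c (Suc k - m) = (if c k then 0 else reset_seq b g m c (k - m) - b k *\<^sub>R g)"
    by (simp add: Suc_diff_le)
  show ?case
  proof (cases "c k")
    case True
    then show ?thesis using V[OF km] z km by (intro bexI[of _ "Suc k"]) auto
  next
    case False
    then have "k0 < k" using Suc.prems k0 by (cases "k = k0") auto
    then obtain j where j: "j \<in> {m..k}" "V k - reset_seq b g m c (k - m) = (\<Sum>i=m..<k. b i *\<^sub>R e i) - (\<Sum>i=m..<j. b i *\<^sub>R e i)"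
      using Suc.IH by auto
    have "V (Suc k) - reset_seq b g m c (Suc k - m) = (V k - reset_seq b g m c (k - m)) + b k *\<^sub>R e k"
    proof -
      have v: "V (Suc k) = V k - b k *\<^sub>R (g - e k)" using False V[OF km] by simp
      have z': "reset_seq b g m c (Suc k - m) = reset_seq b g m c (k - m) - b k *\<^sub>R g" using False z by simp
      show ?thesis unfolding v z' by (simp add: algebra_simps)
    qed
    then show ?thesis using j km by (intro bexI[of _ j]) auto
  qed
qed

text \<open>For the solution a jump falls inside a cell, so at the next knot it is only within
  \<open>\<theta>\<close> of \<open>0\<close>. The error of the last reset is carried along but
  never accumulates.\<close>

lemma reset_seq_close:
  fixes y :: "nat \<Rightarrow> 'v::real_normed_vector"
  assumes keep: "\<And>k. m \<le> k \<Longrightarrow> \<not> c k \<Longrightarrow> y (Suc k) = y k - b k *\<^sub>R g"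
    and reset: "\<And>k. m \<le> k \<Longrightarrow> c k \<Longrightarrow> norm (y (Suc k)) \<le> \<theta>"
    and k0: "c k0" "m \<le> k0" and k: "k0 < k"
  shows "norm (y k - reset_seq b g m c (k - m)) \<le> \<theta>"
  using k
proof (induction k)
  case (Suc k)
  have km: "m \<le> k" using Suc.prems k0 by simp
  then have z: "reset_seq b g m c (Suc k - m) = (if c k then 0 else reset_seq b g m c (k - m) - b k *\<^sub>R g)"
    by (simp add: Suc_diff_le)
  show ?case
  proof (cases "c k")
    case True
    then show ?thesis using reset[OF km] z by simp
  next
    case False
    then have "k0 < k" using Suc.prems k0 by (cases "k = k0") auto
    then show ?thesis using Suc.IH keep[OF km False] z False by simp
  qed
qed simp

locale step_grid =
  fixes b :: "nat \<Rightarrow> real"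
  assumes b_pos: "0 < b n" and b_sum: "\<not> summable b"
begin

text \<open>This is \<Gamma>_n of the setting, and \<open>index\<close> below is N(n,t).\<close>

definition clock :: "nat \<Rightarrow> real" where "clock n = (\<Sum>k=1..<n. b k)"

definition index :: "nat \<Rightarrow> real \<Rightarrow> nat" where
  "index n t = (LEAST m. n \<le> m \<and> (\<Sum>k=n..m. b k) > t)"

lemma clock_diff: "1 \<le> n \<Longrightarrow> n \<le> m \<Longrightarrow> clock m - clock n = (\<Sum>k=n..<m. b k)"
  unfolding clock_def using sum.atLeastLessThan_concat[of 1 n m b] by simp

lemma clock_Suc: "1 \<le> n \<Longrightarrow> clock (Suc n) = clock n + b n"
  by (simp add: clock_def)

lemma clock_mono: "m \<le> n \<Longrightarrow> clock m \<le> clock n"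
  unfolding clock_def using b_pos by (intro sum_mono2) (auto simp: less_imp_le)

lemma clock_less: "1 \<le> m \<Longrightarrow> m < n \<Longrightarrow> clock m < clock n"
  using clock_Suc[of m] clock_mono[of "Suc m" n] b_pos[of m] by simp

lemma clock_less_iff: "1 \<le> m \<Longrightarrow> 1 \<le> n \<Longrightarrow> clock m < clock n \<longleftrightarrow> m < n"
  using clock_less[of m n] clock_mono[of n m] by (auto simp: not_less[symmetric])

lemma clock_unbounded: "\<exists>n. c < clock n"
proof (rule ccontr)
  assume "\<nexists>n. c < clock n"
  then have le: "clock n \<le> c" for n by (auto simp: not_less)
  have "summable b"
  proof (rule bounded_imp_summable)
    show "0 \<le> b n" for n using b_pos[of n] by simp
    fix n
    have "(\<Sum>k\<le>n. b k) = b 0 + clock (Suc n)"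
    proof -
      have "{..n} = insert 0 {1..<Suc n}" by auto
      then show ?thesis by (simp add: clock_def)
    qed
    then show "(\<Sum>k\<le>n. b k) \<le> b 0 + c" using le[of "Suc n"] by simp
  qed
  then show False using b_sum by simp
qed

lemma sum_clock: "1 \<le> n \<Longrightarrow> n \<le> m \<Longrightarrow> (\<Sum>k=n..m. b k) = clock (Suc m) - clock n"
  using clock_diff[of n "Suc m"] by (simp add: atLeastLessThanSuc_atLeastAtMost)

lemma index:
  assumes n: "1 \<le> n" and t: "0 \<le> t"
  shows "n \<le> index n t" "clock (index n t) - clock n \<le> t" "t < clock (Suc (index n t)) - clock n"
proof -
  let ?Q = "\<lambda>m. n \<le> m \<and> (\<Sum>k=n..m. b k) > t"
  obtain k where k: "clock n + t < clock k" using clock_unbounded by blast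
  have "?Q (max n k)"
    using sum_clock[OF n, of "max n k"] clock_mono[OF le_SucI[OF max.cobounded2], of k n] k by auto
  then have Q: "?Q (index n t)" unfolding index_def by (rule LeastI)
  then show le: "n \<le> index n t" and "t < clock (Suc (index n t)) - clock n" using sum_clock[OF n] by auto
  show "clock (index n t) - clock n \<le> t"
  proof (cases "index n t = n")
    case False
    then obtain j where j: "index n t = Suc j" "n \<le> j" using le by (cases "index n t") auto
    have "\<not> ?Q j"
    proof
      assume "?Q j"
      then have "index n t \<le> j" unfolding index_def by (rule Least_le)
      then show False using j by simp
    qed
    then show ?thesis using j sum_clock[OF n, of j] by auto
  qed (use t in simp)
qed

lemma index_eqI:
  assumes n: "1 \<le> n" and t: "0 \<le> t" and k: "n \<le> k" "clock k - clock n \<le> t" "t < clock (Suc k) - clock n"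
  shows "index n t = k"
proof (rule antisym)
  have "clock (index n t) < clock (Suc k)" using index(2)[OF n t] k(3) by simp
  then show "index n t \<le> k" using clock_less_iff[of "index n t" "Suc k"] index(1)[OF n t] n by simp
  have "clock k < clock (Suc (index n t))" using index(3)[OF n t] k(2) by simp
  then show "k \<le> index n t" using clock_less_iff[of k "Suc (index n t)"] n k by simp
qed

lemma index_mono: "1 \<le> n \<Longrightarrow> 0 \<le> s \<Longrightarrow> s \<le> t \<Longrightarrow> index n s \<le> index n t"
proof -
  assume a: "1 \<le> n" "0 \<le> s" "s \<le> t"
  have "clock (index n s) < clock (Suc (index n t))" using index(2)[of n s] index(3)[of n t] a by simp
  then show ?thesis using clock_less_iff[of "index n s" "Suc (index n t)"] index(1)[of n s] a by simp
qed

definition knots :: "nat \<Rightarrow> real \<Rightarrow> real set" where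
  "knots n T = (\<lambda>k. clock k - clock n) ` {n..index n T}"

text \<open>It exhibits \<open>index\<close> as a function of the set of knots passed, the form that
  \<open>cadlag_on_finite_at_most\<close> accepts. The knot of \<open>n\<close> itself is at time
  \<open>0\<close>, hence the \<open>- 1\<close>.\<close>

lemma index_card:
  assumes n: "1 \<le> n" and t: "0 \<le> t" "t \<le> T"
  shows "index n t = n + card {u \<in> knots n T. u \<le> t} - 1"
proof -
  have "{u \<in> knots n T. u \<le> t} = (\<lambda>k. clock k - clock n) ` {n..index n t}"
  proof (intro equalityI subsetI)
    fix u assume "u \<in> {u \<in> knots n T. u \<le> t}"
    then obtain k where k: "u = clock k - clock n" "n \<le> k" "clock k - clock n \<le> t" by (auto simp: knots_def)
    have "clock k < clock (Suc (index n t))" using index(3)[OF n t(1)] k by simp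
    then have "k \<le> index n t" using clock_less_iff[of k "Suc (index n t)"] n k by simp
    then show "u \<in> (\<lambda>k. clock k - clock n) ` {n..index n t}" using k by auto
  next
    fix u assume "u \<in> (\<lambda>k. clock k - clock n) ` {n..index n t}"
    then obtain k where k: "u = clock k - clock n" "n \<le> k" "k \<le> index n t" by auto
    moreover have "clock k - clock n \<le> t" using clock_mono[OF k(3)] index(2)[OF n t(1)] by simp
    moreover have "k \<le> index n T" using k(3) index_mono[OF n t] by simp
    ultimately show "u \<in> {u \<in> knots n T. u \<le> t}" by (auto simp: knots_def)
  qed
  moreover have "inj_on (\<lambda>k. clock k - clock n) {n..index n t}"
    using clock_less n by (intro linorder_inj_onI) (auto simp: less_imp_neq)
  ultimately have "card {u \<in> knots n T. u \<le> t} = Suc (index n t) - n" by (simp add: card_image)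
  then show ?thesis using index(1)[OF n t(1)] by simp
qed

lemma cadlag_index:
  fixes a c :: "nat \<Rightarrow> 'v::real_normed_vector"
  assumes n: "1 \<le> n"
  shows "cadlag_on {0..T} (\<lambda>t. a (index n t) + t *\<^sub>R c (index n t))"
proof -
  have fin: "finite (knots n T)" by (simp add: knots_def)
  from cadlag_on_finite_at_most[OF this, of "{0..T}" "\<lambda>A. a (n + card A - 1)" "\<lambda>A. c (n + card A - 1)"]
  show ?thesis
    by (subst cadlag_on_cong[where y="\<lambda>t. a (n + card {u \<in> knots n T. u \<le> t} - 1) + t *\<^sub>R c (n + card {u \<in> knots n T. u \<le> t} - 1)"])
      (use index_card[OF n] in auto)
qed

definition grid :: "nat \<Rightarrow> real \<Rightarrow> real set" where
  "grid n T = insert T (knots n T)"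

lemma grid_props:
  assumes n: "1 \<le> n" and T: "0 < T"
  shows "finite (grid n T)" "0 \<in> grid n T" "grid n T \<subseteq> {0..T}"
    and "\<And>t. 0 \<le> t \<Longrightarrow> t < T \<Longrightarrow> grid_floor (grid n T) t = clock (index n t) - clock n"
    and "grid_floor (grid n T) T = T"
    and "(\<And>k. n \<le> k \<Longrightarrow> b k \<le> \<theta>) \<Longrightarrow> is_grid T \<theta> (grid n T)"
proof -
  have le: "index n T \<ge> n" by (rule index) (use n T in auto)
  show fin: "finite (grid n T)" by (simp add: grid_def knots_def)
  show zero: "0 \<in> grid n T" using le by (auto simp: grid_def knots_def intro!: image_eqI[of _ _ n])
  show sub: "grid n T \<subseteq> {0..T}"
  proof
    fix u assume "u \<in> grid n T"
    then consider "u = T" | k where "u = clock k - clock n" "n \<le> k" "k \<le> index n T" by (auto simp: grid_def knots_def)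
    then show "u \<in> {0..T}"
    proof cases
      case (2 k)
      then show ?thesis using clock_mono[of n k] clock_mono[of k "index n T"] index(2)[OF n, of T] T by auto
    qed (use T in auto)
  qed
  show "grid_floor (grid n T) t = clock (index n t) - clock n" if t: "0 \<le> t" "t < T" for t
  proof (rule antisym)
    note i = index[OF n t(1)]
    have mem: "clock (index n t) - clock n \<in> grid n T"
      using i(1) index_mono[OF n t(1), of T] t by (auto simp: grid_def knots_def)
    show "clock (index n t) - clock n \<le> grid_floor (grid n T) t" by (rule grid_floor_ge[OF fin mem i(2)])
    have f: "grid_floor (grid n T) t \<in> grid n T" "grid_floor (grid n T) t \<le> t" using grid_floor_mem[OF fin zero t(1)] by auto
    then obtain k where k: "grid_floor (grid n T) t = clock k - clock n" "n \<le> k" using t by (auto simp: grid_def knots_def)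
    then have "clock k < clock (Suc (index n t))" using f(2) i(3) by simp
    then have "k \<le> index n t" using clock_less_iff[of k "Suc (index n t)"] n k by simp
    then show "grid_floor (grid n T) t \<le> clock (index n t) - clock n" using k clock_mono by simp
  qed
  show "grid_floor (grid n T) T = T"
    using grid_floor_mem[OF fin zero, of T] grid_floor_ge[OF fin, of T T] T by (auto simp: grid_def)
  assume b: "\<And>k. n \<le> k \<Longrightarrow> b k \<le> \<theta>"
  show "is_grid T \<theta> (grid n T)"
    unfolding is_grid_def
  proof (intro conjI ballI fin sub zero)
    show "T \<in> grid n T" by (simp add: grid_def)
    fix t assume t: "t \<in> {0..T}"
    note i = index[OF n, of t]
    have Suc: "clock (Suc (index n t)) = clock (index n t) + b (index n t)" using i(1) t n by (intro clock_Suc) auto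
    show "\<exists>u\<in>grid n T. t \<le> u \<and> u \<le> t + \<theta>"
    proof (cases "Suc (index n t) \<le> index n T")
      case True
      then have "clock (Suc (index n t)) - clock n \<in> grid n T" using i(1) t by (auto simp: grid_def knots_def)
      then show ?thesis using i t Suc b[of "index n t"] by (intro bexI[of _ "clock (Suc (index n t)) - clock n"]) auto
    next
      case False
      then have "index n t = index n T" using index_mono[OF n, of t T] t by simp
      then have "T \<le> t + \<theta>" using index(3)[OF n, of T] i t T Suc b[of "index n t"] by simp
      then show ?thesis using t by (intro bexI[of _ T]) (auto simp: grid_def)
    qed
  qed
qed

end

section \<open>The limit process on the grid\<close>

text \<open>The induction carries along that the pattern up to \<open>t K\<close> lies in
  \<open>F (t K)\<close>; the next cell is then independent of it, and a jump there is the
  complement of no jump.\<close>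

lemma (in reset_solution) prob_jump_pattern:
  fixes t :: "nat \<Rightarrow> real"
  assumes t: "0 \<le> t m" "\<And>k. m \<le> k \<Longrightarrow> t (Suc k) = t k + b k" "\<And>k. 0 \<le> b k" and mK: "m \<le> K"
  shows "{\<omega> \<in> space P. \<forall>i\<in>{m..<K}. (N (t i) \<omega> \<noteq> N (t (Suc i)) \<omega>) = c i} \<in> sets (F (t K)) \<and>
    prob {\<omega> \<in> space P. \<forall>i\<in>{m..<K}. (N (t i) \<omega> \<noteq> N (t (Suc i)) \<omega>) = c i} = bern (\<lambda>i. 1 - exp (- (\<gamma> * b i))) {m..<K} c \<and> 0 \<le> t K"
  using mK
proof (induction K rule: dec_induct)
  case base
  then show ?case using t(1) sets.top[of "F (t m)"] by (simp add: bern_def prob_space space_F)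
next
  case (step K)
  let ?A = "{\<omega> \<in> space P. \<forall>i\<in>{m..<K}. (N (t i) \<omega> \<noteq> N (t (Suc i)) \<omega>) = c i}"
  let ?E = "{\<omega> \<in> space P. N (t K) \<omega> = N (t (Suc K)) \<omega>}"
  have tK: "0 \<le> t K" "t K \<le> t (Suc K)" "t (Suc K) - t K = b K" using step t(2)[of K] t(3)[of K] by auto
  have A: "?A \<in> sets (F (t K))" using step by auto
  have A': "?A \<in> sets (F (t (Suc K)))" using A sets_F_mono[OF tK(2)] by blast
  have E: "?E \<in> sets (F (t (Suc K)))" by (rule N_eq_event_F[OF tK(1,2)])
  have AP: "?A \<in> events" "?E \<in> events" using A E sets_F_le by blast+
  have eq: "{\<omega> \<in> space P. \<forall>i\<in>{m..<Suc K}. (N (t i) \<omega> \<noteq> N (t (Suc i)) \<omega>) = c i} = (if c K then ?A - (?A \<inter> ?E) else ?A \<inter> ?E)"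
    using step.hyps by (auto simp: less_Suc_eq)
  have pE: "prob (?A \<inter> ?E) = prob ?A * exp (- (\<gamma> * b K))"
    using indep_eq[OF A tK(1) order_refl tK(2)] tK(3) by simp
  have pD: "prob (?A - (?A \<inter> ?E)) = prob ?A - prob (?A \<inter> ?E)"
    by (rule finite_measure_Diff) (use AP in auto)
  have ins: "{m..<Suc K} = insert K {m..<K}" using step.hyps by auto
  have "bern (\<lambda>i. 1 - exp (- (\<gamma> * b i))) {m..<Suc K} c
      = (if c K then 1 - exp (- (\<gamma> * b K)) else exp (- (\<gamma> * b K))) * bern (\<lambda>i. 1 - exp (- (\<gamma> * b i))) {m..<K} c"
    unfolding bern_def ins by simp
  then show ?case
    unfolding eq using step.IH pE pD A' E tK by (auto simp: algebra_simps)
qed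

text \<open>A sampled path is a measurable function of finitely many coordinates, so equality of
  finite-dimensional laws is enough.\<close>

lemma stationary_grid_expectation:
  fixes Y :: "real \<Rightarrow> 'w \<Rightarrow> 'v::euclidean_space" and h :: "(real \<Rightarrow> 'v) \<Rightarrow> real"
  assumes st: "stationary_process P Y" and Y: "\<And>t. 0 \<le> t \<Longrightarrow> Y t \<in> borel_measurable P"
    and H: "finite H" "0 \<in> H" "H \<subseteq> {0..}" and S: "0 \<le> S"
    and h: "h \<in> borel_measurable (borel_of (skorokhod_topology T))"
  shows "(\<integral>\<omega>. h (process_path T (\<lambda>t. Y (grid_floor H t)) \<omega>) \<partial>P) = (\<integral>\<omega>. h (process_path T (\<lambda>t. Y (grid_floor H t + S)) \<omega>) \<partial>P)"
proof -
  define \<Psi> where "\<Psi> = (\<lambda>f. h (process_path T (\<lambda>t f. f (grid_floor H t)) f))"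
  have "process_path T (\<lambda>t f. f (grid_floor H t)) \<in> PiM H (\<lambda>_. borel :: 'v measure) \<rightarrow>\<^sub>M borel_of (skorokhod_topology T)"
    by (rule measurable_path_grid_floor[where Y="\<lambda>t f. f t"]) (use H in auto)
  then have \<Psi>: "\<Psi> \<in> borel_measurable (PiM H (\<lambda>_. borel :: 'v measure))"
    unfolding \<Psi>_def by (rule measurable_compose[OF _ h])
  have X: "(\<lambda>\<omega>. \<lambda>t\<in>H. Y (t + s) \<omega>) \<in> P \<rightarrow>\<^sub>M PiM H (\<lambda>_. borel)" if "0 \<le> s" for s
    using H that by (intro measurable_restrict Y) auto
  have eq: "\<Psi> (\<lambda>t\<in>H. Y (t + s) \<omega>) = h (process_path T (\<lambda>t. Y (grid_floor H t + s)) \<omega>)" for s \<omega>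
  proof -
    have "(\<lambda>t\<in>H. Y (t + s) \<omega>) (grid_floor H t) = Y (grid_floor H t + s) \<omega>" if "t \<in> {0..T}" for t
      using grid_floor_mem(1)[OF H(1,2), of t] that by simp
    then show ?thesis unfolding \<Psi>_def process_path_def by (intro arg_cong[where f=h] restrict_ext) 
  qed
  have int: "(\<integral>\<omega>. h (process_path T (\<lambda>t. Y (grid_floor H t + s)) \<omega>) \<partial>P)
      = (\<integral>f. \<Psi> f \<partial>distr P (PiM H (\<lambda>_. borel)) (\<lambda>\<omega>. \<lambda>t\<in>H. Y (t + s) \<omega>))" if "0 \<le> s" for s
    by (subst integral_distr[OF X[OF that] \<Psi>]) (simp add: eq)
  have "distr P (PiM H (\<lambda>_. borel)) (\<lambda>\<omega>. \<lambda>t\<in>H. Y (t + S) \<omega>) = distr P (PiM H (\<lambda>_. borel)) (\<lambda>\<omega>. \<lambda>t\<in>H. Y t \<omega>)"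
    using st H S unfolding stationary_process_def by blast
  then show ?thesis using int[of S] int[of 0] S by simp
qed

lemma exp_error: "0 \<le> x \<Longrightarrow> \<bar>x - (1 - exp (- x))\<bar> \<le> x\<^sup>2" for x :: real
proof -
  assume x: "0 \<le> x"
  have 1: "1 - x \<le> exp (- x)" using exp_ge_add_one_self[of "- x"] by simp
  have "(1 + x) * exp (- x) \<le> exp x * exp (- x)" using exp_ge_add_one_self[of x] by (intro mult_right_mono) auto
  then have "(1 + x) * exp (- x) \<le> 1" by (simp add: exp_add[symmetric])
  \<comment> \<open>The product is 1 + x^3.\<close>
  also have "1 \<le> (1 + x) * (1 - x + x\<^sup>2)" using x by (simp add: algebra_simps power2_eq_square)
  finally have "exp (- x) \<le> 1 - x + x\<^sup>2" using x by (metis mult_le_cancel_left_pos add_pos_nonneg zero_less_one)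
  then show ?thesis using 1 by simp
qed

section \<open>Both processes against the path driven by finitely many coins\<close>

definition lipschitz_functional :: "real \<Rightarrow> real \<Rightarrow> real \<Rightarrow> ((real \<Rightarrow> 'v::metric_space) \<Rightarrow> real) \<Rightarrow> bool" where
  "lipschitz_functional T K B h \<longleftrightarrow> 0 \<le> K \<and> (\<forall>x\<in>cadlag_space T. \<forall>y\<in>cadlag_space T. \<bar>h x - h y\<bar> \<le> K * skorokhod_dist T x y)
     \<and> (\<forall>x\<in>cadlag_space T. \<bar>h x\<bar> \<le> B)"

lemma lipschitz_functional_measurable:
  "lipschitz_functional T K B h \<Longrightarrow> h \<in> borel_measurable (borel_of (skorokhod_topology T))"
  unfolding skorokhod_topology_def lipschitz_functional_def
  by (intro continuous_map_measurable_real skorokhod.lipschitz_continuous_map_real) auto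

lemma lipschitz_functional_sup:
  assumes h: "lipschitz_functional T K B h" and xy: "cadlag_on {0..T} x" "cadlag_on {0..T} y"
    and le: "\<And>t. t \<in> {0..T} \<Longrightarrow> dist (x t) (y t) \<le> e" and e: "0 \<le> e"
  shows "\<bar>h (restrict x {0..T}) - h (restrict y {0..T})\<bar> \<le> K * e"
proof -
  have "\<bar>h (restrict x {0..T}) - h (restrict y {0..T})\<bar> \<le> K * skorokhod_dist T (restrict x {0..T}) (restrict y {0..T})"
    using h xy unfolding lipschitz_functional_def by (auto simp: restrict_cadlag_space)
  also have "\<dots> \<le> K * e"
    using h xy le e by (intro mult_left_mono skorokhod_dist_le_sup) (auto simp: restrict_cadlag_space lipschitz_functional_def)
  finally show ?thesis .
qed

definition coin_functional ::
  "((real \<Rightarrow> 'v::real_normed_vector) \<Rightarrow> real) \<Rightarrow> real \<Rightarrow> (nat \<Rightarrow> real) \<Rightarrow> 'v \<Rightarrow> nat \<Rightarrow> (real \<Rightarrow> nat) \<Rightarrow> (nat \<Rightarrow> bool) \<Rightarrow> real" where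
  "coin_functional h T b g m i c = h (restrict (\<lambda>t. reset_seq b g m c (i t - m)) {0..T})"

context step_grid
begin

lemma cadlag_reset_path:
  fixes g :: "'v::real_normed_vector"
  shows "1 \<le> n \<Longrightarrow> cadlag_on {0..T} (\<lambda>t. reset_seq b g m c (index n t - m))"
  using cadlag_index[of n T "\<lambda>i. reset_seq b g m c (i - m)" "\<lambda>_. 0"] by simp

text \<open>Only finitely many coins enter: the knot before \<open>T\<close> has seen none from
  \<open>index n T\<close> on.\<close>

lemma coin_functional_restrict:
  fixes g :: "'v::real_normed_vector"
  assumes n: "1 \<le> n" and mn: "m \<le> n"
  shows "coin_functional h T b g m (index n) (\<lambda>i\<in>{m..<index n T}. c i) = coin_functional h T b g m (index n) c"
  unfolding coin_functional_def
proof (intro arg_cong[where f=h] restrict_ext reset_seq_cong)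
  fix t k assume t: "t \<in> {0..T}" and k: "m \<le> k" "k < m + (index n t - m)"
  have "index n t \<le> index n T" "n \<le> index n t" using index_mono[OF n, of t T] index(1)[OF n, of t] t by auto
  then have "k < index n T" using k mn by simp
  then show "(\<lambda>i\<in>{m..<index n T}. c i) k = c k" using k by simp
qed

lemma coin_functional_bound:
  fixes g :: "'v::real_normed_vector"
  shows "lipschitz_functional T K B h \<Longrightarrow> 1 \<le> n \<Longrightarrow> \<bar>coin_functional h T b g m (index n) c\<bar> \<le> B"
  unfolding coin_functional_def lipschitz_functional_def by (auto simp: restrict_cadlag_space cadlag_reset_path)

text \<open>Time is shifted so that knot \<open>m\<close> is time \<open>0\<close> and knot
  \<open>n\<close> is \<open>S\<close>. If the window contains a jump, one of its cells is marked by
  \<open>C\<close>, and from then on \<open>reset_seq_close\<close> with error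
  \<open>\<theta> * norm g\<close> applies at the knots.\<close>

lemma solution_coins_close:
  fixes g :: "'v::euclidean_space" and P :: "'w measure" and F and N and Y and \<gamma>
  assumes sol: "reset_solution \<gamma> g P F N Y" and h: "lipschitz_functional T Lh B h"
    and mn: "1 \<le> m" "m \<le> n" and T: "0 < T" and \<theta>: "\<And>k. m \<le> k \<Longrightarrow> b k \<le> \<theta>"
  defines "S \<equiv> clock n - clock m"
  defines "C \<equiv> (\<lambda>i \<omega>. N (clock i - clock m) \<omega> \<noteq> N (clock (Suc i) - clock m) \<omega>)"
  shows "\<bar>(\<integral>\<omega>. h (process_path T (\<lambda>t. Y (grid_floor (grid n T) t + S)) \<omega>) \<partial>P)
      - (\<integral>\<omega>. coin_functional h T b g m (index n) (\<lambda>i\<in>{m..<index n T}. C i \<omega>) \<partial>P)\<bar>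
    \<le> Lh * (2 * \<theta> * norm g) + 2 * B * (exp (- (\<gamma> * S)) + \<gamma> * \<theta>)"
proof -
  interpret reset_solution \<gamma> g P F N Y by fact
  have n: "1 \<le> n" using mn by simp
  have g_nn: "0 \<le> norm g" by simp
  have \<theta>0: "0 \<le> \<theta>" using \<theta>[of m] b_pos[of m] by simp
  define K where "K = index n T"
  define t where "t k = clock k - clock m" for k
  have K: "n \<le> K" "clock K - clock n \<le> T" "T < clock (Suc K) - clock n" using index[OF n, of T] T by (auto simp: K_def)
  have tS: "t n = S" "t m = 0" by (simp_all add: t_def S_def)
  have t_Suc: "t (Suc k) = t k + b k" if "m \<le> k" for k using clock_Suc[of k] that mn by (simp add: t_def)
  have t0: "0 \<le> t k" if "m \<le> k" for k using clock_mono[OF that] by (simp add: t_def)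
  have S0: "0 \<le> S" using t0[OF mn(2)] tS by simp
  have tK: "t K \<le> S + T" "S + T - t K \<le> \<theta>" "0 \<le> t K"
    using K clock_Suc[of K] mn \<theta>[of K] t0[of K] by (auto simp: t_def S_def)
  \<comment> \<open>Apart from an empty window, a jump in the incomplete last cell must be excluded:
    the sample at \<open>S + T\<close> comes after the last knot \<open>t K\<close>, and no
    indicator records what happens in between.\<close>
  define A where "A = {\<omega> \<in> space P. N 0 \<omega> = N S \<omega>} \<union> (space P - {\<omega> \<in> space P. N (t K) \<omega> = N (S + T) \<omega>})"
  have ev: "{\<omega> \<in> space P. N 0 \<omega> = N S \<omega>} \<in> events" "{\<omega> \<in> space P. N (t K) \<omega> = N (S + T) \<omega>} \<in> events"
    using S0 tK by (auto intro!: N_eq_event)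
  have A: "A \<in> events" unfolding A_def using ev by auto
  have "prob A \<le> prob {\<omega> \<in> space P. N 0 \<omega> = N S \<omega>} + prob (space P - {\<omega> \<in> space P. N (t K) \<omega> = N (S + T) \<omega>})"
    unfolding A_def by (rule measure_Un_le) (use ev in auto)
  also have "\<dots> = exp (- (\<gamma> * S)) + (1 - exp (- (\<gamma> * (S + T - t K))))"
    using prob_eq[of 0 S] prob_eq[OF tK(3,1)] prob_compl[OF ev(2)] S0 by simp
  also have "\<dots> \<le> exp (- (\<gamma> * S)) + \<gamma> * \<theta>"
    using exp_ge_add_one_self[of "- (\<gamma> * (S + T - t K))"] mult_left_mono[OF tK(2) less_imp_le[OF \<gamma>]] by linarith
  finally have pA: "prob A \<le> exp (- (\<gamma> * S)) + \<gamma> * \<theta>" .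
  have B0: "0 \<le> B" using coin_functional_bound[OF h n, of g m undefined] by simp
  have C_meas: "C i \<in> P \<rightarrow>\<^sub>M count_space UNIV" if "i \<in> {m..<K}" for i
  proof -
    have "{\<omega> \<in> space P. N (t i) \<omega> = N (t (Suc i)) \<omega>} \<in> events"
      using that t0[of i] t_Suc[of i] b_pos[of i] by (intro N_eq_event) auto
    then have "Measurable.pred P (\<lambda>\<omega>. \<not> (N (t i) \<omega> = N (t (Suc i)) \<omega>))" by (simp add: pred_def)
    then show ?thesis unfolding C_def t_def by simp
  qed
  have path: "process_path T (\<lambda>r. Y (grid_floor (grid n T) r + S)) \<in> P \<rightarrow>\<^sub>M borel_of (skorokhod_topology T)"
    using grid_props(1-3)[OF n T] S0 by (intro measurable_path_grid_floor[where Y="\<lambda>u. Y (u + S)"] Y_measurable) auto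
  have cad: "cadlag_on {0..T} (\<lambda>r. Y (grid_floor (grid n T) r + S) \<omega>)" for \<omega>
    using cadlag_on_grid_floor[OF grid_props(1)[OF n T], of _ "\<lambda>u. Y (u + S) \<omega>"] .
  have "\<bar>(\<integral>\<omega>. h (process_path T (\<lambda>r. Y (grid_floor (grid n T) r + S)) \<omega>) \<partial>P)
      - (\<integral>\<omega>. coin_functional h T b g m (index n) (\<lambda>i\<in>{m..<K}. C i \<omega>) \<partial>P)\<bar> \<le> Lh * (2 * \<theta> * norm g) + 2 * B * prob A"
  proof (rule expectation_close[OF _ _ A])
    show "(\<lambda>\<omega>. h (process_path T (\<lambda>r. Y (grid_floor (grid n T) r + S)) \<omega>)) \<in> borel_measurable P"
      by (rule measurable_compose[OF path lipschitz_functional_measurable[OF h]])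
    show "(\<lambda>\<omega>. coin_functional h T b g m (index n) (\<lambda>i\<in>{m..<K}. C i \<omega>)) \<in> borel_measurable P"
      by (rule finite_coins(1)) (use C_meas in auto)
    show "\<bar>h (process_path T (\<lambda>r. Y (grid_floor (grid n T) r + S)) \<omega>)\<bar> \<le> B" for \<omega>
      using h cad by (auto simp: lipschitz_functional_def process_path_def restrict_cadlag_space)
    show "\<bar>coin_functional h T b g m (index n) (\<lambda>i\<in>{m..<K}. C i \<omega>)\<bar> \<le> B" for \<omega>
      by (rule coin_functional_bound[OF h n])
    show "0 \<le> Lh * (2 * \<theta> * norm g)" using h \<theta>0 by (simp add: lipschitz_functional_def)
    show "AE \<omega> in P. \<omega> \<notin> A \<longrightarrow> \<bar>h (process_path T (\<lambda>r. Y (grid_floor (grid n T) r + S)) \<omega>)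
        - coin_functional h T b g m (index n) (\<lambda>i\<in>{m..<K}. C i \<omega>)\<bar> \<le> Lh * (2 * \<theta> * norm g)"
      using AE_reset_drift AE_space
    proof eventually_elim
      case (elim \<omega>)
      show ?case
      proof
        assume "\<omega> \<notin> A"
        then have jump: "N 0 \<omega> \<noteq> N S \<omega>" and last: "N (t K) \<omega> = N (S + T) \<omega>" using elim by (auto simp: A_def)
        have "\<exists>k0. m \<le> k0 \<and> k0 < n \<and> C k0 \<omega>"
        proof (rule ccontr)
          assume no: "\<not> ?thesis"
          have "N (t k) \<omega> = N (t m) \<omega>" if "m \<le> k" "k \<le> n" for k
            using that
          proof (induction k rule: dec_induct)
            case (step k)
            then show ?case using no by (auto simp: C_def t_def)
          qed simp
          from this[of n] show False using mn jump tS by simp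
        qed
        then obtain k0 where k0: "m \<le> k0" "k0 < n" "C k0 \<omega>" by blast
        have close: "norm (Y (t k) \<omega> - reset_seq b g m (\<lambda>i. C i \<omega>) (k - m)) \<le> \<theta> * norm g" if "n \<le> k" for k
        proof (rule reset_seq_close[where y="\<lambda>k. Y (t k) \<omega>" and c="\<lambda>i. C i \<omega>" and ?k0.0=k0])
          fix k assume k: "m \<le> k"
          have lt: "t k < t (Suc k)" "t (Suc k) - t k = b k" using t_Suc[OF k] b_pos[of k] by auto
          show "Y (t (Suc k)) \<omega> = Y (t k) \<omega> - b k *\<^sub>R g" if "\<not> C k \<omega>"
          proof -
            have "N (t k) \<omega> = N (t (Suc k)) \<omega>" using that by (simp add: C_def t_def)
            then show ?thesis using elim(1) lt t0[OF k] unfolding reset_drift_def by metis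
          qed
          show "norm (Y (t (Suc k)) \<omega>) \<le> \<theta> * norm g" if "C k \<omega>"
          proof -
            have "N (t k) \<omega> \<noteq> N (t (Suc k)) \<omega>" using that by (simp add: C_def t_def)
            then obtain a where "0 \<le> a" "a < b k" "Y (t (Suc k)) \<omega> = - (a *\<^sub>R g)"
              using elim(1) lt t0[OF k] unfolding reset_drift_def by metis
            then show ?thesis using \<theta>[OF k] by (auto intro!: mult_right_mono)
          qed
        qed (use k0 that in auto)
        have sup: "dist (Y (grid_floor (grid n T) r + S) \<omega>) (reset_seq b g m (\<lambda>i. C i \<omega>) (index n r - m)) \<le> 2 * \<theta> * norm g"
          if r: "r \<in> {0..T}" for r
        proof (cases "r = T")
          case False
          then have r: "0 \<le> r" "r < T" using r by auto
          have "grid_floor (grid n T) r + S = t (index n r)" using grid_props(4)[OF n T r] by (simp add: t_def S_def)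
          then show ?thesis
            using close[OF index(1)[OF n r(1)]] mult_nonneg_nonneg[OF \<theta>0 g_nn] by (simp add: dist_norm)
        next
          case True
          \<comment> \<open>The last sample has drifted beyond the last knot, which costs a second
            \<open>\<theta> * norm g\<close>.\<close>
          have eq: "Y (T + S) \<omega> = Y (t K) \<omega> - (S + T - t K) *\<^sub>R g"
          proof (cases "t K = S + T")
            case False
            then have "t K < S + T" using tK by simp
            then show ?thesis using elim(1) last tK(3) unfolding reset_drift_def by (metis add.commute)
          qed (simp add: add.commute)
          have "norm (Y (T + S) \<omega> - reset_seq b g m (\<lambda>i. C i \<omega>) (K - m))
              = norm ((Y (t K) \<omega> - reset_seq b g m (\<lambda>i. C i \<omega>) (K - m)) - (S + T - t K) *\<^sub>R g)"
            unfolding eq by (simp add: algebra_simps)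
          also have "\<dots> \<le> norm (Y (t K) \<omega> - reset_seq b g m (\<lambda>i. C i \<omega>) (K - m)) + norm ((S + T - t K) *\<^sub>R g)"
            by (rule norm_triangle_ineq4)
          also have "\<dots> \<le> \<theta> * norm g + \<theta> * norm g"
            using close[OF K(1)] tK by (intro add_mono) (auto intro!: mult_right_mono)
          finally show ?thesis using True grid_props(5)[OF n T] by (simp add: dist_norm K_def)
        qed
        show "\<bar>h (process_path T (\<lambda>r. Y (grid_floor (grid n T) r + S)) \<omega>)
          - coin_functional h T b g m (index n) (\<lambda>i\<in>{m..<K}. C i \<omega>)\<bar> \<le> Lh * (2 * \<theta> * norm g)"
          unfolding K_def coin_functional_restrict[OF n mn(2)]
          unfolding coin_functional_def process_path_def
          by (rule lipschitz_functional_sup[OF h cad cadlag_reset_path[OF n] sup]) (use \<theta>0 in auto)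
      qed
    qed
  qed
  also have "\<dots> \<le> Lh * (2 * \<theta> * norm g) + 2 * B * (exp (- (\<gamma> * S)) + \<gamma> * \<theta>)"
    using pA B0 by (intro add_left_mono mult_left_mono) auto
  finally show ?thesis by (simp add: K_def)
qed

end

section \<open>The rescaled iterates over a window\<close>

locale lpsa_window = lpsa M D PA gradf G \<zeta> coin x x1 xstar \<eta> p L \<mu> \<sigma> + step_grid b
  for M :: "'a measure" and D :: "'z measure" and PA :: "'v::euclidean_space \<Rightarrow> 'v" and gradf G \<zeta> coin x x1 xstar \<eta> p L \<mu> \<sigma>
    and b :: "nat \<Rightarrow> real" +
  fixes \<gamma> :: real and V d :: "nat \<Rightarrow> 'a \<Rightarrow> 'v"
  assumes \<gamma>: "0 < \<gamma>" and p_eq: "p n = min (\<gamma> * b n) 1"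
    and V_Suc: "1 \<le> k \<Longrightarrow> V (Suc k) \<omega> = (if coin k \<omega> then 0 else V k \<omega> - b k *\<^sub>R (d k \<omega> - PA (xi k \<omega>)))"
    and V_meas: "1 \<le> k \<Longrightarrow> V k \<in> borel_measurable M" and d_meas: "1 \<le> k \<Longrightarrow> d k \<in> borel_measurable M"
    and d_int: "1 \<le> k \<Longrightarrow> integrable M (\<lambda>\<omega>. norm (gradf xstar - d k \<omega>))"
begin

definition interpolated :: "nat \<Rightarrow> real \<Rightarrow> 'a \<Rightarrow> 'v" where
  "interpolated n t \<omega> = V (index n t) \<omega>
     - (t - (clock (index n t) - clock n)) *\<^sub>R (d (index n t) \<omega> - PA (xi (index n t) \<omega>))"

lemma cadlag_interpolated:
  assumes n: "1 \<le> n" shows "cadlag_on {0..T} (\<lambda>t. interpolated n t \<omega>)"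
proof -
  have "interpolated n t \<omega> = (V (index n t) \<omega> + (clock (index n t) - clock n) *\<^sub>R (d (index n t) \<omega> - PA (xi (index n t) \<omega>)))
      + t *\<^sub>R (- (d (index n t) \<omega> - PA (xi (index n t) \<omega>)))" for t
    by (simp add: interpolated_def algebra_simps)
  then show ?thesis
    using cadlag_index[OF n, of T "\<lambda>i. V i \<omega> + (clock i - clock n) *\<^sub>R (d i \<omega> - PA (xi i \<omega>))" "\<lambda>i. - (d i \<omega> - PA (xi i \<omega>))"]
    by simp
qed

lemma measurable_interpolated_path:
  assumes n: "1 \<le> n" and T: "0 < T"
  shows "process_path T (interpolated n) \<in> M \<rightarrow>\<^sub>M borel_of (skorokhod_topology T)"
proof (rule measurable_process_path[OF _ T])
  show "interpolated n t \<in> borel_measurable M" if "t \<in> {0..T}" for t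
  proof -
    have i: "1 \<le> index n t" using index(1)[OF n, of t] n that by simp
    note [measurable] = V_meas[OF i] d_meas[OF i] xi_measurable[OF i] PA_measurable
    show ?thesis unfolding interpolated_def[abs_def] by measurable
  qed
qed (rule cadlag_interpolated[OF n])

text \<open>Bad events are a window without reset and a partial error sum of size
  \<open>2 * \<epsilon>\<close>. Otherwise the error at a knot is a difference of two partial sums,
  at most \<open>4 * \<epsilon>\<close>. Inside a cell the linear motion is bounded by its full
  length, at most \<open>\<theta> * norm g\<close> plus one increment of the sums, again
  \<open>4 * \<epsilon>\<close>; the last cell is why the sums run up to
  \<open>Suc K\<close>.\<close>

lemma interpolated_coins_close:
  assumes h: "lipschitz_functional T Lh B h"
    and mn: "1 \<le> m" "m \<le> n" and T: "0 < T" and \<theta>: "\<And>k. m \<le> k \<Longrightarrow> b k \<le> \<theta>" "\<And>k. m \<le> k \<Longrightarrow> \<gamma> * b k \<le> 1"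
    and \<rho>: "\<And>k. m \<le> k \<Longrightarrow> (\<integral>\<omega>. norm (gradf xstar - d k \<omega>) \<partial>M) \<le> \<rho>" and \<epsilon>: "0 < \<epsilon>"
  defines "K \<equiv> index n T"
  shows "\<bar>(\<integral>\<omega>. coin_functional h T b (gradf xstar) m (index n) (\<lambda>i\<in>{m..<K}. coin i \<omega>) \<partial>M) - (\<integral>\<omega>. h (process_path T (interpolated n) \<omega>) \<partial>M)\<bar>
    \<le> Lh * (8 * \<epsilon> + \<theta> * norm (gradf xstar)) + 2 * B * (exp (- (\<gamma> * (clock n - clock m)))
        + ((\<Sum>i=m..<Suc K. b i) * \<rho> / \<epsilon> + (\<Sum>i=m..<Suc K. (b i)\<^sup>2) * \<sigma> / \<epsilon>\<^sup>2))"
proof -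
  define g where "g = gradf xstar"
  have n: "1 \<le> n" using mn by simp
  have \<theta>0: "0 \<le> \<theta>" using \<theta>(1)[of m] b_pos[of m] by simp
  have B0: "0 \<le> B" using coin_functional_bound[OF h n, of g m undefined] by simp
  define e where "e i \<omega> = g - d i \<omega> + PA (xi i \<omega>)" for i \<omega>
  define U where "U j \<omega> = (\<Sum>i=m..<j. b i *\<^sub>R e i \<omega>)" for j \<omega>
  let ?A1 = "{\<omega> \<in> space M. \<forall>i\<in>{m..<n}. coin i \<omega> = False}"
  let ?A2 = "{\<omega> \<in> space M. \<exists>j\<in>{m..Suc K}. 2 * \<epsilon> \<le> norm (U j \<omega>)}"
  have A1: "?A1 \<in> M.events"
  proof (rule sets.sets_Collect_finite_All)
    fix i assume "i \<in> {m..<n}"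
    then have [measurable]: "coin i \<in> M \<rightarrow>\<^sub>M count_space UNIV" using mn by (intro coin_meas) auto
    show "{\<omega> \<in> space M. coin i \<omega> = False} \<in> M.events" by measurable
  qed simp
  have A2: "?A2 \<in> M.events" "M.prob ?A2 \<le> (\<Sum>i=m..<Suc K. b i) * \<rho> / \<epsilon> + (\<Sum>i=m..<Suc K. (b i)\<^sup>2) * \<sigma> / \<epsilon>\<^sup>2"
    unfolding U_def e_def
    by (rule drift_noise_sum_bound[where r=\<rho>]; use mn \<epsilon> b_pos d_meas d_int \<rho> in \<open>auto simp: g_def less_imp_le\<close>)+
  have "M.prob ?A1 = (\<Prod>i\<in>{m..<n}. 1 - p i)"
    using prob_coins[of "{m..<n}" "\<lambda>_. False"] mn by (auto simp: subset_eq)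
  also have "\<dots> \<le> (\<Prod>i\<in>{m..<n}. exp (- (\<gamma> * b i)))"
  proof (rule prod_mono, intro conjI)
    fix i assume "i \<in> {m..<n}"
    then have "p i = \<gamma> * b i" using \<theta>(2)[of i] by (simp add: p_eq)
    then show "1 - p i \<le> exp (- (\<gamma> * b i))" using exp_ge_add_one_self[of "- (\<gamma> * b i)"] by simp
    show "0 \<le> 1 - p i" using p(2)[of i] by simp
  qed
  also have "\<dots> = exp (- (\<gamma> * (clock n - clock m)))"
    using clock_diff[OF mn] by (simp add: exp_sum[symmetric] sum_negf sum_distrib_left)
  finally have pA1: "M.prob ?A1 \<le> exp (- (\<gamma> * (clock n - clock m)))" .
  have pA: "M.prob (?A1 \<union> ?A2) \<le> exp (- (\<gamma> * (clock n - clock m)))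
        + ((\<Sum>i=m..<Suc K. b i) * \<rho> / \<epsilon> + (\<Sum>i=m..<Suc K. (b i)\<^sup>2) * \<sigma> / \<epsilon>\<^sup>2)"
    using measure_Un_le[OF A1 A2(1)] pA1 A2(2) by simp
  have "\<bar>(\<integral>\<omega>. coin_functional h T b g m (index n) (\<lambda>i\<in>{m..<K}. coin i \<omega>) \<partial>M) - (\<integral>\<omega>. h (process_path T (interpolated n) \<omega>) \<partial>M)\<bar>
    \<le> Lh * (8 * \<epsilon> + \<theta> * norm g) + 2 * B * M.prob (?A1 \<union> ?A2)"
  proof (rule M.expectation_close)
    show "(\<lambda>\<omega>. coin_functional h T b g m (index n) (\<lambda>i\<in>{m..<K}. coin i \<omega>)) \<in> borel_measurable M"
      by (rule M.finite_coins(1)) (use coin_meas mn in auto)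
    show "(\<lambda>\<omega>. h (process_path T (interpolated n) \<omega>)) \<in> borel_measurable M"
      by (rule measurable_compose[OF measurable_interpolated_path[OF n T] lipschitz_functional_measurable[OF h]])
    show "?A1 \<union> ?A2 \<in> M.events" using A1 A2 by auto
    show "\<bar>coin_functional h T b g m (index n) (\<lambda>i\<in>{m..<K}. coin i \<omega>)\<bar> \<le> B" for \<omega> by (rule coin_functional_bound[OF h n])
    show "\<bar>h (process_path T (interpolated n) \<omega>)\<bar> \<le> B" for \<omega>
      using h cadlag_interpolated[OF n] by (auto simp: lipschitz_functional_def process_path_def restrict_cadlag_space)
    show "0 \<le> Lh * (8 * \<epsilon> + \<theta> * norm g)" using h \<theta>0 \<epsilon> by (simp add: lipschitz_functional_def)
    show "AE \<omega> in M. \<omega> \<notin> ?A1 \<union> ?A2 \<longrightarrow> \<bar>coin_functional h T b g m (index n) (\<lambda>i\<in>{m..<K}. coin i \<omega>) - h (process_path T (interpolated n) \<omega>)\<bar>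
        \<le> Lh * (8 * \<epsilon> + \<theta> * norm g)"
    proof (rule AE_I2, rule impI)
      fix \<omega> assume w: "\<omega> \<in> space M" "\<omega> \<notin> ?A1 \<union> ?A2"
      obtain k0 where k0: "m \<le> k0" "k0 < n" "coin k0 \<omega>" using w by auto
      have U: "norm (U j \<omega>) < 2 * \<epsilon>" if "m \<le> j" "j \<le> Suc K" for j using w that by (force simp: not_le)
      have sup: "dist (reset_seq b g m (\<lambda>i. coin i \<omega>) (index n t - m)) (interpolated n t \<omega>) \<le> 8 * \<epsilon> + \<theta> * norm g"
        if t: "t \<in> {0..T}" for t
      proof -
        define k where "k = index n t"
        have k: "n \<le> k" "k \<le> K" "clock k - clock n \<le> t" "t < clock (Suc k) - clock n"
          using index[OF n, of t] index_mono[OF n, of t T] t by (auto simp: k_def K_def)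
        have tb: "0 \<le> t - (clock k - clock n)" "t - (clock k - clock n) \<le> b k" using k clock_Suc[of k] n by auto
        have "\<exists>j\<in>{m..k}. V k \<omega> - reset_seq b g m (\<lambda>i. coin i \<omega>) (k - m) = (\<Sum>i=m..<k. b i *\<^sub>R e i \<omega>) - (\<Sum>i=m..<j. b i *\<^sub>R e i \<omega>)"
        proof (rule reset_seq_difference[where ?k0.0=k0 and V="\<lambda>k. V k \<omega>" and c="\<lambda>i. coin i \<omega>" and e="\<lambda>i. e i \<omega>"])
          fix i assume "m \<le> i"
          then show "V (Suc i) \<omega> = (if coin i \<omega> then 0 else V i \<omega> - b i *\<^sub>R (g - e i \<omega>))"
            using V_Suc[of i \<omega>] mn by (simp add: e_def)
        qed (use k0 k in auto)
        then obtain j where j: "j \<in> {m..k}" "V k \<omega> - reset_seq b g m (\<lambda>i. coin i \<omega>) (k - m) = U k \<omega> - U j \<omega>"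
          unfolding U_def by blast
        have 1: "norm (V k \<omega> - reset_seq b g m (\<lambda>i. coin i \<omega>) (k - m)) \<le> 4 * \<epsilon>"
          unfolding j(2) using norm_triangle_ineq4[of "U k \<omega>" "U j \<omega>"] U[of k] U[of j] j(1) k mn by auto
        have "U (Suc k) \<omega> - U k \<omega> = b k *\<^sub>R e k \<omega>" using k mn by (simp add: U_def)
        then have 2: "norm (b k *\<^sub>R e k \<omega>) \<le> 4 * \<epsilon>"
          using norm_triangle_ineq4[of "U (Suc k) \<omega>" "U k \<omega>"] U[of k] U[of "Suc k"] k mn by auto
        have "norm ((t - (clock k - clock n)) *\<^sub>R (d k \<omega> - PA (xi k \<omega>))) \<le> b k * norm (d k \<omega> - PA (xi k \<omega>))"
          using tb by (auto intro!: mult_right_mono)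
        also have "\<dots> = norm (b k *\<^sub>R g - b k *\<^sub>R e k \<omega>)"
          using b_pos[of k] by (simp add: e_def scaleR_diff_right[symmetric] del: scaleR_diff_right)
        also have "\<dots> \<le> b k * norm g + norm (b k *\<^sub>R e k \<omega>)"
          using norm_triangle_ineq4[of "b k *\<^sub>R g" "b k *\<^sub>R e k \<omega>"] b_pos[of k] by simp
        also have "\<dots> \<le> \<theta> * norm g + 4 * \<epsilon>" using \<theta>(1)[of k] k mn 2 by (intro add_mono mult_right_mono) auto
        finally have 3: "norm ((t - (clock k - clock n)) *\<^sub>R (d k \<omega> - PA (xi k \<omega>))) \<le> \<theta> * norm g + 4 * \<epsilon>" .
        have "dist (reset_seq b g m (\<lambda>i. coin i \<omega>) (k - m)) (interpolated n t \<omega>)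
            = norm ((V k \<omega> - reset_seq b g m (\<lambda>i. coin i \<omega>) (k - m)) - (t - (clock k - clock n)) *\<^sub>R (d k \<omega> - PA (xi k \<omega>)))"
          unfolding interpolated_def k_def[symmetric] dist_norm by (subst norm_minus_commute) (simp add: algebra_simps)
        also have "\<dots> \<le> 8 * \<epsilon> + \<theta> * norm g"
          using norm_triangle_ineq4[of "V k \<omega> - reset_seq b g m (\<lambda>i. coin i \<omega>) (k - m)" "(t - (clock k - clock n)) *\<^sub>R (d k \<omega> - PA (xi k \<omega>))"] 1 3
          by linarith
        finally show ?thesis by (simp add: k_def)
      qed
      show "\<bar>coin_functional h T b g m (index n) (\<lambda>i\<in>{m..<K}. coin i \<omega>) - h (process_path T (interpolated n) \<omega>)\<bar> \<le> Lh * (8 * \<epsilon> + \<theta> * norm g)"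
        unfolding K_def coin_functional_restrict[OF n mn(2)]
        unfolding coin_functional_def process_path_def
        by (rule lipschitz_functional_sup[OF h cadlag_reset_path[OF n] cadlag_interpolated[OF n] sup]) (use \<theta>0 \<epsilon> in auto)
    qed
  qed
  also have "\<dots> \<le> Lh * (8 * \<epsilon> + \<theta> * norm g) + 2 * B * (exp (- (\<gamma> * (clock n - clock m)))
        + ((\<Sum>i=m..<Suc K. b i) * \<rho> / \<epsilon> + (\<Sum>i=m..<Suc K. (b i)\<^sup>2) * \<sigma> / \<epsilon>\<^sup>2))"
    using pA B0 by (intro add_left_mono mult_left_mono) auto
  finally show ?thesis by (simp add: g_def)
qed

lemma coins_jumps_close:
  fixes P :: "'w measure"
  assumes sol: "reset_solution \<gamma> (gradf xstar) P F N Y" and h: "lipschitz_functional T Lh B h"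
    and mn: "1 \<le> m" "m \<le> n" and T: "0 < T" and \<theta>: "\<And>k. m \<le> k \<Longrightarrow> b k \<le> \<theta>" "\<And>k. m \<le> k \<Longrightarrow> \<gamma> * b k \<le> 1"
  defines "K \<equiv> index n T"
  defines "C \<equiv> (\<lambda>i \<omega>. N (clock i - clock m) \<omega> \<noteq> N (clock (Suc i) - clock m) \<omega>)"
  shows "\<bar>(\<integral>\<omega>. coin_functional h T b (gradf xstar) m (index n) (\<lambda>i\<in>{m..<K}. coin i \<omega>) \<partial>M)
      - (\<integral>\<omega>. coin_functional h T b (gradf xstar) m (index n) (\<lambda>i\<in>{m..<K}. C i \<omega>) \<partial>P)\<bar> \<le> 2 * B * (\<Sum>i\<in>{m..<K}. (\<gamma> * b i)\<^sup>2)"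
proof -
  interpret S: reset_solution \<gamma> "gradf xstar" P F N Y by fact
  define t where "t k = max 0 (clock (max m k) - clock m)" for k
  have n: "1 \<le> n" using mn by simp
  have mK: "m \<le> K" using index(1)[OF n, of T] T mn by (simp add: K_def)
  have t: "t k = clock k - clock m" if "m \<le> k" for k using clock_mono[OF that] that by (simp add: t_def max_def)
  have B0: "0 \<le> B" using coin_functional_bound[OF h n, of "gradf xstar" m undefined] by simp
  have pat: "measure P {\<omega> \<in> space P. \<forall>i\<in>{m..<K}. C i \<omega> = c i} = bern (\<lambda>i. 1 - exp (- (\<gamma> * b i))) {m..<K} c" for c
  proof -
    have "{\<omega> \<in> space P. \<forall>i\<in>{m..<K}. C i \<omega> = c i} = {\<omega> \<in> space P. \<forall>i\<in>{m..<K}. (N (t i) \<omega> \<noteq> N (t (Suc i)) \<omega>) = c i}"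
      unfolding C_def by (intro Collect_cong conj_cong refl ball_cong) (auto simp: t)
    then show ?thesis
      using S.prob_jump_pattern[of t m b K c] mK clock_Suc mn b_pos by (auto simp: t less_imp_le)
  qed
  have C_meas: "C i \<in> P \<rightarrow>\<^sub>M count_space UNIV" if "i \<in> {m..<K}" for i
  proof -
    have "{\<omega> \<in> space P. N (clock i - clock m) \<omega> = N (clock (Suc i) - clock m) \<omega>} \<in> S.events"
      using that clock_mono[of m i] clock_mono[of i "Suc i"] by (intro S.N_eq_event) auto
    then have "Measurable.pred P (\<lambda>\<omega>. \<not> (N (clock i - clock m) \<omega> = N (clock (Suc i) - clock m) \<omega>))" by (simp add: pred_def)
    then show ?thesis unfolding C_def by simp
  qed
  have "\<bar>(\<integral>\<omega>. coin_functional h T b (gradf xstar) m (index n) (\<lambda>i\<in>{m..<K}. coin i \<omega>) \<partial>M)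
      - (\<integral>\<omega>. coin_functional h T b (gradf xstar) m (index n) (\<lambda>i\<in>{m..<K}. C i \<omega>) \<partial>P)\<bar>
      \<le> 2 * B * (\<Sum>i\<in>{m..<K}. \<bar>p i - (1 - exp (- (\<gamma> * b i)))\<bar>)"
  proof (rule coins_expectation_close)
    show "measure M {\<omega> \<in> space M. \<forall>i\<in>{m..<K}. coin i \<omega> = c i} = bern p {m..<K} c" for c
      unfolding bern_def using mn by (intro prob_coins) auto
    show "0 \<le> 1 - exp (- (\<gamma> * b i)) \<and> 1 - exp (- (\<gamma> * b i)) \<le> 1" for i using \<gamma> b_pos[of i] by simp
    show "coin i \<in> M \<rightarrow>\<^sub>M count_space UNIV" if "i \<in> {m..<K}" for i using that mn by (intro coin_meas) auto
    show "\<bar>coin_functional h T b (gradf xstar) m (index n) c\<bar> \<le> B" for c by (rule coin_functional_bound[OF h n])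
    show "0 \<le> p i \<and> p i \<le> 1" for i using p[of i] by simp
  qed (use M.prob_space_axioms S.prob_space_axioms pat C_meas in auto)
  also have "\<dots> \<le> 2 * B * (\<Sum>i\<in>{m..<K}. (\<gamma> * b i)\<^sup>2)"
  proof (intro mult_left_mono sum_mono)
    fix i assume "i \<in> {m..<K}"
    then have "p i = \<gamma> * b i" using \<theta>(2)[of i] by (simp add: p_eq)
    then show "\<bar>p i - (1 - exp (- (\<gamma> * b i)))\<bar> \<le> (\<gamma> * b i)\<^sup>2" using exp_error[of "\<gamma> * b i"] \<gamma> b_pos[of i] by simp
  qed (use B0 in simp)
  finally show ?thesis .
qed

text \<open>The sampled solution replaces \<open>Y\<close> by dominated convergence, since the mesh
  vanishes; the difference to the iterates is then estimated on one grid for each \<open>n\<close>,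
  with a window that ends at \<open>n\<close>.\<close>

lemma interpolated_tendsto:
  fixes P :: "'w measure"
  assumes sol: "reset_solution \<gamma> (gradf xstar) P F N Y" and st: "stationary_process P Y"
    and h: "lipschitz_functional T Lh B h" and T: "0 < T"
    and b0: "b \<longlonglongrightarrow> 0" and r0: "(\<lambda>k. \<integral>\<omega>. norm (gradf xstar - d k \<omega>) \<partial>M) \<longlonglongrightarrow> 0"
  shows "(\<lambda>n. \<integral>\<omega>. h (process_path T (interpolated (Suc n)) \<omega>) \<partial>M) \<longlonglongrightarrow> (\<integral>\<omega>. h (process_path T Y \<omega>) \<partial>P)"
proof -
  interpret S: reset_solution \<gamma> "gradf xstar" P F N Y by fact
  define g where "g = gradf xstar"
  define I where "I n = (\<integral>\<omega>. h (process_path T (interpolated n) \<omega>) \<partial>M)" for n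
  define Q where "Q n = (\<integral>\<omega>. h (process_path T (\<lambda>t. Y (grid_floor (grid n T) t)) \<omega>) \<partial>P)" for n
  define J where "J = (\<integral>\<omega>. h (process_path T Y \<omega>) \<partial>P)"
  have cadY: "cadlag_on {0..T} (\<lambda>t. Y t \<omega>)" if "\<omega> \<in> space P" for \<omega>
    by (rule cadlag_on_subset[OF S.Y_cadlag[OF that]]) auto
  have hm: "h \<in> borel_measurable (borel_of (skorokhod_topology T))" by (rule lipschitz_functional_measurable[OF h])
  have Lh: "0 \<le> Lh" using h by (simp add: lipschitz_functional_def)
  have B0: "0 \<le> B" using coin_functional_bound[OF h, of 1 g 1 undefined] by simp
  have QJ: "(\<lambda>n. Q (Suc n)) \<longlonglongrightarrow> J"
    unfolding Q_def J_def
  proof (rule integral_dominated_convergence[where w="\<lambda>_. B"])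
    show "(\<lambda>\<omega>. h (process_path T Y \<omega>)) \<in> borel_measurable P"
      using cadY T by (intro measurable_compose[OF measurable_process_path hm] S.Y_measurable) auto
    show "(\<lambda>\<omega>. h (process_path T (\<lambda>t. Y (grid_floor (grid (Suc n) T) t)) \<omega>)) \<in> borel_measurable P" for n
      using grid_props(1-3)[of "Suc n", OF _ T]
      by (intro measurable_compose[OF measurable_path_grid_floor hm] S.Y_measurable) auto
    have is_grid_ev: "\<forall>\<^sub>F n in sequentially. is_grid T (inverse (real (Suc j))) (grid (Suc n) T)" for j
    proof -
      have "\<forall>\<^sub>F k in sequentially. b k < inverse (real (Suc j))" by (rule order_tendstoD(2)[OF b0]) simp
      then obtain k0 where "\<And>k. k \<ge> k0 \<Longrightarrow> b k < inverse (real (Suc j))" by (auto simp: eventually_sequentially)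
      then have "is_grid T (inverse (real (Suc j))) (grid (Suc n) T)" if "n \<ge> k0" for n
        using that by (intro grid_props(6)[OF _ T]) (auto intro: less_imp_le)
      then show ?thesis by (auto simp: eventually_sequentially)
    qed
    show "AE \<omega> in P. (\<lambda>n. h (process_path T (\<lambda>t. Y (grid_floor (grid (Suc n) T) t)) \<omega>)) \<longlonglongrightarrow> h (process_path T Y \<omega>)"
    proof (rule AE_I2)
      fix \<omega> assume w: "\<omega> \<in> space P"
      have "(\<lambda>n. skorokhod_dist T (\<lambda>t\<in>{0..T}. Y (grid_floor (grid (Suc n) T) t) \<omega>) (restrict (\<lambda>t. Y t \<omega>) {0..T})) \<longlonglongrightarrow> 0"
        by (rule skorokhod_dist_grid_floor_tendsto[OF cadY[OF w] T is_grid_ev]) (rule grid_props(1)[OF _ T], simp)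
      then have lim: "(\<lambda>n. Lh * skorokhod_dist T (\<lambda>t\<in>{0..T}. Y (grid_floor (grid (Suc n) T) t) \<omega>) (restrict (\<lambda>t. Y t \<omega>) {0..T})) \<longlonglongrightarrow> 0"
        by (rule tendsto_mult_right_zero)
      show "(\<lambda>n. h (process_path T (\<lambda>t. Y (grid_floor (grid (Suc n) T) t)) \<omega>)) \<longlonglongrightarrow> h (process_path T Y \<omega>)"
      proof (rule Lim_null[THEN iffD2], rule Lim_null_comparison[OF _ lim], rule always_eventually, rule allI)
        fix n
        have "cadlag_on {0..T} (\<lambda>t. Y (grid_floor (grid (Suc n) T) t) \<omega>)"
          by (rule cadlag_on_grid_floor[OF grid_props(1)[OF _ T], of _ _ "\<lambda>u. Y u \<omega>"]) simp
        then show "norm (h (process_path T (\<lambda>t. Y (grid_floor (grid (Suc n) T) t)) \<omega>) - h (process_path T Y \<omega>))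
          \<le> Lh * skorokhod_dist T (\<lambda>t\<in>{0..T}. Y (grid_floor (grid (Suc n) T) t) \<omega>) (restrict (\<lambda>t. Y t \<omega>) {0..T})"
          using h cadY[OF w] unfolding process_path_def lipschitz_functional_def by (auto simp: restrict_cadlag_space)
      qed
    qed
    show "AE \<omega> in P. norm (h (process_path T (\<lambda>t. Y (grid_floor (grid (Suc n) T) t)) \<omega>)) \<le> B" for n
    proof (rule AE_I2)
      fix \<omega>
      have "cadlag_on {0..T} (\<lambda>t. Y (grid_floor (grid (Suc n) T) t) \<omega>)"
        by (rule cadlag_on_grid_floor[OF grid_props(1)[OF _ T], of _ _ "\<lambda>u. Y u \<omega>"]) simp
      then show "norm (h (process_path T (\<lambda>t. Y (grid_floor (grid (Suc n) T) t)) \<omega>)) \<le> B"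
        using h unfolding process_path_def lipschitz_functional_def by (auto simp: restrict_cadlag_space)
    qed
  qed simp
  \<comment> \<open>The chain is: sampled solution, shifted by the window (\<open>X1\<close>),
    functional of the jump indicators (\<open>X2\<close>), functional of the coins
    (\<open>X3\<close>), iterates (\<open>I n\<close>). Terms are sorted by the small parameter that
    controls them.\<close>
  have est: "\<bar>I n - Q n\<bar> \<le> Lh * (8 * \<epsilon>) + 2 * (2 * B * exp (- (\<gamma> * s)))
      + \<theta> * (Lh * (3 * norm g) + 2 * B * \<gamma> + 2 * B * (\<gamma>\<^sup>2 * (s + T + 2)) + 2 * B * ((s + T + 2) * \<sigma> / \<epsilon>\<^sup>2))
      + \<rho> * (2 * B * ((s + T + 2) / \<epsilon>))"
    if mn: "1 \<le> m" "m \<le> n" and s: "s \<le> clock n - clock m" "clock n - clock m \<le> s + 1"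
      and \<theta>: "\<And>k. m \<le> k \<Longrightarrow> b k \<le> \<theta>" "\<And>k. m \<le> k \<Longrightarrow> \<gamma> * b k \<le> 1" "\<theta> \<le> 1"
      and \<rho>: "\<And>k. m \<le> k \<Longrightarrow> (\<integral>\<omega>. norm (gradf xstar - d k \<omega>) \<partial>M) \<le> \<rho>" and \<epsilon>: "0 < \<epsilon>"
    for m n s \<theta> \<rho> \<epsilon>
  proof -
    define K where "K = index n T"
    define C where "C = (\<lambda>i \<omega>. N (clock i - clock m) \<omega> \<noteq> N (clock (Suc i) - clock m) \<omega>)"
    define X1 where "X1 = (\<integral>\<omega>. h (process_path T (\<lambda>t. Y (grid_floor (grid n T) t + (clock n - clock m))) \<omega>) \<partial>P)"
    define X2 where "X2 = (\<integral>\<omega>. coin_functional h T b g m (index n) (\<lambda>i\<in>{m..<K}. C i \<omega>) \<partial>P)"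
    define X3 where "X3 = (\<integral>\<omega>. coin_functional h T b g m (index n) (\<lambda>i\<in>{m..<K}. coin i \<omega>) \<partial>M)"
    have n: "1 \<le> n" using mn by simp
    have K: "n \<le> K" "clock K - clock n \<le> T" using index[OF n, of T] T by (auto simp: K_def)
    have \<theta>0: "0 \<le> \<theta>" using \<theta>(1)[of m] b_pos[of m] by simp
    have \<rho>0: "0 \<le> \<rho>" using \<rho>[of m] by (rule order_trans[rotated]) auto
    have Q: "Q n = X1"
      unfolding Q_def X1_def
      by (rule stationary_grid_expectation[OF st S.Y_measurable _ _ _ _ hm])
        (use grid_props(1-3)[OF n T] clock_mono[OF mn(2)] in auto)
    have es: "exp (- (\<gamma> * (clock n - clock m))) \<le> exp (- (\<gamma> * s))" using s(1) \<gamma> by simp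
    have 1: "\<bar>X1 - X2\<bar> \<le> Lh * (2 * \<theta> * norm g) + 2 * B * (exp (- (\<gamma> * (clock n - clock m))) + \<gamma> * \<theta>)"
      unfolding X1_def X2_def C_def K_def g_def by (rule solution_coins_close[OF sol h mn T \<theta>(1)])
    have 2: "\<bar>X3 - X2\<bar> \<le> 2 * B * (\<Sum>i\<in>{m..<K}. (\<gamma> * b i)\<^sup>2)"
      unfolding X3_def X2_def C_def K_def g_def by (rule coins_jumps_close[OF sol h mn T \<theta>(1,2)])
    have 3: "\<bar>X3 - I n\<bar> \<le> Lh * (8 * \<epsilon> + \<theta> * norm g) + 2 * B * (exp (- (\<gamma> * (clock n - clock m)))
        + ((\<Sum>i=m..<Suc K. b i) * \<rho> / \<epsilon> + (\<Sum>i=m..<Suc K. (b i)\<^sup>2) * \<sigma> / \<epsilon>\<^sup>2))"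
      unfolding X3_def I_def K_def g_def by (rule interpolated_coins_close[OF h mn T \<theta>(1,2) \<rho> \<epsilon>])
    have sum_b: "(\<Sum>i=m..<Suc K. b i) \<le> s + T + 2"
      using clock_diff[of m "Suc K"] clock_Suc[of K] K mn s(2) \<theta>(1)[of K] \<theta>(3) by auto
    have sum_b2: "(\<Sum>i=m..<Suc K. (b i)\<^sup>2) \<le> \<theta> * (s + T + 2)"
    proof -
      have "(\<Sum>i=m..<Suc K. (b i)\<^sup>2) \<le> (\<Sum>i=m..<Suc K. \<theta> * b i)"
        unfolding power2_eq_square using \<theta>(1) b_pos by (intro sum_mono mult_right_mono) (auto intro: less_imp_le)
      also have "\<dots> = \<theta> * (\<Sum>i=m..<Suc K. b i)" by (simp only: sum_distrib_left)
      also have "\<dots> \<le> \<theta> * (s + T + 2)" by (rule mult_left_mono[OF sum_b \<theta>0])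
      finally show ?thesis .
    qed
    have "(\<Sum>i\<in>{m..<K}. (\<gamma> * b i)\<^sup>2) = \<gamma>\<^sup>2 * (\<Sum>i=m..<K. (b i)\<^sup>2)" by (simp add: power_mult_distrib sum_distrib_left)
    also have "\<dots> \<le> \<gamma>\<^sup>2 * (\<Sum>i=m..<Suc K. (b i)\<^sup>2)" by (intro mult_left_mono sum_mono2) auto
    also have "\<dots> \<le> \<gamma>\<^sup>2 * (\<theta> * (s + T + 2))" by (intro mult_left_mono sum_b2) simp
    finally have est2: "\<bar>X3 - X2\<bar> \<le> 2 * B * (\<gamma>\<^sup>2 * (\<theta> * (s + T + 2)))"
      using 2 B0 by (meson mult_left_mono mult_nonneg_nonneg order_trans zero_le_numeral)
    have est1: "\<bar>X1 - X2\<bar> \<le> Lh * (2 * \<theta> * norm g) + 2 * B * (exp (- (\<gamma> * s)) + \<gamma> * \<theta>)"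
      using B0 es by (intro order_trans[OF 1] add_left_mono mult_left_mono add_right_mono) auto
    have est3: "\<bar>X3 - I n\<bar> \<le> Lh * (8 * \<epsilon> + \<theta> * norm g) + 2 * B * (exp (- (\<gamma> * s))
        + ((s + T + 2) * \<rho> / \<epsilon> + \<theta> * (s + T + 2) * \<sigma> / \<epsilon>\<^sup>2))"
      using B0 es sum_b sum_b2 \<rho>0 \<epsilon> \<sigma>
      by (intro order_trans[OF 3] add_left_mono mult_left_mono add_mono divide_right_mono mult_right_mono) auto
    have "\<bar>I n - Q n\<bar> \<le> \<bar>X3 - I n\<bar> + \<bar>X3 - X2\<bar> + \<bar>X1 - X2\<bar>" unfolding Q by linarith
    also have "\<dots> \<le> (Lh * (8 * \<epsilon> + \<theta> * norm g) + 2 * B * (exp (- (\<gamma> * s)) + ((s + T + 2) * \<rho> / \<epsilon> + \<theta> * (s + T + 2) * \<sigma> / \<epsilon>\<^sup>2)))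
        + 2 * B * (\<gamma>\<^sup>2 * (\<theta> * (s + T + 2))) + (Lh * (2 * \<theta> * norm g) + 2 * B * (exp (- (\<gamma> * s)) + \<gamma> * \<theta>))"
      using est1 est2 est3 by linarith
    also have "\<dots> = Lh * (8 * \<epsilon>) + 2 * (2 * B * exp (- (\<gamma> * s)))
      + \<theta> * (Lh * (3 * norm g) + 2 * B * \<gamma> + 2 * B * (\<gamma>\<^sup>2 * (s + T + 2)) + 2 * B * ((s + T + 2) * \<sigma> / \<epsilon>\<^sup>2))
      + \<rho> * (2 * B * ((s + T + 2) / \<epsilon>))"
      by (simp add: algebra_simps add_divide_distrib)
    finally show ?thesis .
  qed
  have IQ: "(\<lambda>n. I n - Q n) \<longlonglongrightarrow> 0"
  proof (rule LIMSEQ_I)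
    fix e :: real assume e: "0 < e"
    \<comment> \<open>Five shares of \<open>e / 5\<close>, two of them for the exponential term,
      which arises once for each process. Adding \<open>1\<close> to the denominators here and below
      avoids division by zero and makes the bounds strict.\<close>
    define \<epsilon> where "\<epsilon> = e / 5 / (8 * Lh + 1)"
    have \<epsilon>: "0 < \<epsilon>" using e Lh by (simp add: \<epsilon>_def)
    have e1: "Lh * (8 * \<epsilon>) < e / 5" using e Lh by (simp add: \<epsilon>_def field_simps)
    have "filterlim (\<lambda>s. - (\<gamma> * s)) at_bot at_top"
      using \<gamma> by (simp add: filterlim_uminus_at_bot filterlim_tendsto_pos_mult_at_top[OF tendsto_const _ filterlim_ident])
    then have "((\<lambda>s. 2 * B * exp (- (\<gamma> * s))) \<longlongrightarrow> 2 * B * 0) at_top"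
      by (intro tendsto_mult tendsto_const filterlim_compose[OF exp_at_bot])
    then have "\<forall>\<^sub>F s in at_top. 2 * B * exp (- (\<gamma> * s)) < e / 5" by (rule order_tendstoD(2)) (use e in simp)
    then have "\<forall>\<^sub>F s in at_top. 2 * B * exp (- (\<gamma> * s)) < e / 5 \<and> 0 < s"
      using eventually_gt_at_top[of 0] by (rule eventually_conj)
    then obtain s where s: "2 * B * exp (- (\<gamma> * s)) < e / 5" "0 < s"
      using eventually_happens'[OF trivial_limit_at_top_linorder] by force
    \<comment> \<open>These constants involve \<open>s\<close> and \<open>\<epsilon>\<close>, so
      \<open>\<theta>\<close> and \<open>\<rho>\<close> can only be chosen now.\<close>
    define C1 where "C1 = Lh * (3 * norm g) + 2 * B * \<gamma> + 2 * B * (\<gamma>\<^sup>2 * (s + T + 2)) + 2 * B * ((s + T + 2) * \<sigma> / \<epsilon>\<^sup>2)"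
    define C2 where "C2 = 2 * B * ((s + T + 2) / \<epsilon>)"
    have C: "0 \<le> C1" "0 \<le> C2" unfolding C1_def C2_def using Lh B0 \<gamma> s(2) T \<sigma> \<epsilon> by auto
    define \<theta> where "\<theta> = min 1 (min (1 / \<gamma>) (e / 5 / (C1 + 1)))"
    define \<rho> where "\<rho> = e / 5 / (C2 + 1)"
    have \<theta>: "0 < \<theta>" "\<theta> \<le> 1" "\<theta> \<le> 1 / \<gamma>" using e C \<gamma> by (auto simp: \<theta>_def)
    have \<rho>: "0 < \<rho>" using e C by (simp add: \<rho>_def)
    have "\<theta> * C1 \<le> e / 5 / (C1 + 1) * C1" using C by (intro mult_right_mono) (auto simp: \<theta>_def)
    also have "\<dots> < e / 5" using e C by (simp add: field_simps)
    finally have e2: "\<theta> * C1 < e / 5" .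
    have e3: "\<rho> * C2 < e / 5" using e C by (simp add: \<rho>_def field_simps)
    have "\<forall>\<^sub>F k in sequentially. b k < \<theta> \<and> (\<integral>\<omega>. norm (gradf xstar - d k \<omega>) \<partial>M) < \<rho>"
      by (intro eventually_conj order_tendstoD(2)[OF b0 \<theta>(1)] order_tendstoD(2)[OF r0 \<rho>])
    then obtain k0 where k0: "\<And>k. k \<ge> k0 \<Longrightarrow> b k < \<theta> \<and> (\<integral>\<omega>. norm (gradf xstar - d k \<omega>) \<partial>M) < \<rho>"
      by (auto simp: eventually_sequentially)
    define k1 where "k1 = max 1 k0"
    obtain n0 where n0: "clock k1 + s + 1 < clock n0" using clock_unbounded by blast
    have "norm (I n - Q n - 0) < e" if n: "n \<ge> n0" for n
    proof -
      have cn: "clock k1 + s + 1 < clock n" using n0 clock_mono[OF n] by simp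
      have k1n: "k1 \<le> n"
      proof (rule ccontr)
        assume "\<not> k1 \<le> n"
        then have "clock n \<le> clock k1" by (intro clock_mono) simp
        then show False using cn s by simp
      qed
      \<comment> \<open>The latest admissible start at least \<open>s\<close> before
        \<open>n\<close>. The next step would overshoot and steps are at most \<open>1\<close>, so
        the window has length between \<open>s\<close> and \<open>s + 1\<close>.\<close>
      define m where "m = Max {k. k1 \<le> k \<and> k \<le> n \<and> clock k \<le> clock n - s}"
      have fin: "finite {k. k1 \<le> k \<and> k \<le> n \<and> clock k \<le> clock n - s}" by simp
      have "m \<in> {k. k1 \<le> k \<and> k \<le> n \<and> clock k \<le> clock n - s}"
        unfolding m_def by (rule Max_in[OF fin]) (use k1n cn s in auto)
      then have m: "k1 \<le> m" "m \<le> n" "clock m \<le> clock n - s" by auto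
      have m_lt: "m < n" using m s by (cases "m = n") auto
      have "clock n - s < clock (Suc m)"
      proof (rule ccontr)
        assume "\<not> clock n - s < clock (Suc m)"
        then have "Suc m \<le> m" unfolding m_def by (intro Max_ge[OF fin]) (use m m_lt in \<open>auto simp: m_def\<close>)
        then show False by simp
      qed
      then have "clock n - clock m \<le> s + 1" using clock_Suc[of m] m(1) k0[of m] \<theta>(2) by (auto simp: k1_def)
      moreover have "\<gamma> * b k \<le> 1" if "m \<le> k" for k
      proof -
        have "b k \<le> 1 / \<gamma>" using k0[of k] \<theta>(3) m(1) that by (auto simp: k1_def)
        then show ?thesis using \<gamma> by (simp add: field_simps)
      qed
      ultimately have "\<bar>I n - Q n\<bar> \<le> Lh * (8 * \<epsilon>) + 2 * (2 * B * exp (- (\<gamma> * s))) + \<theta> * C1 + \<rho> * C2"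
        unfolding C1_def C2_def using m k0 \<theta> \<epsilon> by (intro est[of m]) (auto simp: k1_def less_imp_le)
      then show ?thesis using e1 e2 e3 s(1) by simp
    qed
    then show "\<exists>no. \<forall>n\<ge>no. norm (I n - Q n - 0) < e" by blast
  qed
  have "(\<lambda>n. (I (Suc n) - Q (Suc n)) + Q (Suc n)) \<longlonglongrightarrow> 0 + J"
    by (intro tendsto_add QJ LIMSEQ_Suc[OF IQ])
  then show ?thesis by (simp add: I_def J_def)
qed

end

section \<open>Weak convergence\<close>

text \<open>Time changes fix \<open>0\<close>, so evaluation at \<open>0\<close> is Lipschitz on
  Skorokhod space; this transfers convergence of the processes to the sequence of their initial
  values.\<close>

lemma dist_at_0_le_skorokhod_dist:
  assumes x: "x \<in> cadlag_space T" and y: "y \<in> cadlag_space T" and T: "0 \<le> T"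
  shows "dist (x 0) (y 0) \<le> skorokhod_dist T x y"
proof -
  have "dist (x 0) (y 0) \<le> Inf {e. 0 < e \<and> skorokhod_close T x y e}"
  proof (rule cInf_greatest)
    show "{e. 0 < e \<and> skorokhod_close T x y e} \<noteq> {}" using skorokhod_close_ex[OF x y] by blast
    fix e assume "e \<in> {e. 0 < e \<and> skorokhod_close T x y e}"
    then obtain l where l: "strict_mono_on {0..T} l" "l ` {0..T} = {0..T}" "\<And>t. t \<in> {0..T} \<Longrightarrow> dist (x (l t)) (y t) \<le> e"
      by (auto simp: skorokhod_close_def time_changes_def)
    have "0 \<in> l ` {0..T}" using l(2) T by auto
    then obtain s where s: "s \<in> {0..T}" "l s = 0" by auto
    have "l 0 \<in> {0..T}" using l(2) T by auto
    then have "s = 0" using strict_mono_onD[OF l(1), of 0 s] s T by force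
    then show "dist (x 0) (y 0) \<le> e" using l(3)[of 0] s T by simp
  qed
  then show ?thesis using x y by (simp add: skorokhod_dist_def)
qed

context lpsa_window
begin

lemma interpolated_converges_weakly:
  fixes P :: "'w measure"
  assumes sol: "weak_solution \<gamma> (gradf xstar) P F N Y" and st: "stationary_process P Y" and g: "gradf xstar \<noteq> 0"
    and b0: "b \<longlonglongrightarrow> 0" and r0: "(\<lambda>k. \<integral>\<omega>. norm (gradf xstar - d k \<omega>) \<partial>M) \<longlonglongrightarrow> 0"
  shows "processes_converge_weakly M (\<lambda>n. interpolated (Suc n)) P Y"
  unfolding processes_converge_weakly_def
proof (intro allI impI)
  fix T :: real assume T: "0 < T"
  interpret S: reset_solution \<gamma> "gradf xstar" P F N Y by unfold_locales (fact sol \<gamma> g)+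
  have cadY: "cadlag_on {0..T} (\<lambda>t. Y t \<omega>)" if "\<omega> \<in> space P" for \<omega>
    by (rule cadlag_on_subset[OF S.Y_cadlag[OF that]]) auto
  show "converges_in_law (skorokhod_topology T) M (\<lambda>n. process_path T (interpolated (Suc n))) P (process_path T Y)"
    unfolding skorokhod_topology_def
  proof (rule skorokhod.converges_in_law_lipschitzI[OF S.prob_space_axioms M.prob_space_axioms])
    show "process_path T (interpolated (Suc n)) \<in> M \<rightarrow>\<^sub>M borel_of (skorokhod.mtopology T)" for n
      using measurable_interpolated_path[of "Suc n", OF _ T] by (simp add: skorokhod_topology_def)
    have "process_path T Y \<in> P \<rightarrow>\<^sub>M borel_of (skorokhod_topology T)"
      using cadY T by (intro measurable_process_path S.Y_measurable) auto
    then show "process_path T Y \<in> P \<rightarrow>\<^sub>M borel_of (skorokhod.mtopology T)" by (simp add: skorokhod_topology_def)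
    fix h :: "(real \<Rightarrow> 'v) \<Rightarrow> real" and K B
    assume "\<And>x y. x \<in> cadlag_space T \<Longrightarrow> y \<in> cadlag_space T \<Longrightarrow> \<bar>h x - h y\<bar> \<le> K * skorokhod_dist T x y"
      "\<And>x. x \<in> cadlag_space T \<Longrightarrow> \<bar>h x\<bar> \<le> B" "K \<ge> 0"
    then have "lipschitz_functional T K B h" by (simp add: lipschitz_functional_def)
    then show "(\<lambda>n. \<integral>\<omega>. h (process_path T (interpolated (Suc n)) \<omega>) \<partial>M) \<longlonglongrightarrow> (\<integral>\<omega>. h (process_path T Y \<omega>) \<partial>P)"
      by (rule interpolated_tendsto[OF S.reset_solution_axioms st _ T b0 r0])
  qed
qed

text \<open>Test the path convergence with \<open>h\<close> of the value at time \<open>0\<close>: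
  the interpolated process starts at \<open>V n\<close>, and the stationary solution with initial
  law \<open>exp_ray\<close> has that law there.\<close>

lemma converges_to_exp_ray:
  assumes g: "gradf xstar \<noteq> 0"
    and b0: "b \<longlonglongrightarrow> 0" and r0: "(\<lambda>k. \<integral>\<omega>. norm (gradf xstar - d k \<omega>) \<partial>M) \<longlonglongrightarrow> 0"
  shows "converges_in_law euclidean M (\<lambda>n. V (Suc n)) (exp_ray \<gamma> (gradf xstar)) (\<lambda>y. y)"
proof -
  note er = exp_ray[OF g \<gamma>]
  obtain P :: "'v canonical measure" and F N Y where
    sol: "weak_solution \<gamma> (gradf xstar) P F N Y" and init: "distr P borel (Y 0) = exp_ray \<gamma> (gradf xstar)"
    using weak_solution_canonical[OF \<gamma> er(1,2)] by blast
  interpret S: reset_solution \<gamma> "gradf xstar" P F N Y by unfold_locales (fact sol \<gamma> g)+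
  have "converges_in_law Met_TC.mtopology M (\<lambda>n. V (Suc n)) (exp_ray \<gamma> (gradf xstar)) (\<lambda>y. y)"
  proof (rule Met_TC.converges_in_law_lipschitzI[OF er(1) M.prob_space_axioms])
    show "V (Suc n) \<in> M \<rightarrow>\<^sub>M borel_of Met_TC.mtopology" for n
      using V_meas[of "Suc n"] by (simp add: borel_of_euclidean)
    show "(\<lambda>y. y) \<in> exp_ray \<gamma> (gradf xstar) \<rightarrow>\<^sub>M borel_of Met_TC.mtopology"
      using er(2) by (simp add: borel_of_euclidean measurable_ident_sets)
    fix h :: "'v \<Rightarrow> real" and K B
    assume lipschitz: "\<And>x y. x \<in> UNIV \<Longrightarrow> y \<in> UNIV \<Longrightarrow> \<bar>h x - h y\<bar> \<le> K * dist x y"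
      and bound: "\<And>x. x \<in> UNIV \<Longrightarrow> \<bar>h x\<bar> \<le> B" and K: "K \<ge> 0"
    have h_meas: "h \<in> borel_measurable borel"
      using continuous_map_measurable_real[OF Met_TC.lipschitz_continuous_map_real[OF lipschitz]]
      by (simp add: borel_of_euclidean)
    have "lipschitz_functional 1 K B (\<lambda>y. h (y 0))"
      unfolding lipschitz_functional_def
    proof (intro conjI ballI K)
      fix x y :: "real \<Rightarrow> 'v" assume xy: "x \<in> cadlag_space 1" "y \<in> cadlag_space 1"
      have "\<bar>h (x 0) - h (y 0)\<bar> \<le> K * dist (x 0) (y 0)" by (rule lipschitz) auto
      also have "\<dots> \<le> K * skorokhod_dist 1 x y"
        using dist_at_0_le_skorokhod_dist[OF xy] K by (intro mult_left_mono) auto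
      finally show "\<bar>h (x 0) - h (y 0)\<bar> \<le> K * skorokhod_dist 1 x y" .
    qed (use bound in simp)
    from interpolated_tendsto[OF S.reset_solution_axioms S.stationary[OF init] this _ b0 r0]
    have "(\<lambda>n. \<integral>\<omega>. h (interpolated (Suc n) 0 \<omega>) \<partial>M) \<longlonglongrightarrow> (\<integral>\<omega>. h (Y 0 \<omega>) \<partial>P)"
      by (simp add: process_path_def)
    moreover have "interpolated (Suc n) 0 \<omega> = V (Suc n) \<omega>" for n \<omega>
    proof -
      have "index (Suc n) 0 = Suc n" using clock_Suc[of "Suc n"] b_pos[of "Suc n"] by (intro index_eqI) auto
      then show ?thesis by (simp add: interpolated_def)
    qed
    moreover have "(\<integral>\<omega>. h (Y 0 \<omega>) \<partial>P) = (\<integral>y. h y \<partial>exp_ray \<gamma> (gradf xstar))"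
      using S.Y_measurable[of 0] h_meas unfolding init[symmetric] by (subst integral_distr) auto
    ultimately show "(\<lambda>n. \<integral>\<omega>. h (V (Suc n) \<omega>) \<partial>M) \<longlonglongrightarrow> (\<integral>y. h y \<partial>exp_ray \<gamma> (gradf xstar))" by simp
  qed
  then show ?thesis by simp
qed

end

section \<open>The constraint, the objective and the step sizes\<close>

lemma orth_proj:
  fixes S :: "'v::euclidean_space set"
  assumes S: "subspace S"
  shows "orth_proj S x \<in> S" "y \<in> S \<Longrightarrow> (x - orth_proj S x) \<bullet> y = 0"
    and "\<And>p. p \<in> S \<Longrightarrow> (\<And>y. y \<in> S \<Longrightarrow> (x - p) \<bullet> y = 0) \<Longrightarrow> orth_proj S x = p"
proof -
  have uniq: "p = p'" if p: "p \<in> S" "\<forall>y\<in>S. orthogonal (x - p) y" and p': "p' \<in> S" "\<forall>y\<in>S. orthogonal (x - p') y" for p p'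
  proof -
    have d: "p - p' \<in> S" using p p' S by (simp add: subspace_diff)
    have "(p - p') \<bullet> (p - p') = (x - p') \<bullet> (p - p') - (x - p) \<bullet> (p - p')" by (simp add: inner_diff_left)
    then show ?thesis using p(2) p'(2) d by (simp add: orthogonal_def)
  qed
  obtain p z where p: "p \<in> span S" "\<And>w. w \<in> span S \<Longrightarrow> orthogonal z w" "x = p + z"
    using orthogonal_subspace_decomp_exists by metis
  then have "p \<in> S \<and> (\<forall>y\<in>S. orthogonal (x - p) y)" using S by (simp add: span_eq_iff[THEN iffD2])
  then have ex: "\<exists>!p. p \<in> S \<and> (\<forall>y\<in>S. orthogonal (x - p) y)" using uniq by blast
  from theI'[OF ex] show "orth_proj S x \<in> S" "y \<in> S \<Longrightarrow> (x - orth_proj S x) \<bullet> y = 0"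
    by (auto simp: orth_proj_def orthogonal_def)
  show "orth_proj S x = q" if "q \<in> S" "\<And>y. y \<in> S \<Longrightarrow> (x - q) \<bullet> y = 0" for q
    unfolding orth_proj_def using that by (intro the1_equality[OF ex]) (auto simp: orthogonal_def)
qed

lemma orth_proj_linear:
  fixes S :: "'v::euclidean_space set"
  assumes S: "subspace S"
  shows "linear (orth_proj S)"
proof (rule linearI)
  note P = orth_proj[OF S]
  show "orth_proj S (x + y) = orth_proj S x + orth_proj S y" for x y
  proof (rule P(3))
    show "(x + y - (orth_proj S x + orth_proj S y)) \<bullet> s = 0" if "s \<in> S" for s
      using P(2)[OF that, of x] P(2)[OF that, of y] by (simp add: inner_diff_left inner_add_left)
  qed (use P(1) S in \<open>auto simp: subspace_add\<close>)
  show "orth_proj S (c *\<^sub>R x) = c *\<^sub>R orth_proj S x" for c x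
  proof (rule P(3))
    show "(c *\<^sub>R x - c *\<^sub>R orth_proj S x) \<bullet> y = 0" if "y \<in> S" for y
      using P(2)[OF that, of x] by (simp add: inner_diff_left)
  qed (use P(1) S in \<open>auto simp: subspace_scale\<close>)
qed

lemma orth_proj_inner:
  fixes S :: "'v::euclidean_space set"
  assumes "subspace S"
  shows "orth_proj S y \<bullet> z = orth_proj S y \<bullet> orth_proj S z"
proof -
  have "orth_proj S y \<bullet> (z - orth_proj S z) = 0"
    using orth_proj(2)[OF assms orth_proj(1)[OF assms, of y], of z] by (simp only: inner_commute)
  then show ?thesis by (simp add: inner_diff_right)
qed

lemma transpose_null_iff_orthogonal:
  "transpose A *v w = 0 \<longleftrightarrow> (\<forall>y\<in>column_space A. w \<bullet> y = 0)"
proof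
  assume "transpose A *v w = 0"
  then show "\<forall>y\<in>column_space A. w \<bullet> y = 0"
    using orthogonal_nullspace_rowspace[of "transpose A" w] by (auto simp: column_space_def orthogonal_def)
next
  assume orth: "\<forall>y\<in>column_space A. w \<bullet> y = 0"
  have "column i A \<in> column_space A" for i unfolding column_space_def columns_def by (intro span_base) auto
  then have "(transpose A *v w) $ i = 0" for i
    using orth by (simp add: matrix_vector_mul_component transpose_def column_def inner_commute[of w])
  then show "transpose A *v w = 0" by (simp add: vec_eq_iff)
qed

lemma gradient_orthogonal_at_min:
  fixes f :: "'v::real_inner \<Rightarrow> real"
  assumes "GDERIV f z :> g" and min: "\<And>t. f z \<le> f (z + t *\<^sub>R w)"
  shows "g \<bullet> w = 0"
proof -
  have "(f has_derivative (\<lambda>h. h \<bullet> g)) (at (z + 0 *\<^sub>R w))" using assms(1) by (simp add: gderiv_def)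
  moreover have "((\<lambda>t. z + t *\<^sub>R w) has_derivative (\<lambda>t. t *\<^sub>R w)) (at 0)" by (auto intro!: derivative_eq_intros)
  ultimately have "((\<lambda>t. f (z + t *\<^sub>R w)) has_derivative (\<lambda>t. (t *\<^sub>R w) \<bullet> g)) (at 0)"
    by (rule has_derivative_compose[rotated])
  then have "((\<lambda>t. f (z + t *\<^sub>R w)) has_field_derivative (w \<bullet> g)) (at 0)"
    by (simp add: has_field_derivative_def mult.commute[of _ "w \<bullet> g"])
  then have "w \<bullet> g = 0" by (rule DERIV_local_min[where d=1]) (use min in auto)
  then show ?thesis by (simp add: inner_commute)
qed

section \<open>Joint measurability of the stochastic gradient\<close>

text \<open>Replace \<open>y\<close> by simple functions \<open>s n y\<close>: finitely many values
  give joint measurability, and continuity in \<open>y\<close> passes it to the limit.\<close>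

lemma caratheodory_measurable:
  fixes F :: "'v::euclidean_space \<Rightarrow> 'z \<Rightarrow> real"
  assumes cont: "\<And>z. z \<in> space D \<Longrightarrow> continuous_on UNIV (\<lambda>y. F y z)" and meas: "\<And>y. F y \<in> borel_measurable D"
  shows "(\<lambda>(y, z). F y z) \<in> borel_measurable (borel \<Otimes>\<^sub>M D)"
proof -
  obtain s where s: "\<And>n. simple_function (borel :: 'v measure) (s n)" "\<And>y. (\<lambda>n. s n y) \<longlonglongrightarrow> y"
    using borel_measurable_implies_sequence_metric[of "\<lambda>y. y" borel 0] by auto
  show ?thesis
  proof (rule borel_measurable_LIMSEQ_real)
    show "(\<lambda>n. case u of (y, z) \<Rightarrow> F (s n y) z) \<longlonglongrightarrow> (case u of (y, z) \<Rightarrow> F y z)" if "u \<in> space (borel \<Otimes>\<^sub>M D)" for u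
    proof -
      obtain y z where u: "u = (y, z)" "z \<in> space D" using \<open>u \<in> _\<close> by (auto simp: space_pair_measure)
      have "isCont (\<lambda>y. F y z) y" using cont[OF u(2)] by (simp add: continuous_on_eq_continuous_at)
      from isCont_tendsto_compose[OF this s(2)] show ?thesis by (simp add: u)
    qed
    show "(\<lambda>(y, z). F (s n y) z) \<in> borel_measurable (borel \<Otimes>\<^sub>M D)" for n
    proof -
      have fin: "finite (range (s n))" and vim: "\<And>a. s n -` {a} \<in> sets borel"
        using s(1)[of n] unfolding simple_function_def by (auto, metis vimage_singleton_eq sets.empty_sets equals0I)
      have "s n \<in> borel \<rightarrow>\<^sub>M count_space (range (s n))"
        using vim by (simp add: measurable_count_space_eq2[OF fin])
      then have "(\<lambda>u. s n (fst u)) \<in> borel \<Otimes>\<^sub>M D \<rightarrow>\<^sub>M count_space (range (s n))" by measurable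
      from measurable_compose_countable'[OF _ this countable_finite[OF fin], of "\<lambda>a u. F a (snd u)" borel]
      show ?thesis using meas by (simp add: case_prod_unfold)
    qed
  qed
qed

text \<open>Each coordinate of the gradient is a limit of difference quotients of \<open>F\<close>,
  which is continuous in the point and measurable in the sample.\<close>

lemma gradient_measurable:
  fixes F :: "'v::euclidean_space \<Rightarrow> 'z \<Rightarrow> real"
  assumes grad: "\<And>y z. z \<in> space D \<Longrightarrow> GDERIV (\<lambda>u. F u z) y :> G y z" and meas: "\<And>y. F y \<in> borel_measurable D"
  shows "(\<lambda>(y, z). G y z) \<in> borel_measurable (borel \<Otimes>\<^sub>M D)"
proof (rule borel_measurable_euclidean_space[THEN iffD2], rule ballI)
  fix i :: 'v assume i: "i \<in> Basis"
  have F_meas: "(\<lambda>(y, z). F (y + c *\<^sub>R i) z) \<in> borel_measurable (borel \<Otimes>\<^sub>M D)" for c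
  proof (rule caratheodory_measurable)
    show "continuous_on UNIV (\<lambda>y. F (y + c *\<^sub>R i) z)" if "z \<in> space D" for z
    proof -
      have "isCont (\<lambda>u. F u z) y" for y
        using grad[OF that, of y] unfolding gderiv_def by (rule has_derivative_continuous)
      then have "continuous_on UNIV (\<lambda>u. F u z)" by (simp add: continuous_on_eq_continuous_at)
      moreover have "continuous_on UNIV (\<lambda>y. y + c *\<^sub>R i)" by (intro continuous_intros)
      ultimately show ?thesis by (rule continuous_on_compose2) simp
    qed
  qed (rule meas)
  have F0: "(\<lambda>u. F (fst u) (snd u)) \<in> borel_measurable (borel \<Otimes>\<^sub>M D)" using F_meas[of 0] by (simp add: case_prod_unfold)
  show "(\<lambda>u. (case u of (y, z) \<Rightarrow> G y z) \<bullet> i) \<in> borel_measurable (borel \<Otimes>\<^sub>M D)"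
  proof (rule borel_measurable_LIMSEQ_real)
    show "(\<lambda>u. (F (fst u + inverse (real (Suc n)) *\<^sub>R i) (snd u) - F (fst u) (snd u)) / inverse (real (Suc n))) \<in> borel_measurable (borel \<Otimes>\<^sub>M D)" for n
      using F_meas[of "inverse (real (Suc n))"] F0 by (intro borel_measurable_divide borel_measurable_diff) (auto simp: case_prod_unfold)
    fix u assume "u \<in> space ((borel :: 'v measure) \<Otimes>\<^sub>M D)"
    then obtain y z where u: "u = (y, z)" "z \<in> space D" by (auto simp: space_pair_measure)
    have "((\<lambda>u. F u z) has_derivative (\<lambda>h. h \<bullet> G y z)) (at (y + 0 *\<^sub>R i))" using grad[OF u(2), of y] by (simp add: gderiv_def)
    moreover have "((\<lambda>t. y + t *\<^sub>R i) has_derivative (\<lambda>t. t *\<^sub>R i)) (at 0)" by (auto intro!: derivative_eq_intros)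
    ultimately have "((\<lambda>t. F (y + t *\<^sub>R i) z) has_derivative (\<lambda>t. (t *\<^sub>R i) \<bullet> G y z)) (at 0)"
      by (rule has_derivative_compose[rotated])
    then have "((\<lambda>t. F (y + t *\<^sub>R i) z) has_field_derivative (i \<bullet> G y z)) (at 0)"
      by (simp add: has_field_derivative_def mult.commute[of _ "i \<bullet> G y z"])
    then have "((\<lambda>h. (F (y + h *\<^sub>R i) z - F y z) / h) \<longlongrightarrow> i \<bullet> G y z) (at 0)"
      by (simp add: DERIV_def)
    moreover have "filterlim (\<lambda>n. inverse (real (Suc n))) (at 0) sequentially"
      by (rule filterlim_atI[OF LIMSEQ_inverse_real_of_nat]) auto
    ultimately have "(\<lambda>n. (F (y + inverse (real (Suc n)) *\<^sub>R i) z - F y z) / inverse (real (Suc n))) \<longlonglongrightarrow> i \<bullet> G y z"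
      by (rule filterlim_compose)
    then show "(\<lambda>n. (F (fst u + inverse (real (Suc n)) *\<^sub>R i) (snd u) - F (fst u) (snd u)) / inverse (real (Suc n)))
        \<longlonglongrightarrow> (case u of (y, z) \<Rightarrow> G y z) \<bullet> i"
      by (simp add: u inner_commute)
  qed
qed

lemma strongly_convex_gradient_monotone:
  assumes "strongly_convex_with_gradient \<mu> f f'"
  shows "(f' y - f' z) \<bullet> (y - z) \<ge> \<mu> * (norm (y - z))\<^sup>2"
proof -
  have "f y \<ge> f z + f' z \<bullet> (y - z) + \<mu> / 2 * (norm (y - z))\<^sup>2" "f z \<ge> f y + f' y \<bullet> (z - y) + \<mu> / 2 * (norm (y - z))\<^sup>2"
    using assms unfolding strongly_convex_with_gradient_def by (metis norm_minus_commute)+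
  then have "f' z \<bullet> (y - z) + f' y \<bullet> (z - y) + \<mu> * (norm (y - z))\<^sup>2 \<le> 0" by (simp add: field_simps)
  then show ?thesis by (simp add: inner_diff_left inner_diff_right)
qed

lemma square_moment_le:
  fixes X :: "'a \<Rightarrow> 'v::euclidean_space"
  assumes "prob_space M" "X \<in> borel_measurable M" "2 < q"
  shows "(\<integral>\<^sup>+\<omega>. ennreal ((norm (X \<omega>))\<^sup>2) \<partial>M) \<le> 1 + (\<integral>\<^sup>+\<omega>. ennreal (norm (X \<omega>) powr q) \<partial>M)"
proof -
  interpret prob_space M by fact
  note [measurable] = assms(2)
  have le: "r\<^sup>2 \<le> 1 + r powr q" if "0 \<le> r" for r :: real
  proof (cases "r \<le> 1")
    case True
    then have "r\<^sup>2 \<le> 1" using that by (simp add: power_le_one)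
    then show ?thesis using powr_ge_zero[of r q] by linarith
  next
    case False
    then have "r powr 2 \<le> r powr q" using assms(3) by (intro powr_mono) auto
    then show ?thesis using False by simp
  qed
  have "(\<integral>\<^sup>+\<omega>. ennreal ((norm (X \<omega>))\<^sup>2) \<partial>M) \<le> (\<integral>\<^sup>+\<omega>. 1 + ennreal (norm (X \<omega>) powr q) \<partial>M)"
  proof (rule nn_integral_mono)
    fix \<omega>
    show "ennreal ((norm (X \<omega>))\<^sup>2) \<le> 1 + ennreal (norm (X \<omega>) powr q)"
      using ennreal_leI[OF le[of "norm (X \<omega>)"]] by (simp add: ennreal_plus)
  qed
  also have "\<dots> = 1 + (\<integral>\<^sup>+\<omega>. ennreal (norm (X \<omega>) powr q) \<partial>M)"
    by (subst nn_integral_add) (auto simp: emeasure_space_1)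
  finally show ?thesis .
qed

section \<open>Polynomial step sizes\<close>

text \<open>Factor out \<open>k powr a\<close> and use that r \<le> r^a on [0,1] for a \<le> 1, with
  r = 1 - 1/k. It bounds the relative change of the scaling factor.\<close>

lemma powr_diff_le:
  fixes k :: nat
  assumes "1 \<le> k" "0 \<le> a" "a \<le> 1"
  shows "real k powr a - real (k - 1) powr a \<le> real k powr (a - 1)"
proof -
  have r: "real (k - 1) = real k * (1 - 1 / real k)" using assms(1) by (simp add: field_simps of_nat_diff)
  have k1: "1 - 1 / real k \<in> {0..1}" using assms(1) by auto
  have "1 - 1 / real k \<le> (1 - 1 / real k) powr a"
  proof (cases "1 - 1 / real k = 0")
    case False
    then show ?thesis using k1 assms powr_mono'[of a 1 "1 - 1 / real k"] by simp
  qed simp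
  then have "real k powr a * (1 - 1 / real k) \<le> real k powr a * (1 - 1 / real k) powr a" by (rule mult_left_mono) simp
  also have "\<dots> = real (k - 1) powr a" unfolding r using k1 by (simp only: powr_mult)
  finally show ?thesis using assms(1) by (simp add: powr_diff field_simps)
qed

lemma polynomial_steps:
  fixes \<eta> p :: "nat \<Rightarrow> real"
  assumes \<alpha>: "0 < \<alpha>" "\<alpha> \<le> 1" and \<beta>: "0 < \<beta>" "\<beta> < 1" and pos: "0 < \<eta>\<^sub>0" "0 < \<gamma>"
    and \<eta>: "\<forall>n\<ge>1. \<eta> n = \<eta>\<^sub>0 * real n powr (- \<alpha>)" and \<eta>_0: "\<eta> 0 = \<eta>\<^sub>0"
    and p: "\<And>n. p n = min (\<gamma> * \<eta> n powr \<beta>) 1"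
  shows "0 < \<eta> n" "\<eta> \<longlonglongrightarrow> 0" "\<not> summable \<eta>" "(\<lambda>n. \<eta> n powr \<beta>) \<longlonglongrightarrow> 0" "\<not> summable (\<lambda>n. \<eta> n powr \<beta>)"
    "(\<lambda>n. \<eta> n / p n) \<longlonglongrightarrow> 0"
    and "k \<ge> 1 \<Longrightarrow> \<bar>(\<eta> k powr (\<beta> - 1) - \<eta> (k - 1) powr (\<beta> - 1)) / \<eta> k powr \<beta>\<bar> \<le> 1 / \<eta>\<^sub>0"
proof -
  show \<eta>_pos: "0 < \<eta> n" for n using \<eta> \<eta>_0 pos by (cases "n = 0") auto
  have \<eta>_powr: "\<eta> n powr c = \<eta>\<^sub>0 powr c * real n powr (- (\<alpha> * c))" if "n \<ge> 1" for n c
    using that pos by (simp add: \<eta> powr_mult powr_powr)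
  have lim: "(\<lambda>n. \<eta> n powr c) \<longlonglongrightarrow> 0" if "0 < c" for c
  proof -
    have "(\<lambda>n. \<eta>\<^sub>0 powr c * real n powr (- (\<alpha> * c))) \<longlonglongrightarrow> \<eta>\<^sub>0 powr c * 0"
      using that \<alpha> by (intro tendsto_mult tendsto_const tendsto_neg_powr filterlim_real_sequentially) simp
    then have "(\<lambda>n. \<eta>\<^sub>0 powr c * real n powr (- (\<alpha> * c))) \<longlonglongrightarrow> 0" by simp
    moreover have "\<forall>\<^sub>F n in sequentially. \<eta>\<^sub>0 powr c * real n powr (- (\<alpha> * c)) = \<eta> n powr c"
      using eventually_ge_at_top[of 1] by eventually_elim (simp add: \<eta>_powr)
    ultimately show ?thesis by (rule Lim_transform_eventually)
  qed
  have nsum: "\<not> summable (\<lambda>n. \<eta> n powr c)" if "\<alpha> * c \<le> 1" for c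
  proof
    assume "summable (\<lambda>n. \<eta> n powr c)"
    moreover have "\<forall>\<^sub>F n in sequentially. \<eta> n powr c = \<eta>\<^sub>0 powr c * real n powr (- (\<alpha> * c))"
      using eventually_ge_at_top[of 1] by eventually_elim (simp add: \<eta>_powr)
    ultimately have "summable (\<lambda>n. \<eta>\<^sub>0 powr c * real n powr (- (\<alpha> * c)))" by (simp only: summable_cong)
    then show False using pos that by (simp add: summable_cmult_iff summable_real_powr_iff)
  qed
  show "\<eta> \<longlonglongrightarrow> 0" "\<not> summable \<eta>" using lim[of 1] nsum[of 1] \<alpha> \<eta>_pos by (simp_all add: abs_of_pos)
  show b0: "(\<lambda>n. \<eta> n powr \<beta>) \<longlonglongrightarrow> 0" by (rule lim) fact
  show "\<not> summable (\<lambda>n. \<eta> n powr \<beta>)" using mult_mono[of \<alpha> 1 \<beta> 1] \<alpha> \<beta> by (intro nsum) auto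
  have "(\<lambda>n. \<eta> n powr (1 - \<beta>) / \<gamma>) \<longlonglongrightarrow> 0 / \<gamma>" using \<beta> pos by (intro tendsto_divide lim tendsto_const) auto
  then have "(\<lambda>n. \<eta> n powr (1 - \<beta>) / \<gamma>) \<longlonglongrightarrow> 0" by simp
  moreover have "\<forall>\<^sub>F n in sequentially. \<eta> n powr (1 - \<beta>) / \<gamma> = \<eta> n / p n"
  proof -
    have "\<forall>\<^sub>F n in sequentially. \<eta> n powr \<beta> < 1 / \<gamma>" using pos by (intro order_tendstoD(2)[OF b0]) simp
    then show ?thesis
    proof eventually_elim
      case (elim n)
      then have "p n = \<gamma> * \<eta> n powr \<beta>" using pos by (simp add: p field_simps)
      then show ?case using \<eta>_pos[of n] by (simp add: powr_diff)
    qed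
  qed
  ultimately show "(\<lambda>n. \<eta> n / p n) \<longlonglongrightarrow> 0" by (rule Lim_transform_eventually)
  show "\<bar>(\<eta> k powr (\<beta> - 1) - \<eta> (k - 1) powr (\<beta> - 1)) / \<eta> k powr \<beta>\<bar> \<le> 1 / \<eta>\<^sub>0" if k: "k \<ge> 1"
  \<comment> \<open>Here \<eta> 0 and \<eta> 1 coincide, so the quotient is
    \<open>0\<close>.\<close>
  proof (cases "k = 1")
    case True
    then show ?thesis using \<eta> \<eta>_0 pos by simp
  next
    case False
    then have k: "k \<ge> 1" "k - 1 \<ge> 1" using k by auto
    define a where "a = \<alpha> * (1 - \<beta>)"
    have a: "0 \<le> a" "a \<le> 1" using mult_mono[of \<alpha> 1 "1 - \<beta>" 1] \<alpha> \<beta> by (auto simp: a_def)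
    have ma: "- (\<alpha> * (\<beta> - 1)) = a" by (simp add: a_def algebra_simps)
    have nn: "0 \<le> real k powr a - real (k - 1) powr a" using a by (simp add: powr_mono2)
    have "(\<eta> k powr (\<beta> - 1) - \<eta> (k - 1) powr (\<beta> - 1)) / \<eta> k powr \<beta>
        = \<eta>\<^sub>0 powr (\<beta> - 1) * (real k powr a - real (k - 1) powr a) / (\<eta>\<^sub>0 powr \<beta> * real k powr (- (\<alpha> * \<beta>)))"
      unfolding \<eta>_powr[OF k(1)] \<eta>_powr[OF k(2)] ma by (simp only: right_diff_distrib)
    also have "\<dots> = (real k powr a - real (k - 1) powr a) * real k powr (\<alpha> * \<beta>) / \<eta>\<^sub>0"
      using pos k by (simp add: powr_diff powr_minus field_simps)
    finally have eq: "(\<eta> k powr (\<beta> - 1) - \<eta> (k - 1) powr (\<beta> - 1)) / \<eta> k powr \<beta>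
      = (real k powr a - real (k - 1) powr a) * real k powr (\<alpha> * \<beta>) / \<eta>\<^sub>0" .
    have "(real k powr a - real (k - 1) powr a) * real k powr (\<alpha> * \<beta>) \<le> real k powr (a - 1) * real k powr (\<alpha> * \<beta>)"
      using powr_diff_le[OF k(1) a] by (rule mult_right_mono) simp
    \<comment> \<open>The exponents add up: \<alpha>(1-\<beta>) - 1 + \<alpha>\<beta> = \<alpha> -
      1, which is at most \<open>0\<close>.\<close>
    also have "\<dots> = real k powr (\<alpha> - 1)" by (simp add: powr_add[symmetric] a_def algebra_simps)
    also have "\<dots> \<le> real k powr 0" using k \<alpha> by (intro powr_mono) auto
    also have "\<dots> = 1" using k by simp
    finally show ?thesis unfolding eq using nn pos by (simp add: divide_right_mono)
  qed
qed

theorem theorem3p4: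
  fixes A :: "real^'m^'d"
    and D :: "'z measure" and M :: "'a measure"
    and F :: "real^'d \<Rightarrow> 'z \<Rightarrow> real" and G :: "real^'d \<Rightarrow> 'z \<Rightarrow> real^'d"
    and f :: "real^'d \<Rightarrow> real" and gradf :: "real^'d \<Rightarrow> real^'d"
    and \<zeta> :: "nat \<Rightarrow> 'a \<Rightarrow> 'z" and coin :: "nat \<Rightarrow> 'a \<Rightarrow> bool"
    and x1 xstar :: "real^'d"
    and \<eta>\<^sub>0 \<alpha> \<beta> \<gamma> \<mu> L q :: real
    and \<eta> p \<Gamma> :: "nat \<Rightarrow> real" and N :: "nat \<Rightarrow> real \<Rightarrow> nat"
    and x xhalf v \<xi> vc vcpre \<xi>2 d :: "nat \<Rightarrow> 'a \<Rightarrow> real^'d"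
    and vbar :: "nat \<Rightarrow> real \<Rightarrow> 'a \<Rightarrow> real^'d"
  defines "PA \<equiv> orth_proj (column_space A)"
  (* the objective *)
  assumes "prob_space D"
    and "\<And>y z. z \<in> space D \<Longrightarrow> GDERIV (\<lambda>u. F u z) y :> G y z"
    and "\<And>y. integrable D (F y)" and "\<And>y. f y = (\<integral>z. F y z \<partial>D)"
    and "\<And>y. GDERIV f y :> gradf y"
    and "\<And>y. integrable D (G y)" and "\<And>y. (\<integral>z. G y z \<partial>D) = gradf y"
    and "\<And>y. integrable D (\<lambda>z. (norm (G y z))\<^sup>2)"
    and "transpose A *v xstar = 0"
    and "\<And>y. transpose A *v y = 0 \<Longrightarrow> y \<noteq> xstar \<Longrightarrow> f xstar < f y"
    and "gradf xstar \<noteq> 0"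
  (* parameters *)
    and "\<gamma> > 0" and "0 < \<alpha>" and "\<alpha> \<le> 1" and "1 / 2 < \<beta>" and "\<beta> < 1"
    and "\<mu> > 0" and "\<eta>\<^sub>0 > 0" and "\<eta>\<^sub>0 > 2 * of_bool (\<alpha> = 1) / \<mu>"
    and "\<And>n. n \<ge> 1 \<Longrightarrow> \<eta> n = \<eta>\<^sub>0 * real n powr (- \<alpha>)" and "\<eta> 0 = \<eta>\<^sub>0"
    and "\<And>n. p n = min (\<gamma> * \<eta> n powr \<beta>) 1"
  (* the random input *)
    and "prob_space M"
    and "\<And>n. n \<ge> 1 \<Longrightarrow> \<zeta> n \<in> M \<rightarrow>\<^sub>M D"
    and "\<And>n. n \<ge> 1 \<Longrightarrow> distr M D (\<zeta> n) = D"
    and "\<And>n. n \<ge> 1 \<Longrightarrow> coin n \<in> M \<rightarrow>\<^sub>M count_space UNIV"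
    and "\<And>n. n \<ge> 1 \<Longrightarrow> distr M (count_space UNIV) (coin n) = measure_pmf (bernoulli_pmf (p n))"
    and "prob_space.indep_sets M
           (case_sum (\<lambda>n. {\<zeta> n -` B \<inter> space M | B. B \<in> sets D})
                     (\<lambda>n. {coin n -` B \<inter> space M | B. True})) ({1..} <+> {1..})"
  (* the iterates *)
    and "\<And>\<omega>. x 1 \<omega> = x1"
    and "\<And>n \<omega>. n \<ge> 1 \<Longrightarrow> xhalf n \<omega> = x n \<omega> - \<eta> n *\<^sub>R G (x n \<omega>) (\<zeta> n \<omega>)"
    and "\<And>n \<omega>. n \<ge> 1 \<Longrightarrow>
           x (Suc n) \<omega> = (if coin n \<omega> then xhalf n \<omega> - PA (xhalf n \<omega>) else xhalf n \<omega>)"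
    and "\<And>n \<omega>. n \<ge> 1 \<Longrightarrow> \<xi> n \<omega> = gradf (x n \<omega>) - G (x n \<omega>) (\<zeta> n \<omega>)"
    and "\<And>n \<omega>. n \<ge> 1 \<Longrightarrow> v n \<omega> = PA (x n \<omega>)"
    and "\<And>n \<omega>. n \<ge> 1 \<Longrightarrow> vc n \<omega> = \<eta> (n - 1) powr (\<beta> - 1) *\<^sub>R v n \<omega>"
  (* regularity assumptions *)
    and "\<And>y z. norm (gradf y - gradf z) \<le> L * norm (y - z)"
    and "strongly_convex_with_gradient \<mu> f gradf"
    and "\<And>y z. spectral_norm (covariance_matrix D (G y) - covariance_matrix D (G z))
                  \<le> L * norm (y - z)"
    and "q > 2"
    and "(SUP n\<in>{1..}. \<integral>\<^sup>+\<omega>. ennreal (norm (\<xi> n \<omega>) powr q) \<partial>M) < \<infinity>"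
  (* the interpolated processes; vcpre n is the value of vc (n + 1) before the coin toss *)
    and "\<And>n \<omega>. n \<ge> 1 \<Longrightarrow> vcpre n \<omega> = \<eta> n powr (\<beta> - 1) *\<^sub>R PA (xhalf n \<omega>)"
    and "\<And>n \<omega>. n \<ge> 1 \<Longrightarrow> \<xi>2 n \<omega> = PA (\<xi> n \<omega>)"
    and "\<And>n \<omega>. n \<ge> 1 \<Longrightarrow>
           vcpre n \<omega> = vc n \<omega> - \<eta> n powr \<beta> *\<^sub>R d n \<omega> + \<eta> n powr \<beta> *\<^sub>R \<xi>2 n \<omega>"
    and "\<And>n t. N n t = (LEAST m. n \<le> m \<and> (\<Sum>k=n..m. \<eta> k powr \<beta>) > t)"
    and "\<And>n. \<Gamma> n = (\<Sum>k=1..<n. \<eta> k powr \<beta>)"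
    and "\<And>n t \<omega>. n \<ge> 1 \<Longrightarrow> t \<ge> 0 \<Longrightarrow>
           vbar n t \<omega> = vc (N n t) \<omega>
             - (t - (\<Gamma> (N n t) - \<Gamma> n)) *\<^sub>R (d (N n t) \<omega> - \<xi>2 (N n t) \<omega>)"
  defines "g \<equiv> gradf xstar"
  defines "\<pi> \<equiv> distr (density lborel (exponential_density (\<gamma> / norm g))) borel
                   (\<lambda>e. - (e / norm g) *\<^sub>R g)"
  (* conclusion: the stationary weak solution exists; the processes converge weakly to every
     stationary weak solution, so its law is unique; \<pi> is the invariant distribution and
     is unique; the sequence vc converges weakly to \<pi> *)
  shows
    "(\<exists>(P :: ((real^'d) canonical) measure) \<F> K Y.
        weak_solution \<gamma> g P \<F> K Y \<and> stationary_process P Y) \<and>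
     (\<forall>(P :: 'c measure) \<F> K Y.
        weak_solution \<gamma> g P \<F> K Y \<and> stationary_process P Y \<longrightarrow>
        processes_converge_weakly M (\<lambda>n. vbar (Suc n)) P Y) \<and>
     invariant_distribution TYPE('c) \<gamma> g \<pi> \<and>
     (\<forall>\<nu>. invariant_distribution TYPE((real^'d) canonical) \<gamma> g \<nu> \<longrightarrow> \<nu> = \<pi>) \<and>
     converges_in_law euclidean M (\<lambda>n. vc (Suc n)) \<pi> (\<lambda>y. y)"
proof -
  interpret D: prob_space D by (rule assms(2))
  interpret M: prob_space M by (rule assms(24))
  note [measurable] = assms(25,27)
  have \<beta>: "0 < \<beta>" using assms(16) by simp
  have \<eta>: "\<forall>n\<ge>1. \<eta> n = \<eta>\<^sub>0 * real n powr (- \<alpha>)" using assms(21) by blast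
  note steps = polynomial_steps[OF assms(14,15) \<beta> assms(17,19,13) \<eta> assms(22,23)]
  have S: "subspace (column_space A)" by (simp add: column_space_def)
  have PA_linear: "linear PA" unfolding PA_def by (rule orth_proj_linear[OF S])
  have null_xstar: "xstar \<bullet> y = 0" if "y \<in> column_space A" for y
    using that assms(10) unfolding transpose_null_iff_orthogonal by blast
  have PA_xstar: "PA xstar = 0"
    unfolding PA_def using S null_xstar by (intro orth_proj(3)) (auto simp: subspace_0)
  \<comment> \<open>The first-order condition: \<open>w\<close> is a feasible direction, along which
    \<open>f\<close> is minimal at \<open>xstar\<close>, so \<open>g\<close> is orthogonal to
    \<open>w\<close>, its own component off the column space.\<close>
  have PA_g: "PA g = g"
  proof -
    define w where "w = g - PA g"
    have w: "w \<bullet> y = 0" if "y \<in> column_space A" for y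
      using orth_proj(2)[OF S that, of g] by (simp add: w_def PA_def)
    have "f xstar \<le> f (xstar + t *\<^sub>R w)" for t
    proof -
      have "transpose A *v (xstar + t *\<^sub>R w) = 0"
        unfolding transpose_null_iff_orthogonal using w null_xstar by (simp add: inner_add_left)
      then show ?thesis using assms(11)[of "xstar + t *\<^sub>R w"] by force
    qed
    from gradient_orthogonal_at_min[OF assms(6) this] have "g \<bullet> w = 0" by (simp add: g_def)
    moreover have "PA g \<bullet> w = 0"
      using w[of "PA g"] orth_proj(1)[OF S, of g] by (simp add: PA_def inner_commute)
    ultimately have "w \<bullet> w = 0" by (simp add: w_def inner_diff_left)
    then show ?thesis by (simp add: w_def)
  qed
  have L: "0 \<le> L"
  proof -
    \<comment> \<open>Two distinct points are needed to read off the sign of \<open>L\<close>;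
      \<open>gradf xstar\<close> and \<open>0\<close> serve as such.\<close>
    have "0 \<le> L * norm (gradf xstar - 0)" by (rule order_trans[OF norm_ge_zero assms(36)])
    then show ?thesis using assms(12) by (simp add: zero_le_mult_iff)
  qed
  have G_meas: "(\<lambda>(y, z). G y z) \<in> borel \<Otimes>\<^sub>M D \<rightarrow>\<^sub>M borel"
    using assms(4) by (intro gradient_measurable[where F=F] assms(3)) auto
  have PA_meas [measurable]: "PA \<in> borel_measurable borel"
    using PA_linear by (intro borel_measurable_continuous_onI linear_continuous_on) (simp add: linear_conv_bounded_linear)
  have "L-lipschitz_on UNIV gradf" using assms(36) L by (intro lipschitz_onI) (auto simp: dist_norm)
  then have gradf_meas [measurable]: "gradf \<in> borel_measurable borel"
    by (intro borel_measurable_continuous_onI lipschitz_on_continuous_on)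
  have G_step: "(\<lambda>\<omega>. G (x n \<omega>) (\<zeta> n \<omega>)) \<in> borel_measurable M" if "1 \<le> n" "x n \<in> borel_measurable M" for n
    using measurable_compose[OF measurable_Pair[OF that(2) assms(25)[OF that(1)]] G_meas] by simp
  have x_meas: "x n \<in> borel_measurable M" if "1 \<le> n" for n
    using that
  proof (induction n rule: nat_induct_at_least)
    case base
    have "x 1 = (\<lambda>_. x1)" using assms(30) by auto
    then show ?case by simp
  next
    case (Suc n)
    note [measurable] = Suc.IH G_step[OF Suc.hyps Suc.IH] assms(27)[OF Suc.hyps]
    show ?case unfolding assms(32)[OF Suc.hyps] assms(31)[OF Suc.hyps, abs_def] by measurable
  qed
  \<comment> \<open>A uniform second-moment bound from the moment of order \<open>q\<close>, by r^2
    \<le> 1 + r^q.\<close>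
  define \<sigma> where "\<sigma> = enn2real (1 + (SUP n\<in>{1..}. \<integral>\<^sup>+\<omega>. ennreal (norm (\<xi> n \<omega>) powr q) \<partial>M))"
  have noise: "(\<integral>\<^sup>+\<omega>. ennreal ((norm (gradf (x n \<omega>) - G (x n \<omega>) (\<zeta> n \<omega>)))\<^sup>2) \<partial>M) \<le> ennreal \<sigma>" if n: "1 \<le> n" for n
  proof -
    note [measurable] = x_meas[OF n] G_step[OF n x_meas[OF n]]
    have "\<xi> n = (\<lambda>\<omega>. gradf (x n \<omega>) - G (x n \<omega>) (\<zeta> n \<omega>))" using assms(33)[OF n] by auto
    then have "\<xi> n \<in> borel_measurable M" by simp
    then have "(\<integral>\<^sup>+\<omega>. ennreal ((norm (\<xi> n \<omega>))\<^sup>2) \<partial>M) \<le> 1 + (\<integral>\<^sup>+\<omega>. ennreal (norm (\<xi> n \<omega>) powr q) \<partial>M)"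
      by (rule square_moment_le[OF M.prob_space_axioms _ assms(39)])
    also have "\<dots> \<le> 1 + (SUP n\<in>{1..}. \<integral>\<^sup>+\<omega>. ennreal (norm (\<xi> n \<omega>) powr q) \<partial>M)"
      using n by (intro add_left_mono SUP_upper) simp
    also have "\<dots> = ennreal \<sigma>"
      using assms(40) by (simp add: \<sigma>_def less_top[symmetric])
    finally show ?thesis by (simp add: assms(33)[OF n])
  qed
  have coin_prob: "M.prob {\<omega> \<in> space M. coin n \<omega>} = p n" if n: "1 \<le> n" for n
  proof -
    have "{\<omega> \<in> space M. coin n \<omega>} = coin n -` {True} \<inter> space M" by auto
    then have "M.prob {\<omega> \<in> space M. coin n \<omega>} = measure (distr M (count_space UNIV) (coin n)) {True}"
      using assms(27)[OF n] by (simp add: measure_distr)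
    also have "\<dots> = p n" using steps(1)[of n] assms(13) by (simp add: assms(28)[OF n] measure_pmf_single assms(23))
    finally show ?thesis .
  qed
  interpret I: lpsa M D PA gradf G \<zeta> coin x x1 xstar \<eta> p L \<mu> \<sigma>
  proof unfold_locales
    show "PA (PA y) = PA y" for y
      unfolding PA_def using orth_proj(1)[OF S] by (intro orth_proj(3)[OF S]) auto
    show "PA y \<bullet> z = PA y \<bullet> PA z" for y z unfolding PA_def by (rule orth_proj_inner[OF S])
    show "PA (gradf xstar) = gradf xstar" using PA_g by (simp add: g_def)
    show "\<mu> * (norm (y - z))\<^sup>2 \<le> (gradf y - gradf z) \<bullet> (y - z)" for y z
      by (rule strongly_convex_gradient_monotone[OF assms(37)])
    show "0 < p n" "p n \<le> 1" for n using steps(1)[of n] assms(13) by (auto simp: assms(23))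
    show "x (Suc n) \<omega> = (let h = x n \<omega> - \<eta> n *\<^sub>R G (x n \<omega>) (\<zeta> n \<omega>) in if coin n \<omega> then h - PA h else h)" if "1 \<le> n" for n \<omega>
      using assms(31,32)[OF that] by (simp add: Let_def)
    show "0 \<le> \<sigma>" by (simp add: \<sigma>_def)
    show "0 < \<eta> n" for n by (rule steps(1))
  qed (fact linear_add[OF PA_linear] linear_scale[OF PA_linear] PA_xstar G_meas L assms(7,8,18,25-27,29,30,36) coin_prob noise)+
  \<comment> \<open>Changing the scaling factor between consecutive steps adds this multiple of
    \<open>PA (x k)\<close> to the drift. It stays bounded, so its contribution vanishes with the
    distance to \<open>xstar\<close>.\<close>
  define \<kappa> where "\<kappa> k = (\<eta> k powr (\<beta> - 1) - \<eta> (k - 1) powr (\<beta> - 1)) / \<eta> k powr \<beta>" for k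
  have d_eq: "d k = (\<lambda>\<omega>. PA (gradf (x k \<omega>)) - \<kappa> k *\<^sub>R PA (x k \<omega>))" if k: "1 \<le> k" for k
  proof
    fix \<omega>
    have b: "\<eta> k powr (\<beta> - 1) * \<eta> k = \<eta> k powr \<beta>" "\<eta> k powr \<beta> \<noteq> 0" using steps(1)[of k] by (simp_all add: powr_diff)
    have "\<eta> k powr \<beta> *\<^sub>R d k \<omega> = vc k \<omega> - vcpre k \<omega> + \<eta> k powr \<beta> *\<^sub>R \<xi>2 k \<omega>" unfolding assms(43)[OF k] by simp
    also have "\<dots> = \<eta> (k - 1) powr (\<beta> - 1) *\<^sub>R PA (x k \<omega>)
        - (\<eta> k powr (\<beta> - 1) *\<^sub>R PA (x k \<omega>) - (\<eta> k powr (\<beta> - 1) * \<eta> k) *\<^sub>R PA (G (x k \<omega>) (\<zeta> k \<omega>)))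
        + (\<eta> k powr \<beta> *\<^sub>R PA (gradf (x k \<omega>)) - \<eta> k powr \<beta> *\<^sub>R PA (G (x k \<omega>) (\<zeta> k \<omega>)))"
      by (simp add: assms(31,33,34,35,41,42)[OF k] I.PA_diff I.PA_scaleR scaleR_diff_right)
    also have "\<dots> = \<eta> k powr \<beta> *\<^sub>R PA (gradf (x k \<omega>)) - (\<eta> k powr (\<beta> - 1) - \<eta> (k - 1) powr (\<beta> - 1)) *\<^sub>R PA (x k \<omega>)"
      unfolding b(1) by (simp add: scaleR_diff_left)
    also have "\<dots> = \<eta> k powr \<beta> *\<^sub>R (PA (gradf (x k \<omega>)) - \<kappa> k *\<^sub>R PA (x k \<omega>))"
      using b(2) by (simp add: \<kappa>_def scaleR_diff_right)
    finally show "d k \<omega> = PA (gradf (x k \<omega>)) - \<kappa> k *\<^sub>R PA (x k \<omega>)" using b(2) by simp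
  qed
  have v_eq: "vc k = (\<lambda>\<omega>. \<eta> (k - 1) powr (\<beta> - 1) *\<^sub>R PA (x k \<omega>))" if "1 \<le> k" for k
    using assms(34,35)[OF that] by auto
  have \<xi>2_eq: "\<xi>2 k \<omega> = PA (I.xi k \<omega>)" if "1 \<le> k" for k \<omega>
    by (simp add: assms(33,42)[OF that] I.xi_def)
  interpret W: lpsa_window M D PA gradf G \<zeta> coin x x1 xstar \<eta> p L \<mu> \<sigma> "\<lambda>n. \<eta> n powr \<beta>" \<gamma> vc d
  proof unfold_locales
    show "0 < \<eta> n powr \<beta>" for n using steps(1)[of n] by simp
    show "vc (Suc k) \<omega> = (if coin k \<omega> then 0 else vc k \<omega> - \<eta> k powr \<beta> *\<^sub>R (d k \<omega> - PA (I.xi k \<omega>)))" if k: "1 \<le> k" for k \<omega>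
    proof -
      have "vc (Suc k) \<omega> = (if coin k \<omega> then 0 else vcpre k \<omega>)"
        using I.PA_idem by (simp add: v_eq assms(32,41)[OF k] I.PA_diff)
      then show ?thesis unfolding assms(43)[OF k] \<xi>2_eq[OF k] by (simp add: scaleR_diff_right)
    qed
    fix k :: nat assume k: "1 \<le> k"
    note [measurable] = x_meas[OF k]
    show "vc k \<in> borel_measurable M" unfolding v_eq[OF k] by measurable
    show "d k \<in> borel_measurable M" unfolding d_eq[OF k] by measurable
    show "integrable M (\<lambda>\<omega>. norm (gradf xstar - d k \<omega>))" unfolding d_eq[OF k] by (rule I.expectation_drift_error(1)[OF k])
  qed (use assms(13,23) steps(5) in auto)
  have drift: "(\<lambda>k. \<integral>\<omega>. norm (gradf xstar - d k \<omega>) \<partial>M) \<longlonglongrightarrow> 0"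
  proof (rule Lim_null_comparison)
    show "\<forall>\<^sub>F k in sequentially. norm (\<integral>\<omega>. norm (gradf xstar - d k \<omega>) \<partial>M) \<le> (L + 1 / \<eta>\<^sub>0) * sqrt (I.gap k)"
      using eventually_ge_at_top[of 1]
    proof eventually_elim
      case (elim k)
      have "(\<integral>\<omega>. norm (gradf xstar - d k \<omega>) \<partial>M) \<le> (L + \<bar>\<kappa> k\<bar>) * sqrt (I.gap k)"
        unfolding d_eq[OF elim] by (rule I.expectation_drift_error(2)[OF elim])
      also have "\<dots> \<le> (L + 1 / \<eta>\<^sub>0) * sqrt (I.gap k)"
        using steps(7)[OF elim] I.gap_nonneg[of k] by (intro mult_right_mono add_left_mono) (auto simp: \<kappa>_def)
      finally show ?case by simp
    qed
    have "(\<lambda>k. sqrt (I.gap k)) \<longlonglongrightarrow> sqrt 0" by (intro tendsto_real_sqrt I.gap_tendsto_0 steps)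
    then show "(\<lambda>k. (L + 1 / \<eta>\<^sub>0) * sqrt (I.gap k)) \<longlonglongrightarrow> 0" by (intro tendsto_mult_right_zero) simp
  qed
  have vbar_eq: "vbar (Suc n) t \<omega> = W.interpolated (Suc n) t \<omega>" if t: "0 \<le> t" for n t \<omega>
  proof -
    have N: "N (Suc n) t = W.index (Suc n) t" by (simp add: assms(44) W.index_def)
    have "1 \<le> W.index (Suc n) t" using W.index(1)[of "Suc n" t] t by simp
    then show ?thesis using assms(46)[of "Suc n" t \<omega>] t by (simp add: W.interpolated_def N assms(45) W.clock_def \<xi>2_eq)
  qed
  then have path_eq: "process_path T (vbar (Suc n)) = process_path T (W.interpolated (Suc n))" for T n
    by (auto simp: process_path_def fun_eq_iff restrict_def)
  have g: "g \<noteq> 0" using assms(12) by (simp add: g_def)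
  have \<pi>: "\<pi> = exp_ray \<gamma> g" by (simp add: \<pi>_def exp_ray_def)
  show ?thesis
  proof (intro conjI allI impI)
    obtain P :: "(real^'d) canonical measure" and \<F> K Y where
      sol: "weak_solution \<gamma> g P \<F> K Y" "distr P borel (Y 0) = exp_ray \<gamma> g"
      using weak_solution_canonical[OF assms(13) exp_ray(1,2)[OF g assms(13)]] by blast
    interpret S: reset_solution \<gamma> g P \<F> K Y by unfold_locales (fact sol assms(13) g)+
    show "\<exists>(P :: ((real^'d) canonical) measure) \<F> K Y. weak_solution \<gamma> g P \<F> K Y \<and> stationary_process P Y"
      using sol(1) S.stationary[OF sol(2)] by blast
    show "processes_converge_weakly M (\<lambda>n. vbar (Suc n)) P Y"
      if "weak_solution \<gamma> g P \<F> K Y \<and> stationary_process P Y" for P :: "'c measure" and \<F> K Y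
      using W.interpolated_converges_weakly[of P \<F> K Y, OF _ _ assms(12) steps(4) drift] that
      by (simp add: processes_converge_weakly_def path_eq g_def)
    show "invariant_distribution TYPE('c) \<gamma> g \<pi>"
      unfolding \<pi> by (rule exp_ray_invariant_distribution[OF assms(13) g])
    show "\<nu> = \<pi>" if "invariant_distribution TYPE((real^'d) canonical) \<gamma> g \<nu>" for \<nu>
      unfolding \<pi> by (rule invariant_distribution_unique[OF assms(13) g that])
    show "converges_in_law euclidean M (\<lambda>n. vc (Suc n)) \<pi> (\<lambda>y. y)"
      unfolding \<pi> g_def by (rule W.converges_to_exp_ray[OF assms(12) steps(4) drift])
  qed
qed

end
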